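(* Let $\mu$ be an absolutely continuous, log-concave probability measure on $\mathbb{R}^n$ and let $0\not\equiv\varphi\in H^1(\mu)$. Then with $\varphi_s=Q_s\varphi$, the Rayleigh quotient $$R_\varphi(s)=\frac{\int_{\mathbb{R}^n}|\nabla\varphi_s|^2\,d\mu_s}{\int_{\mathbb{R}^n}\varphi_s^2\,d\mu_s}$$ is non-increasing in $s\in[0,\infty)$. Consequently, the function $\log\|\varphi_s\|_{L^2(\mu_s)}$ is convex in $s\in[0,\infty)$.
   Context: An absolutely continuous probability measure on $\mathbb{R}^n$ is log-concave if it has a density $\rho$ such that $K=\{\rho>0\}$ is convex and $\log\rho$ is concave in $K$. Let $\rho$ be the log-concave density of $\mu$. For $s>0$ let $\gamma_s(x)=(2\pi s)^{-n/2}e^{-|x|^2/(2s)}$ (also denoting the Gaussian measure with this density), $P_sf=f*\gamma_s$, $\mu_s=\mu*\gamma_s$, and let $\rho_s=P_s\rho=\rho*\gamma_s$ be the density of $\mu_s$; also $\mu_0=\mu$, $\rho_0=\rho$. The operator $Q_s:L^2(\mu)\to L^2(\mu_s)$ is defined by $Q_0\varphi=\varphi$ and $Q_s\varphi=P_s(\varphi\rho)/\rho_s$ for $s>0$. $H^1(\mu)$ is the space of all functions in $L^2(\mu)$ whose weak derivatives belong to $L^2(\mu)$, with norm $\|f\|_{H^1(\mu)}=\sqrt{\int f^2\,d\mu+\int|\nabla f|^2\,d\mu}$. *)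

theory Defs
  imports "HOL-Probability.Probability"
begin

section \<open>Log-concave densities\<close>

definition log_concave_density :: "'a::euclidean_space measure \<Rightarrow> ('a \<Rightarrow> real) \<Rightarrow> bool" where
  "log_concave_density M \<rho> \<longleftrightarrow>
     \<rho> \<in> borel_measurable borel \<and> (\<forall>x. 0 \<le> \<rho> x) \<and>
     M = density lborel (\<lambda>x. ennreal (\<rho> x)) \<and>
     convex {x. 0 < \<rho> x} \<and> concave_on {x. 0 < \<rho> x} (\<lambda>x. ln (\<rho> x))"

section \<open>Weak gradients and the weighted Sobolev space\<close>

primrec C_k :: "nat \<Rightarrow> ('a::euclidean_space \<Rightarrow> real) \<Rightarrow> bool" where
  "C_k 0 f \<longleftrightarrow> continuous_on UNIV f"
| "C_k (Suc k) f \<longleftrightarrow> (\<forall>x. f differentiable (at x)) \<and>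
     (\<forall>v. C_k k (\<lambda>x. frechet_derivative f (at x) v))"

definition test_functions :: "'a::euclidean_space set \<Rightarrow> ('a \<Rightarrow> real) set" where
  "test_functions U = {\<psi>. (\<forall>k. C_k k \<psi>) \<and>
     compact (closure {x. \<psi> x \<noteq> 0}) \<and> closure {x. \<psi> x \<noteq> 0} \<subseteq> U}"

definition locally_integrable_on ::
  "'a::euclidean_space set \<Rightarrow> ('a \<Rightarrow> 'b::{banach, second_countable_topology}) \<Rightarrow> bool" where
  "locally_integrable_on U f \<longleftrightarrow> (\<forall>C. compact C \<and> C \<subseteq> U \<longrightarrow> set_integrable lborel C f)"

text \<open>Global Borel measurability of the gradient is harmless, as only its values on \<open>U\<close> matter;
  it ensures that integrals of \<open>g\<close> against a measure concentrated on \<open>U\<close>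
  do not depend on the representative.\<close>

definition is_weak_gradient ::
  "'a::euclidean_space set \<Rightarrow> ('a \<Rightarrow> real) \<Rightarrow> ('a \<Rightarrow> 'a) \<Rightarrow> bool" where
  "is_weak_gradient U f g \<longleftrightarrow>
     locally_integrable_on U f \<and> g \<in> borel_measurable borel \<and> locally_integrable_on U g \<and>
     (\<forall>\<psi>\<in>test_functions U. \<forall>b\<in>Basis.
        (LINT x|lborel. f x * frechet_derivative \<psi> (at x) b) =
        - (LINT x|lborel. (g x \<bullet> b) * \<psi> x))"

definition weak_gradient :: "'a::euclidean_space set \<Rightarrow> ('a \<Rightarrow> real) \<Rightarrow> 'a \<Rightarrow> 'a" where
  "weak_gradient U f = (SOME g. is_weak_gradient U f g)"

definition L2_space :: "'a measure \<Rightarrow> ('a \<Rightarrow> 'b::real_normed_vector) set" where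
  "L2_space M = {f. f \<in> borel_measurable M \<and> integrable M (\<lambda>x. (norm (f x))\<^sup>2)}"

definition L2_norm :: "'a measure \<Rightarrow> ('a \<Rightarrow> 'b::real_normed_vector) \<Rightarrow> real" where
  "L2_norm M f = sqrt (LINT x|M. (norm (f x))\<^sup>2)"

text \<open>A function in \<open>L\<^sup>2(\<mu>)\<close> is only determined on the convex set \<open>K = {\<rho> > 0}\<close>, so derivatives are
  taken in the sense of distributions on the interior of \<open>K\<close>; the boundary of \<open>K\<close> is a null set.\<close>

definition pos_domain :: "('a::euclidean_space \<Rightarrow> real) \<Rightarrow> 'a set" where
  "pos_domain \<rho> = interior {x. 0 < \<rho> x}"

definition H1_space :: "'a::euclidean_space set \<Rightarrow> 'a measure \<Rightarrow> ('a \<Rightarrow> real) set" where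
  "H1_space U M = {f \<in> L2_space M. \<exists>g. is_weak_gradient U f g \<and> g \<in> L2_space M}"

definition rayleigh :: "'a::euclidean_space set \<Rightarrow> 'a measure \<Rightarrow> ('a \<Rightarrow> real) \<Rightarrow> real" where
  "rayleigh U M f = (LINT x|M. (norm (weak_gradient U f x))\<^sup>2) / (LINT x|M. (f x)\<^sup>2)"

section \<open>The Gaussian evolution\<close>

definition gauss :: "real \<Rightarrow> 'a::euclidean_space \<Rightarrow> real" where
  "gauss s x = (2 * pi * s) powr (- (real DIM('a) / 2)) * exp (- (norm x)\<^sup>2 / (2 * s))"

definition heat :: "real \<Rightarrow> ('a::euclidean_space \<Rightarrow> real) \<Rightarrow> 'a \<Rightarrow> real" where
  "heat s f x = (LINT y|lborel. f y * gauss s (x - y))"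

definition measure_at :: "'a::ordered_euclidean_space measure \<Rightarrow> real \<Rightarrow> 'a measure" where
  "measure_at M s = (if s = 0 then M else M \<star> density lborel (\<lambda>x. ennreal (gauss s x)))"

definition density_at :: "('a::euclidean_space \<Rightarrow> real) \<Rightarrow> real \<Rightarrow> 'a \<Rightarrow> real" where
  "density_at \<rho> s = (if s = 0 then \<rho> else heat s \<rho>)"

definition Q :: "('a::euclidean_space \<Rightarrow> real) \<Rightarrow> real \<Rightarrow> ('a \<Rightarrow> real) \<Rightarrow> 'a \<Rightarrow> real" where
  "Q \<rho> s \<phi> = (if s = 0 then \<phi> else (\<lambda>x. heat s (\<lambda>y. \<phi> y * \<rho> y) x / heat s \<rho> x))"

end

theory Submission
  imports Defs
begin

text \<open>
  Let \<open>Y\<close> have density \<open>\<rho>\<close> and \<open>X = Y + \<surd>s Z\<close> with an independent standard Gaussian vector \<open>Z\<close>. Then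
  \<open>\<rho>\<^sub>s\<close> is the density of \<open>X\<close>, and \<open>f = Q\<^sub>s \<phi>\<close> is the conditional expectation of \<open>\<phi>(Y)\<close> given \<open>X\<close>. Write
  \<open>N(s) = \<integral> f\<^sup>2 d\<mu>\<^sub>s\<close> (\<open>mass\<close>), \<open>D(s) = \<integral> |\<nabla> f|\<^sup>2 d\<mu>\<^sub>s\<close> (\<open>energy\<close>) and \<open>L f = \<Delta> f + \<nabla> ln \<rho>\<^sub>s \<cdot> \<nabla> f\<close>,
  the symmetric operator with \<open>\<integral> f L f d\<mu>\<^sub>s = - D(s)\<close>. The heat equation for \<open>\<rho>\<^sub>s\<close> and \<open>f \<rho>\<^sub>s\<close> and
  integrations by parts give, for \<open>s > 0\<close>,
  \<open>N' = - D\<close> and \<open>D' = - \<integral> (L f)\<^sup>2 d\<mu>\<^sub>s + \<integral> (Hess (ln \<rho>\<^sub>s) \<nabla> f) \<cdot> \<nabla> f d\<mu>\<^sub>s\<close>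
  (\<open>mass_deriv\<close>, \<open>energy_deriv\<close>). By the Prekopa--Leindler inequality \<open>\<rho>\<^sub>s\<close> is log-concave
  (\<open>log_concave_heat\<close>), so the last integral is nonpositive, and Cauchy--Schwarz gives
  \<open>D\<^sup>2 \<le> N \<integral> (L f)\<^sup>2 d\<mu>\<^sub>s\<close>. Hence \<open>R = D / N\<close> has derivative \<open>(D' N + D\<^sup>2) / N\<^sup>2 \<le> 0\<close>, and
  \<open>(ln N)' = - R\<close> is nondecreasing, that is, \<open>ln N\<close> is convex.

  Three points need care. First, these computations require that derivatives and integrals may be exchanged.
  For bounded \<open>\<phi>\<close> all functions that occur are bounded by conditional moments of \<open>|X - Y|\<close>, and
  products of such functions are again of this kind (\<open>tame\<close>, \<open>moment_mult_le\<close>). General \<open>\<phi>\<close> in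
  \<open>L\<^sup>2(\<mu>)\<close> are reached by truncation, since \<open>N(s) \<le> N(0)\<close> and \<open>D(s) \<le> N(0) / s\<close> make both quantities
  continuous in \<open>\<phi>\<close>.

  Second, \<open>N\<close> must not vanish. The inequalities are proved for \<open>N + \<epsilon>\<close>; the convexity of
  \<open>ln (N + \<epsilon>)\<close> shows that a zero of \<open>N\<close> would propagate to all smaller times, which is
  impossible because \<open>N(s) \<rightarrow> N(0) > 0\<close> as \<open>s \<rightarrow> 0\<close> (\<open>mass_tendsto_mass0\<close>, \<open>mass_pos\<close>).

  Third, time 0 has to be included, where \<open>\<nabla> \<phi>\<close> is only a weak gradient in the interior of
  \<open>{\<rho> > 0}\<close>. It suffices to show \<open>D(s) \<le> \<integral> |\<nabla> \<phi>|\<^sup>2 d\<mu>\<close> for \<open>s > 0\<close> (\<open>energy_le_gradient\<close>), because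
  then \<open>D(t) N(r) \<le> D(r) N(t) \<le> \<integral> |\<nabla> \<phi>|\<^sup>2 d\<mu> N(t)\<close> for \<open>0 < r < t\<close>, and \<open>r \<rightarrow> 0\<close>. For smooth
  Lipschitz \<open>\<phi>\<close> the bound holds because \<open>r D(s) \<le> N(0) - N(r)\<close> for \<open>r < s\<close>, and
  \<open>N(0) - N(r)\<close> is an expected conditional variance, at most \<open>E (\<phi>(X) - \<phi>(Y))\<^sup>2\<close> at time \<open>r\<close>, which is
  asymptotically \<open>r \<integral> |\<nabla> \<phi>|\<^sup>2 d\<mu>\<close>. A general \<open>\<phi>\<close> is cut off and averaged over the points
  \<open>l x + (1 - l) z\<close> with \<open>z\<close> in a box inside the domain: these stay away from its boundary, and by
  log-concavity the energy grows at most by a factor tending to 1 as \<open>l \<rightarrow> 1\<close> (\<open>mollification\<close>).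
\<close>

section \<open>Integrals depending on a parameter, translations and divergences\<close>

text \<open>Differentiation under the integral sign: the mean value theorem bounds the difference
  quotients by the dominating function \<open>h\<close>, so dominated convergence applies to them.\<close>

lemma has_real_derivative_integral:
  fixes F :: "real \<Rightarrow> 'a \<Rightarrow> real"
  assumes t: "t \<in> {a<..<b}"
    and int: "\<And>r. r \<in> {a<..<b} \<Longrightarrow> integrable M (F r)"
    and der: "\<And>r x. r \<in> {a<..<b} \<Longrightarrow> x \<in> space M \<Longrightarrow>
                ((\<lambda>r. F r x) has_real_derivative F' r x) (at r)"
    and bound: "\<And>r x. r \<in> {a<..<b} \<Longrightarrow> x \<in> space M \<Longrightarrow> \<bar>F' r x\<bar> \<le> h x"
    and h: "integrable M h"
  shows "((\<lambda>r. LINT x|M. F r x) has_real_derivative (LINT x|M. F' t x)) (at t)"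
proof -
  let ?S = "{a<..<b}"
  have "((\<lambda>r. ((LINT x|M. F r x) - (LINT x|M. F t x)) / (r - t)) \<longlongrightarrow> (LINT x|M. F' t x)) (at t within ?S)"
    unfolding tendsto_at_iff_sequentially
  proof (intro allI impI)
    fix X assume X: "\<forall>i. X i \<in> ?S - {t}" and lim: "X \<longlonglongrightarrow> t"
    let ?G = "\<lambda>i x. (F (X i) x - F t x) / (X i - t)"
    have conv: "(\<lambda>i. ?G i x) \<longlonglongrightarrow> F' t x" if "x \<in> space M" for x
    proof -
      have "((\<lambda>r. (F r x - F t x) / (r - t)) \<longlongrightarrow> F' t x) (at t within ?S)"
        using has_field_derivative_at_within[OF der[OF t that], of ?S] by (simp add: has_field_derivative_iff)
      from this[unfolded tendsto_at_iff_sequentially, rule_format, of X] X lim show ?thesis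
        by (simp add: comp_def)
    qed
    have meas: "?G i \<in> borel_measurable M" for i
    proof -
      have "F (X i) \<in> borel_measurable M" "F t \<in> borel_measurable M"
        using int[of "X i"] int[OF t] X by auto
      then show ?thesis by measurable
    qed
    have bd: "norm (?G i x) \<le> h x" if "x \<in> space M" for i x
    proof -
      have "norm (F (X i) x - F t x) \<le> h x * norm (X i - t)"
      proof (rule field_differentiable_bound[of ?S "\<lambda>r. F r x" "\<lambda>r. F' r x"])
        show "((\<lambda>r. F r x) has_field_derivative F' r x) (at r within ?S)" if "r \<in> ?S" for r
          by (rule has_field_derivative_at_within[OF der[OF that \<open>x \<in> space M\<close>]])
        show "norm (F' r x) \<le> h x" if "r \<in> ?S" for r
          using bound[OF that \<open>x \<in> space M\<close>] by simp
        show "X i \<in> ?S" "t \<in> ?S" using X t by blast+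
      qed simp
      moreover have "norm (X i - t) > 0" using X by auto
      ultimately show ?thesis by (simp add: divide_le_eq)
    qed
    have "(\<lambda>i. LINT x|M. ?G i x) \<longlonglongrightarrow> (LINT x|M. F' t x)"
    proof (rule integral_dominated_convergence[OF _ _ h])
      show "F' t \<in> borel_measurable M"
        using conv meas by (rule borel_measurable_LIMSEQ_real)
      show "AE x in M. (\<lambda>i. ?G i x) \<longlonglongrightarrow> F' t x" by (rule AE_I2[OF conv])
      show "AE x in M. norm (?G i x) \<le> h x" for i by (rule AE_I2[OF bd])
    qed (rule meas)
    moreover have "(\<lambda>i. LINT x|M. ?G i x)
        = ((\<lambda>r. ((LINT x|M. F r x) - (LINT x|M. F t x)) / (r - t)) \<circ> X)"
    proof
      fix i
      show "(LINT x|M. ?G i x) = ((\<lambda>r. ((LINT x|M. F r x) - (LINT x|M. F t x)) / (r - t)) \<circ> X) i"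
        using Bochner_Integration.integral_diff[OF int[of "X i"] int[OF t]] X by (simp del: Bochner_Integration.integral_diff)
    qed
    ultimately show "((\<lambda>r. ((LINT x|M. F r x) - (LINT x|M. F t x)) / (r - t)) \<circ> X) \<longlonglongrightarrow> (LINT x|M. F' t x)"
      by (rule back_subst[where P="\<lambda>g. g \<longlonglongrightarrow> (LINT x|M. F' t x)"])
  qed
  then have "((\<lambda>r. LINT x|M. F r x) has_real_derivative (LINT x|M. F' t x)) (at t within ?S)"
    by (simp add: has_field_derivative_iff)
  then show ?thesis using at_within_open[OF t] by simp
qed

lemma lborel_translation:
  fixes f :: "'a::euclidean_space \<Rightarrow> 'b::{banach, second_countable_topology}"
  assumes [measurable]: "f \<in> borel_measurable borel"
  shows integrable_lborel_translation: "integrable lborel (\<lambda>x. f (x + c)) \<longleftrightarrow> integrable lborel f"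
    and integral_lborel_translation: "(LINT x|lborel. f (x + c)) = (LINT x|lborel. f x)"
proof -
  have d: "distr lborel borel (\<lambda>x. x + c) = lborel"
  proof -
    have "(\<lambda>x. x + c) = (+) c" by (simp add: fun_eq_iff add.commute)
    then show ?thesis using lborel_distr_plus[of c] by (simp only:)
  qed
  show "integrable lborel (\<lambda>x. f (x + c)) \<longleftrightarrow> integrable lborel f"
    using integrable_distr_eq[of "\<lambda>x. x + c" lborel borel f] by (simp add: d)
  show "(LINT x|lborel. f (x + c)) = (LINT x|lborel. f x)"
    using integral_distr[of "\<lambda>x. x + c" lborel borel f] by (simp add: d)
qed

lemma lborel_affine_substitution:
  fixes f :: "'a::euclidean_space \<Rightarrow> real"
  assumes [measurable]: "f \<in> borel_measurable borel" and c: "c \<noteq> 0"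
  shows integrable_lborel_affine: "integrable lborel (\<lambda>x. f (t + c *\<^sub>R x)) \<longleftrightarrow> integrable lborel f"
    and integral_lborel_affine:
      "(LINT x|lborel. f (t + c *\<^sub>R x)) = (LINT x|lborel. f x) / \<bar>c\<bar> ^ DIM('a)"
proof -
  let ?D = "distr lborel borel (\<lambda>x::'a. t + c *\<^sub>R x)"
  have L: "lborel = density ?D (\<lambda>_. ennreal (\<bar>c\<bar>^DIM('a)))"
    using lborel_affine[OF c, of t] by (simp add: ennreal_power)
  have "integrable lborel f \<longleftrightarrow> integrable (density ?D (\<lambda>_. ennreal (\<bar>c\<bar>^DIM('a)))) f"
    by (subst L) simp
  also have "\<dots> \<longleftrightarrow> integrable lborel (\<lambda>x. f (t + c *\<^sub>R x))"
    using c by (simp add: integrable_density integrable_distr_eq)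
  finally show "integrable lborel (\<lambda>x. f (t + c *\<^sub>R x)) \<longleftrightarrow> integrable lborel f" ..
  have "(LINT x|lborel. f x) = (LINT x|density ?D (\<lambda>_. ennreal (\<bar>c\<bar>^DIM('a))). f x)"
    by (subst L) simp
  also have "\<dots> = \<bar>c\<bar> ^ DIM('a) * (LINT x|lborel. f (t + c *\<^sub>R x))"
    using c by (simp add: integral_density integral_distr)
  finally show "(LINT x|lborel. f (t + c *\<^sub>R x)) = (LINT x|lborel. f x) / \<bar>c\<bar> ^ DIM('a)"
    using c by (simp add: field_simps)
qed

lemma directional_deriv_shift:
  fixes F F' :: "'a::real_vector \<Rightarrow> real"
  assumes der: "\<And>x. ((\<lambda>t. F (x + t *\<^sub>R e)) has_real_derivative F' x) (at 0)"
  shows "((\<lambda>t. F (x + t *\<^sub>R e)) has_real_derivative F' (x + t *\<^sub>R e)) (at t)"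
proof -
  have "(\<lambda>r. F ((x + t *\<^sub>R e) + r *\<^sub>R e)) = (\<lambda>r. F (x + (t + r) *\<^sub>R e))"
    by (simp add: algebra_simps)
  then show ?thesis
    using der[of "x + t *\<^sub>R e"] DERIV_at_within_shift[of "\<lambda>r. F (x + r *\<^sub>R e)" "F' (x + t *\<^sub>R e)" t 0 UNIV]
    by simp
qed

text \<open>Integrating \<open>F'\<close> along the segment from \<open>x\<close> to \<open>x + e\<close> gives \<open>F (x + e) - F x\<close>. Integration
  over \<open>x\<close> annihilates the right-hand side, and turns the left-hand side into the integral of
  \<open>F'\<close>, by translation invariance. This replaces the divergence theorem on the whole space.\<close>

lemma integral_directional_derivative_eq_0:
  fixes F F' :: "'a::euclidean_space \<Rightarrow> real"
  assumes der: "\<And>x. ((\<lambda>t. F (x + t *\<^sub>R e)) has_real_derivative F' x) (at 0)"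
    and cont: "continuous_on UNIV F'"
    and F: "integrable lborel F" and F': "integrable lborel F'"
  shows "(LINT x|lborel. F' x) = 0"
proof -
  have [measurable]: "F' \<in> borel_measurable borel" "F \<in> borel_measurable borel"
    using cont F by (auto intro: borel_measurable_continuous_onI)
  note der' = directional_deriv_shift[of F e F', OF der]
  have FTC: "(LINT t|lborel. indicator {0..1} t * F' (x + t *\<^sub>R e)) = F (x + e) - F x" for x
  proof -
    have "(LINT t|lborel. indicator {0..1} t *\<^sub>R F' (x + t *\<^sub>R e)) = F (x + 1 *\<^sub>R e) - F (x + 0 *\<^sub>R e)"
    proof (rule integral_FTC_Icc)
      show "continuous_on {0..1} (\<lambda>t. F' (x + t *\<^sub>R e))"
        by (rule continuous_on_compose2[OF cont]) (auto intro!: continuous_intros)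
    qed (use der' in \<open>auto simp: has_real_derivative_iff_has_vector_derivative intro: has_vector_derivative_at_within\<close>)
    then show ?thesis by simp
  qed
  let ?G = "\<lambda>(t, x). indicator {0..1::real} t * F' (x + t *\<^sub>R e)"
  have G: "integrable (lborel \<Otimes>\<^sub>M lborel) ?G"
  proof (rule lborel_pair.Fubini_integrable)
    have "(LINT x|lborel. norm (case (t, x) of (t, x) \<Rightarrow> indicator {0..1::real} t * F' (x + t *\<^sub>R e)))
        = indicator {0..1} t * (LINT x|lborel. \<bar>F' x\<bar>)" for t
      using integral_lborel_translation[of "\<lambda>x. \<bar>F' x\<bar>" "t *\<^sub>R e"] by (simp add: abs_mult)
    then show "integrable lborel (\<lambda>t. LINT x|lborel. norm (case (t, x) of (t, x) \<Rightarrow> indicator {0..1::real} t * F' (x + t *\<^sub>R e)))"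
      by (auto intro!: integrable_mult_left)
    show "AE t in lborel. integrable lborel (\<lambda>x. case (t, x) of (t, x) \<Rightarrow> indicator {0..1::real} t * F' (x + t *\<^sub>R e))"
      using F' by (simp add: integrable_lborel_translation)
  qed measurable
  have "(LINT x|lborel. (LINT t|lborel. indicator {0..1} t * F' (x + t *\<^sub>R e)))
      = (LINT t|lborel. (LINT x|lborel. indicator {0..1} t * F' (x + t *\<^sub>R e)))"
    using lborel_pair.Fubini_integral[OF G] by simp
  also have "\<dots> = (LINT t|lborel. indicator {0..1::real} t * (LINT x|lborel. F' x))"
    by (simp add: integral_lborel_translation)
  also have "\<dots> = (LINT x|lborel. F' x)"
    by simp
  finally have "(LINT x|lborel. F' x) = (LINT x|lborel. F (x + e) - F x)"
    by (simp add: FTC)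
  also have "\<dots> = 0"
    using F by (simp add: integrable_lborel_translation integral_lborel_translation)
  finally show ?thesis .
qed

section \<open>The heat kernel and its derivatives\<close>

lemma gauss_inner: "gauss s (x::'a::euclidean_space) = (2 * pi * s) powr (- (real DIM('a) / 2)) * exp (- (x \<bullet> x) / (2 * s))"
  by (simp add: gauss_def power2_norm_eq_inner)

lemma gauss_pos: "0 < s \<Longrightarrow> 0 < gauss s x"
  by (simp add: gauss_def)

lemma gauss_nonneg [simp]: "0 \<le> gauss s x"
  by (simp add: gauss_def)

lemma gauss_minus: "gauss s (- x) = gauss s x"
  by (simp add: gauss_def)

lemma continuous_gauss [continuous_intros]: "continuous_on UNIV (gauss s)"
  unfolding gauss_def divide_inverse by (intro continuous_intros)

lemma borel_measurable_gauss [measurable]: "gauss s \<in> borel_measurable borel"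
  by (intro borel_measurable_continuous_onI continuous_intros)

lemma gauss_eq_prod:
  assumes "0 < s"
  shows "gauss s (x::'a::euclidean_space) = (\<Prod>b\<in>Basis. normal_density 0 (sqrt s) (x \<bullet> b))"
proof -
  define y where "y = 2 * pi * s"
  have y: "y > 0" using assms by (simp add: y_def)
  have "y powr (real DIM('a) / 2) = (y powr (1 / 2)) powr real DIM('a)"
    by (simp only: powr_powr) simp
  also have "\<dots> = sqrt y ^ DIM('a)"
    using y powr_realpow[of "sqrt y" "DIM('a)"] by (simp add: powr_half_sqrt)
  finally have p: "(2 * pi * s) powr (- (real DIM('a) / 2)) = (1 / sqrt (2 * pi * s)) ^ DIM('a)"
    unfolding y_def by (simp only: powr_minus) (simp add: power_one_over inverse_eq_divide)
  have "(\<Prod>b\<in>Basis. normal_density 0 (sqrt s) (x \<bullet> b))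
      = (1 / sqrt (2 * pi * s)) ^ DIM('a) * (\<Prod>b\<in>Basis. exp (- (x \<bullet> b)\<^sup>2 / (2 * s)))"
    using assms by (simp only: normal_density_def prod.distrib prod_constant) simp
  also have "(\<Prod>b\<in>Basis. exp (- (x \<bullet> b)\<^sup>2 / (2 * s))) = exp (- (x \<bullet> x) / (2 * s))"
    by (subst euclidean_inner) (simp add: exp_sum [symmetric] sum_negf sum_divide_distrib power2_eq_square)
  finally show ?thesis by (simp add: gauss_inner p)
qed

lemma has_bochner_integral_gauss:
  assumes "0 < s"
  shows "has_bochner_integral lborel (gauss s :: 'a::euclidean_space \<Rightarrow> real) 1"
proof (rule has_bochner_integral_nn_integral)
  have one: "(\<integral>\<^sup>+x. ennreal (normal_density 0 (sqrt s) x) \<partial>lborel) = 1"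
    using assms by (subst nn_integral_eq_integral) auto
  have "(\<integral>\<^sup>+x. ennreal (gauss s (x::'a)) \<partial>lborel)
      = (\<integral>\<^sup>+x. (\<Prod>b\<in>Basis. ennreal (normal_density 0 (sqrt s) ((x::'a) \<bullet> b))) \<partial>lborel)"
    using assms by (simp add: gauss_eq_prod prod_ennreal)
  also have "\<dots> = 1"
    by (subst nn_integral_lborel_prod) (auto simp: one)
  finally show "(\<integral>\<^sup>+x. ennreal (gauss s (x::'a)) \<partial>lborel) = ennreal 1" by simp
qed (use assms gauss_pos[OF assms] in \<open>auto intro: less_imp_le\<close>)

lemma integrable_gauss: "0 < s \<Longrightarrow> integrable lborel (gauss s)"
  and integral_gauss: "0 < s \<Longrightarrow> (LINT z|lborel. gauss s z) = 1"
  using has_bochner_integral_gauss by (auto simp: has_bochner_integral_iff)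

text \<open>Only the normalising constants compete: the exponential factor increases with the variance.
  The bound lets a whole compact interval of times be dominated by a single Gaussian.\<close>

lemma gauss_le_gauss:
  assumes "0 < a" "a \<le> b"
  shows "\<exists>C>0. \<forall>s\<in>{a..b}. \<forall>z::'a::euclidean_space. gauss s z \<le> C * gauss b z"
proof -
  let ?n = "real DIM('a) / 2"
  define C where "C = (2 * pi * a) powr (- ?n) / (2 * pi * b) powr (- ?n)"
  have C: "C > 0" using assms by (simp add: C_def)
  have "gauss s z \<le> C * gauss b z" if s: "s \<in> {a..b}" for s and z :: 'a
  proof -
    have "(2 * pi * s) powr (- ?n) \<le> (2 * pi * a) powr (- ?n)"
      using s assms by (intro powr_mono2') auto
    moreover have "exp (- (z \<bullet> z) / (2 * s)) \<le> exp (- (z \<bullet> z) / (2 * b))"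
      using s assms by (auto intro!: divide_left_mono)
    ultimately have "gauss s z \<le> (2 * pi * a) powr (- ?n) * exp (- (z \<bullet> z) / (2 * b))"
      unfolding gauss_inner by (intro mult_mono) auto
    also have "\<dots> = C * gauss b z"
      using assms by (simp add: C_def gauss_inner)
    finally show ?thesis .
  qed
  with C show ?thesis by blast
qed

text \<open>Derivatives of the Gaussian are polynomials times the Gaussian; \<open>pgauss K\<close> is the majorant
  for those of degree at most \<open>K\<close>.\<close>

definition pgauss :: "nat \<Rightarrow> real \<Rightarrow> 'a::euclidean_space \<Rightarrow> real" where
  "pgauss K s z = (1 + norm z) ^ K * gauss s z"

lemma pgauss_pos: "0 < s \<Longrightarrow> 0 < pgauss K s z"
  unfolding pgauss_def using gauss_pos[of s z] by (intro mult_pos_pos zero_less_power) (auto intro: add_pos_nonneg)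

lemma pgauss_nonneg [simp]: "0 \<le> pgauss K s z"
  by (simp add: pgauss_def)

lemma continuous_pgauss [continuous_intros]: "continuous_on UNIV (pgauss K s)"
  unfolding pgauss_def by (intro continuous_intros)

lemma borel_measurable_pgauss [measurable]: "pgauss K s \<in> borel_measurable borel"
  by (intro borel_measurable_continuous_onI continuous_intros)

lemma pgauss_mono: "0 < s \<Longrightarrow> K \<le> L \<Longrightarrow> pgauss K s z \<le> pgauss L s z"
  unfolding pgauss_def using gauss_pos[of s z] by (intro mult_right_mono power_increasing) auto

text \<open>A polynomial is absorbed by doubling the variance.\<close>

lemma pgauss_le_gauss:
  assumes s: "0 < s"
  shows "\<exists>C>0. \<forall>z::'a::euclidean_space. pgauss K s z \<le> C * gauss (2 * s) z"
proof -
  define b where "b = 1 / (4 * s * (real K + 1))"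
  have b: "b > 0" using s by (simp add: b_def)
  have lin: "1 + r \<le> (1 + 1 / b) * exp (b * r\<^sup>2)" if "r \<ge> 0" for r
  proof -
    have "0 \<le> (b * r - 1)\<^sup>2 / b" using b by simp
    then have "2 * r \<le> 1 / b + b * r\<^sup>2" using b by (simp add: field_simps power2_eq_square)
    moreover have "0 \<le> b * r\<^sup>2" "0 \<le> 1 / b" using b by auto
    moreover have "(1 + 1 / b) * (1 + b * r\<^sup>2) = 1 + 1/b + b * r\<^sup>2 + r\<^sup>2"
      using b by (simp add: field_simps)
    ultimately have "1 + r \<le> (1 + 1 / b) * (1 + b * r\<^sup>2)" using that zero_le_power2[of r] by linarith
    also have "\<dots> \<le> (1 + 1 / b) * exp (b * r\<^sup>2)"
      using b by (intro mult_left_mono exp_ge_add_one_self) auto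
    finally show ?thesis .
  qed
  let ?n = "real DIM('a) / 2"
  define C where "C = (1 + 1 / b) ^ K * ((2 * pi * s) powr (- ?n) / (2 * pi * (2 * s)) powr (- ?n))"
  have C: "C > 0" using b s by (simp add: C_def add_pos_pos)
  have "pgauss K s z \<le> C * gauss (2 * s) z" for z :: 'a
  proof -
    have "(1 + norm z) ^ K \<le> ((1 + 1 / b) * exp (b * (norm z)\<^sup>2)) ^ K"
      by (intro power_mono lin) auto
    also have "\<dots> = (1 + 1 / b) ^ K * exp (real K * (b * (norm z)\<^sup>2))"
      by (simp add: power_mult_distrib exp_of_nat_mult)
    also have "\<dots> \<le> (1 + 1 / b) ^ K * exp ((norm z)\<^sup>2 / (4 * s))"
    proof -
      have "real K * b \<le> 1 / (4 * s)" using s by (simp add: b_def divide_simps)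
      then have "real K * b * (norm z)\<^sup>2 \<le> 1 / (4 * s) * (norm z)\<^sup>2" by (intro mult_right_mono) auto
      then show ?thesis using b by (intro mult_left_mono) (auto simp: mult.assoc)
    qed
    finally have "pgauss K s z \<le> (1 + 1 / b) ^ K * exp ((norm z)\<^sup>2 / (4 * s)) * gauss s z"
      unfolding pgauss_def using gauss_pos[OF s, of z] by (intro mult_right_mono) auto
    also have "\<dots> = C * gauss (2 * s) z"
    proof -
      have "exp ((norm z)\<^sup>2 / (4 * s)) * exp (- (norm z)\<^sup>2 / (2 * s)) = exp (- (norm z)\<^sup>2 / (2 * (2 * s)))"
        unfolding exp_add[symmetric] by (simp add: field_simps)
      then show ?thesis using s by (simp add: C_def gauss_def mult.assoc mult.left_commute)
    qed
    finally show ?thesis .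
  qed
  with C show ?thesis by blast
qed

lemma gauss_bounded: "0 < s \<Longrightarrow> gauss s (z::'a::euclidean_space) \<le> (2 * pi * s) powr (- (real DIM('a) / 2))"
  by (simp add: gauss_def mult_left_le)

lemma pgauss_bounded:
  assumes s: "0 < s" shows "\<exists>C>0. \<forall>z::'a::euclidean_space. pgauss K s z \<le> C"
proof -
  obtain C where "C > 0" "\<And>z::'a. pgauss K s z \<le> C * gauss (2 * s) z" using pgauss_le_gauss[OF s] by blast
  moreover have "gauss (2 * s) z \<le> (2 * pi * (2 * s)) powr (- (real DIM('a) / 2))" for z :: 'a
    using s by (intro gauss_bounded) simp
  ultimately have "pgauss K s z \<le> C * (2 * pi * (2 * s)) powr (- (real DIM('a) / 2))" for z :: 'a
    by (meson mult_left_mono less_imp_le order.trans)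
  then show ?thesis using s \<open>C > 0\<close>
    by (intro exI[of _ "C * (2 * pi * (2 * s)) powr (- (real DIM('a) / 2))"]) auto
qed

lemma integrable_pgauss:
  assumes s: "0 < s" shows "integrable lborel (pgauss K s :: 'a::euclidean_space \<Rightarrow> real)"
proof -
  obtain C where C: "C > 0" "\<And>z::'a. pgauss K s z \<le> C * gauss (2 * s) z" using pgauss_le_gauss[OF s] by blast
  show ?thesis
  proof (rule Bochner_Integration.integrable_bound)
    show "integrable lborel (\<lambda>z::'a. C * gauss (2 * s) z)" using integrable_gauss[of "2 * s"] s by auto
    show "AE z::'a in lborel. norm (pgauss K s z) \<le> norm (C * gauss (2 * s) z)"
    proof (rule AE_I2)
      fix z :: 'a
      show "norm (pgauss K s z) \<le> norm (C * gauss (2 * s) z)"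
        using order.trans[OF C(2)[of z] abs_ge_self] pgauss_pos[OF s, of K z] by simp
    qed
  qed simp
qed

text \<open>The derivatives of the heat kernel: \<open>gauss1\<close> and \<open>gauss2\<close> are the first and second
  directional derivatives, \<open>gaussL\<close> is the Laplacian, and \<open>gaussL1\<close> is the directional derivative
  of the Laplacian. Explicit formulas make the polynomial bounds immediate.\<close>

definition gauss1 :: "real \<Rightarrow> 'a::euclidean_space \<Rightarrow> 'a \<Rightarrow> real" where
  "gauss1 s e z = - (z \<bullet> e) / s * gauss s z"

definition gauss2 :: "real \<Rightarrow> 'a::euclidean_space \<Rightarrow> 'a \<Rightarrow> 'a \<Rightarrow> real" where
  "gauss2 s d e z = ((z \<bullet> d) * (z \<bullet> e) / s\<^sup>2 - (d \<bullet> e) / s) * gauss s z"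

definition gaussL :: "real \<Rightarrow> 'a::euclidean_space \<Rightarrow> real" where
  "gaussL s z = ((z \<bullet> z) / s\<^sup>2 - real DIM('a) / s) * gauss s z"

definition gaussL1 :: "real \<Rightarrow> 'a::euclidean_space \<Rightarrow> 'a \<Rightarrow> real" where
  "gaussL1 s e z = (z \<bullet> e) / s * (2 / s - ((z \<bullet> z) / s\<^sup>2 - real DIM('a) / s)) * gauss s z"

lemma continuous_gauss_derivs [continuous_intros]:
  "continuous_on UNIV (gauss1 s e)" "continuous_on UNIV (gauss2 s d e)"
  "continuous_on UNIV (gaussL s)" "continuous_on UNIV (gaussL1 s e)"
  unfolding gauss1_def gauss2_def gaussL_def gaussL1_def divide_inverse by (intro continuous_intros)+

lemma gauss_deriv:
  assumes "0 < s"
  shows "((\<lambda>t. gauss s (z + t *\<^sub>R e)) has_real_derivative gauss1 s e (z + t *\<^sub>R e)) (at t)"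
proof -
  have "((\<lambda>t. (2 * pi * s) powr (- (real DIM('a) / 2)) *
      exp (- (z \<bullet> z + 2 * t * (z \<bullet> e) + t * t * (e \<bullet> e)) / (2 * s))) has_real_derivative
        - ((z + t *\<^sub>R e) \<bullet> e) / s * gauss s (z + t *\<^sub>R e)) (at t)"
    unfolding gauss_inner using assms
    by (auto intro!: derivative_eq_intros simp: inner_simps inner_commute field_simps)
  then show ?thesis
    by (simp add: gauss_inner gauss1_def inner_simps inner_commute algebra_simps)
qed

lemma gauss1_deriv:
  assumes "0 < s"
  shows "((\<lambda>t. gauss1 s d (z + t *\<^sub>R e)) has_real_derivative gauss2 s d e (z + t *\<^sub>R e)) (at t)"
proof -
  have "((\<lambda>t. - ((z + t *\<^sub>R e) \<bullet> d) / s) has_real_derivative - (e \<bullet> d) / s) (at t)"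
    using assms by (auto intro!: derivative_eq_intros simp: inner_simps)
  from DERIV_mult[OF this gauss_deriv[OF assms]] show ?thesis
    unfolding gauss1_def
    by (rule DERIV_cong) (use assms in \<open>simp add: gauss1_def gauss2_def inner_commute field_simps power2_eq_square\<close>)
qed

lemma gaussL_deriv:
  assumes "0 < s"
  shows "((\<lambda>t. gaussL s (z + t *\<^sub>R e)) has_real_derivative gaussL1 s e (z + t *\<^sub>R e)) (at t)"
proof -
  have "((\<lambda>t. (z \<bullet> z + 2 * t * (z \<bullet> e) + t * t * (e \<bullet> e)) / s\<^sup>2 - real DIM('a) / s) has_real_derivative
      2 * ((z + t *\<^sub>R e) \<bullet> e) / s\<^sup>2) (at t)"
    using assms by (auto intro!: derivative_eq_intros simp: inner_simps inner_commute field_simps)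
  then have "((\<lambda>t. ((z + t *\<^sub>R e) \<bullet> (z + t *\<^sub>R e)) / s\<^sup>2 - real DIM('a) / s) has_real_derivative
      2 * ((z + t *\<^sub>R e) \<bullet> e) / s\<^sup>2) (at t)"
    by (simp add: inner_simps inner_commute algebra_simps)
  from DERIV_mult[OF this gauss_deriv[OF assms]] show ?thesis
    unfolding gaussL_def
    by (rule DERIV_cong) (use assms in \<open>simp add: gauss1_def gaussL1_def field_simps power2_eq_square\<close>)
qed

text \<open>The heat equation \<open>\<partial>\<^sub>s \<gamma>\<^sub>s = \<Delta> \<gamma>\<^sub>s / 2\<close>.\<close>

lemma gauss_time_deriv:
  assumes "0 < s"
  shows "((\<lambda>s. gauss s (z::'a::euclidean_space)) has_real_derivative gaussL s z / 2) (at s)"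
proof -
  define c where "c = - (real DIM('a) / 2)"
  have "((\<lambda>s. (2 * pi * s) powr c) has_real_derivative c / s * (2 * pi * s) powr c) (at s)"
    using assms by (auto intro!: derivative_eq_intros simp: powr_diff)
  moreover have "((\<lambda>s. exp (- (z \<bullet> z) / (2 * s))) has_real_derivative
      (z \<bullet> z) / (2 * s\<^sup>2) * exp (- (z \<bullet> z) / (2 * s))) (at s)"
    using assms by (auto intro!: derivative_eq_intros simp: power2_eq_square)
  ultimately have "((\<lambda>s. (2 * pi * s) powr c * exp (- (z \<bullet> z) / (2 * s))) has_real_derivative
      c / s * (2 * pi * s) powr c * exp (- (z \<bullet> z) / (2 * s)) +
      (z \<bullet> z) / (2 * s\<^sup>2) * exp (- (z \<bullet> z) / (2 * s)) * (2 * pi * s) powr c) (at s)"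
    by (rule DERIV_mult)
  then show ?thesis
    unfolding gauss_inner c_def[symmetric]
    by (rule DERIV_cong) (simp add: gaussL_def gauss_inner c_def algebra_simps)
qed

lemma gauss1_time_deriv:
  assumes "0 < s"
  shows "((\<lambda>s. gauss1 s e z) has_real_derivative gaussL1 s e z / 2) (at s)"
proof -
  have "((\<lambda>s. - (z \<bullet> e) / s) has_real_derivative (z \<bullet> e) / s\<^sup>2) (at s)"
    using assms by (auto intro!: derivative_eq_intros simp: power2_eq_square)
  from DERIV_mult[OF this gauss_time_deriv[OF assms]] show ?thesis
    unfolding gauss1_def
    by (rule DERIV_cong) (use assms in \<open>simp add: gaussL_def gaussL1_def field_simps power2_eq_square\<close>)
qed

lemma sum_gauss2: "(\<Sum>b\<in>Basis. gauss2 s b b z) = gaussL s z"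
proof -
  have "(\<Sum>b\<in>Basis. (z \<bullet> b) * (z \<bullet> b) / s\<^sup>2 - (b \<bullet> b) / s) = (z \<bullet> z) / s\<^sup>2 - real DIM('a) / s"
    by (simp add: sum_subtractf euclidean_inner[of z z] flip: sum_divide_distrib)
  then show ?thesis
    unfolding gauss2_def gaussL_def by (simp flip: sum_distrib_right)
qed

text \<open>The exponent 3 is the degree of the polynomial in \<open>gaussL1\<close>, the highest derivative in use.
  The constant is uniform over compact time intervals, so that such kernels can be differentiated
  in time under the integral.\<close>

definition gauss_dominated :: "(real \<Rightarrow> 'a::euclidean_space \<Rightarrow> real) \<Rightarrow> bool" where
  "gauss_dominated k \<longleftrightarrow> (\<forall>a b. 0 < a \<longrightarrow> a \<le> b \<longrightarrow> (\<exists>C>0. \<forall>s\<in>{a..b}. \<forall>z. \<bar>k s z\<bar> \<le> C * pgauss 3 s z))"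

lemma gauss_dominatedI:
  assumes "\<And>a b. 0 < a \<Longrightarrow> a \<le> b \<Longrightarrow> \<exists>C. \<forall>s\<in>{a..b}. \<forall>z. \<bar>p s z\<bar> \<le> C * (1 + norm z) ^ 3"
  shows "gauss_dominated (\<lambda>s z. p s z * gauss s z)"
  unfolding gauss_dominated_def
proof (intro allI impI)
  fix a b :: real assume ab: "0 < a" "a \<le> b"
  obtain C where C: "\<And>s z. s \<in> {a..b} \<Longrightarrow> \<bar>p s z\<bar> \<le> C * (1 + norm z) ^ 3" using assms[OF ab] by blast
  have "\<bar>p s z * gauss s z\<bar> \<le> (\<bar>C\<bar> + 1) * pgauss 3 s z" if "s \<in> {a..b}" for s z
  proof -
    have "\<bar>p s z\<bar> \<le> (\<bar>C\<bar> + 1) * (1 + norm z) ^ 3"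
      by (rule order.trans[OF C[OF that]]) (auto intro!: mult_right_mono)
    then show ?thesis
      using gauss_pos[of s z] that ab by (auto simp: pgauss_def abs_mult mult.assoc[symmetric] intro!: mult_right_mono)
  qed
  then show "\<exists>C>0. \<forall>s\<in>{a..b}. \<forall>z. \<bar>p s z * gauss s z\<bar> \<le> C * pgauss 3 s z"
    by (intro exI[of _ "\<bar>C\<bar> + 1"]) auto
qed

text \<open>Over a time interval \<open>[a, b]\<close> with \<open>0 < a\<close> the factors \<open>1 / s\<close> are bounded by \<open>1 / a\<close>.\<close>

lemma gauss_dominated_derivs:
  fixes d e :: "'a::euclidean_space"
  shows "gauss_dominated (gauss :: real \<Rightarrow> 'a \<Rightarrow> real)"
    "gauss_dominated (\<lambda>s. gauss1 s e)" "gauss_dominated (\<lambda>s. gauss2 s d e)"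
    "gauss_dominated (gaussL :: real \<Rightarrow> 'a \<Rightarrow> real)" "gauss_dominated (\<lambda>s. gaussL1 s e)"
proof -
  have n: "1 \<le> 1 + norm z" "norm z \<le> 1 + norm z" for z :: 'a by auto
  have p1: "1 + norm z \<le> (1 + norm z) ^ 3" for z :: 'a using power_increasing[of 1 3 "1 + norm z"] by simp
  have p2: "(1 + norm z) ^ 2 \<le> (1 + norm z) ^ 3" for z :: 'a by (intro power_increasing) auto
  have p0: "1 \<le> (1 + norm z) ^ 3" for z :: 'a by simp
  have zz: "z \<bullet> z \<le> (1 + norm z) ^ 2" for z :: 'a
    using power_mono[of "norm z" "1 + norm z" 2] by (simp add: power2_norm_eq_inner)
  have ze: "\<bar>z \<bullet> e\<bar> \<le> norm e * (1 + norm z)" for z e :: 'a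
    using Cauchy_Schwarz_ineq2[of z e] by (smt (verit) mult_left_mono mult.commute n(2) norm_ge_zero)
  have 1: "\<exists>C. \<forall>s\<in>{a..b}. \<forall>z::'a. \<bar>1\<bar> \<le> C * (1 + norm z) ^ 3" for a b :: real
    using p0 by (intro exI[of _ 1]) auto
  show "gauss_dominated (gauss :: real \<Rightarrow> 'a \<Rightarrow> real)"
    using gauss_dominatedI[of "\<lambda>s z. 1::real", OF 1] by simp
  have 2: "\<exists>C. \<forall>s\<in>{a..b}. \<forall>z::'a. \<bar>- (z \<bullet> e) / s\<bar> \<le> C * (1 + norm z) ^ 3" if "0 < a" for a b :: real and e :: 'a
  proof (intro exI ballI allI)
    fix s and z :: 'a assume "s \<in> {a..b}"
    with that have "\<bar>- (z \<bullet> e) / s\<bar> \<le> norm e * (1 + norm z) ^ 3 / a"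
      using order.trans[OF ze mult_left_mono[OF p1 norm_ge_zero], of z e]
      by (auto intro!: frac_le)
    then show "\<bar>- (z \<bullet> e) / s\<bar> \<le> norm e / a * (1 + norm z) ^ 3" by simp
  qed
  show "gauss_dominated (\<lambda>s. gauss1 s e)"
    unfolding gauss1_def by (rule gauss_dominatedI, rule 2)
  have 3: "\<exists>C. \<forall>s\<in>{a..b}. \<forall>z::'a. \<bar>(z \<bullet> d) * (z \<bullet> e) / s\<^sup>2 - (d \<bullet> e) / s\<bar> \<le> C * (1 + norm z) ^ 3"
    if "0 < a" for a b :: real and d e :: 'a
  proof (intro exI ballI allI)
    fix s and z :: 'a assume s: "s \<in> {a..b}"
    have "\<bar>z \<bullet> d\<bar> * \<bar>z \<bullet> e\<bar> \<le> (norm d * (1 + norm z)) * (norm e * (1 + norm z))"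
      by (intro mult_mono ze) auto
    also have "\<dots> \<le> norm d * norm e * (1 + norm z) ^ 3"
      using mult_left_mono[OF p2[of z], of "norm d * norm e"] by (simp add: power2_eq_square algebra_simps)
    finally have "\<bar>(z \<bullet> d) * (z \<bullet> e) / s\<^sup>2\<bar> \<le> norm d * norm e * (1 + norm z) ^ 3 / a\<^sup>2"
      using s that by (auto simp: abs_mult intro!: frac_le power_mono)
    moreover have "\<bar>(d \<bullet> e) / s\<bar> \<le> norm d * norm e * (1 + norm z) ^ 3 / a"
      using s that order.trans[OF Cauchy_Schwarz_ineq2[of d e] mult_left_mono[OF p0[of z], of "norm d * norm e", simplified]]
      by (auto intro!: frac_le)
    ultimately have "\<bar>(z \<bullet> d) * (z \<bullet> e) / s\<^sup>2\<bar> + \<bar>(d \<bullet> e) / s\<bar>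
        \<le> norm d * norm e * (1 + norm z) ^ 3 / a\<^sup>2 + norm d * norm e * (1 + norm z) ^ 3 / a"
      by (rule add_mono)
    from order.trans[OF abs_triangle_ineq4 this]
    show "\<bar>(z \<bullet> d) * (z \<bullet> e) / s\<^sup>2 - (d \<bullet> e) / s\<bar> \<le> (norm d * norm e / a\<^sup>2 + norm d * norm e / a) * (1 + norm z) ^ 3"
      by (simp add: distrib_right)
  qed
  show "gauss_dominated (\<lambda>s. gauss2 s d e)"
    unfolding gauss2_def by (rule gauss_dominatedI, rule 3)
  have LL: "\<bar>(z \<bullet> z) / s\<^sup>2 - real DIM('a) / s\<bar> \<le> (1 / a\<^sup>2 + real DIM('a) / a) * (1 + norm z) ^ 2"
    if "0 < a" "s \<in> {a..b}" for a b s :: real and z :: 'a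
  proof -
    have "\<bar>(z \<bullet> z) / s\<^sup>2\<bar> \<le> (1 + norm z) ^ 2 / a\<^sup>2"
      using that zz[of z] by (auto intro!: frac_le power_mono)
    moreover have "real DIM('a) * 1 \<le> real DIM('a) * (1 + norm z) ^ 2" by (intro mult_left_mono) auto
    then have "\<bar>real DIM('a) / s\<bar> \<le> real DIM('a) * (1 + norm z) ^ 2 / a"
      using that by (auto intro!: frac_le)
    ultimately have "\<bar>(z \<bullet> z) / s\<^sup>2\<bar> + \<bar>real DIM('a) / s\<bar>
        \<le> (1 + norm z) ^ 2 / a\<^sup>2 + real DIM('a) * (1 + norm z) ^ 2 / a"
      by (rule add_mono)
    from order.trans[OF abs_triangle_ineq4 this] show ?thesis by (simp add: distrib_right)
  qed
  have 4: "\<exists>C. \<forall>s\<in>{a..b}. \<forall>z::'a. \<bar>(z \<bullet> z) / s\<^sup>2 - real DIM('a) / s\<bar> \<le> C * (1 + norm z) ^ 3"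
    if "0 < a" for a b :: real
  proof (intro exI ballI allI)
    fix s and z :: 'a assume s: "s \<in> {a..b}"
    show "\<bar>(z \<bullet> z) / s\<^sup>2 - real DIM('a) / s\<bar> \<le> (1 / a\<^sup>2 + real DIM('a) / a) * (1 + norm z) ^ 3"
      using order.trans[OF LL[OF that s, of z] mult_left_mono[OF p2[of z]]] that by simp
  qed
  show "gauss_dominated (gaussL :: real \<Rightarrow> 'a \<Rightarrow> real)"
    unfolding gaussL_def by (rule gauss_dominatedI, rule 4)
  have 5: "\<exists>C. \<forall>s\<in>{a..b}. \<forall>z::'a. \<bar>(z \<bullet> e) / s * (2 / s - ((z \<bullet> z) / s\<^sup>2 - real DIM('a) / s))\<bar> \<le> C * (1 + norm z) ^ 3"
    if "0 < a" for a b :: real and e :: 'a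
  proof (intro exI ballI allI)
    fix s and z :: 'a assume s: "s \<in> {a..b}"
    have "\<bar>2 / s\<bar> \<le> 2 / a * (1 + norm z) ^ 2"
    proof -
      have "\<bar>2 / s\<bar> \<le> 2 / a * 1" using s that by (auto intro!: frac_le)
      also have "\<dots> \<le> 2 / a * (1 + norm z) ^ 2" using that by (intro mult_left_mono) auto
      finally show ?thesis .
    qed
    then have "\<bar>2 / s - ((z \<bullet> z) / s\<^sup>2 - real DIM('a) / s)\<bar> \<le> (2 / a + (1 / a\<^sup>2 + real DIM('a) / a)) * (1 + norm z) ^ 2"
      using order.trans[OF abs_triangle_ineq4 add_mono[OF _ LL[OF that s, of z]]] by (simp add: distrib_right)
    moreover have "\<bar>(z \<bullet> e) / s\<bar> \<le> norm e * (1 + norm z) / a"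
      using ze[of z e] s that by (auto intro!: frac_le)
    ultimately have "\<bar>(z \<bullet> e) / s\<bar> * \<bar>2 / s - ((z \<bullet> z) / s\<^sup>2 - real DIM('a) / s)\<bar>
        \<le> norm e * (1 + norm z) / a * ((2 / a + (1 / a\<^sup>2 + real DIM('a) / a)) * (1 + norm z) ^ 2)"
      using that by (intro mult_mono) auto
    then show "\<bar>(z \<bullet> e) / s * (2 / s - ((z \<bullet> z) / s\<^sup>2 - real DIM('a) / s))\<bar>
        \<le> norm e / a * (2 / a + (1 / a\<^sup>2 + real DIM('a) / a)) * (1 + norm z) ^ 3"
      by (simp add: abs_mult power3_eq_cube power2_eq_square mult_ac)
  qed
  show "gauss_dominated (\<lambda>s. gaussL1 s e)"
    unfolding gaussL1_def by (rule gauss_dominatedI, rule 5)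
qed

section \<open>Convolutions\<close>

definition conv :: "('a::euclidean_space \<Rightarrow> real) \<Rightarrow> ('a \<Rightarrow> real) \<Rightarrow> 'a \<Rightarrow> real" where
  "conv k w x = (LINT y|lborel. w y * k (x - y))"

lemma heat_eq_conv: "heat s = conv (gauss s)"
  by (intro ext) (simp add: heat_def conv_def)

lemma integrable_conv_kernel:
  fixes w k :: "'a::euclidean_space \<Rightarrow> real"
  assumes w: "integrable lborel w" and [measurable]: "k \<in> borel_measurable borel" and C: "\<And>z. \<bar>k z\<bar> \<le> C"
  shows "integrable lborel (\<lambda>y. w y * k (x - y))"
proof (rule Bochner_Integration.integrable_bound)
  show "integrable lborel (\<lambda>y. w y * C)" using w by simp
  have [measurable]: "w \<in> borel_measurable borel" using w by auto
  show "(\<lambda>y. w y * k (x - y)) \<in> borel_measurable lborel" by measurable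
  show "AE y in lborel. norm (w y * k (x - y)) \<le> norm (w y * C)"
  proof (rule AE_I2)
    fix y
    show "norm (w y * k (x - y)) \<le> norm (w y * C)"
      using mult_left_mono[OF order.trans[OF C[of "x - y"] abs_ge_self], of "\<bar>w y\<bar>"] by (simp add: abs_mult)
  qed
qed

lemma continuous_conv:
  fixes w k :: "'a::euclidean_space \<Rightarrow> real"
  assumes w: "integrable lborel w" and k: "continuous_on UNIV k" and C: "\<And>z. \<bar>k z\<bar> \<le> C"
  shows "continuous_on UNIV (conv k w)"
proof (rule continuous_on_sequentiallyI)
  fix X x assume X: "X \<longlonglongrightarrow> (x::'a)"
  have [measurable]: "k \<in> borel_measurable borel" using k by (rule borel_measurable_continuous_onI)
  have [measurable]: "w \<in> borel_measurable borel" using w by auto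
  show "(\<lambda>n. conv k w (X n)) \<longlonglongrightarrow> conv k w x"
    unfolding conv_def
  proof (rule integral_dominated_convergence[where w="\<lambda>y. \<bar>w y\<bar> * C"])
    show "integrable lborel (\<lambda>y. \<bar>w y\<bar> * C)" using w by simp
    show "AE y in lborel. (\<lambda>n. w y * k (X n - y)) \<longlonglongrightarrow> w y * k (x - y)"
    proof (rule AE_I2)
      fix y
      have "isCont k (x - y)" using k by (simp add: continuous_on_eq_continuous_at)
      moreover have "(\<lambda>n. X n - y) \<longlonglongrightarrow> x - y" by (intro tendsto_intros X)
      ultimately show "(\<lambda>n. w y * k (X n - y)) \<longlonglongrightarrow> w y * k (x - y)"
        by (intro tendsto_mult tendsto_const isCont_tendsto_compose[of _ k])
    qed
    show "AE y in lborel. norm (w y * k (X n - y)) \<le> \<bar>w y\<bar> * C" for n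
      by (rule AE_I2) (simp add: abs_mult C mult_left_mono)
  qed measurable
qed

lemma conv_deriv:
  fixes w k k' :: "'a::euclidean_space \<Rightarrow> real"
  assumes w: "integrable lborel w" and k: "continuous_on UNIV k" and C: "\<And>z. \<bar>k z\<bar> \<le> C"
    and C': "\<And>z. \<bar>k' z\<bar> \<le> C'"
    and der: "\<And>z t. ((\<lambda>t. k (z + t *\<^sub>R e)) has_real_derivative k' (z + t *\<^sub>R e)) (at t)"
  shows "((\<lambda>t. conv k w (x + t *\<^sub>R e)) has_real_derivative conv k' w (x + t *\<^sub>R e)) (at t)"
  unfolding conv_def
proof (rule has_real_derivative_integral[where a="t - 1" and b="t + 1" and h="\<lambda>y. \<bar>w y\<bar> * C'"])
  have [measurable]: "k \<in> borel_measurable borel" using k by (rule borel_measurable_continuous_onI)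
  show "integrable lborel (\<lambda>y. w y * k (x + r *\<^sub>R e - y))" for r
    by (rule integrable_conv_kernel[OF w _ C]) measurable
  show "((\<lambda>r. w y * k (x + r *\<^sub>R e - y)) has_real_derivative w y * k' (x + r *\<^sub>R e - y)) (at r)" for r y
    using DERIV_cmult[OF der[of "x - y" r], of "w y"] by (simp add: algebra_simps)
  show "\<bar>w y * k' (x + r *\<^sub>R e - y)\<bar> \<le> \<bar>w y\<bar> * C'" for r y
    by (simp add: abs_mult C' mult_left_mono)
  show "integrable lborel (\<lambda>y. \<bar>w y\<bar> * C')" using w by simp
qed simp

lemma conv_time_deriv:
  fixes w :: "'a::euclidean_space \<Rightarrow> real" and k k' :: "real \<Rightarrow> 'a \<Rightarrow> real"
  assumes w: "integrable lborel w" and s: "s \<in> {a<..<b}"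
    and k: "\<And>s. s \<in> {a<..<b} \<Longrightarrow> continuous_on UNIV (k s)"
    and C: "\<And>s z. s \<in> {a<..<b} \<Longrightarrow> \<bar>k s z\<bar> \<le> C" and C': "\<And>s z. s \<in> {a<..<b} \<Longrightarrow> \<bar>k' s z\<bar> \<le> C'"
    and der: "\<And>s z. s \<in> {a<..<b} \<Longrightarrow> ((\<lambda>s. k s z) has_real_derivative k' s z) (at s)"
  shows "((\<lambda>s. conv (k s) w x) has_real_derivative conv (k' s) w x) (at s)"
  unfolding conv_def
proof (rule has_real_derivative_integral[where h="\<lambda>y. \<bar>w y\<bar> * C'", OF s])
  show "integrable lborel (\<lambda>y. w y * k s (x - y))" if s: "s \<in> {a<..<b}" for s
    by (rule integrable_conv_kernel[OF w borel_measurable_continuous_onI[OF k[OF s]] C[OF s]])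
  show "((\<lambda>s. w y * k s (x - y)) has_real_derivative w y * k' s (x - y)) (at s)" if s: "s \<in> {a<..<b}" for s y
    by (rule DERIV_cmult[OF der[OF s]])
  show "\<bar>w y * k' s (x - y)\<bar> \<le> \<bar>w y\<bar> * C'" if s: "s \<in> {a<..<b}" for s y
    by (simp add: abs_mult C'[OF s] mult_left_mono)
  show "integrable lborel (\<lambda>y. \<bar>w y\<bar> * C')" using w by simp
qed

lemma gauss_dominated_bounded:
  fixes k :: "real \<Rightarrow> 'a::euclidean_space \<Rightarrow> real"
  assumes k: "gauss_dominated k" and ab: "0 < a" "a \<le> b"
  shows "\<exists>C. \<forall>s\<in>{a..b}. \<forall>z. \<bar>k s z\<bar> \<le> C"
proof -
  obtain C1 where C1: "C1 > 0" "\<And>s z. s \<in> {a..b} \<Longrightarrow> \<bar>k s z\<bar> \<le> C1 * pgauss 3 s z"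
    using k[unfolded gauss_dominated_def, rule_format, OF ab] by blast
  obtain C2 where C2: "C2 > 0" "\<And>s (z::'a). s \<in> {a..b} \<Longrightarrow> gauss s z \<le> C2 * gauss b z"
    using gauss_le_gauss[OF ab] by blast
  have "0 < b" using ab by simp
  from pgauss_bounded[OF this] obtain C3 where C3: "\<And>z::'a. pgauss 3 b z \<le> C3" by blast
  have "\<bar>k s z\<bar> \<le> C1 * (C2 * C3)" if s: "s \<in> {a..b}" for s z
  proof -
    have "pgauss 3 s z \<le> C2 * pgauss 3 b z"
      using mult_left_mono[OF C2(2)[OF s, of z], of "(1 + norm z) ^ 3"] by (simp add: pgauss_def algebra_simps)
    also have "\<dots> \<le> C2 * C3" using C2(1) C3 by simp
    finally have "C1 * pgauss 3 s z \<le> C1 * (C2 * C3)" using C1(1) by (intro mult_left_mono) auto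
    with C1(2)[OF s, of z] show ?thesis by (rule order.trans)
  qed
  then show ?thesis by blast
qed

text \<open>The joint law of a point \<open>y\<close> and its displaced copy \<open>x = y + z\<close>, with a bounded weight \<open>h\<close>;
  this is the form in which Fubini's theorem is applied to Gaussian averages.\<close>

lemma integrable_pair_conv:
  fixes w k :: "'a::euclidean_space \<Rightarrow> real" and h :: "'a \<Rightarrow> 'a \<Rightarrow> real"
  assumes w: "integrable lborel w" and k: "integrable lborel k"
    and [measurable]: "(\<lambda>(x, y). h x y) \<in> borel_measurable (borel \<Otimes>\<^sub>M borel)" and C: "\<And>x y. \<bar>h x y\<bar> \<le> C"
  shows "integrable (lborel \<Otimes>\<^sub>M lborel) (\<lambda>(x, y). h x y * (w y * k (x - y)))"
proof -
  have [measurable]: "k \<in> borel_measurable borel" "w \<in> borel_measurable borel" using w k by auto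
  have "integrable (lborel \<Otimes>\<^sub>M lborel) (\<lambda>(y, x). w y * k (x - y))"
  proof (rule lborel_pair.Fubini_integrable)
    have "(LINT x|lborel. norm (case (y, x) of (y, x) \<Rightarrow> w y * k (x - y))) = \<bar>w y\<bar> * (LINT x|lborel. \<bar>k x\<bar>)" for y
      using integral_lborel_translation[of "\<lambda>x. \<bar>k x\<bar>" "- y"] by (simp add: abs_mult)
    then show "integrable lborel (\<lambda>y. LINT x|lborel. norm (case (y, x) of (y, x) \<Rightarrow> w y * k (x - y)))"
      using w by simp
    show "AE y in lborel. integrable lborel (\<lambda>x. case (y, x) of (y, x) \<Rightarrow> w y * k (x - y))"
      using k integrable_lborel_translation[of k "- y" for y] by simp
  qed measurable
  then have I: "integrable (lborel \<Otimes>\<^sub>M lborel) (\<lambda>(x, y). w y * k (x - y))"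
    using lborel_pair.integrable_product_swap[of "\<lambda>(y, x). w y * k (x - y)"] by simp
  show ?thesis
  proof (rule Bochner_Integration.integrable_bound)
    show "integrable (lborel \<Otimes>\<^sub>M lborel) (\<lambda>p. C * (case p of (x, y) \<Rightarrow> w y * k (x - y)))"
      using I by simp
    show "AE p in lborel \<Otimes>\<^sub>M lborel. norm (case p of (x, y) \<Rightarrow> h x y * (w y * k (x - y)))
        \<le> norm (C * (case p of (x, y) \<Rightarrow> w y * k (x - y)))"
      using order.trans[OF C abs_ge_self] by (intro AE_I2) (auto simp: abs_mult split_beta intro!: mult_right_mono)
  qed measurable
qed

lemma integrable_conv:
  assumes w: "integrable lborel w" and k: "integrable lborel k"
  shows "integrable lborel (conv k w)"
proof -
  have "integrable (lborel \<Otimes>\<^sub>M lborel) (\<lambda>(x, y). 1 * (w y * k (x - y)))"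
    by (rule integrable_pair_conv[OF w k, of _ 1]) auto
  from lborel_pair.integrable_fst[OF this] show ?thesis
    by (simp add: conv_def[abs_def])
qed

lemma conv_nonneg: "(\<And>y. 0 \<le> w y) \<Longrightarrow> (\<And>z. 0 \<le> k z) \<Longrightarrow> 0 \<le> conv k w x"
  unfolding conv_def by (intro integral_nonneg_AE AE_I2) simp

section \<open>The evolved density and functions of moderate growth\<close>

locale prob_density =
  fixes \<rho> :: "'a::euclidean_space \<Rightarrow> real"
  assumes nonneg: "0 \<le> \<rho> x" and integrable: "integrable lborel \<rho>" and integral: "(LINT x|lborel. \<rho> x) = 1"
begin

lemma measurable_density [measurable]: "\<rho> \<in> borel_measurable borel"
  using integrable by auto

text \<open>The density \<open>\<rho>\<^sub>s\<close> and its relatives: up to the factor \<open>\<rho>\<^sub>s(x)\<close>, \<open>moment K s x\<close> is the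
  conditional moment of \<open>1 + |X - Y|\<close> of order \<open>K\<close> given \<open>X = x\<close>, where \<open>Y\<close> has density \<open>\<rho>\<close> and
  \<open>X = Y + \<surd>s Z\<close> with an independent standard Gaussian \<open>Z\<close>.\<close>

definition moment :: "nat \<Rightarrow> real \<Rightarrow> 'a \<Rightarrow> real" where
  "moment K s = conv (pgauss K s) \<rho>"

definition evol :: "real \<Rightarrow> 'a \<Rightarrow> real" where
  "evol s = conv (gauss s) \<rho>"

lemma moment_0: "moment 0 s = evol s"
  by (simp add: moment_def evol_def pgauss_def conv_def fun_eq_iff)

lemma integrable_moment_kernel: "0 < s \<Longrightarrow> integrable lborel (\<lambda>y. \<rho> y * pgauss K s (x - y))"
proof -
  assume s: "0 < s"
  then obtain C where "\<And>z::'a. pgauss K s z \<le> C" using pgauss_bounded by blast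
  then show ?thesis
    by (intro integrable_conv_kernel[OF integrable, of _ C]) (auto simp: abs_of_pos[OF pgauss_pos[OF s]])
qed

lemma evol_pos: assumes s: "0 < s" shows "0 < evol s x"
proof -
  have "evol s x \<noteq> 0"
  proof
    assume "evol s x = 0"
    moreover have "0 \<le> \<rho> y * gauss s (x - y)" for y
      using nonneg[of y] gauss_pos[OF s, of "x - y"] by simp
    ultimately have "AE y in lborel. \<rho> y * gauss s (x - y) = 0"
      using integrable_moment_kernel[OF s, of 0 x]
      by (subst integral_nonneg_eq_0_iff_AE[symmetric]) (auto simp: evol_def conv_def pgauss_def)
    then have "AE y in lborel. \<rho> y = 0"
    proof (rule AE_mp[OF _ AE_I2], intro impI)
      fix y assume "\<rho> y * gauss s (x - y) = 0"
      then show "\<rho> y = 0" using gauss_pos[OF s, of "x - y"] by simp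
    qed
    then have "(LINT y|lborel. \<rho> y) = 0" by (rule integral_eq_zero_AE)
    then show False using integral by simp
  qed
  moreover have "0 \<le> evol s x"
    unfolding evol_def using nonneg by (intro conv_nonneg) auto
  ultimately show ?thesis by simp
qed

lemma moment_mono: assumes "0 < s" "K \<le> L" shows "moment K s x \<le> moment L s x"
  unfolding moment_def conv_def using assms
  by (intro integral_mono integrable_moment_kernel mult_left_mono pgauss_mono nonneg)

lemma evol_le_moment: "0 < s \<Longrightarrow> evol s x \<le> moment K s x"
  using moment_mono[of s 0 K] by (simp add: moment_0)

text \<open>Chebyshev's association inequality: under the conditional law of \<open>Y\<close> given \<open>X = x\<close>, both
  powers of \<open>1 + |x - Y|\<close> are increasing functions of the same variable, hence positively
  correlated.\<close>

lemma moment_mult_le: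
  assumes s: "0 < s"
  shows "moment K s x * moment L s x \<le> evol s x * moment (K + L) s x"
proof (cases "K = 0")
  case True then show ?thesis by (simp add: moment_0)
next
  case False
  let ?g = "\<lambda>y. \<rho> y * gauss s (x - y)"
  let ?A = "\<lambda>y. 1 + norm (x - y)"
  have v: "evol s x > 0" by (rule evol_pos[OF s])
  \<comment> \<open>With this choice \<open>a ^ K\<close> is the conditional mean of the first power, so that the terms with
    \<open>a ^ L\<close> cancel after integration.\<close>
  define a where "a = root K (moment K s x / evol s x)"
  have m: "0 \<le> moment K s x / evol s x" using evol_le_moment[OF s, of x K] v by auto
  have a: "0 \<le> a" "a ^ K = moment K s x / evol s x"
    using False m by (auto simp: a_def)
  have int: "integrable lborel (\<lambda>y. ?A y ^ J * ?g y)" for J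
    using integrable_moment_kernel[OF s, of J x] by (simp add: pgauss_def algebra_simps)
  have mom: "moment J s x = (LINT y|lborel. ?A y ^ J * ?g y)" for J
    by (simp add: moment_def conv_def pgauss_def algebra_simps)
  have "0 \<le> (LINT y|lborel. (?A y ^ K - a ^ K) * (?A y ^ L - a ^ L) * ?g y)"
  proof (rule integral_nonneg_AE, rule AE_I2, rule mult_nonneg_nonneg)
    fix y
    show "0 \<le> (?A y ^ K - a ^ K) * (?A y ^ L - a ^ L)"
    proof (cases "a \<le> ?A y")
      case True
      then show ?thesis using a(1) by (intro mult_nonneg_nonneg) (auto intro!: power_mono)
    next
      case False
      then show ?thesis using a(1) by (intro mult_nonpos_nonpos) (auto intro!: power_mono add_nonneg_nonneg)
    qed
  qed (use nonneg in auto)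
  also have "\<dots> = (LINT y|lborel. ?A y ^ (K + L) * ?g y - a ^ K * (?A y ^ L * ?g y) - a ^ L * (?A y ^ K * ?g y) + a ^ K * a ^ L * (?A y ^ 0 * ?g y))"
    by (intro Bochner_Integration.integral_cong refl) (simp add: power_add algebra_simps)
  also have "\<dots> = moment (K + L) s x - a ^ K * moment L s x - a ^ L * moment K s x + a ^ K * a ^ L * moment 0 s x"
    unfolding mom using int[of "K + L"] int[of K] int[of L] int[of 0] by simp
  also have "\<dots> = moment (K + L) s x - moment K s x * moment L s x / evol s x"
    using v by (simp add: a moment_0)
  finally show ?thesis using v by (simp add: field_simps)
qed

lemma moment_dominated:
  assumes ab: "0 < a" "a \<le> b"
  shows "\<exists>C>0. \<forall>s\<in>{a..b}. \<forall>x. moment K s x \<le> C * moment K b x"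
proof -
  obtain C where C: "C > 0" "\<And>s (z::'a). s \<in> {a..b} \<Longrightarrow> gauss s z \<le> C * gauss b z"
    using gauss_le_gauss[OF ab] by blast
  have "moment K s x \<le> C * moment K b x" if s: "s \<in> {a..b}" for s x
  proof -
    have p: "pgauss K s z \<le> C * pgauss K b z" for z :: 'a
      using mult_left_mono[OF C(2)[OF s, of z], of "(1 + norm z) ^ K"] by (simp add: pgauss_def algebra_simps)
    have "moment K s x \<le> (LINT y|lborel. C * (\<rho> y * pgauss K b (x - y)))"
      unfolding moment_def conv_def
    proof (intro integral_mono)
      fix y
      show "\<rho> y * pgauss K s (x - y) \<le> C * (\<rho> y * pgauss K b (x - y))"
        using mult_left_mono[OF p[of "x - y"] nonneg[of y]] by (simp add: algebra_simps)
    qed (use s ab in \<open>auto intro!: integrable_moment_kernel integrable_mult_right\<close>)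
    then show ?thesis by (simp add: moment_def conv_def)
  qed
  with C(1) show ?thesis by blast
qed

lemma integrable_moment: "0 < s \<Longrightarrow> integrable lborel (moment K s)"
  unfolding moment_def by (intro integrable_conv integrable integrable_pgauss)

text \<open>Functions bounded by conditional moments, locally uniformly in time. Multiplied by \<open>\<rho>\<^sub>s\<close>
  they have integrable majorants, and by \<open>moment_mult_le\<close> they form an algebra. All functions
  built from logarithmic derivatives of \<open>\<rho>\<^sub>s\<close> and derivatives of \<open>Q\<^sub>s \<phi>\<close> with bounded \<open>\<phi>\<close> are of
  this kind, although they need not be bounded.\<close>

definition tame :: "(real \<Rightarrow> 'a \<Rightarrow> real) \<Rightarrow> bool" where
  "tame G \<longleftrightarrow> (\<forall>s>0. continuous_on UNIV (G s)) \<and>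
     (\<exists>K. \<forall>a b. 0 < a \<longrightarrow> a \<le> b \<longrightarrow> (\<exists>C\<ge>0. \<forall>s\<in>{a..b}. \<forall>x. \<bar>G s x\<bar> * evol s x \<le> C * moment K s x))"

lemma tameI:
  assumes "\<And>s. 0 < s \<Longrightarrow> continuous_on UNIV (G s)"
    and "\<And>a b. 0 < a \<Longrightarrow> a \<le> b \<Longrightarrow> \<exists>C\<ge>0. \<forall>s\<in>{a..b}. \<forall>x. \<bar>G s x\<bar> * evol s x \<le> C * moment K s x"
  shows "tame G"
  using assms unfolding tame_def by blast

lemma tame_continuous: "tame G \<Longrightarrow> 0 < s \<Longrightarrow> continuous_on UNIV (G s)"
  by (simp add: tame_def)

lemma tame_const [intro, simp]: "tame (\<lambda>s x. c)"
proof (rule tameI[where K=0])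
  fix a b :: real
  show "\<exists>C\<ge>0. \<forall>s\<in>{a..b}. \<forall>x. \<bar>c\<bar> * evol s x \<le> C * moment 0 s x"
    by (intro exI[of _ "\<bar>c\<bar>"]) (simp add: moment_0)
qed auto

lemma tame_add [intro]:
  assumes F: "tame F" and G: "tame G"
  shows "tame (\<lambda>s x. F s x + G s x)"
proof -
  obtain K where K: "\<And>a b. 0 < a \<Longrightarrow> a \<le> b \<Longrightarrow> \<exists>C\<ge>0. \<forall>s\<in>{a..b}. \<forall>x. \<bar>F s x\<bar> * evol s x \<le> C * moment K s x"
    using F unfolding tame_def by blast
  obtain L where L: "\<And>a b. 0 < a \<Longrightarrow> a \<le> b \<Longrightarrow> \<exists>C\<ge>0. \<forall>s\<in>{a..b}. \<forall>x. \<bar>G s x\<bar> * evol s x \<le> C * moment L s x"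
    using G unfolding tame_def by blast
  show ?thesis
  proof (rule tameI[where K="K + L"])
    fix a b :: real assume ab: "0 < a" "a \<le> b"
    obtain C where C: "C \<ge> 0" "\<And>s x. s \<in> {a..b} \<Longrightarrow> \<bar>F s x\<bar> * evol s x \<le> C * moment K s x"
      using K[OF ab] by blast
    obtain D where D: "D \<ge> 0" "\<And>s x. s \<in> {a..b} \<Longrightarrow> \<bar>G s x\<bar> * evol s x \<le> D * moment L s x"
      using L[OF ab] by blast
    have "\<bar>F s x + G s x\<bar> * evol s x \<le> (C + D) * moment (K + L) s x" if s: "s \<in> {a..b}" for s x
    proof -
      have s0: "0 < s" using s ab by auto
      have "\<bar>F s x + G s x\<bar> * evol s x \<le> (\<bar>F s x\<bar> + \<bar>G s x\<bar>) * evol s x"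
        using evol_pos[OF s0, of x] by (intro mult_right_mono abs_triangle_ineq) auto
      also have "\<dots> \<le> C * moment K s x + D * moment L s x"
        using C(2)[OF s, of x] D(2)[OF s, of x] by (simp add: distrib_right)
      also have "\<dots> \<le> C * moment (K + L) s x + D * moment (K + L) s x"
        using C(1) D(1) by (intro add_mono mult_left_mono moment_mono[OF s0]) auto
      finally show ?thesis by (simp add: distrib_right)
    qed
    then show "\<exists>C\<ge>0. \<forall>s\<in>{a..b}. \<forall>x. \<bar>F s x + G s x\<bar> * evol s x \<le> C * moment (K + L) s x"
      using C(1) D(1) by (intro exI[of _ "C + D"]) auto
  qed (use F G in \<open>auto simp: tame_def intro!: continuous_intros\<close>)
qed

lemma tame_mult [intro]:
  assumes F: "tame F" and G: "tame G"
  shows "tame (\<lambda>s x. F s x * G s x)"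
proof -
  obtain K where K: "\<And>a b. 0 < a \<Longrightarrow> a \<le> b \<Longrightarrow> \<exists>C\<ge>0. \<forall>s\<in>{a..b}. \<forall>x. \<bar>F s x\<bar> * evol s x \<le> C * moment K s x"
    using F unfolding tame_def by blast
  obtain L where L: "\<And>a b. 0 < a \<Longrightarrow> a \<le> b \<Longrightarrow> \<exists>C\<ge>0. \<forall>s\<in>{a..b}. \<forall>x. \<bar>G s x\<bar> * evol s x \<le> C * moment L s x"
    using G unfolding tame_def by blast
  show ?thesis
  proof (rule tameI[where K="K + L"])
    fix a b :: real assume ab: "0 < a" "a \<le> b"
    obtain C where C: "C \<ge> 0" "\<And>s x. s \<in> {a..b} \<Longrightarrow> \<bar>F s x\<bar> * evol s x \<le> C * moment K s x"
      using K[OF ab] by blast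
    obtain D where D: "D \<ge> 0" "\<And>s x. s \<in> {a..b} \<Longrightarrow> \<bar>G s x\<bar> * evol s x \<le> D * moment L s x"
      using L[OF ab] by blast
    have "\<bar>F s x * G s x\<bar> * evol s x \<le> (C * D) * moment (K + L) s x" if s: "s \<in> {a..b}" for s x
    proof -
      have s0: "0 < s" using s ab by auto
      have v: "evol s x > 0" by (rule evol_pos[OF s0])
      have m: "0 \<le> moment J s x" for J using evol_le_moment[OF s0, of x J] v by simp
      have "(\<bar>F s x * G s x\<bar> * evol s x) * evol s x = (\<bar>F s x\<bar> * evol s x) * (\<bar>G s x\<bar> * evol s x)"
        by (simp add: abs_mult algebra_simps)
      also have "\<dots> \<le> (C * moment K s x) * (D * moment L s x)"
        using v C(1) m[of K] by (intro mult_mono C(2)[OF s] D(2)[OF s]) auto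
      also have "\<dots> = C * D * (moment K s x * moment L s x)" by (simp add: algebra_simps)
      also have "\<dots> \<le> C * D * (evol s x * moment (K + L) s x)"
        using C(1) D(1) by (intro mult_left_mono moment_mult_le[OF s0]) auto
      finally have "(\<bar>F s x * G s x\<bar> * evol s x) * evol s x \<le> (C * D * moment (K + L) s x) * evol s x"
        by (simp add: algebra_simps)
      then show ?thesis using v by simp
    qed
    then show "\<exists>C\<ge>0. \<forall>s\<in>{a..b}. \<forall>x. \<bar>F s x * G s x\<bar> * evol s x \<le> C * moment (K + L) s x"
      using C(1) D(1) by (intro exI[of _ "C * D"]) auto
  qed (use F G in \<open>auto simp: tame_def intro!: continuous_intros\<close>)
qed

lemma tame_diff [intro]: "tame F \<Longrightarrow> tame G \<Longrightarrow> tame (\<lambda>s x. F s x - G s x)"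
  using tame_add[of F "\<lambda>s x. (-1) * G s x"] tame_mult[of "\<lambda>s x. -1" G] by simp

lemma tame_minus [intro]: "tame G \<Longrightarrow> tame (\<lambda>s x. - G s x)"
  using tame_diff[of "\<lambda>s x. 0" G] by simp

lemma tame_power2 [intro]: "tame G \<Longrightarrow> tame (\<lambda>s x. (G s x)\<^sup>2)"
  unfolding power2_eq_square by (rule tame_mult)

lemma tame_divide [intro]: "tame G \<Longrightarrow> tame (\<lambda>s x. G s x / c)"
  using tame_mult[of G "\<lambda>s x. 1 / c"] by simp

lemma tame_sum [intro]: "finite I \<Longrightarrow> (\<And>i. i \<in> I \<Longrightarrow> tame (F i)) \<Longrightarrow> tame (\<lambda>s x. \<Sum>i\<in>I. F i s x)"
  by (induction I rule: finite_induct) auto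

lemma tame_dominated:
  assumes G: "tame G" and ab: "0 < a" "a \<le> b"
  shows "\<exists>h. integrable lborel h \<and> (\<forall>s\<in>{a..b}. \<forall>x. \<bar>G s x * evol s x\<bar> \<le> h x)"
proof -
  obtain K where K: "\<And>a b. 0 < a \<Longrightarrow> a \<le> b \<Longrightarrow> \<exists>C\<ge>0. \<forall>s\<in>{a..b}. \<forall>x. \<bar>G s x\<bar> * evol s x \<le> C * moment K s x"
    using G unfolding tame_def by blast
  obtain C where C: "C \<ge> 0" "\<And>s x. s \<in> {a..b} \<Longrightarrow> \<bar>G s x\<bar> * evol s x \<le> C * moment K s x"
    using K[OF ab] by blast
  obtain D where D: "D > 0" "\<And>s x. s \<in> {a..b} \<Longrightarrow> moment K s x \<le> D * moment K b x"
    using moment_dominated[OF ab] by blast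
  have "\<bar>G s x * evol s x\<bar> \<le> C * (D * moment K b x)" if s: "s \<in> {a..b}" for s x
  proof -
    have "\<bar>G s x * evol s x\<bar> = \<bar>G s x\<bar> * evol s x"
      using evol_pos[of s x] s ab by (simp add: abs_mult)
    also have "\<dots> \<le> C * moment K s x" by (rule C(2)[OF s])
    also have "\<dots> \<le> C * (D * moment K b x)" using C(1) D(2)[OF s] by (intro mult_left_mono)
    finally show ?thesis .
  qed
  moreover have "integrable lborel (\<lambda>x. C * (D * moment K b x))"
    using integrable_moment[of b K] ab by simp
  ultimately show ?thesis by blast
qed

lemma continuous_evol: "0 < s \<Longrightarrow> continuous_on UNIV (evol s)"
proof -
  assume s: "0 < s"
  obtain C where "\<And>z::'a. \<bar>gauss s z\<bar> \<le> C"
    using gauss_dominated_bounded[OF gauss_dominated_derivs(1) s order.refl] by auto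
  then show ?thesis unfolding evol_def by (rule continuous_conv[OF integrable continuous_gauss])
qed

lemma measurable_evol [measurable]: "0 < s \<Longrightarrow> evol s \<in> borel_measurable borel"
  by (intro borel_measurable_continuous_onI continuous_evol)

lemma tame_integrable:
  assumes G: "tame G" and s: "0 < s"
  shows "integrable lborel (\<lambda>x. G s x * evol s x)"
proof -
  obtain h where h: "integrable lborel h" "\<And>x. \<bar>G s x * evol s x\<bar> \<le> h x"
    using tame_dominated[OF G s order.refl] by auto
  have [measurable]: "G s \<in> borel_measurable borel" "evol s \<in> borel_measurable borel"
    using tame_continuous[OF G s] s by (auto intro: borel_measurable_continuous_onI)
  show ?thesis
  proof (rule Bochner_Integration.integrable_bound[OF h(1)])
    show "AE x in lborel. norm (G s x * evol s x) \<le> norm (h x)"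
    proof (rule AE_I2)
      fix x show "norm (G s x * evol s x) \<le> norm (h x)"
        using order.trans[OF h(2)[of x] abs_ge_self] by (simp only: real_norm_def)
    qed
  qed measurable
qed

end

context prob_density begin

section \<open>Conditional expectations and their derivatives\<close>

definition bounded_fun :: "('a \<Rightarrow> real) \<Rightarrow> bool" where
  "bounded_fun \<phi> \<longleftrightarrow> \<phi> \<in> borel_measurable borel \<and> (\<exists>B. \<forall>x. \<bar>\<phi> x\<bar> \<le> B)"

lemma bounded_fun_const [simp]: "bounded_fun (\<lambda>_. c)"
  by (auto simp: bounded_fun_def)

lemma bounded_fun_integrable:
  assumes "bounded_fun \<phi>" shows "integrable lborel (\<lambda>y. \<phi> y * \<rho> y)"
proof -
  obtain B where B: "\<And>x. \<bar>\<phi> x\<bar> \<le> B" and [measurable]: "\<phi> \<in> borel_measurable borel"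
    using assms by (auto simp: bounded_fun_def)
  show ?thesis
  proof (rule Bochner_Integration.integrable_bound)
    show "integrable lborel (\<lambda>y. B * \<rho> y)" using integrable by simp
    show "AE y in lborel. norm (\<phi> y * \<rho> y) \<le> norm (B * \<rho> y)"
      using order.trans[OF B abs_ge_self] by (intro AE_I2) (auto simp: abs_mult intro!: mult_right_mono)
  qed measurable
qed

text \<open>The conditional expectation of \<open>\<phi>(Y) k\<^sub>s(x - Y) / \<gamma>\<^sub>s(x - Y)\<close> given \<open>X = x\<close>. With \<open>k = \<gamma>\<close> it
  is \<open>Q\<^sub>s \<phi>\<close>; with derivatives of \<open>\<gamma>\<close> and \<open>\<phi> = 1\<close> it yields the logarithmic derivatives of \<open>\<rho>\<^sub>s\<close>.\<close>

definition ratio :: "('a \<Rightarrow> real) \<Rightarrow> (real \<Rightarrow> 'a \<Rightarrow> real) \<Rightarrow> real \<Rightarrow> 'a \<Rightarrow> real" where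
  "ratio \<phi> k s x = conv (k s) (\<lambda>y. \<phi> y * \<rho> y) x / evol s x"

text \<open>\<open>score\<close> and \<open>score_hess\<close> are the first and second directional derivatives of \<open>ln \<rho>\<^sub>s\<close>.\<close>

definition score :: "'a \<Rightarrow> real \<Rightarrow> 'a \<Rightarrow> real" where
  "score e = ratio (\<lambda>_. 1) (\<lambda>s. gauss1 s e)"

definition score_hess :: "'a \<Rightarrow> 'a \<Rightarrow> real \<Rightarrow> 'a \<Rightarrow> real" where
  "score_hess d e s x = ratio (\<lambda>_. 1) (\<lambda>s. gauss2 s d e) s x - score d s x * score e s x"

text \<open>\<open>mean \<phi> s\<close> is \<open>Q\<^sub>s \<phi>\<close>, and \<open>dmean \<phi> e s\<close> is its derivative in direction \<open>e\<close>.\<close>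

definition mean :: "('a \<Rightarrow> real) \<Rightarrow> real \<Rightarrow> 'a \<Rightarrow> real" where
  "mean \<phi> = ratio \<phi> gauss"

definition dmean :: "('a \<Rightarrow> real) \<Rightarrow> 'a \<Rightarrow> real \<Rightarrow> 'a \<Rightarrow> real" where
  "dmean \<phi> e s x = ratio \<phi> (\<lambda>s. gauss1 s e) s x - mean \<phi> s x * score e s x"

lemma continuous_ratio:
  assumes "integrable lborel (\<lambda>y. \<phi> y * \<rho> y)" "gauss_dominated k" "continuous_on UNIV (k s)" "0 < s"
  shows "continuous_on UNIV (ratio \<phi> k s)"
proof -
  obtain C where "\<And>z. \<bar>k s z\<bar> \<le> C"
    using gauss_dominated_bounded[OF assms(2,4) order.refl] by auto
  then have "continuous_on UNIV (conv (k s) (\<lambda>y. \<phi> y * \<rho> y))"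
    by (rule continuous_conv[OF assms(1,3)])
  then show ?thesis
    unfolding ratio_def using evol_pos[OF \<open>0 < s\<close>] continuous_evol[OF \<open>0 < s\<close>]
    by (intro continuous_intros) (auto simp: less_imp_neq[symmetric])
qed

text \<open>A bounded \<open>\<phi>\<close> and a kernel dominated by \<open>pgauss 3\<close> give a quotient dominated by the third
  conditional moment.\<close>

lemma tame_ratio:
  assumes \<phi>: "bounded_fun \<phi>" and k: "gauss_dominated k" and cont: "\<And>s. 0 < s \<Longrightarrow> continuous_on UNIV (k s)"
  shows "tame (ratio \<phi> k)"
proof (rule tameI[where K=3])
  show "continuous_on UNIV (ratio \<phi> k s)" if "0 < s" for s
    by (rule continuous_ratio[OF bounded_fun_integrable[OF \<phi>] k cont[OF that] that])
  obtain B where B: "\<And>x. \<bar>\<phi> x\<bar> \<le> B" and [measurable]: "\<phi> \<in> borel_measurable borel"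
    using \<phi> by (auto simp: bounded_fun_def)
  have B0: "0 \<le> B" using order.trans[OF abs_ge_zero B] .
  fix a b :: real assume ab: "0 < a" "a \<le> b"
  obtain C where C: "C > 0" "\<And>s z. s \<in> {a..b} \<Longrightarrow> \<bar>k s z\<bar> \<le> C * pgauss 3 s z"
    using k[unfolded gauss_dominated_def, rule_format, OF ab] by blast
  obtain C' where C': "\<And>s z. s \<in> {a..b} \<Longrightarrow> \<bar>k s z\<bar> \<le> C'"
    using gauss_dominated_bounded[OF k ab] by blast
  have "\<bar>ratio \<phi> k s x\<bar> * evol s x \<le> (B * C) * moment 3 s x" if s: "s \<in> {a..b}" for s x
  proof -
    have s0: "0 < s" using s ab by auto
    have [measurable]: "k s \<in> borel_measurable borel"
      by (rule borel_measurable_continuous_onI[OF cont[OF s0]])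
    have "\<bar>ratio \<phi> k s x\<bar> * evol s x = \<bar>conv (k s) (\<lambda>y. \<phi> y * \<rho> y) x\<bar>"
      using evol_pos[OF s0, of x] by (simp add: ratio_def)
    also have "\<dots> \<le> (LINT y|lborel. (B * C) * (\<rho> y * pgauss 3 s (x - y)))"
      unfolding conv_def
    proof (rule order.trans[OF integral_abs_bound integral_mono])
      show "integrable lborel (\<lambda>y. \<bar>\<phi> y * \<rho> y * k s (x - y)\<bar>)"
        by (rule integrable_abs[OF integrable_conv_kernel[OF bounded_fun_integrable[OF \<phi>] _ C'[OF s]]]) measurable
      show "integrable lborel (\<lambda>y. (B * C) * (\<rho> y * pgauss 3 s (x - y)))"
        by (intro integrable_mult_right integrable_moment_kernel s0)
      fix y
      have "\<bar>\<phi> y\<bar> * \<rho> y * \<bar>k s (x - y)\<bar> \<le> B * \<rho> y * (C * pgauss 3 s (x - y))"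
        using B C(2)[OF s] nonneg B0 by (intro mult_mono) auto
      then show "\<bar>\<phi> y * \<rho> y * k s (x - y)\<bar> \<le> (B * C) * (\<rho> y * pgauss 3 s (x - y))"
        by (simp add: abs_mult nonneg algebra_simps)
    qed
    finally show ?thesis by (simp add: moment_def conv_def)
  qed
  then show "\<exists>C\<ge>0. \<forall>s\<in>{a..b}. \<forall>x. \<bar>ratio \<phi> k s x\<bar> * evol s x \<le> C * moment 3 s x"
    using B0 C(1) by (intro exI[of _ "B * C"]) auto
qed

lemmas tame_gauss_ratio =
  tame_ratio[OF _ gauss_dominated_derivs(1) continuous_gauss]
  tame_ratio[OF _ gauss_dominated_derivs(2) continuous_gauss_derivs(1)]
  tame_ratio[OF _ gauss_dominated_derivs(3) continuous_gauss_derivs(2)]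
  tame_ratio[OF _ gauss_dominated_derivs(4) continuous_gauss_derivs(3)]
  tame_ratio[OF _ gauss_dominated_derivs(5) continuous_gauss_derivs(4)]

lemma tame_score: "tame (score e)"
  unfolding score_def by (rule tame_gauss_ratio) simp

lemma tame_mean: "bounded_fun \<phi> \<Longrightarrow> tame (mean \<phi>)"
  unfolding mean_def by (rule tame_gauss_ratio)

lemma tame_score_hess: "tame (score_hess d e)"
  unfolding score_hess_def[abs_def] by (intro tame_diff tame_mult tame_gauss_ratio tame_score) simp

lemma tame_dmean: "bounded_fun \<phi> \<Longrightarrow> tame (dmean \<phi> e)"
  unfolding dmean_def[abs_def] by (intro tame_diff tame_mult tame_gauss_ratio tame_score tame_mean)

lemma evol_deriv:
  assumes s: "0 < s"
  shows "((\<lambda>t. evol s (x + t *\<^sub>R e)) has_real_derivative evol s (x + t *\<^sub>R e) * score e s (x + t *\<^sub>R e)) (at t)"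
proof -
  obtain C where C: "\<And>z::'a. \<bar>gauss s z\<bar> \<le> C"
    using gauss_dominated_bounded[OF gauss_dominated_derivs(1) s order.refl] by auto
  obtain C' where C': "\<And>z::'a. \<bar>gauss1 s e z\<bar> \<le> C'"
    using gauss_dominated_bounded[OF gauss_dominated_derivs(2) s order.refl] by auto
  have "evol s y * score e s y = conv (gauss1 s e) \<rho> y" for y
    using evol_pos[OF s, of y] by (simp add: score_def ratio_def)
  then show ?thesis
    unfolding evol_def[symmetric]
    using conv_deriv[OF integrable continuous_gauss C C' gauss_deriv[OF s]] by (simp add: evol_def)
qed

lemma ratio_deriv:
  assumes \<phi>: "integrable lborel (\<lambda>y. \<phi> y * \<rho> y)" and s: "0 < s"
    and k: "gauss_dominated k" "continuous_on UNIV (k s)" and k': "gauss_dominated k'"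
    and der: "\<And>z t. ((\<lambda>t. k s (z + t *\<^sub>R e)) has_real_derivative k' s (z + t *\<^sub>R e)) (at t)"
  shows "((\<lambda>t. ratio \<phi> k s (x + t *\<^sub>R e)) has_real_derivative
     ratio \<phi> k' s (x + t *\<^sub>R e) - ratio \<phi> k s (x + t *\<^sub>R e) * score e s (x + t *\<^sub>R e)) (at t)"
proof -
  obtain C where C: "\<And>z. \<bar>k s z\<bar> \<le> C" using gauss_dominated_bounded[OF k(1) s order.refl] by auto
  obtain C' where C': "\<And>z. \<bar>k' s z\<bar> \<le> C'" using gauss_dominated_bounded[OF k' s order.refl] by auto
  have v: "evol s (x + t *\<^sub>R e) \<noteq> 0" using evol_pos[OF s] by (simp add: less_imp_neq[symmetric])
  from DERIV_divide[OF conv_deriv[OF \<phi> k(2) C C' der] evol_deriv[OF s] v]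
  show ?thesis
    unfolding ratio_def by (rule DERIV_cong) (use v in \<open>simp add: field_simps\<close>)
qed

lemma evol_time_deriv:
  assumes s: "0 < s"
  shows "((\<lambda>s. evol s x) has_real_derivative evol s x * (ratio (\<lambda>_. 1) gaussL s x / 2)) (at s)"
proof -
  let ?a = "s / 2" and ?b = "2 * s"
  have ab: "0 < ?a" "?a \<le> ?b" using s by auto
  obtain C where C: "\<And>r z. r \<in> {?a..?b} \<Longrightarrow> \<bar>gauss r (z::'a)\<bar> \<le> C"
    using gauss_dominated_bounded[OF gauss_dominated_derivs(1) ab] by blast
  obtain C' where C': "\<And>r z. r \<in> {?a..?b} \<Longrightarrow> \<bar>gaussL r (z::'a)\<bar> \<le> C'"
    using gauss_dominated_bounded[OF gauss_dominated_derivs(4) ab] by blast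
  have "((\<lambda>s. conv (gauss s) \<rho> x) has_real_derivative conv (\<lambda>z. gaussL s z / 2) \<rho> x) (at s)"
  proof (rule conv_time_deriv[OF integrable, where a="?a" and b="?b" and C=C and C'=C'])
    fix r and z :: 'a assume r: "r \<in> {?a<..<?b}"
    show "\<bar>gauss r z\<bar> \<le> C" using C[of r z] r by auto
    show "\<bar>gaussL r z / 2\<bar> \<le> C'" using C'[of r z] r by auto
    show "((\<lambda>s. gauss s z) has_real_derivative gaussL r z / 2) (at r)"
      using r s by (intro gauss_time_deriv) auto
  qed (use s in \<open>auto intro: continuous_gauss\<close>)
  moreover have "conv (\<lambda>z. gaussL s z / 2) \<rho> x = evol s x * (ratio (\<lambda>_. 1) gaussL s x / 2)"
    using evol_pos[OF s, of x] by (simp add: ratio_def conv_def)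
  ultimately show ?thesis by (simp add: evol_def)
qed

lemma ratio_time_deriv:
  fixes k k' :: "real \<Rightarrow> 'a \<Rightarrow> real"
  assumes \<phi>: "integrable lborel (\<lambda>y. \<phi> y * \<rho> y)" and s: "0 < s"
    and k: "gauss_dominated k" "\<And>s. continuous_on UNIV (k s)" and k': "gauss_dominated k'"
    and der: "\<And>s z. 0 < s \<Longrightarrow> ((\<lambda>s. k s z) has_real_derivative k' s z / 2) (at s)"
  shows "((\<lambda>s. ratio \<phi> k s x) has_real_derivative
      (ratio \<phi> k' s x - ratio \<phi> k s x * ratio (\<lambda>_. 1) gaussL s x) / 2) (at s)"
proof -
  let ?a = "s / 2" and ?b = "2 * s"
  have ab: "0 < ?a" "?a \<le> ?b" using s by auto
  obtain C where C: "\<And>r z. r \<in> {?a..?b} \<Longrightarrow> \<bar>k r z\<bar> \<le> C"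
    using gauss_dominated_bounded[OF k(1) ab] by blast
  obtain C' where C': "\<And>r z. r \<in> {?a..?b} \<Longrightarrow> \<bar>k' r z\<bar> \<le> C'"
    using gauss_dominated_bounded[OF k' ab] by blast
  have d: "((\<lambda>s. conv (k s) (\<lambda>y. \<phi> y * \<rho> y) x) has_real_derivative conv (\<lambda>z. k' s z / 2) (\<lambda>y. \<phi> y * \<rho> y) x) (at s)"
  proof (rule conv_time_deriv[OF \<phi>, where a="?a" and b="?b" and C=C and C'=C'])
    fix r and z :: 'a assume r: "r \<in> {?a<..<?b}"
    show "\<bar>k r z\<bar> \<le> C" using C[of r z] r by auto
    show "\<bar>k' r z / 2\<bar> \<le> C'" using C'[of r z] r by auto
    show "((\<lambda>s. k s z) has_real_derivative k' r z / 2) (at r)"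
      using r s by (intro der) auto
  qed (use s k(2) in auto)
  have v: "evol s x \<noteq> 0" using evol_pos[OF s] by (simp add: less_imp_neq[symmetric])
  have c: "conv (\<lambda>z. k' s z / 2) (\<lambda>y. \<phi> y * \<rho> y) x = conv (k' s) (\<lambda>y. \<phi> y * \<rho> y) x / 2"
    by (simp add: conv_def)
  from DERIV_divide[OF d evol_time_deriv[OF s] v]
  show ?thesis
    unfolding ratio_def c by (rule DERIV_cong) (use v in \<open>simp add: ratio_def field_simps\<close>)
qed

lemma mean_deriv:
  assumes "integrable lborel (\<lambda>y. \<phi> y * \<rho> y)" and s: "0 < s"
  shows "((\<lambda>t. mean \<phi> s (x + t *\<^sub>R e)) has_real_derivative dmean \<phi> e s (x + t *\<^sub>R e)) (at t)"
  unfolding mean_def dmean_def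
  by (rule ratio_deriv[OF assms gauss_dominated_derivs(1) continuous_gauss gauss_dominated_derivs(2) gauss_deriv[OF s]])

lemma ratio1_deriv:
  assumes "integrable lborel (\<lambda>y. \<phi> y * \<rho> y)" and s: "0 < s"
  shows "((\<lambda>t. ratio \<phi> (\<lambda>s. gauss1 s d) s (x + t *\<^sub>R e)) has_real_derivative
     ratio \<phi> (\<lambda>s. gauss2 s d e) s (x + t *\<^sub>R e) - ratio \<phi> (\<lambda>s. gauss1 s d) s (x + t *\<^sub>R e) * score e s (x + t *\<^sub>R e)) (at t)"
  by (rule ratio_deriv[OF assms gauss_dominated_derivs(2) continuous_gauss_derivs(1) gauss_dominated_derivs(3) gauss1_deriv[OF s]])

lemma ratioL_deriv:
  assumes "integrable lborel (\<lambda>y. \<phi> y * \<rho> y)" and s: "0 < s"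
  shows "((\<lambda>t. ratio \<phi> gaussL s (x + t *\<^sub>R e)) has_real_derivative
     ratio \<phi> (\<lambda>s. gaussL1 s e) s (x + t *\<^sub>R e) - ratio \<phi> gaussL s (x + t *\<^sub>R e) * score e s (x + t *\<^sub>R e)) (at t)"
  by (rule ratio_deriv[OF assms gauss_dominated_derivs(4) continuous_gauss_derivs(3) gauss_dominated_derivs(5) gaussL_deriv[OF s]])

lemma score_deriv:
  assumes s: "0 < s"
  shows "((\<lambda>t. score d s (x + t *\<^sub>R e)) has_real_derivative score_hess d e s (x + t *\<^sub>R e)) (at t)"
  using ratio1_deriv[of "\<lambda>_. 1", OF _ s, of d x e t] integrable by (simp add: score_def score_hess_def)

lemma mean_time_deriv:
  assumes "integrable lborel (\<lambda>y. \<phi> y * \<rho> y)" and s: "0 < s"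
  shows "((\<lambda>s. mean \<phi> s x) has_real_derivative
      (ratio \<phi> gaussL s x - mean \<phi> s x * ratio (\<lambda>_. 1) gaussL s x) / 2) (at s)"
  unfolding mean_def
  by (rule ratio_time_deriv[OF assms gauss_dominated_derivs(1) continuous_gauss gauss_dominated_derivs(4) gauss_time_deriv])

lemma ratio1_time_deriv:
  assumes "integrable lborel (\<lambda>y. \<phi> y * \<rho> y)" and s: "0 < s"
  shows "((\<lambda>s. ratio \<phi> (\<lambda>s. gauss1 s e) s x) has_real_derivative
      (ratio \<phi> (\<lambda>s. gaussL1 s e) s x - ratio \<phi> (\<lambda>s. gauss1 s e) s x * ratio (\<lambda>_. 1) gaussL s x) / 2) (at s)"
  by (rule ratio_time_deriv[OF assms gauss_dominated_derivs(2) continuous_gauss_derivs(1) gauss_dominated_derivs(5) gauss1_time_deriv])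

lemma score_time_deriv:
  assumes s: "0 < s"
  shows "((\<lambda>s. score e s x) has_real_derivative
      (ratio (\<lambda>_. 1) (\<lambda>s. gaussL1 s e) s x - score e s x * ratio (\<lambda>_. 1) gaussL s x) / 2) (at s)"
  using ratio1_time_deriv[of "\<lambda>_. 1", OF _ s, of e x] integrable by (simp add: score_def)

lemma sum_ratio2:
  assumes \<phi>: "integrable lborel (\<lambda>y. \<phi> y * \<rho> y)" and s: "0 < s"
  shows "(\<Sum>b\<in>Basis. ratio \<phi> (\<lambda>s. gauss2 s b b) s x) = ratio \<phi> gaussL s x"
proof -
  have "integrable lborel (\<lambda>y. \<phi> y * \<rho> y * gauss2 s b b (x - y))" for b :: 'a
  proof -
    obtain C where C: "\<And>z::'a. \<bar>gauss2 s b b z\<bar> \<le> C"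
      using gauss_dominated_bounded[OF gauss_dominated_derivs(3)[of b b] s order.refl] by auto
    show ?thesis
      by (rule integrable_conv_kernel[OF \<phi> _ C]) (rule borel_measurable_continuous_onI[OF continuous_gauss_derivs(2)])
  qed
  then have "(\<Sum>b\<in>Basis. conv (gauss2 s b b) (\<lambda>y. \<phi> y * \<rho> y) x) = conv (gaussL s) (\<lambda>y. \<phi> y * \<rho> y) x"
    unfolding conv_def sum_gauss2[symmetric] sum_distrib_left by simp
  then show ?thesis by (simp add: ratio_def flip: sum_divide_distrib)
qed

lemma ratio2_commute: "ratio \<phi> (\<lambda>s. gauss2 s d e) = ratio \<phi> (\<lambda>s. gauss2 s e d)"
  by (simp add: ratio_def fun_eq_iff gauss2_def[abs_def] inner_commute mult.commute)

section \<open>Integrals against the evolved density\<close>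

text \<open>The last term is the contribution of \<open>\<partial>\<^sub>s \<rho>\<^sub>s = \<Delta> \<rho>\<^sub>s / 2\<close>, as \<open>ratio (\<lambda>_. 1) gaussL\<close> is
  \<open>\<Delta> \<rho>\<^sub>s / \<rho>\<^sub>s\<close>.\<close>

lemma tame_integral_time_deriv:
  assumes F: "tame F" and F': "tame F'" and s: "0 < s"
    and der: "\<And>s x. 0 < s \<Longrightarrow> ((\<lambda>s. F s x) has_real_derivative F' s x) (at s)"
  shows "((\<lambda>s. LINT x|lborel. F s x * evol s x) has_real_derivative
     (LINT x|lborel. (F' s x + F s x * (ratio (\<lambda>_. 1) gaussL s x / 2)) * evol s x)) (at s)"
proof -
  let ?G = "\<lambda>s x. F' s x + F s x * (ratio (\<lambda>_. 1) gaussL s x / 2)"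
  have "tame ?G"
    by (intro tame_add tame_mult tame_divide tame_gauss_ratio F F') simp
  moreover have "0 < s / 2" "s / 2 \<le> 2 * s" using s by auto
  ultimately have "\<exists>h. integrable lborel h \<and> (\<forall>r\<in>{s / 2..2 * s}. \<forall>x. \<bar>?G r x * evol r x\<bar> \<le> h x)"
    by (rule tame_dominated)
  then obtain h where h: "integrable lborel h" "\<And>r x. r \<in> {s / 2..2 * s} \<Longrightarrow> \<bar>?G r x * evol r x\<bar> \<le> h x"
    by blast
  show ?thesis
  proof (rule has_real_derivative_integral[where a="s / 2" and b="2 * s" and h=h and F="\<lambda>s x. F s x * evol s x" and F'="\<lambda>s x. ?G s x * evol s x"])
    fix r x assume r: "r \<in> {s / 2<..<2 * s}"
    then have r0: "0 < r" using s by auto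
    show "integrable lborel (\<lambda>x. F r x * evol r x)" by (rule tame_integrable[OF F r0])
    show "((\<lambda>s. F s x * evol s x) has_real_derivative ?G r x * evol r x) (at r)"
      by (rule DERIV_cong[OF DERIV_mult[OF der[OF r0] evol_time_deriv[OF r0]]]) (simp add: algebra_simps)
    show "\<bar>?G r x * evol r x\<bar> \<le> h x" using h(2)[of r x] r by auto
  qed (use s h(1) in auto)
qed

text \<open>Integration by parts against \<open>\<rho>\<^sub>s\<close>: the integrand is the derivative of \<open>F \<rho>\<^sub>s\<close> in direction
  \<open>e\<close>.\<close>

lemma tame_divergence:
  assumes F: "tame F" and F': "tame F'" and s: "0 < s"
    and der: "\<And>x. ((\<lambda>t. F s (x + t *\<^sub>R e)) has_real_derivative F' s x) (at 0)"
  shows "(LINT x|lborel. (F' s x + F s x * score e s x) * evol s x) = 0"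
proof (rule integral_directional_derivative_eq_0[where e=e and F="\<lambda>x. F s x * evol s x"])
  have G: "tame (\<lambda>s x. F' s x + F s x * score e s x)"
    by (intro tame_add tame_mult tame_score F F')
  show "integrable lborel (\<lambda>x. F s x * evol s x)" by (rule tame_integrable[OF F s])
  show "integrable lborel (\<lambda>x. (F' s x + F s x * score e s x) * evol s x)" by (rule tame_integrable[OF G s])
  show "continuous_on UNIV (\<lambda>x. (F' s x + F s x * score e s x) * evol s x)"
    by (rule continuous_on_mult[OF tame_continuous[OF G s] continuous_evol[OF s]])
  show "((\<lambda>t. F s (x + t *\<^sub>R e) * evol s (x + t *\<^sub>R e)) has_real_derivative (F' s x + F s x * score e s x) * evol s x) (at 0)" for x
    by (rule DERIV_cong[OF DERIV_mult[OF der[of x] evol_deriv[OF s, of x e 0]]]) (simp add: algebra_simps)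
qed

end

section \<open>Time derivatives of mass and energy\<close>

lemma discriminant_nonneg_quadratic:
  fixes a b c :: real
  assumes "\<And>l. 0 \<le> a + 2 * b * l + c * l\<^sup>2" "0 \<le> c"
  shows "b\<^sup>2 \<le> a * c"
proof (cases "c = 0")
  case True
  have "b = 0"
  proof (rule ccontr)
    assume "b \<noteq> 0"
    then show False using assms(1)[of "- (a + 1) / (2 * b)"] True by simp
  qed
  then show ?thesis using True by simp
next
  case False
  then have "0 < c" using assms by simp
  have "a + 2 * b * (- b / c) + c * (- b / c)\<^sup>2 = a - b\<^sup>2 / c"
    using \<open>0 < c\<close> by (simp add: field_simps power2_eq_square)
  then have "b\<^sup>2 / c \<le> a" using assms(1)[of "- b / c"] by simp
  then show ?thesis using \<open>0 < c\<close> by (simp add: field_simps)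
qed

context prob_density begin

text \<open>With \<open>f = Q\<^sub>s \<phi>\<close>: \<open>hess_mean\<close> is the Hessian of \<open>f\<close>, and \<open>gen\<close> is
  \<open>L f = \<Delta> f + \<nabla> ln \<rho>\<^sub>s \<cdot> \<nabla> f\<close>, the generator that is symmetric in \<open>L\<^sup>2(\<mu>\<^sub>s)\<close>; \<open>dgen\<close> is its
  directional derivative. They are written in terms of \<open>ratio\<close> since this is the form that is
  visibly tame and differentiable.\<close>

definition hess_mean :: "('a \<Rightarrow> real) \<Rightarrow> 'a \<Rightarrow> 'a \<Rightarrow> real \<Rightarrow> 'a \<Rightarrow> real" where
  "hess_mean \<phi> d e s x = ratio \<phi> (\<lambda>s. gauss2 s d e) s x - ratio \<phi> (\<lambda>s. gauss1 s d) s x * score e s x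
     - dmean \<phi> e s x * score d s x - mean \<phi> s x * score_hess d e s x"

definition gen :: "('a \<Rightarrow> real) \<Rightarrow> real \<Rightarrow> 'a \<Rightarrow> real" where
  "gen \<phi> s x = ratio \<phi> gaussL s x - mean \<phi> s x * ratio (\<lambda>_. 1) gaussL s x
     - (\<Sum>b\<in>Basis. score b s x * dmean \<phi> b s x)"

definition dgen :: "('a \<Rightarrow> real) \<Rightarrow> 'a \<Rightarrow> real \<Rightarrow> 'a \<Rightarrow> real" where
  "dgen \<phi> e s x = (ratio \<phi> (\<lambda>s. gaussL1 s e) s x - ratio \<phi> gaussL s x * score e s x)
     - dmean \<phi> e s x * ratio (\<lambda>_. 1) gaussL s x
     - mean \<phi> s x * (ratio (\<lambda>_. 1) (\<lambda>s. gaussL1 s e) s x - ratio (\<lambda>_. 1) gaussL s x * score e s x)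
     - (\<Sum>b\<in>Basis. score_hess b e s x * dmean \<phi> b s x + score b s x * hess_mean \<phi> b e s x)"

lemma dmean_deriv:
  assumes \<phi>: "integrable lborel (\<lambda>y. \<phi> y * \<rho> y)" and s: "0 < s"
  shows "((\<lambda>t. dmean \<phi> d s (x + t *\<^sub>R e)) has_real_derivative hess_mean \<phi> d e s (x + t *\<^sub>R e)) (at t)"
  unfolding dmean_def
  by (rule DERIV_cong[OF DERIV_diff[OF ratio1_deriv[OF \<phi> s] DERIV_mult[OF mean_deriv[OF \<phi> s] score_deriv[OF s]]]])
     (simp add: hess_mean_def algebra_simps)

lemma hess_mean_commute: "hess_mean \<phi> d e s x = hess_mean \<phi> e d s x"
proof -
  have "ratio \<phi> (\<lambda>s. gauss2 s d e) s x = ratio \<phi> (\<lambda>s. gauss2 s e d) s x" for \<phi>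
    by (subst ratio2_commute) simp
  then show ?thesis by (simp add: hess_mean_def dmean_def score_hess_def algebra_simps)
qed

lemma sum_hess_mean:
  assumes \<phi>: "integrable lborel (\<lambda>y. \<phi> y * \<rho> y)" and s: "0 < s"
  shows "(\<Sum>b\<in>Basis. hess_mean \<phi> b b s x + score b s x * dmean \<phi> b s x) = gen \<phi> s x"
proof -
  have E: "hess_mean \<phi> b b s x + score b s x * dmean \<phi> b s x
      = ratio \<phi> (\<lambda>s. gauss2 s b b) s x - mean \<phi> s x * ratio (\<lambda>_. 1) (\<lambda>s. gauss2 s b b) s x
        - score b s x * dmean \<phi> b s x" for b
    by (simp add: hess_mean_def dmean_def score_hess_def algebra_simps)
  have "(\<Sum>b\<in>Basis. ratio (\<lambda>_. 1) (\<lambda>s. gauss2 s b b) s x) = ratio (\<lambda>_. 1) gaussL s x"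
    using sum_ratio2[of "\<lambda>_. 1", OF _ s] integrable by simp
  then show ?thesis
    unfolding E gen_def by (simp only: sum_subtractf sum_ratio2[OF \<phi> s] sum_distrib_left[symmetric])
qed

lemma sum_score_hess:
  assumes s: "0 < s"
  shows "(\<Sum>b\<in>Basis. score_hess b b s x + (score b s x)\<^sup>2) = ratio (\<lambda>_. 1) gaussL s x"
  using sum_ratio2[of "\<lambda>_. 1", OF _ s] integrable by (simp add: score_hess_def power2_eq_square)

lemma gen_deriv:
  assumes \<phi>: "integrable lborel (\<lambda>y. \<phi> y * \<rho> y)" and s: "0 < s"
  shows "((\<lambda>t. gen \<phi> s (x + t *\<^sub>R e)) has_real_derivative dgen \<phi> e s (x + t *\<^sub>R e)) (at t)"
proof -
  have 1: "integrable lborel (\<lambda>y. (\<lambda>_. 1) y * \<rho> y)" using integrable by simp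
  have S: "((\<lambda>t. \<Sum>b\<in>Basis. score b s (x + t *\<^sub>R e) * dmean \<phi> b s (x + t *\<^sub>R e)) has_real_derivative
      (\<Sum>b\<in>Basis. score_hess b e s (x + t *\<^sub>R e) * dmean \<phi> b s (x + t *\<^sub>R e)
         + hess_mean \<phi> b e s (x + t *\<^sub>R e) * score b s (x + t *\<^sub>R e))) (at t)"
    by (intro DERIV_sum DERIV_mult score_deriv[OF s] dmean_deriv[OF \<phi> s])
  show ?thesis
    unfolding gen_def
    by (rule DERIV_cong[OF DERIV_diff[OF DERIV_diff[OF ratioL_deriv[OF \<phi> s]
          DERIV_mult[OF mean_deriv[OF \<phi> s] ratioL_deriv[OF 1 s]]] S]])
       (simp add: dgen_def algebra_simps)
qed

text \<open>The evolution \<open>\<partial>\<^sub>s f = \<Delta> f / 2 + \<nabla> ln \<rho>\<^sub>s \<cdot> \<nabla> f\<close>, which is \<open>L f / 2 + \<nabla> ln \<rho>\<^sub>s \<cdot> \<nabla> f / 2\<close>,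
  differentiated once in space.\<close>

lemma dmean_time_deriv:
  assumes \<phi>: "integrable lborel (\<lambda>y. \<phi> y * \<rho> y)" and s: "0 < s"
  shows "((\<lambda>s. dmean \<phi> e s x) has_real_derivative
     (dgen \<phi> e s x + (\<Sum>b\<in>Basis. score_hess b e s x * dmean \<phi> b s x + score b s x * hess_mean \<phi> b e s x)) / 2) (at s)"
  unfolding dmean_def
  by (rule DERIV_cong[OF DERIV_diff[OF ratio1_time_deriv[OF \<phi> s] DERIV_mult[OF mean_time_deriv[OF \<phi> s] score_time_deriv[OF s]]]])
     (simp add: dgen_def dmean_def field_simps)

lemma tame_hess_mean: "bounded_fun \<phi> \<Longrightarrow> tame (hess_mean \<phi> d e)"
  unfolding hess_mean_def[abs_def]
  by (intro tame_diff tame_mult tame_gauss_ratio tame_score tame_mean tame_dmean tame_score_hess)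

lemma tame_gen: "bounded_fun \<phi> \<Longrightarrow> tame (gen \<phi>)"
  unfolding gen_def[abs_def]
  by (intro tame_diff tame_mult tame_sum tame_gauss_ratio tame_score tame_mean tame_dmean finite_Basis) simp_all

lemma tame_dgen: "bounded_fun \<phi> \<Longrightarrow> tame (dgen \<phi> e)"
  unfolding dgen_def[abs_def]
  by (intro tame_add tame_diff tame_mult tame_sum tame_gauss_ratio tame_score tame_mean tame_dmean tame_score_hess
        tame_hess_mean finite_Basis) simp_all

definition mass :: "('a \<Rightarrow> real) \<Rightarrow> real \<Rightarrow> real" where
  "mass \<phi> s = (LINT x|lborel. (mean \<phi> s x)\<^sup>2 * evol s x)"

definition energy :: "('a \<Rightarrow> real) \<Rightarrow> real \<Rightarrow> real" where
  "energy \<phi> s = (LINT x|lborel. (\<Sum>b\<in>Basis. (dmean \<phi> b s x)\<^sup>2) * evol s x)"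

definition gen_sq :: "('a \<Rightarrow> real) \<Rightarrow> real \<Rightarrow> real" where
  "gen_sq \<phi> s = (LINT x|lborel. (gen \<phi> s x)\<^sup>2 * evol s x)"

lemma tame_energy: "bounded_fun \<phi> \<Longrightarrow> tame (\<lambda>s x. \<Sum>b\<in>Basis. (dmean \<phi> b s x)\<^sup>2)"
  by (intro tame_sum tame_power2 tame_dmean finite_Basis)

text \<open>Two integrands that differ by a sum of divergences have the same integral.\<close>

lemma integral_evol_sum_diff:
  fixes P :: "real \<Rightarrow> 'a \<Rightarrow> real" and E :: "'a \<Rightarrow> real \<Rightarrow> 'a \<Rightarrow> real" and Q :: "'a \<Rightarrow> real"
  assumes P: "tame P" and E: "\<And>b. b \<in> Basis \<Longrightarrow> tame (E b)" and s: "0 < s"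
    and zero: "\<And>b. b \<in> Basis \<Longrightarrow> (LINT x|lborel. E b s x * evol s x) = 0"
    and eq: "\<And>x. Q x = P s x + (\<Sum>b\<in>(Basis :: 'a set). E b s x)"
  shows "(LINT x|lborel. Q x * evol s x) = (LINT x|lborel. P s x * evol s x)"
proof -
  have "(LINT x|lborel. Q x * evol s x)
      = (LINT x|lborel. P s x * evol s x + (\<Sum>b\<in>Basis. E b s x * evol s x))"
    by (simp add: eq distrib_right sum_distrib_right)
  also have "\<dots> = (LINT x|lborel. P s x * evol s x) + (\<Sum>b\<in>Basis. LINT x|lborel. E b s x * evol s x)"
    using tame_integrable[OF P s] tame_integrable[OF E s] by simp
  finally show ?thesis using zero by simp
qed

text \<open>Differentiating \<open>f\<^sup>2 \<rho>\<^sub>s\<close> in time and subtracting the divergence of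
  \<open>\<rho>\<^sub>s (f \<nabla> f + f\<^sup>2 \<nabla> ln \<rho>\<^sub>s / 2)\<close> leaves \<open>- |\<nabla> f|\<^sup>2 \<rho>\<^sub>s\<close>.\<close>

lemma mass_deriv:
  assumes b: "bounded_fun \<phi>" and s: "0 < s"
  shows "(mass \<phi> has_real_derivative - energy \<phi> s) (at s)"
proof -
  note \<phi> = bounded_fun_integrable[OF b]
  define T where "T = (\<lambda>s x. 2 * mean \<phi> s x * ((ratio \<phi> gaussL s x - mean \<phi> s x * ratio (\<lambda>_. 1) gaussL s x) / 2))"
  have T: "tame T"
    unfolding T_def by (intro tame_mult tame_divide tame_diff tame_mean tame_gauss_ratio b) simp_all
  have D: "((\<lambda>s. LINT x|lborel. (mean \<phi> s x)\<^sup>2 * evol s x) has_real_derivative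
     (LINT x|lborel. (T s x + (mean \<phi> s x)\<^sup>2 * (ratio (\<lambda>_. 1) gaussL s x / 2)) * evol s x)) (at s)"
  proof (rule tame_integral_time_deriv[OF _ T s])
    show "tame (\<lambda>s x. (mean \<phi> s x)\<^sup>2)" by (intro tame_power2 tame_mean b)
    show "((\<lambda>s. (mean \<phi> s x)\<^sup>2) has_real_derivative T s x) (at s)" if "0 < s" for s x
      by (rule DERIV_cong[OF DERIV_power[OF mean_time_deriv[OF \<phi> that]]]) (simp add: T_def)
  qed
  define F where "F = (\<lambda>b s x. mean \<phi> s x * dmean \<phi> b s x + (mean \<phi> s x)\<^sup>2 * score b s x / 2)"
  define F' where "F' = (\<lambda>b s x. (dmean \<phi> b s x)\<^sup>2 + mean \<phi> s x * hess_mean \<phi> b b s x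
      + mean \<phi> s x * dmean \<phi> b s x * score b s x + (mean \<phi> s x)\<^sup>2 * score_hess b b s x / 2)"
  have F: "tame (F b)" and F': "tame (F' b)" for b
    unfolding F_def F'_def
    by (intro tame_add tame_mult tame_divide tame_power2 tame_mean tame_dmean tame_hess_mean tame_score tame_score_hess b)+
  have dF: "((\<lambda>t. F b s (x + t *\<^sub>R b)) has_real_derivative F' b s x) (at 0)" for b x
    unfolding F_def F'_def
    by (rule DERIV_cong[OF DERIV_add[OF DERIV_mult[OF mean_deriv[OF \<phi> s] dmean_deriv[OF \<phi> s]]
          DERIV_cdivide[OF DERIV_mult[OF DERIV_power[OF mean_deriv[OF \<phi> s]] score_deriv[OF s]]]]])
       (simp add: algebra_simps power2_eq_square)
  have "(LINT x|lborel. (T s x + (mean \<phi> s x)\<^sup>2 * (ratio (\<lambda>_. 1) gaussL s x / 2)) * evol s x)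
      = (LINT x|lborel. - (\<Sum>b\<in>Basis. (dmean \<phi> b s x)\<^sup>2) * evol s x)"
  proof (rule integral_evol_sum_diff[where E="\<lambda>b s x. F' b s x + F b s x * score b s x"
          and P="\<lambda>s x. - (\<Sum>b\<in>Basis. (dmean \<phi> b s x)\<^sup>2)", OF _ _ s])
    show "tame (\<lambda>s x. - (\<Sum>b\<in>Basis. (dmean \<phi> b s x)\<^sup>2))" by (intro tame_minus tame_energy b)
    show "tame (\<lambda>s x. F' b s x + F b s x * score b s x)" for b by (intro tame_add tame_mult tame_score F F')
    show "(LINT x|lborel. (F' b s x + F b s x * score b s x) * evol s x) = 0" for b
      by (rule tame_divergence[OF F F' s dF])
    fix x
    have "F' b s x + F b s x * score b s x = (dmean \<phi> b s x)\<^sup>2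
        + mean \<phi> s x * (hess_mean \<phi> b b s x + score b s x * dmean \<phi> b s x)
        + mean \<phi> s x * (score b s x * dmean \<phi> b s x)
        + (mean \<phi> s x)\<^sup>2 / 2 * (score_hess b b s x + (score b s x)\<^sup>2)" for b
      by (simp add: F_def F'_def algebra_simps power2_eq_square)
    then have "(\<Sum>b\<in>Basis. F' b s x + F b s x * score b s x) = (\<Sum>b\<in>Basis. (dmean \<phi> b s x)\<^sup>2)
        + mean \<phi> s x * gen \<phi> s x + mean \<phi> s x * (\<Sum>b\<in>Basis. score b s x * dmean \<phi> b s x)
        + (mean \<phi> s x)\<^sup>2 / 2 * ratio (\<lambda>_. 1) gaussL s x"
      by (simp only: sum.distrib sum_distrib_left[symmetric] sum_hess_mean[OF \<phi> s, symmetric] sum_score_hess[OF s, symmetric])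
    then show "T s x + (mean \<phi> s x)\<^sup>2 * (ratio (\<lambda>_. 1) gaussL s x / 2)
        = - (\<Sum>b\<in>Basis. (dmean \<phi> b s x)\<^sup>2) + (\<Sum>b\<in>Basis. F' b s x + F b s x * score b s x)"
      by (simp add: T_def gen_def field_simps power2_eq_square)
  qed
  then have "(LINT x|lborel. (T s x + (mean \<phi> s x)\<^sup>2 * (ratio (\<lambda>_. 1) gaussL s x / 2)) * evol s x) = - energy \<phi> s"
    by (simp add: energy_def)
  with D show ?thesis unfolding mass_def[abs_def] by simp
qed

text \<open>Symmetry of \<open>L\<close>: integrate the divergence of \<open>\<rho>\<^sub>s f \<nabla> f\<close>.\<close>

lemma energy_eq_mean_gen:
  assumes b: "bounded_fun \<phi>" and s: "0 < s"
  shows "energy \<phi> s = - (LINT x|lborel. mean \<phi> s x * gen \<phi> s x * evol s x)"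
proof -
  note \<phi> = bounded_fun_integrable[OF b]
  define F where "F = (\<lambda>b s x. mean \<phi> s x * dmean \<phi> b s x)"
  define F' where "F' = (\<lambda>b s x. (dmean \<phi> b s x)\<^sup>2 + mean \<phi> s x * hess_mean \<phi> b b s x)"
  have F: "tame (F b)" and F': "tame (F' b)" for b
    unfolding F_def F'_def
    by (intro tame_add tame_mult tame_power2 tame_mean tame_dmean tame_hess_mean b)+
  have dF: "((\<lambda>t. F b s (x + t *\<^sub>R b)) has_real_derivative F' b s x) (at 0)" for b x
    unfolding F_def F'_def
    by (rule DERIV_cong[OF DERIV_mult[OF mean_deriv[OF \<phi> s] dmean_deriv[OF \<phi> s]]])
       (simp add: algebra_simps power2_eq_square)
  have "(LINT x|lborel. (\<Sum>b\<in>Basis. (dmean \<phi> b s x)\<^sup>2) * evol s x)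
      = (LINT x|lborel. - (mean \<phi> s x * gen \<phi> s x) * evol s x)"
  proof (rule integral_evol_sum_diff[where E="\<lambda>b s x. F' b s x + F b s x * score b s x"
          and P="\<lambda>s x. - (mean \<phi> s x * gen \<phi> s x)", OF _ _ s])
    show "tame (\<lambda>s x. - (mean \<phi> s x * gen \<phi> s x))" by (intro tame_minus tame_mult tame_mean tame_gen b)
    show "tame (\<lambda>s x. F' b s x + F b s x * score b s x)" for b by (intro tame_add tame_mult tame_score F F')
    show "(LINT x|lborel. (F' b s x + F b s x * score b s x) * evol s x) = 0" for b
      by (rule tame_divergence[OF F F' s dF])
    fix x
    have "F' b s x + F b s x * score b s x = (dmean \<phi> b s x)\<^sup>2
        + mean \<phi> s x * (hess_mean \<phi> b b s x + score b s x * dmean \<phi> b s x)" for b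
      by (simp add: F_def F'_def algebra_simps power2_eq_square)
    then have "(\<Sum>b\<in>Basis. F' b s x + F b s x * score b s x) = (\<Sum>b\<in>Basis. (dmean \<phi> b s x)\<^sup>2)
        + mean \<phi> s x * gen \<phi> s x"
      by (simp only: sum.distrib sum_distrib_left[symmetric] sum_hess_mean[OF \<phi> s, symmetric])
    then show "(\<Sum>b\<in>Basis. (dmean \<phi> b s x)\<^sup>2)
        = - (mean \<phi> s x * gen \<phi> s x) + (\<Sum>b\<in>Basis. F' b s x + F b s x * score b s x)"
      by simp
  qed
  then show ?thesis by (simp add: energy_def)
qed

text \<open>Cauchy--Schwarz for \<open>f\<close> and \<open>L f\<close>, whose inner product in \<open>L\<^sup>2(\<mu>\<^sub>s)\<close> is \<open>- energy\<close>.\<close>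

lemma energy_sq_le:
  assumes b: "bounded_fun \<phi>" and s: "0 < s"
  shows "(energy \<phi> s)\<^sup>2 \<le> mass \<phi> s * gen_sq \<phi> s"
proof (rule discriminant_nonneg_quadratic)
  have m: "tame (\<lambda>s x. (mean \<phi> s x)\<^sup>2)" and g: "tame (\<lambda>s x. (gen \<phi> s x)\<^sup>2)" and mg: "tame (\<lambda>s x. mean \<phi> s x * gen \<phi> s x)"
    by (intro tame_power2 tame_mult tame_mean tame_gen b)+
  show "0 \<le> gen_sq \<phi> s"
    unfolding gen_sq_def by (intro integral_nonneg_AE AE_I2) (simp add: less_imp_le[OF evol_pos[OF s]])
  fix l
  have "0 \<le> (LINT x|lborel. (mean \<phi> s x - l * gen \<phi> s x)\<^sup>2 * evol s x)"
    by (intro integral_nonneg_AE AE_I2) (simp add: less_imp_le[OF evol_pos[OF s]])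
  also have "\<dots> = (LINT x|lborel. (mean \<phi> s x)\<^sup>2 * evol s x - 2 * l * (mean \<phi> s x * gen \<phi> s x * evol s x)
      + l\<^sup>2 * ((gen \<phi> s x)\<^sup>2 * evol s x))"
    by (simp add: power2_eq_square algebra_simps)
  also have "\<dots> = mass \<phi> s + 2 * energy \<phi> s * l + gen_sq \<phi> s * l\<^sup>2"
    using tame_integrable[OF m s] tame_integrable[OF g s] tame_integrable[OF mg s]
    by (simp add: mass_def gen_sq_def energy_eq_mean_gen[OF b s])
  finally show "0 \<le> mass \<phi> s + 2 * energy \<phi> s * l + gen_sq \<phi> s * l\<^sup>2" .
qed

text \<open>The Bochner-type identity behind the theorem. Differentiating \<open>|\<nabla> f|\<^sup>2 \<rho>\<^sub>s\<close> in time and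
  subtracting the divergence of \<open>\<rho>\<^sub>s (L f \<nabla> f + |\<nabla> f|\<^sup>2 \<nabla> ln \<rho>\<^sub>s / 2)\<close> leaves \<open>- (L f)\<^sup>2 \<rho>\<^sub>s\<close> and
  the Hessian of \<open>ln \<rho>\<^sub>s\<close> evaluated at \<open>\<nabla> f\<close>; the Hessians of \<open>f\<close> cancel because they are
  symmetric.\<close>

lemma energy_deriv:
  assumes b: "bounded_fun \<phi>" and s: "0 < s"
  shows "(energy \<phi> has_real_derivative - gen_sq \<phi> s
     + (LINT x|lborel. (\<Sum>i\<in>Basis. \<Sum>c\<in>Basis. dmean \<phi> i s x * dmean \<phi> c s x * score_hess c i s x) * evol s x)) (at s)"
proof -
  note \<phi> = bounded_fun_integrable[OF b]
  define P where "P = (\<lambda>s x. \<Sum>b\<in>Basis. (dmean \<phi> b s x)\<^sup>2)"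
  have P: "tame P" unfolding P_def by (rule tame_energy[OF b])
  define T where "T = (\<lambda>s x. \<Sum>i\<in>Basis. dmean \<phi> i s x *
      (dgen \<phi> i s x + (\<Sum>c\<in>Basis. score_hess c i s x * dmean \<phi> c s x + score c s x * hess_mean \<phi> c i s x)))"
  note tame = tame_add tame_mult tame_divide tame_diff tame_minus tame_sum tame_power2 tame_mean tame_dmean
    tame_hess_mean tame_score tame_score_hess tame_gen tame_dgen finite_Basis tame_const tame_gauss_ratio b P bounded_fun_const
  have T: "tame T" unfolding T_def by (intro tame)
  have D: "((\<lambda>s. LINT x|lborel. P s x * evol s x) has_real_derivative
     (LINT x|lborel. (T s x + P s x * (ratio (\<lambda>_. 1) gaussL s x / 2)) * evol s x)) (at s)"
  proof (rule tame_integral_time_deriv[OF P T s])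
    show "((\<lambda>s. P s x) has_real_derivative T s x) (at s)" if "0 < s" for s x
      unfolding P_def
      by (rule DERIV_cong[OF DERIV_sum[OF DERIV_power[OF dmean_time_deriv[OF \<phi> that]]]])
         (unfold T_def, intro sum.cong refl, simp add: field_simps)
  qed
  define F where "F = (\<lambda>i s x. dmean \<phi> i s x * gen \<phi> s x + P s x * score i s x / 2)"
  define F' where "F' = (\<lambda>i s x. hess_mean \<phi> i i s x * gen \<phi> s x + dgen \<phi> i s x * dmean \<phi> i s x
      + ((\<Sum>c\<in>Basis. 2 * (dmean \<phi> c s x * hess_mean \<phi> c i s x)) * score i s x + score_hess i i s x * P s x) / 2)"
  have F: "tame (F b)" and F': "tame (F' b)" for b
    unfolding F_def F'_def by (intro tame)+
  have dP: "((\<lambda>t. P s (x + t *\<^sub>R i)) has_real_derivative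
      (\<Sum>c\<in>Basis. 2 * (dmean \<phi> c s (x + t *\<^sub>R i) * hess_mean \<phi> c i s (x + t *\<^sub>R i)))) (at t)" for i x t
    unfolding P_def
    by (rule DERIV_cong[OF DERIV_sum[OF DERIV_power[OF dmean_deriv[OF \<phi> s]]]]) (simp add: algebra_simps)
  have dF: "((\<lambda>t. F i s (x + t *\<^sub>R i)) has_real_derivative F' i s x) (at 0)" for i x
    unfolding F_def F'_def
    by (rule DERIV_cong[OF DERIV_add[OF DERIV_mult[OF dmean_deriv[OF \<phi> s] gen_deriv[OF \<phi> s]]
          DERIV_cdivide[OF DERIV_mult[OF dP score_deriv[OF s]]]]]) simp
  define H where "H = (\<lambda>s x. \<Sum>i\<in>Basis. \<Sum>c\<in>Basis. dmean \<phi> i s x * dmean \<phi> c s x * score_hess c i s x)"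
  have H: "tame H" unfolding H_def by (intro tame)
  have "(LINT x|lborel. (T s x + P s x * (ratio (\<lambda>_. 1) gaussL s x / 2)) * evol s x)
      = (LINT x|lborel. (- (gen \<phi> s x)\<^sup>2 + H s x) * evol s x)"
  proof (rule integral_evol_sum_diff[where E="\<lambda>b s x. F' b s x + F b s x * score b s x"
          and P="\<lambda>s x. - (gen \<phi> s x)\<^sup>2 + H s x", OF _ _ s])
    show "tame (\<lambda>s x. - (gen \<phi> s x)\<^sup>2 + H s x)" by (intro tame H)
    show "tame (\<lambda>s x. F' b s x + F b s x * score b s x)" for b by (intro tame F F')
    show "(LINT x|lborel. (F' b s x + F b s x * score b s x) * evol s x) = 0" for b
      by (rule tame_divergence[OF F F' s dF])
    fix x
    have c: "F' i s x + F i s x * score i s x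
        = gen \<phi> s x * (hess_mean \<phi> i i s x + score i s x * dmean \<phi> i s x)
        + dmean \<phi> i s x * dgen \<phi> i s x
        + score i s x * (\<Sum>c\<in>Basis. dmean \<phi> c s x * hess_mean \<phi> c i s x)
        + P s x / 2 * (score_hess i i s x + (score i s x)\<^sup>2)" for i
      by (simp add: F_def F'_def algebra_simps power2_eq_square add_divide_distrib flip: sum_distrib_left)
    have "(\<Sum>i\<in>Basis. F' i s x + F i s x * score i s x)
        = gen \<phi> s x * gen \<phi> s x + (\<Sum>i\<in>Basis. dmean \<phi> i s x * dgen \<phi> i s x)
        + (\<Sum>i\<in>Basis. score i s x * (\<Sum>c\<in>Basis. dmean \<phi> c s x * hess_mean \<phi> c i s x))
        + P s x / 2 * ratio (\<lambda>_. 1) gaussL s x"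
      by (simp only: c sum.distrib sum_distrib_left[symmetric])
         (simp only: sum.distrib[symmetric] sum_hess_mean[OF \<phi> s] sum_score_hess[OF s])
    moreover have "(\<Sum>i\<in>Basis. score i s x * (\<Sum>c\<in>Basis. dmean \<phi> c s x * hess_mean \<phi> c i s x))
        = (\<Sum>i\<in>Basis. \<Sum>c\<in>Basis. dmean \<phi> i s x * (score c s x * hess_mean \<phi> c i s x))"
      by (simp only: sum_distrib_left, subst sum.swap)
         (intro sum.cong refl, simp add: hess_mean_commute mult.left_commute)
    moreover have "T s x = (\<Sum>i\<in>Basis. dmean \<phi> i s x * dgen \<phi> i s x) + H s x
        + (\<Sum>i\<in>Basis. \<Sum>c\<in>Basis. dmean \<phi> i s x * (score c s x * hess_mean \<phi> c i s x))"
      by (simp add: T_def H_def distrib_left sum.distrib sum_distrib_left mult_ac)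
    ultimately show "T s x + P s x * (ratio (\<lambda>_. 1) gaussL s x / 2)
        = (- (gen \<phi> s x)\<^sup>2 + H s x) + (\<Sum>b\<in>Basis. F' b s x + F b s x * score b s x)"
      by (simp add: power2_eq_square)
  qed
  also have "\<dots> = - gen_sq \<phi> s + (LINT x|lborel. H s x * evol s x)"
  proof -
    have g: "tame (\<lambda>s x. (gen \<phi> s x)\<^sup>2)" by (intro tame)
    have "(LINT x|lborel. (- (gen \<phi> s x)\<^sup>2 + H s x) * evol s x)
        = (LINT x|lborel. H s x * evol s x - (gen \<phi> s x)\<^sup>2 * evol s x)"
      by (simp add: algebra_simps)
    then show ?thesis
      using tame_integrable[OF g s] tame_integrable[OF H s] by (simp add: gen_sq_def)
  qed
  finally show ?thesis
    using D unfolding H_def P_def energy_def[abs_def] by simp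
qed

end

section \<open>Monotonicity for bounded functions\<close>

text \<open>Log-concavity of \<open>\<rho>\<close> enters the differential inequalities only through this property:
  \<open>ln \<rho>\<^sub>s\<close> is concave at all positive times.\<close>

locale concave_evolution = prob_density +
  assumes score_hess_nonpos:
    "0 < s \<Longrightarrow> (\<Sum>i\<in>Basis. \<Sum>c\<in>Basis. a i * a c * score_hess c i s x) \<le> 0"
begin

lemma energy_deriv_le:
  assumes b: "bounded_fun \<phi>" and s: "0 < s"
  shows "\<exists>D. (energy \<phi> has_real_derivative D) (at s) \<and> D \<le> - gen_sq \<phi> s"
proof -
  have "(LINT x|lborel. (\<Sum>i\<in>Basis. \<Sum>c\<in>Basis. dmean \<phi> i s x * dmean \<phi> c s x * score_hess c i s x) * evol s x) \<le> 0"
  proof -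
    have "0 \<le> (LINT x|lborel. - ((\<Sum>i\<in>Basis. \<Sum>c\<in>Basis. dmean \<phi> i s x * dmean \<phi> c s x * score_hess c i s x) * evol s x))"
      using score_hess_nonpos[OF s, of "\<lambda>i. dmean \<phi> i s x" x for x] evol_pos[OF s]
      by (intro integral_nonneg_AE AE_I2) (simp add: mult_nonpos_nonneg less_imp_le)
    then show ?thesis by simp
  qed
  with energy_deriv[OF b s] show ?thesis by (intro exI conjI) auto
qed

lemma energy_nonneg: "0 < s \<Longrightarrow> 0 \<le> energy \<phi> s"
  unfolding energy_def using evol_pos
  by (intro integral_nonneg_AE AE_I2 mult_nonneg_nonneg sum_nonneg) (auto simp: less_imp_le)

lemma mass_nonneg: "0 < s \<Longrightarrow> 0 \<le> mass \<phi> s"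
  unfolding mass_def using evol_pos by (intro integral_nonneg_AE AE_I2 mult_nonneg_nonneg) (auto simp: less_imp_le)

lemma gen_sq_nonneg: "0 < s \<Longrightarrow> 0 \<le> gen_sq \<phi> s"
  unfolding gen_sq_def using evol_pos by (intro integral_nonneg_AE AE_I2 mult_nonneg_nonneg) (auto simp: less_imp_le)

lemma energy_antimono:
  assumes b: "bounded_fun \<phi>" and s: "0 < s" "s \<le> t"
  shows "energy \<phi> t \<le> energy \<phi> s"
proof (rule DERIV_nonpos_imp_nonincreasing[OF s(2)])
  fix r assume "s \<le> r" "r \<le> t"
  then have r: "0 < r" using s by simp
  obtain D where "(energy \<phi> has_real_derivative D) (at r)" "D \<le> - gen_sq \<phi> r"
    using energy_deriv_le[OF b r] by blast
  then show "\<exists>y. (energy \<phi> has_real_derivative y) (at r) \<and> y \<le> 0"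
    using gen_sq_nonneg[OF r, of \<phi>] by (intro exI[of _ D]) auto
qed

text \<open>With \<open>N\<close> the mass and \<open>D\<close> the energy, \<open>N' = - D\<close> and \<open>D' \<le> - \<integral> (L f)\<^sup>2 \<rho>\<^sub>s\<close>, so
  \<open>(D / N)' \<le> (D\<^sup>2 - N \<integral> (L f)\<^sup>2 \<rho>\<^sub>s) / N\<^sup>2 \<le> 0\<close>. The constant \<open>\<epsilon>\<close> avoids division by zero: that
  \<open>N\<close> stays positive is a consequence of the resulting log-convexity, see \<open>mass_pos\<close>.\<close>

lemma regularized_rayleigh_antimono:
  assumes b: "bounded_fun \<phi>" and s: "0 < s" "s \<le> t" and \<epsilon>: "0 < \<epsilon>"
  shows "energy \<phi> t / (mass \<phi> t + \<epsilon>) \<le> energy \<phi> s / (mass \<phi> s + \<epsilon>)"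
proof (rule DERIV_nonpos_imp_nonincreasing[OF s(2)])
  fix r assume "s \<le> r" "r \<le> t"
  then have r: "0 < r" using s by simp
  obtain D where D: "(energy \<phi> has_real_derivative D) (at r)" "D \<le> - gen_sq \<phi> r"
    using energy_deriv_le[OF b r] by blast
  have pos: "0 < mass \<phi> r + \<epsilon>" using mass_nonneg[OF r, of \<phi>] \<epsilon> by simp
  have "((\<lambda>s. mass \<phi> s + \<epsilon>) has_real_derivative - energy \<phi> r) (at r)"
    using DERIV_add[OF mass_deriv[OF b r] DERIV_const] by simp
  from DERIV_divide[OF D(1) this]
  have der: "((\<lambda>s. energy \<phi> s / (mass \<phi> s + \<epsilon>)) has_real_derivative
      (D * (mass \<phi> r + \<epsilon>) - energy \<phi> r * (- energy \<phi> r)) / ((mass \<phi> r + \<epsilon>) * (mass \<phi> r + \<epsilon>))) (at r)"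
    using pos by simp
  have "D * (mass \<phi> r + \<epsilon>) - energy \<phi> r * (- energy \<phi> r) \<le> 0"
  proof -
    have "D * (mass \<phi> r + \<epsilon>) \<le> - gen_sq \<phi> r * (mass \<phi> r + \<epsilon>)"
      using D(2) pos by (intro mult_right_mono) auto
    also have "\<dots> \<le> - (mass \<phi> r * gen_sq \<phi> r)"
      using gen_sq_nonneg[OF r, of \<phi>] \<epsilon> by (simp add: algebra_simps)
    also have "\<dots> \<le> - (energy \<phi> r)\<^sup>2" using energy_sq_le[OF b r] by simp
    finally show ?thesis by (simp add: power2_eq_square)
  qed
  then have "(D * (mass \<phi> r + \<epsilon>) - energy \<phi> r * (- energy \<phi> r)) / ((mass \<phi> r + \<epsilon>) * (mass \<phi> r + \<epsilon>)) \<le> 0"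
    using pos by (intro divide_nonpos_pos) auto
  with der show "\<exists>y. ((\<lambda>s. energy \<phi> s / (mass \<phi> s + \<epsilon>)) has_real_derivative y) (at r) \<and> y \<le> 0"
    by blast
qed

lemma convex_ln_mass_bounded:
  assumes b: "bounded_fun \<phi>" and \<epsilon>: "0 < \<epsilon>"
  shows "convex_on {0<..} (\<lambda>s. ln (mass \<phi> s + \<epsilon>))"
proof (rule convex_on_realI[where f'="\<lambda>s. - (energy \<phi> s / (mass \<phi> s + \<epsilon>))"])
  fix r :: real assume "r \<in> {0<..}"
  then have r: "0 < r" by simp
  have pos: "0 < mass \<phi> r + \<epsilon>" using mass_nonneg[OF r, of \<phi>] \<epsilon> by simp
  have "((\<lambda>s. mass \<phi> s + \<epsilon>) has_real_derivative - energy \<phi> r) (at r)"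
    using DERIV_add[OF mass_deriv[OF b r] DERIV_const] by simp
  from DERIV_chain2[OF DERIV_ln_divide[OF pos] this]
  show "((\<lambda>s. ln (mass \<phi> s + \<epsilon>)) has_real_derivative - (energy \<phi> r / (mass \<phi> r + \<epsilon>))) (at r)"
    by simp
qed (use regularized_rayleigh_antimono[OF b _ _ \<epsilon>] in auto)

text \<open>The cross-multiplied form makes sense for vanishing mass and survives limits.\<close>

lemma energy_mass_cross_bounded:
  assumes b: "bounded_fun \<phi>" and s: "0 < s" "s \<le> t"
  shows "energy \<phi> t * mass \<phi> s \<le> energy \<phi> s * mass \<phi> t"
proof (rule field_le_epsilon)
  fix e :: real assume e: "0 < e"
  have t: "0 < t" using s by simp
  \<comment> \<open>Small enough for the error term \<open>\<epsilon> * energy \<phi> s\<close> to be at most \<open>e\<close>.\<close>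
  define \<epsilon> where "\<epsilon> = e / (energy \<phi> s + 1)"
  have \<epsilon>: "0 < \<epsilon>" "\<epsilon> * energy \<phi> s \<le> e"
    using e energy_nonneg[OF s(1), of \<phi>] by (auto simp: \<epsilon>_def field_simps add_nonneg_pos)
  have "energy \<phi> t * (mass \<phi> s + \<epsilon>) \<le> energy \<phi> s * (mass \<phi> t + \<epsilon>)"
    using regularized_rayleigh_antimono[OF b s \<epsilon>(1)] mass_nonneg[OF s(1), of \<phi>] mass_nonneg[OF t, of \<phi>] \<epsilon>(1)
    by (simp add: divide_simps add_nonneg_pos split: if_splits)
  moreover have "0 \<le> energy \<phi> t * \<epsilon>" using energy_nonneg[OF t, of \<phi>] \<epsilon> by simp
  ultimately show "energy \<phi> t * mass \<phi> s \<le> energy \<phi> s * mass \<phi> t + e"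
    using \<epsilon>(2) by (simp add: algebra_simps)
qed

text \<open>The mean value theorem gives an intermediate energy, which is at least the final one.\<close>

lemma energy_le_mass_drop:
  assumes b: "bounded_fun \<phi>" and s: "0 < s" "s < t"
  shows "(t - s) * energy \<phi> t \<le> mass \<phi> s - mass \<phi> t"
proof -
  have "\<exists>z>s. z < t \<and> mass \<phi> t - mass \<phi> s = (t - s) * (- energy \<phi> z)"
    using s by (intro MVT2 mass_deriv[OF b]) auto
  then obtain z where z: "s < z" "z < t" "mass \<phi> t - mass \<phi> s = (t - s) * (- energy \<phi> z)" by blast
  have "(t - s) * energy \<phi> t \<le> (t - s) * energy \<phi> z"
    using energy_antimono[OF b, of z t] z s by (intro mult_left_mono) auto
  with z(3) show ?thesis by simp
qed

end

section \<open>Square integrable functions\<close>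

text \<open>Young's inequality for the mixed term \<open>2 (a - b) \<bullet> b\<close>.\<close>

lemma norm_sq_diff_le:
  fixes a b :: "'b::real_inner"
  assumes "0 < \<eta>"
  shows "\<bar>(norm a)\<^sup>2 - (norm b)\<^sup>2\<bar> \<le> (1 + 1 / \<eta>) * (norm (a - b))\<^sup>2 + \<eta> * (norm b)\<^sup>2"
proof -
  let ?d = "norm (a - b)" and ?n = "norm b"
  have e: "(norm a)\<^sup>2 - (norm b)\<^sup>2 = ?d\<^sup>2 + 2 * ((a - b) \<bullet> b)"
    by (simp add: power2_norm_eq_inner inner_diff_left inner_diff_right inner_commute)
  have cs: "\<bar>(a - b) \<bullet> b\<bar> \<le> ?d * ?n" by (rule Cauchy_Schwarz_ineq2)
  have "0 \<le> (?d - \<eta> * ?n)\<^sup>2 / \<eta>" using assms by simp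
  also have "\<dots> = ?d\<^sup>2 / \<eta> - 2 * (?d * ?n) + \<eta> * ?n\<^sup>2"
    using assms by (simp add: field_simps power2_eq_square)
  finally have "2 * (?d * ?n) \<le> ?d\<^sup>2 / \<eta> + \<eta> * ?n\<^sup>2" by simp
  then have "\<bar>?d\<^sup>2 + 2 * ((a - b) \<bullet> b)\<bar> \<le> ?d\<^sup>2 + (?d\<^sup>2 / \<eta> + \<eta> * ?n\<^sup>2)"
    using cs zero_le_power2[of ?d] by linarith
  then show ?thesis using e by (simp add: algebra_simps)
qed

text \<open>Integrate \<open>norm_sq_diff_le\<close>: its last term is made small by the choice of \<open>\<eta>\<close>, and the other
  one tends to 0 for fixed \<open>\<eta>\<close>.\<close>

lemma weighted_L2_tendsto:
  fixes F :: "nat \<Rightarrow> 'a \<Rightarrow> 'b::euclidean_space" and G :: "'a \<Rightarrow> 'b"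
  assumes [measurable]: "\<And>n. F n \<in> borel_measurable M" "G \<in> borel_measurable M" "w \<in> borel_measurable M"
    and w: "\<And>x. 0 \<le> w x"
    and G: "integrable M (\<lambda>x. (norm (G x))\<^sup>2 * w x)"
    and D: "\<And>n. integrable M (\<lambda>x. (norm (F n x - G x))\<^sup>2 * w x)"
    and lim: "(\<lambda>n. LINT x|M. (norm (F n x - G x))\<^sup>2 * w x) \<longlonglongrightarrow> 0"
  shows "(\<lambda>n. LINT x|M. (norm (F n x))\<^sup>2 * w x) \<longlonglongrightarrow> (LINT x|M. (norm (G x))\<^sup>2 * w x)"
proof (rule LIMSEQ_I)
  let ?d = "\<lambda>n. LINT x|M. (norm (F n x - G x))\<^sup>2 * w x"
  let ?g = "LINT x|M. (norm (G x))\<^sup>2 * w x"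
  have g: "0 \<le> ?g" using w by (intro integral_nonneg_AE AE_I2) simp
  have bd: "\<bar>(norm (F n x))\<^sup>2 * w x - (norm (G x))\<^sup>2 * w x\<bar>
      \<le> (1 + 1 / \<eta>) * ((norm (F n x - G x))\<^sup>2 * w x) + \<eta> * ((norm (G x))\<^sup>2 * w x)" if "0 < \<eta>" for \<eta> n x
  proof -
    have "\<bar>(norm (F n x))\<^sup>2 * w x - (norm (G x))\<^sup>2 * w x\<bar> = \<bar>(norm (F n x))\<^sup>2 - (norm (G x))\<^sup>2\<bar> * w x"
      using w[of x] by (simp add: abs_mult flip: left_diff_distrib)
    then show ?thesis
      using mult_right_mono[OF norm_sq_diff_le[OF that, of "F n x" "G x"] w[of x]]
      by (simp add: algebra_simps)
  qed
  have F: "integrable M (\<lambda>x. (norm (F n x))\<^sup>2 * w x)" for n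
  proof -
    have "integrable M (\<lambda>x. (norm (F n x))\<^sup>2 * w x - (norm (G x))\<^sup>2 * w x)"
    proof (rule Bochner_Integration.integrable_bound)
      show "integrable M (\<lambda>x. (1 + 1 / 1) * ((norm (F n x - G x))\<^sup>2 * w x) + 1 * ((norm (G x))\<^sup>2 * w x))"
        using D G by simp
      show "AE x in M. norm ((norm (F n x))\<^sup>2 * w x - (norm (G x))\<^sup>2 * w x)
          \<le> norm ((1 + 1 / 1) * ((norm (F n x - G x))\<^sup>2 * w x) + 1 * ((norm (G x))\<^sup>2 * w x))"
        by (rule AE_I2) (use order.trans[OF bd[of 1] abs_ge_self] in \<open>simp only: real_norm_def zero_less_one simp_thms\<close>)
    qed measurable
    from Bochner_Integration.integrable_add[OF this G] show ?thesis by simp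
  qed
  fix e :: real assume e: "0 < e"
  define \<eta> where "\<eta> = e / (2 * (?g + 1))"
  have \<eta>: "0 < \<eta>" "\<eta> * ?g < e / 2"
    using e g by (auto simp: \<eta>_def field_simps add_nonneg_pos)
  define c where "c = 1 + 1 / \<eta>"
  have c: "0 < c" using \<eta>(1) by (simp add: c_def add_pos_pos)
  define e' where "e' = e / (2 * c)"
  have e': "0 < e'" "c * e' = e / 2"
    using e c by (auto simp: e'_def)
  obtain N where N: "\<And>n. N \<le> n \<Longrightarrow> \<bar>?d n\<bar> < e'"
    using LIMSEQ_D[OF lim e'(1)] by auto
  show "\<exists>no. \<forall>n\<ge>no. norm ((LINT x|M. (norm (F n x))\<^sup>2 * w x) - ?g) < e"
  proof (intro exI allI impI)
    fix n assume n: "N \<le> n"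
    have "\<bar>(LINT x|M. (norm (F n x))\<^sup>2 * w x) - ?g\<bar> = \<bar>LINT x|M. (norm (F n x))\<^sup>2 * w x - (norm (G x))\<^sup>2 * w x\<bar>"
      using F G by simp
    also have "\<dots> \<le> (LINT x|M. (1 + 1 / \<eta>) * ((norm (F n x - G x))\<^sup>2 * w x) + \<eta> * ((norm (G x))\<^sup>2 * w x))"
    proof (rule order.trans[OF integral_abs_bound integral_mono])
      show "integrable M (\<lambda>x. \<bar>(norm (F n x))\<^sup>2 * w x - (norm (G x))\<^sup>2 * w x\<bar>)" using F G by simp
      show "integrable M (\<lambda>x. (1 + 1 / \<eta>) * ((norm (F n x - G x))\<^sup>2 * w x) + \<eta> * ((norm (G x))\<^sup>2 * w x))"
        using D[of n] G by simp
    qed (rule bd[OF \<eta>(1)])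
    also have "\<dots> = c * ?d n + \<eta> * ?g" using D[of n] G by (simp add: c_def)
    also have "\<dots> < e"
    proof -
      have "c * ?d n \<le> c * e'"
        using N[OF n] c by (intro mult_left_mono) auto
      then show ?thesis using \<eta>(2) e'(2) by linarith
    qed
    finally show "norm ((LINT x|M. (norm (F n x))\<^sup>2 * w x) - ?g) < e" by simp
  qed
qed

lemma integral_conv:
  assumes w: "integrable lborel w" and k: "integrable lborel k"
  shows "(LINT x|lborel. conv k w x) = (LINT y|lborel. w y) * (LINT z|lborel. k z)"
proof -
  have [measurable]: "k \<in> borel_measurable borel" using k by auto
  have "integrable (lborel \<Otimes>\<^sub>M lborel) (\<lambda>(x, y). 1 * (w y * k (x - y)))"
    by (rule integrable_pair_conv[OF w k, of _ 1]) auto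
  from lborel_pair.Fubini_integral[OF this]
  have "(LINT x|lborel. conv k w x) = (LINT y|lborel. (LINT x|lborel. w y * k (x - y)))"
    by (simp add: conv_def)
  also have "\<dots> = (LINT y|lborel. w y * (LINT z|lborel. k z))"
    using integral_lborel_translation[of k "- y" for y] by simp
  finally show ?thesis by simp
qed

context prob_density begin

definition sq_int :: "('a \<Rightarrow> real) \<Rightarrow> bool" where
  "sq_int \<phi> \<longleftrightarrow> \<phi> \<in> borel_measurable borel \<and> integrable lborel (\<lambda>x. (\<phi> x)\<^sup>2 * \<rho> x)"

definition mass0 :: "('a \<Rightarrow> real) \<Rightarrow> real" where
  "mass0 \<phi> = (LINT x|lborel. (\<phi> x)\<^sup>2 * \<rho> x)"

lemma sq_int_measurable: "sq_int \<phi> \<Longrightarrow> \<phi> \<in> borel_measurable borel"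
  by (simp add: sq_int_def)

lemma mass0_nonneg: "0 \<le> mass0 \<phi>"
  unfolding mass0_def using nonneg by (intro integral_nonneg_AE AE_I2) simp

lemma sq_int_dominated:
  assumes g: "sq_int g" and [measurable]: "f \<in> borel_measurable borel" and le: "\<And>x. \<bar>f x\<bar> \<le> \<bar>g x\<bar>"
  shows "sq_int f" "mass0 f \<le> mass0 g"
proof -
  have G: "integrable lborel (\<lambda>x. (g x)\<^sup>2 * \<rho> x)" using g by (simp add: sq_int_def)
  have l: "(f x)\<^sup>2 * \<rho> x \<le> (g x)\<^sup>2 * \<rho> x" for x
    using power_mono[OF le abs_ge_zero, of x 2] nonneg[of x] by (intro mult_right_mono) simp_all
  have F: "integrable lborel (\<lambda>x. (f x)\<^sup>2 * \<rho> x)"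
    using l nonneg by (intro Bochner_Integration.integrable_bound[OF G]) auto
  then show "sq_int f" by (simp add: sq_int_def)
  show "mass0 f \<le> mass0 g" unfolding mass0_def by (intro integral_mono F G l)
qed

lemma sq_int_add:
  assumes f: "sq_int f" and g: "sq_int g" shows "sq_int (\<lambda>x. f x + g x)"
proof -
  have [measurable]: "f \<in> borel_measurable borel" "g \<in> borel_measurable borel"
    using f g by (auto simp: sq_int_def)
  have "integrable lborel (\<lambda>x. (f x + g x)\<^sup>2 * \<rho> x)"
  proof (rule Bochner_Integration.integrable_bound)
    show "integrable lborel (\<lambda>x. 2 * ((f x)\<^sup>2 * \<rho> x) + 2 * ((g x)\<^sup>2 * \<rho> x))"
      using f g by (simp add: sq_int_def)
    show "AE x in lborel. norm ((f x + g x)\<^sup>2 * \<rho> x) \<le> norm (2 * ((f x)\<^sup>2 * \<rho> x) + 2 * ((g x)\<^sup>2 * \<rho> x))"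
    proof (rule AE_I2)
      fix x
      have "(f x + g x)\<^sup>2 \<le> 2 * (f x)\<^sup>2 + 2 * (g x)\<^sup>2"
        using zero_le_power2[of "f x - g x"] by (simp add: power2_eq_square algebra_simps)
      from mult_right_mono[OF this nonneg[of x]]
      show "norm ((f x + g x)\<^sup>2 * \<rho> x) \<le> norm (2 * ((f x)\<^sup>2 * \<rho> x) + 2 * ((g x)\<^sup>2 * \<rho> x))"
        using nonneg[of x] by (simp add: algebra_simps)
    qed
  qed measurable
  then show ?thesis by (simp add: sq_int_def)
qed

lemma sq_int_cmult: "sq_int f \<Longrightarrow> sq_int (\<lambda>x. c * f x)"
  by (auto simp: sq_int_def power_mult_distrib mult.assoc)

lemma sq_int_diff: "sq_int f \<Longrightarrow> sq_int g \<Longrightarrow> sq_int (\<lambda>x. f x - g x)"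
  using sq_int_add[of f "\<lambda>x. (-1) * g x"] sq_int_cmult[of g "-1"] by simp

lemma bounded_sq_int: assumes "bounded_fun \<phi>" shows "sq_int \<phi>"
proof -
  obtain B where B: "\<And>x. \<bar>\<phi> x\<bar> \<le> B" and m: "\<phi> \<in> borel_measurable borel"
    using assms by (auto simp: bounded_fun_def)
  have "sq_int (\<lambda>_. B)" using integrable by (simp add: sq_int_def)
  then show ?thesis using order.trans[OF B abs_ge_self] by (rule sq_int_dominated[OF _ m])
qed

lemma sq_int_integrable: assumes "sq_int \<phi>" shows "integrable lborel (\<lambda>x. \<phi> x * \<rho> x)"
proof (rule Bochner_Integration.integrable_bound)
  have [measurable]: "\<phi> \<in> borel_measurable borel" using assms by (simp add: sq_int_def)
  show "integrable lborel (\<lambda>x. \<rho> x + (\<phi> x)\<^sup>2 * \<rho> x)" using assms integrable by (simp add: sq_int_def)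
  show "AE x in lborel. norm (\<phi> x * \<rho> x) \<le> norm (\<rho> x + (\<phi> x)\<^sup>2 * \<rho> x)"
  proof (rule AE_I2)
    fix x
    have "0 \<le> (\<bar>\<phi> x\<bar> - 1)\<^sup>2" by simp
    then have "\<bar>\<phi> x\<bar> \<le> 1 + (\<phi> x)\<^sup>2" by (simp add: power2_eq_square algebra_simps)
    from mult_right_mono[OF this nonneg[of x]]
    show "norm (\<phi> x * \<rho> x) \<le> norm (\<rho> x + (\<phi> x)\<^sup>2 * \<rho> x)"
      using nonneg[of x] by (simp add: abs_mult algebra_simps)
  qed
  show "(\<lambda>x. \<phi> x * \<rho> x) \<in> borel_measurable lborel" by measurable
qed

lemma integrable_gauss_kernel:
  fixes w :: "'a \<Rightarrow> real"
  assumes "integrable lborel w" "0 < s"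
  shows "integrable lborel (\<lambda>y. w y * gauss s (x - y))"
proof -
  obtain C where C: "\<And>z::'a. \<bar>gauss s z\<bar> \<le> C"
    using gauss_dominated_bounded[OF gauss_dominated_derivs(1) assms(2) order.refl] by auto
  show ?thesis by (rule integrable_conv_kernel[OF assms(1) borel_measurable_gauss C])
qed

lemma mean_times_evol: "0 < s \<Longrightarrow> mean \<phi> s x * evol s x = conv (gauss s) (\<lambda>y. \<phi> y * \<rho> y) x"
  using evol_pos[of s x] by (simp add: mean_def ratio_def)

text \<open>The bias--variance decomposition, for the conditional law of \<open>Y\<close> given \<open>X = x\<close> and before
  division by \<open>\<rho>\<^sub>s(x)\<close>.\<close>

lemma expected_sq_deviation:
  assumes \<phi>: "sq_int \<phi>" and s: "0 < s"
  shows "integrable lborel (\<lambda>y. (\<phi> y - c)\<^sup>2 * (\<rho> y * gauss s (x - y)))"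
    and "(LINT y|lborel. (\<phi> y - c)\<^sup>2 * (\<rho> y * gauss s (x - y)))
      = conv (gauss s) (\<lambda>y. (\<phi> y)\<^sup>2 * \<rho> y) x - (mean \<phi> s x)\<^sup>2 * evol s x + (mean \<phi> s x - c)\<^sup>2 * evol s x"
proof -
  have i2: "integrable lborel (\<lambda>y. (\<phi> y)\<^sup>2 * \<rho> y * gauss s (x - y))"
    using \<phi> by (intro integrable_gauss_kernel s) (simp add: sq_int_def)
  have i1: "integrable lborel (\<lambda>y. \<phi> y * \<rho> y * gauss s (x - y))"
    by (intro integrable_gauss_kernel s sq_int_integrable \<phi>)
  have i0: "integrable lborel (\<lambda>y. \<rho> y * gauss s (x - y))"
    by (intro integrable_gauss_kernel s integrable)
  have eq: "(\<phi> y - c)\<^sup>2 * (\<rho> y * gauss s (x - y)) = (\<phi> y)\<^sup>2 * \<rho> y * gauss s (x - y)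
      - 2 * c * (\<phi> y * \<rho> y * gauss s (x - y)) + c\<^sup>2 * (\<rho> y * gauss s (x - y))" for y
    by (simp add: power2_eq_square algebra_simps)
  show "integrable lborel (\<lambda>y. (\<phi> y - c)\<^sup>2 * (\<rho> y * gauss s (x - y)))"
    unfolding eq using i0 i1 i2 by simp
  have "(LINT y|lborel. (\<phi> y - c)\<^sup>2 * (\<rho> y * gauss s (x - y)))
      = conv (gauss s) (\<lambda>y. (\<phi> y)\<^sup>2 * \<rho> y) x - 2 * c * (mean \<phi> s x * evol s x) + c\<^sup>2 * evol s x"
    unfolding eq mean_times_evol[OF s] using i0 i1 i2 by (simp add: conv_def evol_def)
  then show "(LINT y|lborel. (\<phi> y - c)\<^sup>2 * (\<rho> y * gauss s (x - y)))
      = conv (gauss s) (\<lambda>y. (\<phi> y)\<^sup>2 * \<rho> y) x - (mean \<phi> s x)\<^sup>2 * evol s x + (mean \<phi> s x - c)\<^sup>2 * evol s x"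
    by (simp add: power2_eq_square algebra_simps)
qed

lemma mean_sq_le:
  assumes \<phi>: "sq_int \<phi>" and s: "0 < s"
  shows "(mean \<phi> s x)\<^sup>2 * evol s x \<le> conv (gauss s) (\<lambda>y. (\<phi> y)\<^sup>2 * \<rho> y) x"
proof -
  have "0 \<le> (LINT y|lborel. (\<phi> y - mean \<phi> s x)\<^sup>2 * (\<rho> y * gauss s (x - y)))"
    using nonneg by (intro integral_nonneg_AE AE_I2) simp
  then show ?thesis using expected_sq_deviation(2)[OF \<phi> s, of "mean \<phi> s x" x] by simp
qed

lemma continuous_mean: "sq_int \<phi> \<Longrightarrow> 0 < s \<Longrightarrow> continuous_on UNIV (mean \<phi> s)"
  unfolding mean_def by (intro continuous_ratio sq_int_integrable gauss_dominated_derivs continuous_gauss)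

lemma continuous_dmean: "sq_int \<phi> \<Longrightarrow> 0 < s \<Longrightarrow> continuous_on UNIV (dmean \<phi> e s)"
  unfolding dmean_def
  by (intro continuous_intros continuous_ratio sq_int_integrable gauss_dominated_derivs continuous_gauss_derivs
      continuous_mean tame_continuous[OF tame_score])

lemma sq_int_sq_integrable: "sq_int \<phi> \<Longrightarrow> integrable lborel (\<lambda>y. (\<phi> y)\<^sup>2 * \<rho> y)"
  by (simp add: sq_int_def)

lemma integrable_mean_sq:
  assumes \<phi>: "sq_int \<phi>" and s: "0 < s"
  shows "integrable lborel (\<lambda>x. (mean \<phi> s x)\<^sup>2 * evol s x)"
proof (rule Bochner_Integration.integrable_bound)
  show "integrable lborel (conv (gauss s) (\<lambda>y. (\<phi> y)\<^sup>2 * \<rho> y))"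
    by (intro integrable_conv sq_int_sq_integrable[OF \<phi>] integrable_gauss s)
  have [measurable]: "mean \<phi> s \<in> borel_measurable borel" "evol s \<in> borel_measurable borel"
    by (auto intro!: borel_measurable_continuous_onI continuous_mean \<phi> s continuous_evol)
  show "(\<lambda>x. (mean \<phi> s x)\<^sup>2 * evol s x) \<in> borel_measurable lborel" by measurable
  show "AE x in lborel. norm ((mean \<phi> s x)\<^sup>2 * evol s x) \<le> norm (conv (gauss s) (\<lambda>y. (\<phi> y)\<^sup>2 * \<rho> y) x)"
  proof (rule AE_I2)
    fix x
    show "norm ((mean \<phi> s x)\<^sup>2 * evol s x) \<le> norm (conv (gauss s) (\<lambda>y. (\<phi> y)\<^sup>2 * \<rho> y) x)"
      using order.trans[OF mean_sq_le[OF \<phi> s, of x] abs_ge_self] evol_pos[OF s, of x]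
      by (simp add: abs_mult)
  qed
qed

text \<open>\<open>Q\<^sub>s\<close> is a conditional expectation, hence a contraction from \<open>L\<^sup>2(\<mu>)\<close> to \<open>L\<^sup>2(\<mu>\<^sub>s)\<close>.\<close>

lemma mass_le_mass0:
  assumes \<phi>: "sq_int \<phi>" and s: "0 < s"
  shows "mass \<phi> s \<le> mass0 \<phi>"
proof -
  have "mass \<phi> s \<le> (LINT x|lborel. conv (gauss s) (\<lambda>y. (\<phi> y)\<^sup>2 * \<rho> y) x)"
    unfolding mass_def
    by (intro integral_mono integrable_mean_sq[OF \<phi> s] mean_sq_le[OF \<phi> s] integrable_conv sq_int_sq_integrable[OF \<phi>] integrable_gauss s)
  also have "\<dots> = mass0 \<phi>"
    using integral_conv[OF sq_int_sq_integrable[OF \<phi>] integrable_gauss[OF s]] by (simp add: mass0_def integral_gauss[OF s])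
  finally show ?thesis .
qed

lemma ratio_diff:
  assumes \<phi>: "integrable lborel (\<lambda>y. \<phi> y * \<rho> y)" and \<psi>: "integrable lborel (\<lambda>y. \<psi> y * \<rho> y)" and s: "0 < s"
    and k: "gauss_dominated k" "continuous_on UNIV (k s)"
  shows "ratio (\<lambda>y. \<phi> y - \<psi> y) k s x = ratio \<phi> k s x - ratio \<psi> k s x"
proof -
  obtain C where C: "\<And>z. \<bar>k s z\<bar> \<le> C" using gauss_dominated_bounded[OF k(1) s order.refl] by auto
  have [measurable]: "k s \<in> borel_measurable borel" by (rule borel_measurable_continuous_onI[OF k(2)])
  have "conv (k s) (\<lambda>y. (\<phi> y - \<psi> y) * \<rho> y) x = conv (k s) (\<lambda>y. \<phi> y * \<rho> y) x - conv (k s) (\<lambda>y. \<psi> y * \<rho> y) x"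
    unfolding conv_def left_diff_distrib
    by (intro Bochner_Integration.integral_diff integrable_conv_kernel[OF \<phi> _ C] integrable_conv_kernel[OF \<psi> _ C]) measurable
  then show ?thesis by (simp add: ratio_def diff_divide_distrib)
qed

lemma mean_diff:
  assumes "sq_int \<phi>" "sq_int \<psi>" "0 < s"
  shows "mean (\<lambda>y. \<phi> y - \<psi> y) s x = mean \<phi> s x - mean \<psi> s x"
  unfolding mean_def using assms by (intro ratio_diff sq_int_integrable gauss_dominated_derivs continuous_gauss)

lemma dmean_diff:
  assumes "sq_int \<phi>" "sq_int \<psi>" "0 < s"
  shows "dmean (\<lambda>y. \<phi> y - \<psi> y) e s x = dmean \<phi> e s x - dmean \<psi> e s x"
proof -
  have "ratio (\<lambda>y. \<phi> y - \<psi> y) (\<lambda>s. gauss1 s e) s x = ratio \<phi> (\<lambda>s. gauss1 s e) s x - ratio \<psi> (\<lambda>s. gauss1 s e) s x"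
    using assms by (intro ratio_diff sq_int_integrable gauss_dominated_derivs continuous_gauss_derivs)
  then show ?thesis by (simp add: dmean_def mean_diff[OF assms] algebra_simps)
qed

lemma dmean_tendsto:
  assumes "\<And>k x. gauss_dominated k \<Longrightarrow> (\<And>s. continuous_on UNIV (k s)) \<Longrightarrow> (\<lambda>n. ratio (f n) k s x) \<longlonglongrightarrow> ratio \<phi> k s x"
  shows "(\<lambda>n. dmean (f n) e s x) \<longlonglongrightarrow> dmean \<phi> e s x"
  unfolding dmean_def mean_def
  by (intro tendsto_intros assms gauss_dominated_derivs continuous_gauss continuous_gauss_derivs)

lemma ratio_tendsto_dominated:
  assumes g: "integrable lborel (\<lambda>y. g y * \<rho> y)" and [measurable]: "\<And>n. f n \<in> borel_measurable borel" "\<phi> \<in> borel_measurable borel"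
    and lim: "\<And>x. (\<lambda>n. f n x) \<longlonglongrightarrow> \<phi> x" and le: "\<And>n x. \<bar>f n x\<bar> \<le> \<bar>g x\<bar>"
    and k: "gauss_dominated k" "continuous_on UNIV (k s)" and s: "0 < s"
  shows "(\<lambda>n. ratio (f n) k s x) \<longlonglongrightarrow> ratio \<phi> k s x"
proof -
  obtain C where C: "\<And>z. \<bar>k s z\<bar> \<le> C" using gauss_dominated_bounded[OF k(1) s order.refl] by auto
  have [measurable]: "k s \<in> borel_measurable borel" by (rule borel_measurable_continuous_onI[OF k(2)])
  have "(\<lambda>n. conv (k s) (\<lambda>y. f n y * \<rho> y) x) \<longlonglongrightarrow> conv (k s) (\<lambda>y. \<phi> y * \<rho> y) x"
    unfolding conv_def
  proof (rule integral_dominated_convergence[where w="\<lambda>y. \<bar>g y * \<rho> y\<bar> * C"])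
    show "integrable lborel (\<lambda>y. \<bar>g y * \<rho> y\<bar> * C)" using g by simp
    show "AE y in lborel. (\<lambda>n. f n y * \<rho> y * k s (x - y)) \<longlonglongrightarrow> \<phi> y * \<rho> y * k s (x - y)"
      by (intro AE_I2 tendsto_intros lim)
    show "AE y in lborel. norm (f n y * \<rho> y * k s (x - y)) \<le> \<bar>g y * \<rho> y\<bar> * C" for n
      by (intro AE_I2) (auto simp: abs_mult intro!: mult_mono le C)
  qed measurable
  then show ?thesis
    unfolding ratio_def using evol_pos[OF s, of x] by (intro tendsto_intros) simp_all
qed

text \<open>Fatou's lemma: the energy is lower semicontinuous under pointwise convergence of the gradients.\<close>

lemma energy_fatou:
  assumes s: "0 < s" and f: "\<And>n. sq_int (f n)" and \<phi>: "sq_int \<phi>"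
    and int: "\<And>n. integrable lborel (\<lambda>x. (\<Sum>b\<in>Basis. (dmean (f n) b s x)\<^sup>2) * evol s x)"
    and lim: "\<And>b x. (\<lambda>n. dmean (f n) b s x) \<longlonglongrightarrow> dmean \<phi> b s x"
    and le: "\<And>n. energy (f n) s \<le> C n" and C: "C \<longlonglongrightarrow> c"
  shows "integrable lborel (\<lambda>x. (\<Sum>b\<in>Basis. (dmean \<phi> b s x)\<^sup>2) * evol s x)" "energy \<phi> s \<le> c"
proof -
  let ?e = "\<lambda>\<phi> x. (\<Sum>b\<in>Basis. (dmean \<phi> b s x)\<^sup>2) * evol s x"
  have e0: "0 \<le> ?e \<phi> x" for \<phi> x
    using evol_pos[OF s, of x] by (intro mult_nonneg_nonneg sum_nonneg) auto
  have m: "?e \<psi> \<in> borel_measurable borel" if "sq_int \<psi>" for \<psi>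
    by (intro borel_measurable_continuous_onI continuous_intros continuous_dmean that s continuous_evol)
  have c: "0 \<le> c"
  proof (rule LIMSEQ_le_const[OF C])
    have "0 \<le> energy (f n) s" for n unfolding energy_def by (intro integral_nonneg_AE AE_I2 e0)
    then show "\<exists>N. \<forall>n\<ge>N. 0 \<le> C n" using le order.trans by blast
  qed
  have "(\<integral>\<^sup>+x. ennreal (?e \<phi> x) \<partial>lborel) = (\<integral>\<^sup>+x. liminf (\<lambda>n. ennreal (?e (f n) x)) \<partial>lborel)"
  proof (rule nn_integral_cong)
    fix x
    have "(\<lambda>n. ennreal (?e (f n) x)) \<longlonglongrightarrow> ennreal (?e \<phi> x)"
      by (intro tendsto_intros lim)
    then show "ennreal (?e \<phi> x) = liminf (\<lambda>n. ennreal (?e (f n) x))"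
      by (intro lim_imp_Liminf[symmetric]) simp_all
  qed
  also have "\<dots> \<le> liminf (\<lambda>n. \<integral>\<^sup>+x. ennreal (?e (f n) x) \<partial>lborel)"
    using m[OF f] by (intro nn_integral_liminf) simp
  also have "\<dots> \<le> liminf (\<lambda>n. ennreal (C n))"
  proof (rule Liminf_mono, rule always_eventually, rule allI)
    fix n
    have "(\<integral>\<^sup>+x. ennreal (?e (f n) x) \<partial>lborel) = ennreal (energy (f n) s)"
      unfolding energy_def using int e0 by (intro nn_integral_eq_integral) auto
    then show "(\<integral>\<^sup>+x. ennreal (?e (f n) x) \<partial>lborel) \<le> ennreal (C n)"
      using le[of n] by (simp add: ennreal_leI)
  qed
  also have "\<dots> = ennreal c"
    using tendsto_ennrealI[OF C] by (intro lim_imp_Liminf) simp_all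
  finally have le: "(\<integral>\<^sup>+x. ennreal (?e \<phi> x) \<partial>lborel) \<le> ennreal c" .
  show "integrable lborel (?e \<phi>)"
    using m[OF \<phi>] e0 le by (intro integrableI_nonneg) (auto intro: le_less_trans)
  show "energy \<phi> s \<le> c"
    unfolding energy_def by (rule integral_real_bounded[OF c le])
qed

text \<open>Truncation carries results from bounded functions, for which everything is tame, to
  \<open>L\<^sup>2(\<mu>)\<close>.\<close>

definition trunc :: "nat \<Rightarrow> ('a \<Rightarrow> real) \<Rightarrow> 'a \<Rightarrow> real" where
  "trunc n \<phi> x = max (- real n) (min (real n) (\<phi> x))"

lemma trunc_le: "\<bar>trunc n \<phi> x\<bar> \<le> \<bar>\<phi> x\<bar>"
  by (auto simp: trunc_def)

lemma trunc_bounded: "\<phi> \<in> borel_measurable borel \<Longrightarrow> bounded_fun (trunc n \<phi>)"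
  unfolding bounded_fun_def trunc_def[abs_def] by (auto intro!: exI[of _ "real n"])

lemma trunc_tendsto: "(\<lambda>n. trunc n \<phi> x) \<longlonglongrightarrow> \<phi> x"
proof (rule tendsto_eventually)
  obtain N where "\<bar>\<phi> x\<bar> \<le> real N" using real_arch_simple by blast
  then have "\<forall>n\<ge>N. trunc n \<phi> x = \<phi> x" by (auto simp: trunc_def)
  then show "eventually (\<lambda>n. trunc n \<phi> x = \<phi> x) sequentially" using eventually_sequentially by blast
qed

lemma mass0_trunc_tendsto:
  assumes \<phi>: "sq_int \<phi>"
  shows "(\<lambda>n. mass0 (\<lambda>x. trunc n \<phi> x - \<phi> x)) \<longlonglongrightarrow> 0"
proof -
  have [measurable]: "\<phi> \<in> borel_measurable borel" by (rule sq_int_measurable[OF \<phi>])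
  have [measurable]: "trunc n \<phi> \<in> borel_measurable borel" for n unfolding trunc_def[abs_def] by measurable
  have "(\<lambda>n. LINT x|lborel. (trunc n \<phi> x - \<phi> x)\<^sup>2 * \<rho> x) \<longlonglongrightarrow> (LINT x|(lborel :: 'a measure). 0)"
  proof (rule integral_dominated_convergence[where w="\<lambda>x. (\<phi> x)\<^sup>2 * \<rho> x"])
    show "integrable lborel (\<lambda>x. (\<phi> x)\<^sup>2 * \<rho> x)" by (rule sq_int_sq_integrable[OF \<phi>])
    show "AE x in lborel. (\<lambda>n. (trunc n \<phi> x - \<phi> x)\<^sup>2 * \<rho> x) \<longlonglongrightarrow> 0"
    proof (rule AE_I2)
      fix x
      have "(\<lambda>n. (trunc n \<phi> x - \<phi> x)\<^sup>2 * \<rho> x) \<longlonglongrightarrow> (\<phi> x - \<phi> x)\<^sup>2 * \<rho> x"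
        by (intro tendsto_intros trunc_tendsto)
      then show "(\<lambda>n. (trunc n \<phi> x - \<phi> x)\<^sup>2 * \<rho> x) \<longlonglongrightarrow> 0" by simp
    qed
    show "AE x in lborel. norm ((trunc n \<phi> x - \<phi> x)\<^sup>2 * \<rho> x) \<le> (\<phi> x)\<^sup>2 * \<rho> x" for n
    proof (rule AE_I2)
      fix x
      have "\<bar>trunc n \<phi> x - \<phi> x\<bar> \<le> \<bar>\<phi> x\<bar>" by (auto simp: trunc_def max_def min_def)
      from power_mono[OF this abs_ge_zero, of 2] show "norm ((trunc n \<phi> x - \<phi> x)\<^sup>2 * \<rho> x) \<le> (\<phi> x)\<^sup>2 * \<rho> x"
        using nonneg[of x] by (simp add: abs_mult mult_right_mono)
    qed
  qed measurable
  then show ?thesis by (simp add: mass0_def)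
qed

definition grad_mean :: "('a \<Rightarrow> real) \<Rightarrow> real \<Rightarrow> 'a \<Rightarrow> 'a" where
  "grad_mean \<phi> s x = (\<Sum>b\<in>Basis. dmean \<phi> b s x *\<^sub>R b)"

lemma norm_grad_mean: "(norm (grad_mean \<phi> s x))\<^sup>2 = (\<Sum>b\<in>Basis. (dmean \<phi> b s x)\<^sup>2)"
proof -
  have "grad_mean \<phi> s x \<bullet> b = dmean \<phi> b s x" if "b \<in> Basis" for b
    using that by (simp add: grad_mean_def)
  then have "(\<Sum>b\<in>Basis. (grad_mean \<phi> s x \<bullet> b) * (grad_mean \<phi> s x \<bullet> b)) = (\<Sum>b\<in>Basis. (dmean \<phi> b s x)\<^sup>2)"
    by (simp add: power2_eq_square)
  then show ?thesis
    using euclidean_inner[of "grad_mean \<phi> s x" "grad_mean \<phi> s x"] by (simp only: power2_norm_eq_inner)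
qed

lemma continuous_grad_mean: "sq_int \<phi> \<Longrightarrow> 0 < s \<Longrightarrow> continuous_on UNIV (grad_mean \<phi> s)"
  unfolding grad_mean_def by (intro continuous_intros continuous_dmean)

lemma energy_eq: "energy \<phi> s = (LINT x|lborel. (norm (grad_mean \<phi> s x))\<^sup>2 * evol s x)"
  by (simp add: energy_def norm_grad_mean)

lemma grad_mean_diff:
  assumes "sq_int \<phi>" "sq_int \<psi>" "0 < s"
  shows "grad_mean (\<lambda>y. \<phi> y - \<psi> y) s x = grad_mean \<phi> s x - grad_mean \<psi> s x"
  unfolding grad_mean_def by (simp add: dmean_diff[OF assms] scaleR_diff_left sum_subtractf)

lemma mass_tendsto_L2:
  assumes \<phi>: "sq_int \<phi>" and f: "\<And>n. sq_int (f n)" and s: "0 < s"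
    and lim: "(\<lambda>n. mass0 (\<lambda>x. f n x - \<phi> x)) \<longlonglongrightarrow> 0"
  shows "(\<lambda>n. mass (f n) s) \<longlonglongrightarrow> mass \<phi> s"
proof -
  have d: "sq_int (\<lambda>x. f n x - \<phi> x)" for n by (intro sq_int_diff f \<phi>)
  have e: "mean (f n) s x - mean \<phi> s x = mean (\<lambda>x. f n x - \<phi> x) s x" for n x
    by (simp add: mean_diff[OF f \<phi> s])
  have "(\<lambda>n. LINT x|lborel. (norm (mean (f n) s x))\<^sup>2 * evol s x) \<longlonglongrightarrow> (LINT x|lborel. (norm (mean \<phi> s x))\<^sup>2 * evol s x)"
  proof (rule weighted_L2_tendsto)
    show "(\<lambda>n. LINT x|lborel. (norm (mean (f n) s x - mean \<phi> s x))\<^sup>2 * evol s x) \<longlonglongrightarrow> 0"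
    proof (rule tendsto_sandwich[OF _ _ tendsto_const lim])
      show "\<forall>\<^sub>F n in sequentially. 0 \<le> (LINT x|lborel. (norm (mean (f n) s x - mean \<phi> s x))\<^sup>2 * evol s x)"
        using evol_pos[OF s] by (intro always_eventually allI integral_nonneg_AE AE_I2 mult_nonneg_nonneg) (auto simp: less_imp_le)
      show "\<forall>\<^sub>F n in sequentially. (LINT x|lborel. (norm (mean (f n) s x - mean \<phi> s x))\<^sup>2 * evol s x) \<le> mass0 (\<lambda>x. f n x - \<phi> x)"
        using mass_le_mass0[OF d s] by (intro always_eventually allI) (simp add: e mass_def)
    qed
  qed (use integrable_mean_sq[OF d s] integrable_mean_sq[OF \<phi> s] evol_pos[OF s] in
      \<open>auto simp: e less_imp_le intro!: borel_measurable_continuous_onI continuous_mean f \<phi> s continuous_evol\<close>)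
  then show ?thesis by (simp add: mass_def)
qed

end

context concave_evolution begin

text \<open>The bound \<open>energy_le_mass_drop\<close> as its left endpoint tends to 0. As the mass is nonnegative,
  it makes \<open>\<phi> \<mapsto> \<nabla> Q\<^sub>t \<phi>\<close> a bounded operator on \<open>L\<^sup>2(\<mu>)\<close>, which permits passing from bounded to
  square integrable \<open>\<phi>\<close>.\<close>

lemma energy_le_mass0_drop:
  assumes b: "bounded_fun \<phi>" and t: "0 < t"
  shows "t * energy \<phi> t \<le> mass0 \<phi> - mass \<phi> t"
proof -
  have e: "0 \<le> energy \<phi> t" by (rule energy_nonneg[OF t])
  show "t * energy \<phi> t \<le> mass0 \<phi> - mass \<phi> t"
  proof (rule field_le_epsilon)
    fix \<epsilon> :: real assume \<epsilon>: "0 < \<epsilon>"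
    define s where "s = min (t / 2) (\<epsilon> / (energy \<phi> t + 1))"
    have s: "0 < s" "s < t" "s * energy \<phi> t \<le> \<epsilon>"
    proof -
      show "0 < s" "s < t" using t \<epsilon> e by (auto simp: s_def)
      have "s * energy \<phi> t \<le> \<epsilon> / (energy \<phi> t + 1) * energy \<phi> t"
        using e by (intro mult_right_mono) (auto simp: s_def)
      also have "\<dots> \<le> \<epsilon>" using e \<epsilon> by (simp add: field_simps add_nonneg_pos)
      finally show "s * energy \<phi> t \<le> \<epsilon>" .
    qed
    have "(t - s) * energy \<phi> t \<le> mass \<phi> s - mass \<phi> t" by (rule energy_le_mass_drop[OF b s(1,2)])
    also have "\<dots> \<le> mass0 \<phi> - mass \<phi> t"
      using mass_le_mass0[OF bounded_sq_int[OF b] s(1)] by simp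
    finally show "t * energy \<phi> t \<le> mass0 \<phi> - mass \<phi> t + \<epsilon>" using s(3) by (simp add: algebra_simps)
  qed
qed

lemma energy_le_mass0_bounded:
  assumes b: "bounded_fun \<phi>" and t: "0 < t"
  shows "energy \<phi> t \<le> mass0 \<phi> / t"
  using energy_le_mass0_drop[OF assms] mass_nonneg[OF t, of \<phi>] t by (simp add: field_simps)

lemma
  assumes \<phi>: "sq_int \<phi>" and t: "0 < t"
  shows integrable_energy: "integrable lborel (\<lambda>x. (\<Sum>b\<in>Basis. (dmean \<phi> b t x)\<^sup>2) * evol t x)"
    and energy_le_mass0: "energy \<phi> t \<le> mass0 \<phi> / t"
proof -
  have m: "\<phi> \<in> borel_measurable borel" by (rule sq_int_measurable[OF \<phi>])
  have b: "bounded_fun (trunc n \<phi>)" for n by (rule trunc_bounded[OF m])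
  have le: "energy (trunc n \<phi>) t \<le> mass0 \<phi> / t" for n
  proof -
    have "mass0 (trunc n \<phi>) \<le> mass0 \<phi>"
      using b[of n] by (intro sq_int_dominated(2)[OF \<phi>] trunc_le) (simp add: bounded_fun_def)
    then show ?thesis
      using energy_le_mass0_bounded[OF b t, of n] t by (simp add: field_simps)
  qed
  have lim: "(\<lambda>n. dmean (trunc n \<phi>) e t x) \<longlonglongrightarrow> dmean \<phi> e t x" for e x
    using b m by (intro dmean_tendsto ratio_tendsto_dominated[OF sq_int_integrable[OF \<phi>]] trunc_tendsto trunc_le t)
       (auto simp: bounded_fun_def)
  have int: "integrable lborel (\<lambda>x. (\<Sum>b\<in>Basis. (dmean (trunc n \<phi>) b t x)\<^sup>2) * evol t x)" for n
    by (rule tame_integrable[OF tame_energy[OF b] t])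
  show "integrable lborel (\<lambda>x. (\<Sum>b\<in>Basis. (dmean \<phi> b t x)\<^sup>2) * evol t x)"
    by (rule energy_fatou(1)[OF t bounded_sq_int[OF b] \<phi> int lim le tendsto_const])
  show "energy \<phi> t \<le> mass0 \<phi> / t"
    by (rule energy_fatou(2)[OF t bounded_sq_int[OF b] \<phi> int lim le tendsto_const])
qed

lemma energy_tendsto_L2:
  assumes \<phi>: "sq_int \<phi>" and f: "\<And>n. sq_int (f n)" and s: "0 < s"
    and lim: "(\<lambda>n. mass0 (\<lambda>x. f n x - \<phi> x)) \<longlonglongrightarrow> 0"
  shows "(\<lambda>n. energy (f n) s) \<longlonglongrightarrow> energy \<phi> s"
  unfolding energy_eq
proof (rule weighted_L2_tendsto)
  have d: "sq_int (\<lambda>x. f n x - \<phi> x)" for n by (intro sq_int_diff f \<phi>)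
  have e: "grad_mean (f n) s x - grad_mean \<phi> s x = grad_mean (\<lambda>x. f n x - \<phi> x) s x" for n x
    by (simp add: grad_mean_diff[OF f \<phi> s])
  show "(\<lambda>n. LINT x|lborel. (norm (grad_mean (f n) s x - grad_mean \<phi> s x))\<^sup>2 * evol s x) \<longlonglongrightarrow> 0"
  proof (rule tendsto_sandwich[OF _ _ tendsto_const])
    show "(\<lambda>n. mass0 (\<lambda>x. f n x - \<phi> x) / s) \<longlonglongrightarrow> 0"
      using tendsto_divide[OF lim tendsto_const, of s] s by simp
    show "\<forall>\<^sub>F n in sequentially. 0 \<le> (LINT x|lborel. (norm (grad_mean (f n) s x - grad_mean \<phi> s x))\<^sup>2 * evol s x)"
      using evol_pos[OF s] by (intro always_eventually allI integral_nonneg_AE AE_I2 mult_nonneg_nonneg) (auto simp: less_imp_le)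
    show "\<forall>\<^sub>F n in sequentially. (LINT x|lborel. (norm (grad_mean (f n) s x - grad_mean \<phi> s x))\<^sup>2 * evol s x) \<le> mass0 (\<lambda>x. f n x - \<phi> x) / s"
      using energy_le_mass0[OF d s] by (intro always_eventually allI) (simp only: e energy_eq)
  qed
  show "integrable lborel (\<lambda>x. (norm (grad_mean (f n) s x - grad_mean \<phi> s x))\<^sup>2 * evol s x)" for n
    using integrable_energy[OF d s, of n] by (simp only: e norm_grad_mean)
  show "integrable lborel (\<lambda>x. (norm (grad_mean \<phi> s x))\<^sup>2 * evol s x)"
    using integrable_energy[OF \<phi> s] by (simp only: norm_grad_mean)
qed (use evol_pos[OF s] in \<open>auto simp: less_imp_le intro!: borel_measurable_continuous_onI continuous_grad_mean f \<phi> s continuous_evol\<close>)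

lemma energy_mass_cross:
  assumes \<phi>: "sq_int \<phi>" and s: "0 < s" "s \<le> t"
  shows "energy \<phi> t * mass \<phi> s \<le> energy \<phi> s * mass \<phi> t"
proof (rule LIMSEQ_le)
  have b: "bounded_fun (trunc n \<phi>)" for n by (rule trunc_bounded[OF sq_int_measurable[OF \<phi>]])
  note L = mass_tendsto_L2[OF \<phi> bounded_sq_int[OF b] _ mass0_trunc_tendsto[OF \<phi>]]
    energy_tendsto_L2[OF \<phi> bounded_sq_int[OF b] _ mass0_trunc_tendsto[OF \<phi>]]
  show "(\<lambda>n. energy (trunc n \<phi>) t * mass (trunc n \<phi>) s) \<longlonglongrightarrow> energy \<phi> t * mass \<phi> s"
    using s by (intro tendsto_mult L) auto
  show "(\<lambda>n. energy (trunc n \<phi>) s * mass (trunc n \<phi>) t) \<longlonglongrightarrow> energy \<phi> s * mass \<phi> t"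
    using s by (intro tendsto_mult L) auto
  show "\<exists>N. \<forall>n\<ge>N. energy (trunc n \<phi>) t * mass (trunc n \<phi>) s \<le> energy (trunc n \<phi>) s * mass (trunc n \<phi>) t"
    using energy_mass_cross_bounded[OF b s] by blast
qed

lemma convex_ln_mass_regularized:
  assumes \<phi>: "sq_int \<phi>" and \<epsilon>: "0 < \<epsilon>"
  shows "convex_on {0<..} (\<lambda>s. ln (mass \<phi> s + \<epsilon>))"
proof (rule convex_onI)
  have b: "bounded_fun (trunc n \<phi>)" for n by (rule trunc_bounded[OF sq_int_measurable[OF \<phi>]])
  fix t x y :: real assume t: "0 < t" "t < 1" and xy: "x \<in> {0<..}" "y \<in> {0<..}"
  have L: "(\<lambda>n. ln (mass (trunc n \<phi>) s + \<epsilon>)) \<longlonglongrightarrow> ln (mass \<phi> s + \<epsilon>)" if "0 < s" for s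
    using mass_nonneg[OF that, of \<phi>] \<epsilon>
    by (intro tendsto_intros mass_tendsto_L2[OF \<phi> bounded_sq_int[OF b] that mass0_trunc_tendsto[OF \<phi>]]) auto
  show "ln (mass \<phi> ((1 - t) *\<^sub>R x + t *\<^sub>R y) + \<epsilon>) \<le> (1 - t) * ln (mass \<phi> x + \<epsilon>) + t * ln (mass \<phi> y + \<epsilon>)"
  proof (rule LIMSEQ_le)
    show "(\<lambda>n. ln (mass (trunc n \<phi>) ((1 - t) *\<^sub>R x + t *\<^sub>R y) + \<epsilon>)) \<longlonglongrightarrow> ln (mass \<phi> ((1 - t) *\<^sub>R x + t *\<^sub>R y) + \<epsilon>)"
      using t xy by (intro L) (simp add: add_pos_pos)
    show "(\<lambda>n. (1 - t) * ln (mass (trunc n \<phi>) x + \<epsilon>) + t * ln (mass (trunc n \<phi>) y + \<epsilon>))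
        \<longlonglongrightarrow> (1 - t) * ln (mass \<phi> x + \<epsilon>) + t * ln (mass \<phi> y + \<epsilon>)"
      using xy by (intro tendsto_intros L) auto
    show "\<exists>N. \<forall>n\<ge>N. ln (mass (trunc n \<phi>) ((1 - t) *\<^sub>R x + t *\<^sub>R y) + \<epsilon>)
        \<le> (1 - t) * ln (mass (trunc n \<phi>) x + \<epsilon>) + t * ln (mass (trunc n \<phi>) y + \<epsilon>)"
      using convex_onD[OF convex_ln_mass_bounded[OF b \<epsilon>], of t x y] t xy by auto
  qed
qed (rule convex_real_interval)

end

section \<open>Small times\<close>

text \<open>The second derivative of \<open>\<gamma>\<^sub>1\<close> in direction \<open>e\<close> is \<open>((e \<bullet> z)\<^sup>2 - |e|\<^sup>2) \<gamma>\<^sub>1(z)\<close>, and its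
  integral vanishes.\<close>

lemma gauss_second_moment:
  "(LINT z|lborel. (e \<bullet> z)\<^sup>2 * gauss 1 (z::'a::euclidean_space)) = (norm e)\<^sup>2"
proof -
  have bd: "integrable lborel (k 1)" if k: "gauss_dominated k" "continuous_on UNIV (k 1)" for k :: "real \<Rightarrow> 'a \<Rightarrow> real"
  proof -
    obtain C where C: "\<And>z. \<bar>k 1 z\<bar> \<le> C * pgauss 3 1 z"
      using k(1)[unfolded gauss_dominated_def, rule_format, of 1 1] by auto
    have [measurable]: "k 1 \<in> borel_measurable borel" by (rule borel_measurable_continuous_onI[OF k(2)])
    show ?thesis
    proof (rule Bochner_Integration.integrable_bound)
      show "integrable lborel (\<lambda>z::'a. C * pgauss 3 1 z)" using integrable_pgauss[where 'a='a, of 1 3] by simp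
      show "AE z in lborel. norm (k 1 z) \<le> norm (C * pgauss 3 1 z)"
        using order.trans[OF C abs_ge_self] by (intro AE_I2) simp
    qed measurable
  qed
  have g: "integrable lborel (gauss 1 :: 'a \<Rightarrow> real)" by (rule integrable_gauss) simp
  have g2: "integrable lborel (gauss2 1 e e)" by (rule bd[OF gauss_dominated_derivs(3) continuous_gauss_derivs(2)])
  have eq: "(e \<bullet> z)\<^sup>2 * gauss 1 z = gauss2 1 e e z + (e \<bullet> e) * gauss 1 z" for z
    by (simp add: gauss2_def inner_commute power2_eq_square algebra_simps)
  have "(LINT z|lborel. gauss2 1 e e z) = 0"
    using gauss1_deriv[of 1 e _ e 0]
    by (intro integral_directional_derivative_eq_0[of "gauss1 1 e" e] continuous_gauss_derivs g2
          bd[OF gauss_dominated_derivs(2) continuous_gauss_derivs(1)]) simp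
  then have "(LINT z|lborel. (e \<bullet> z)\<^sup>2 * gauss 1 z) = (e \<bullet> e) * (LINT z|lborel. gauss 1 (z::'a))"
    unfolding eq using g g2 by simp
  then show ?thesis by (simp add: integral_gauss power2_norm_eq_inner)
qed

lemma integrable_pair_prod:
  fixes w k :: "'a::euclidean_space \<Rightarrow> real"
  assumes w: "integrable lborel w" and k: "integrable lborel k"
  shows "integrable (lborel \<Otimes>\<^sub>M lborel) (\<lambda>(y, z). w y * k z)"
proof (rule lborel_pair.Fubini_integrable)
  have [measurable]: "k \<in> borel_measurable borel" "w \<in> borel_measurable borel" using w k by auto
  show "(\<lambda>(y, z). w y * k z) \<in> borel_measurable (lborel \<Otimes>\<^sub>M lborel)" by measurable
  show "integrable lborel (\<lambda>y. LINT z|lborel. norm (case (y, z) of (y, z) \<Rightarrow> w y * k z))"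
    using w by (simp add: abs_mult)
  show "AE y in lborel. integrable lborel (\<lambda>z. case (y, z) of (y, z) \<Rightarrow> w y * k z)"
    using k by simp
qed

lemma integral_gauss_scaled:
  fixes g :: "'a::euclidean_space \<Rightarrow> real"
  assumes [measurable]: "g \<in> borel_measurable borel" and r: "0 < r"
  shows "(LINT x|lborel. g x * gauss r (x - y)) = (LINT z|lborel. g (y + sqrt r *\<^sub>R z) * gauss 1 z)"
proof -
  have sc: "gauss r (sqrt r *\<^sub>R z) * sqrt r ^ DIM('a) = gauss 1 z" for z :: 'a
  proof -
    define q where "q = - (real DIM('a) / 2)"
    have "sqrt r ^ DIM('a) = (r powr (1 / 2)) powr real DIM('a)"
      using r powr_realpow[of "sqrt r" "DIM('a)"] by (simp add: powr_half_sqrt)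
    then have s: "sqrt r ^ DIM('a) = r powr (- q)" by (simp only: powr_powr q_def) simp
    have pw: "(2 * pi * r) powr q * r powr (- q) = (2 * pi) powr q"
      using r by (simp add: powr_mult powr_minus)
    have gs: "gauss r (sqrt r *\<^sub>R z) = (2 * pi * r) powr q * exp (- (z \<bullet> z) / 2)"
    proof -
      have "(sqrt r *\<^sub>R z) \<bullet> (sqrt r *\<^sub>R z) = r * (z \<bullet> z)"
        using r by (simp flip: mult.assoc)
      then have "gauss r (sqrt r *\<^sub>R z) = (2 * pi * r) powr q * exp (- (r * (z \<bullet> z)) / (2 * r))"
        by (simp only: gauss_inner q_def)
      then show ?thesis using r by simp
    qed
    have "gauss r (sqrt r *\<^sub>R z) * r powr (- q) = ((2 * pi * r) powr q * r powr (- q)) * exp (- (z \<bullet> z) / 2)"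
      by (simp only: gs mult_ac)
    also have "\<dots> = gauss 1 z" by (simp only: pw) (simp add: gauss_inner q_def)
    finally show ?thesis by (simp only: s)
  qed
  have "(LINT z|lborel. g (y + sqrt r *\<^sub>R z) * gauss r (y + sqrt r *\<^sub>R z - y))
      = (LINT x|lborel. g x * gauss r (x - y)) / sqrt r ^ DIM('a)"
    using integral_lborel_affine[of "\<lambda>x. g x * gauss r (x - y)" "sqrt r" y] r by simp
  then have "(LINT x|lborel. g x * gauss r (x - y))
      = (LINT z|lborel. g (y + sqrt r *\<^sub>R z) * gauss r (sqrt r *\<^sub>R z)) * sqrt r ^ DIM('a)"
    using r by simp
  also have "\<dots> = (LINT z|lborel. g (y + sqrt r *\<^sub>R z) * gauss r (sqrt r *\<^sub>R z) * sqrt r ^ DIM('a))"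
    by simp
  finally show ?thesis by (simp add: mult.assoc sc)
qed

context prob_density begin

text \<open>The mean square displacement \<open>E (\<xi>(Y + \<surd>r Z) - \<xi>(Y))\<^sup>2\<close>.\<close>

definition jump :: "('a \<Rightarrow> real) \<Rightarrow> real \<Rightarrow> real" where
  "jump \<xi> r = (LINT p|(lborel \<Otimes>\<^sub>M lborel). (\<xi> (fst p + sqrt r *\<^sub>R snd p) - \<xi> (fst p))\<^sup>2 * (\<rho> (fst p) * gauss 1 (snd p)))"

text \<open>The left-hand side is the expected conditional variance of \<open>\<xi>(Y)\<close> given \<open>X = Y + \<surd>r Z\<close>. The
  conditional mean is the best predictor of \<open>\<xi>(Y)\<close>, so \<open>\<xi>(X)\<close> predicts no better.\<close>

lemma mass0_diff_mass_le_jump: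
  assumes b: "bounded_fun \<xi>" and r: "0 < r"
  shows "mass0 \<xi> - mass \<xi> r \<le> jump \<xi> r"
proof -
  obtain B where B: "\<And>x. \<bar>\<xi> x\<bar> \<le> B" and [measurable]: "\<xi> \<in> borel_measurable borel"
    using b by (auto simp: bounded_fun_def)
  define B2 where "B2 = (2 * B)\<^sup>2"
  have B2 [simp]: "\<bar>B2\<bar> = B2" by (simp add: B2_def)
  have sq: "(\<xi> y - \<xi> x)\<^sup>2 \<le> B2" for x y
  proof -
    have "\<bar>\<xi> y - \<xi> x\<bar> \<le> 2 * B" using B[of x] B[of y] by linarith
    from power_mono[OF this abs_ge_zero, of 2] show ?thesis by (simp only: B2_def power2_abs)
  qed
  note sqi = bounded_sq_int[OF b]
  have P: "integrable (lborel \<Otimes>\<^sub>M lborel) (\<lambda>(x, y). (\<xi> y - \<xi> x)\<^sup>2 * (\<rho> y * gauss r (x - y)))"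
    by (rule integrable_pair_conv[OF integrable integrable_gauss[OF r], of _ B2])
       (measurable, simp add: sq)
  have J: "integrable (lborel \<Otimes>\<^sub>M lborel) (\<lambda>(y, z). (\<xi> (y + sqrt r *\<^sub>R z) - \<xi> y)\<^sup>2 * (\<rho> y * gauss 1 z))"
  proof (rule Bochner_Integration.integrable_bound)
    show "integrable (lborel \<Otimes>\<^sub>M lborel) (\<lambda>p. B2 * (case p of (y, z) \<Rightarrow> \<rho> y * gauss 1 (z :: 'a)))"
      by (intro integrable_mult_right integrable_pair_prod integrable integrable_gauss) simp
    show "AE p in (lborel \<Otimes>\<^sub>M lborel). norm (case p of (y, z) \<Rightarrow> (\<xi> (y + sqrt r *\<^sub>R z) - \<xi> y)\<^sup>2 * (\<rho> y * gauss 1 z))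
        \<le> norm (B2 * (case p of (y, z) \<Rightarrow> \<rho> y * gauss 1 (z :: 'a)))"
      using sq nonneg by (intro AE_I2) (auto simp: case_prod_unfold abs_mult intro!: mult_right_mono)
  qed measurable
  have Ai: "integrable lborel (conv (gauss r) (\<lambda>y. (\<xi> y)\<^sup>2 * \<rho> y))"
    by (intro integrable_conv sq_int_sq_integrable[OF sqi] integrable_gauss r)
  have "mass0 \<xi> - mass \<xi> r = (LINT x|lborel. conv (gauss r) (\<lambda>y. (\<xi> y)\<^sup>2 * \<rho> y) x - (mean \<xi> r x)\<^sup>2 * evol r x)"
    using Ai integrable_mean_sq[OF sqi r] integral_conv[OF sq_int_sq_integrable[OF sqi] integrable_gauss[OF r]]
    by (simp add: mass_def mass0_def integral_gauss[OF r])
  also have "\<dots> \<le> (LINT x|lborel. (LINT y|lborel. (\<xi> y - \<xi> x)\<^sup>2 * (\<rho> y * gauss r (x - y))))"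
  proof (rule integral_mono)
    show "integrable lborel (\<lambda>x. conv (gauss r) (\<lambda>y. (\<xi> y)\<^sup>2 * \<rho> y) x - (mean \<xi> r x)\<^sup>2 * evol r x)"
      using Ai integrable_mean_sq[OF sqi r] by simp
    show "integrable lborel (\<lambda>x. LINT y|lborel. (\<xi> y - \<xi> x)\<^sup>2 * (\<rho> y * gauss r (x - y)))"
      using lborel_pair.integrable_fst[OF P] by simp
    fix x
    show "conv (gauss r) (\<lambda>y. (\<xi> y)\<^sup>2 * \<rho> y) x - (mean \<xi> r x)\<^sup>2 * evol r x
        \<le> (LINT y|lborel. (\<xi> y - \<xi> x)\<^sup>2 * (\<rho> y * gauss r (x - y)))"
      using evol_pos[OF r, of x] by (simp add: expected_sq_deviation(2)[OF sqi r])
  qed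
  also have "\<dots> = (LINT y|lborel. (LINT x|lborel. (\<xi> y - \<xi> x)\<^sup>2 * (\<rho> y * gauss r (x - y))))"
    using lborel_pair.Fubini_integral[OF P] by simp
  also have "\<dots> = (LINT y|lborel. (LINT z|lborel. (\<xi> (y + sqrt r *\<^sub>R z) - \<xi> y)\<^sup>2 * (\<rho> y * gauss 1 z)))"
  proof (rule Bochner_Integration.integral_cong[OF refl])
    fix y
    show "(LINT x|lborel. (\<xi> y - \<xi> x)\<^sup>2 * (\<rho> y * gauss r (x - y)))
        = (LINT z|lborel. (\<xi> (y + sqrt r *\<^sub>R z) - \<xi> y)\<^sup>2 * (\<rho> y * gauss 1 z))"
      using integral_gauss_scaled[of "\<lambda>x. (\<xi> y - \<xi> x)\<^sup>2 * \<rho> y" r y] r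
      by (simp add: mult.assoc power2_commute)
  qed
  also have "\<dots> = jump \<xi> r"
    using lborel_pair.integral_fst[OF J] by (simp add: jump_def case_prod_unfold)
  finally show ?thesis .
qed

lemma jump_tendsto_0:
  assumes cont: "continuous_on UNIV \<xi>" and b: "bounded_fun \<xi>"
  shows "(jump \<xi> \<longlongrightarrow> 0) (at_right 0)"
  unfolding tendsto_at_iff_sequentially
proof (intro allI impI)
  fix X :: "nat \<Rightarrow> real" assume X: "\<forall>i. X i \<in> {0<..} - {0}" "X \<longlonglongrightarrow> 0"
  obtain B where B: "\<And>x. \<bar>\<xi> x\<bar> \<le> B" and [measurable]: "\<xi> \<in> borel_measurable borel"
    using b by (auto simp: bounded_fun_def)
  define B2 where "B2 = (2 * B)\<^sup>2"
  have B2 [simp]: "\<bar>B2\<bar> = B2" by (simp add: B2_def)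
  have sq: "(\<xi> y - \<xi> x)\<^sup>2 \<le> B2" for x y
  proof -
    have "\<bar>\<xi> y - \<xi> x\<bar> \<le> 2 * B" using B[of x] B[of y] by linarith
    from power_mono[OF this abs_ge_zero, of 2] show ?thesis by (simp only: B2_def power2_abs)
  qed
  have "(\<lambda>i. jump \<xi> (X i)) \<longlonglongrightarrow> (LINT p|(lborel \<Otimes>\<^sub>M lborel :: ('a \<times> 'a) measure). 0)"
    unfolding jump_def
  proof (rule integral_dominated_convergence[where w="\<lambda>p. B2 * (case p of (y, z) \<Rightarrow> \<rho> y * gauss 1 (z :: 'a))"])
    show "integrable (lborel \<Otimes>\<^sub>M lborel) (\<lambda>p. B2 * (case p of (y, z) \<Rightarrow> \<rho> y * gauss 1 (z :: 'a)))"
      by (intro integrable_mult_right integrable_pair_prod integrable integrable_gauss) simp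
    show "AE p in (lborel \<Otimes>\<^sub>M lborel). norm ((\<xi> (fst p + sqrt (X i) *\<^sub>R snd p) - \<xi> (fst p))\<^sup>2 * (\<rho> (fst p) * gauss 1 (snd p)))
        \<le> B2 * (case p of (y, z) \<Rightarrow> \<rho> y * gauss 1 (z :: 'a))" for i
      using sq nonneg by (intro AE_I2) (auto simp: case_prod_unfold abs_mult intro!: mult_right_mono)
    show "AE p in (lborel \<Otimes>\<^sub>M lborel). (\<lambda>i. (\<xi> (fst p + sqrt (X i) *\<^sub>R snd p) - \<xi> (fst p))\<^sup>2 * (\<rho> (fst p) * gauss 1 (snd p))) \<longlonglongrightarrow> 0"
    proof (rule AE_I2)
      fix p :: "'a \<times> 'a"
      have "(\<lambda>i. fst p + sqrt (X i) *\<^sub>R snd p) \<longlonglongrightarrow> fst p + sqrt 0 *\<^sub>R snd p"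
        by (intro tendsto_intros X)
      then have "(\<lambda>i. fst p + sqrt (X i) *\<^sub>R snd p) \<longlonglongrightarrow> fst p" by simp
      moreover have "isCont \<xi> (fst p)" using cont by (simp add: continuous_on_eq_continuous_at)
      ultimately have "(\<lambda>i. \<xi> (fst p + sqrt (X i) *\<^sub>R snd p)) \<longlonglongrightarrow> \<xi> (fst p)"
        by (intro isCont_tendsto_compose[of _ \<xi>])
      then have "(\<lambda>i. (\<xi> (fst p + sqrt (X i) *\<^sub>R snd p) - \<xi> (fst p))\<^sup>2 * (\<rho> (fst p) * gauss 1 (snd p)))
          \<longlonglongrightarrow> (\<xi> (fst p) - \<xi> (fst p))\<^sup>2 * (\<rho> (fst p) * gauss 1 (snd p))"
        by (intro tendsto_intros)
      then show "(\<lambda>i. (\<xi> (fst p + sqrt (X i) *\<^sub>R snd p) - \<xi> (fst p))\<^sup>2 * (\<rho> (fst p) * gauss 1 (snd p))) \<longlonglongrightarrow> 0"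
        by simp
    qed
  qed measurable
  then show "(jump \<xi> \<circ> X) \<longlonglongrightarrow> 0" by (simp add: comp_def)
qed

text \<open>The difference quotients tend to \<open>G(Y) \<bullet> Z\<close>, and the second moment of this in \<open>Z\<close> is
  \<open>|G(Y)|\<^sup>2\<close>. The Lipschitz bound provides the majorant \<open>L\<^sup>2 (1 + |Z|)\<^sup>2\<close>.\<close>

lemma jump_quotient_tendsto:
  assumes [measurable]: "\<xi> \<in> borel_measurable borel" "G \<in> borel_measurable borel" "U \<in> sets borel"
    and lip: "\<And>x y. \<bar>\<xi> x - \<xi> y\<bar> \<le> L * norm (x - y)"
    and U: "AE y in lborel. \<rho> y \<noteq> 0 \<longrightarrow> y \<in> U"
    and der: "\<And>y z. y \<in> U \<Longrightarrow> ((\<lambda>t. \<xi> (y + t *\<^sub>R z)) has_real_derivative G y \<bullet> z) (at 0)"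
  shows "((\<lambda>r. jump \<xi> r / r) \<longlongrightarrow> (LINT y|lborel. (norm (G y))\<^sup>2 * \<rho> y)) (at_right 0)"
  unfolding tendsto_at_iff_sequentially
proof (intro allI impI)
  fix X :: "nat \<Rightarrow> real" assume X: "\<forall>i. X i \<in> {0<..} - {0}" "X \<longlonglongrightarrow> 0"
  then have Xp: "0 < X i" for i by auto
  let ?Q = "\<lambda>i p. ((\<xi> (fst p + sqrt (X i) *\<^sub>R snd p) - \<xi> (fst p)) / sqrt (X i))\<^sup>2 * (\<rho> (fst p) * gauss 1 (snd p))"
  let ?R = "\<lambda>p. (G (fst p) \<bullet> snd p)\<^sup>2 * (\<rho> (fst p) * gauss 1 (snd p))"
  have [measurable]: "(\<lambda>p. G (fst p) \<bullet> snd p) \<in> borel_measurable (lborel \<Otimes>\<^sub>M lborel)"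
    by (intro borel_measurable_inner) measurable
  have W: "integrable (lborel \<Otimes>\<^sub>M lborel) (\<lambda>p. L\<^sup>2 * (case p of (y, z) \<Rightarrow> \<rho> y * pgauss 2 1 (z :: 'a)))"
    by (intro integrable_mult_right integrable_pair_prod integrable integrable_pgauss) simp
  have bd: "?Q i p \<le> L\<^sup>2 * (case p of (y, z) \<Rightarrow> \<rho> y * pgauss 2 1 (z :: 'a))" for i p
  proof -
    have L: "0 \<le> L"
    proof -
      have "0 \<le> L * norm (One :: 'a)" using order.trans[OF abs_ge_zero lip[of One 0]] by simp
      moreover have "0 < norm (One :: 'a)" using One_neq_0 by simp
      ultimately show ?thesis by (simp add: zero_le_mult_iff)
    qed
    have "\<bar>\<xi> (fst p + sqrt (X i) *\<^sub>R snd p) - \<xi> (fst p)\<bar> \<le> L * (sqrt (X i) * norm (snd p))"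
      using lip[of "fst p + sqrt (X i) *\<^sub>R snd p" "fst p"] Xp[of i] by simp
    then have "\<bar>(\<xi> (fst p + sqrt (X i) *\<^sub>R snd p) - \<xi> (fst p)) / sqrt (X i)\<bar> \<le> L * norm (snd p)"
      using Xp[of i] by (simp add: field_simps)
    also have "\<dots> \<le> L * (1 + norm (snd p))" using L by (intro mult_left_mono) auto
    finally have "\<bar>(\<xi> (fst p + sqrt (X i) *\<^sub>R snd p) - \<xi> (fst p)) / sqrt (X i)\<bar> \<le> L * (1 + norm (snd p))" .
    from power_mono[OF this abs_ge_zero, of 2]
    have "((\<xi> (fst p + sqrt (X i) *\<^sub>R snd p) - \<xi> (fst p)) / sqrt (X i))\<^sup>2 \<le> L\<^sup>2 * (1 + norm (snd p))\<^sup>2"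
      by (simp only: power2_abs power_mult_distrib)
    from mult_right_mono[OF this, of "\<rho> (fst p) * gauss 1 (snd p)"] show ?thesis
      using nonneg by (simp add: case_prod_unfold pgauss_def algebra_simps)
  qed
  have lim: "AE p in (lborel \<Otimes>\<^sub>M lborel). (\<lambda>i. ?Q i p) \<longlonglongrightarrow> ?R p"
  proof -
    have "AE p in (lborel \<Otimes>\<^sub>M lborel). \<rho> (fst p) \<noteq> 0 \<longrightarrow> fst p \<in> U"
    proof (rule lborel_pair.AE_pair_measure)
      show "{p \<in> space (lborel \<Otimes>\<^sub>M lborel). \<rho> (fst p) \<noteq> 0 \<longrightarrow> fst p \<in> U} \<in> sets (lborel \<Otimes>\<^sub>M lborel)"
        by measurable
      show "AE y in lborel. AE z in lborel. \<rho> (fst (y, z)) \<noteq> 0 \<longrightarrow> fst (y, z) \<in> U"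
        using U by eventually_elim simp
    qed
    then show ?thesis
    proof eventually_elim
      case (elim p)
      show ?case
      proof (cases "\<rho> (fst p) = 0")
        case False
        then have "((\<lambda>t. \<xi> (fst p + t *\<^sub>R snd p)) has_real_derivative G (fst p) \<bullet> snd p) (at 0)"
          using elim der by simp
        then have d: "((\<lambda>t. (\<xi> (fst p + t *\<^sub>R snd p) - \<xi> (fst p)) / t) \<longlongrightarrow> G (fst p) \<bullet> snd p) (at 0)"
          by (simp add: has_field_derivative_iff)
        have "(\<lambda>i. sqrt (X i)) \<longlonglongrightarrow> sqrt 0" by (intro tendsto_intros X)
        then have "(\<lambda>i. (\<xi> (fst p + sqrt (X i) *\<^sub>R snd p) - \<xi> (fst p)) / sqrt (X i)) \<longlonglongrightarrow> G (fst p) \<bullet> snd p"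
          using d[unfolded tendsto_at_iff_sequentially, rule_format, of "\<lambda>i. sqrt (X i)"] Xp
          by (simp add: comp_def less_imp_neq[symmetric])
        then show ?thesis by (intro tendsto_intros)
      qed simp
    qed
  qed
  have Q: "(\<lambda>i. LINT p|(lborel \<Otimes>\<^sub>M lborel). ?Q i p) \<longlonglongrightarrow> (LINT p|(lborel \<Otimes>\<^sub>M lborel). ?R p)"
    and R: "integrable (lborel \<Otimes>\<^sub>M lborel) ?R"
  proof -
    have "norm (?Q i p) \<le> L\<^sup>2 * (case p of (y, z) \<Rightarrow> \<rho> y * pgauss 2 1 (z :: 'a))" for i p
      using bd[where i=i and p=p] nonneg[of "fst p"] by (simp add: abs_mult)
    note d = this
    have m: "?Q i \<in> borel_measurable (lborel \<Otimes>\<^sub>M lborel)" for i by measurable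
    have m': "?R \<in> borel_measurable (lborel \<Otimes>\<^sub>M lborel)" by measurable
    show "(\<lambda>i. LINT p|(lborel \<Otimes>\<^sub>M lborel). ?Q i p) \<longlonglongrightarrow> (LINT p|(lborel \<Otimes>\<^sub>M lborel). ?R p)"
      by (rule integral_dominated_convergence[OF m' m W lim AE_I2[OF d]])
    show "integrable (lborel \<Otimes>\<^sub>M lborel) ?R"
      by (rule integrable_dominated_convergence[OF m' m W lim AE_I2[OF d]])
  qed
  have R': "integrable (lborel \<Otimes>\<^sub>M lborel) (\<lambda>(y, z). (G y \<bullet> z)\<^sup>2 * (\<rho> y * gauss 1 z))"
    using R by (simp add: case_prod_unfold)
  have "(LINT p|(lborel \<Otimes>\<^sub>M lborel). ?R p) = (LINT y|lborel. (LINT z|lborel. (G y \<bullet> z)\<^sup>2 * (\<rho> y * gauss 1 z)))"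
    using lborel_pair.integral_fst[OF R'] by (simp add: case_prod_unfold)
  also have "\<dots> = (LINT y|lborel. (LINT z|lborel. \<rho> y * ((G y \<bullet> z)\<^sup>2 * gauss 1 z)))"
    by (simp add: mult.left_commute)
  also have "\<dots> = (LINT y|lborel. (norm (G y))\<^sup>2 * \<rho> y)"
    by (simp only: integral_mult_right_zero gauss_second_moment) (simp only: mult.commute)
  finally have "(\<lambda>i. LINT p|(lborel \<Otimes>\<^sub>M lborel). ?Q i p) \<longlonglongrightarrow> (LINT y|lborel. (norm (G y))\<^sup>2 * \<rho> y)"
    using Q by simp
  moreover have "(LINT p|(lborel \<Otimes>\<^sub>M lborel). ?Q i p) = jump \<xi> (X i) / X i" for i
  proof -
    have "?Q i p = (\<xi> (fst p + sqrt (X i) *\<^sub>R snd p) - \<xi> (fst p))\<^sup>2 * (\<rho> (fst p) * gauss 1 (snd p)) / X i" for p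
      using Xp[of i] by (simp add: power_divide)
    then show ?thesis by (simp add: jump_def)
  qed
  ultimately show "((\<lambda>r. jump \<xi> r / r) \<circ> X) \<longlonglongrightarrow> (LINT y|lborel. (norm (G y))\<^sup>2 * \<rho> y)"
    by (simp add: comp_def)
qed

text \<open>Truncation followed by pointwise approximation of a measurable function by continuous ones.\<close>

lemma bounded_continuous_dense:
  assumes \<phi>: "sq_int \<phi>" and e: "0 < e"
  shows "\<exists>\<xi>. continuous_on UNIV \<xi> \<and> bounded_fun \<xi> \<and> mass0 (\<lambda>x. \<phi> x - \<xi> x) < e"
proof -
  have [measurable]: "\<phi> \<in> borel_measurable borel" by (rule sq_int_measurable[OF \<phi>])
  have sw: "mass0 (\<lambda>x. f x - g x) = mass0 (\<lambda>x. g x - f x)" for f g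
    by (simp add: mass0_def power2_commute)
  have "\<exists>N. \<forall>n\<ge>N. norm (mass0 (\<lambda>x. trunc n \<phi> x - \<phi> x) - 0) < e / 4"
    using e by (intro LIMSEQ_D[OF mass0_trunc_tendsto[OF \<phi>]]) simp
  then obtain n where "norm (mass0 (\<lambda>x. trunc n \<phi> x - \<phi> x) - 0) < e / 4" by blast
  then have n: "mass0 (\<lambda>x. \<phi> x - trunc n \<phi> x) < e / 4"
    using sw[of \<phi> "trunc n \<phi>"] by simp
  define \<psi> where "\<psi> = trunc n \<phi>"
  have \<psi>: "bounded_fun \<psi>" unfolding \<psi>_def by (intro trunc_bounded) measurable
  then have [measurable]: "\<psi> \<in> borel_measurable borel" by (simp add: bounded_fun_def)
  have \<psi>n: "\<bar>\<psi> x\<bar> \<le> real n" for x by (auto simp: \<psi>_def trunc_def)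
  have "\<psi> measurable_on UNIV"
    by (rule lebesgue_measurable_imp_measurable_on) (auto intro: measurable_completion)
  then obtain N g where N: "negligible N" and g: "\<And>k. continuous_on UNIV (g k)"
    and lim: "\<And>x. x \<notin> N \<Longrightarrow> (\<lambda>k. g k x) \<longlonglongrightarrow> \<psi> x"
    unfolding measurable_on_def by auto
  define h where "h k x = max (- real n) (min (real n) (g k x))" for k :: nat and x
  have h: "continuous_on UNIV (h k)" "bounded_fun (h k)" and hn: "\<bar>h k x\<bar> \<le> real n" for k x
  proof -
    show c: "continuous_on UNIV (h k)" unfolding h_def[abs_def] by (intro continuous_intros g)
    show b: "\<bar>h k x\<bar> \<le> real n" for x by (auto simp: h_def)
    show "bounded_fun (h k)" using b borel_measurable_continuous_onI[OF c] by (auto simp: bounded_fun_def)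
  qed
  have [measurable]: "h k \<in> borel_measurable borel" for k by (rule borel_measurable_continuous_onI[OF h(1)])
  have hlim: "(\<lambda>k. h k x) \<longlonglongrightarrow> \<psi> x" if "x \<notin> N" for x
  proof -
    have "(\<lambda>k. h k x) \<longlonglongrightarrow> max (- real n) (min (real n) (\<psi> x))"
      unfolding h_def by (intro tendsto_intros lim that)
    moreover have "max (- real n) (min (real n) (\<psi> x)) = \<psi> x" using \<psi>n[of x] by auto
    ultimately show ?thesis by simp
  qed
  have "AE x in lebesgue. x \<notin> N" using N by (simp add: negligible_iff_null_sets AE_not_in)
  then have AEN: "AE x in lborel. x \<notin> N" by (simp add: AE_completion_iff)
  have "(\<lambda>k. mass0 (\<lambda>x. \<psi> x - h k x)) \<longlonglongrightarrow> (LINT x|(lborel :: 'a measure). 0)"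
    unfolding mass0_def
  proof (rule integral_dominated_convergence[where w="\<lambda>x. (2 * real n)\<^sup>2 * \<rho> x"])
    show "integrable lborel (\<lambda>x. (2 * real n)\<^sup>2 * \<rho> x)" using integrable by simp
    show "AE x in lborel. (\<lambda>k. (\<psi> x - h k x)\<^sup>2 * \<rho> x) \<longlonglongrightarrow> 0"
      using AEN
    proof eventually_elim
      case (elim x)
      have "(\<lambda>k. (\<psi> x - h k x)\<^sup>2 * \<rho> x) \<longlonglongrightarrow> (\<psi> x - \<psi> x)\<^sup>2 * \<rho> x"
        by (intro tendsto_intros hlim elim)
      then show ?case by simp
    qed
    show "AE x in lborel. norm ((\<psi> x - h k x)\<^sup>2 * \<rho> x) \<le> (2 * real n)\<^sup>2 * \<rho> x" for k
    proof (rule AE_I2)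
      fix x
      have "(\<psi> x - h k x)\<^sup>2 \<le> (2 * real n)\<^sup>2"
        using \<psi>n[of x] hn[of k x] by (intro abs_le_square_iff[THEN iffD1]) auto
      from mult_right_mono[OF this nonneg[of x]]
      show "norm ((\<psi> x - h k x)\<^sup>2 * \<rho> x) \<le> (2 * real n)\<^sup>2 * \<rho> x" using nonneg[of x] by simp
    qed
  qed measurable
  then have "(\<lambda>k. mass0 (\<lambda>x. \<psi> x - h k x)) \<longlonglongrightarrow> 0" by simp
  then have "\<exists>N. \<forall>k\<ge>N. norm (mass0 (\<lambda>x. \<psi> x - h k x) - 0) < e / 4"
    using e by (intro LIMSEQ_D) simp_all
  then obtain k where "norm (mass0 (\<lambda>x. \<psi> x - h k x) - 0) < e / 4" by blast
  then have k: "mass0 (\<lambda>x. \<psi> x - h k x) < e / 4" by simp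
  have i: "sq_int (\<lambda>x. \<phi> x - \<psi> x)" "sq_int (\<lambda>x. \<psi> x - h k x)" "sq_int (\<lambda>x. \<phi> x - h k x)"
    by (intro sq_int_diff \<phi> bounded_sq_int \<psi> h)+
  have "mass0 (\<lambda>x. \<phi> x - h k x) \<le> (LINT x|lborel. 2 * ((\<phi> x - \<psi> x)\<^sup>2 * \<rho> x) + 2 * ((\<psi> x - h k x)\<^sup>2 * \<rho> x))"
    unfolding mass0_def
  proof (rule integral_mono)
    fix x
    have "(\<phi> x - h k x)\<^sup>2 \<le> 2 * (\<phi> x - \<psi> x)\<^sup>2 + 2 * (\<psi> x - h k x)\<^sup>2"
      using zero_le_power2[of "(\<phi> x - \<psi> x) - (\<psi> x - h k x)"] by (simp add: power2_eq_square algebra_simps)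
    from mult_right_mono[OF this nonneg[of x]]
    show "(\<phi> x - h k x)\<^sup>2 * \<rho> x \<le> 2 * ((\<phi> x - \<psi> x)\<^sup>2 * \<rho> x) + 2 * ((\<psi> x - h k x)\<^sup>2 * \<rho> x)"
      by (simp add: algebra_simps)
  qed (use i[THEN sq_int_sq_integrable] in simp_all)
  also have "\<dots> = 2 * mass0 (\<lambda>x. \<phi> x - \<psi> x) + 2 * mass0 (\<lambda>x. \<psi> x - h k x)"
    using i[THEN sq_int_sq_integrable] by (simp add: mass0_def)
  also have "\<dots> < e" using n k by (simp add: \<psi>_def)
  finally show ?thesis using h by blast
qed

text \<open>Both masses are squared norms of linear images of \<open>\<phi>\<close>. Applied to \<open>\<xi>\<close> and \<open>\<phi> - \<xi>\<close>, the law
  bounds the loss of mass of \<open>\<phi>\<close> by the loss of mass of \<open>\<xi>\<close> and the initial mass of \<open>\<phi> - \<xi>\<close>.\<close>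

lemma mass_parallelogram:
  assumes f: "sq_int f" and g: "sq_int g" and s: "0 < s"
  shows "mass (\<lambda>x. f x + g x) s + mass (\<lambda>x. f x - g x) s = 2 * mass f s + 2 * mass g s"
    and "mass0 (\<lambda>x. f x + g x) + mass0 (\<lambda>x. f x - g x) = 2 * mass0 f + 2 * mass0 g"
proof -
  have pl: "sq_int (\<lambda>x. f x + g x)" and mi: "sq_int (\<lambda>x. f x - g x)" by (intro sq_int_add sq_int_diff f g)+
  have p: "mean (\<lambda>x. f x + g x) s x = mean f s x + mean g s x" for x
    using mean_diff[OF pl g s, of x] by simp
  note m = mean_diff[OF f g s]
  have "mass (\<lambda>x. f x + g x) s + mass (\<lambda>x. f x - g x) s
      = (LINT x|lborel. (mean f s x + mean g s x)\<^sup>2 * evol s x + (mean f s x - mean g s x)\<^sup>2 * evol s x)"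
    using integrable_mean_sq[OF pl s] integrable_mean_sq[OF mi s] by (simp add: mass_def p m)
  also have "\<dots> = (LINT x|lborel. 2 * ((mean f s x)\<^sup>2 * evol s x) + 2 * ((mean g s x)\<^sup>2 * evol s x))"
    by (simp add: power2_eq_square algebra_simps)
  also have "\<dots> = 2 * mass f s + 2 * mass g s"
    using integrable_mean_sq[OF f s] integrable_mean_sq[OF g s] by (simp add: mass_def)
  finally show "mass (\<lambda>x. f x + g x) s + mass (\<lambda>x. f x - g x) s = 2 * mass f s + 2 * mass g s" .
  have "mass0 (\<lambda>x. f x + g x) + mass0 (\<lambda>x. f x - g x)
      = (LINT x|lborel. (f x + g x)\<^sup>2 * \<rho> x + (f x - g x)\<^sup>2 * \<rho> x)"
    using sq_int_sq_integrable[OF pl] sq_int_sq_integrable[OF mi] by (simp add: mass0_def)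
  also have "\<dots> = (LINT x|lborel. 2 * ((f x)\<^sup>2 * \<rho> x) + 2 * ((g x)\<^sup>2 * \<rho> x))"
    by (simp add: power2_eq_square algebra_simps)
  also have "\<dots> = 2 * mass0 f + 2 * mass0 g"
    using sq_int_sq_integrable[OF f] sq_int_sq_integrable[OF g] by (simp add: mass0_def)
  finally show "mass0 (\<lambda>x. f x + g x) + mass0 (\<lambda>x. f x - g x) = 2 * mass0 f + 2 * mass0 g" .
qed

end

context concave_evolution begin

text \<open>Strong continuity of \<open>Q\<^sub>s\<close> at 0: for continuous bounded functions the loss of mass is at
  most the mean square displacement, and these functions are dense.\<close>

lemma mass_tendsto_mass0:
  assumes \<phi>: "sq_int \<phi>"
  shows "(mass \<phi> \<longlongrightarrow> mass0 \<phi>) (at_right 0)"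
proof (rule tendstoI)
  fix e :: real assume e: "0 < e"
  obtain \<xi> where \<xi>: "continuous_on UNIV \<xi>" "bounded_fun \<xi>" "mass0 (\<lambda>x. \<phi> x - \<xi> x) < e / 4"
    using bounded_continuous_dense[OF \<phi>, of "e / 4"] e by auto
  have "\<forall>\<^sub>F r in at_right 0. dist (jump \<xi> r) 0 < e / 4"
    using e by (intro tendstoD[OF jump_tendsto_0[OF \<xi>(1,2)]]) simp
  moreover have "\<forall>\<^sub>F r::real in at_right 0. 0 < r" by (simp add: eventually_at_right_less)
  ultimately show "\<forall>\<^sub>F r in at_right 0. dist (mass \<phi> r) (mass0 \<phi>) < e"
  proof eventually_elim
    case (elim r)
    note c = bounded_sq_int[OF \<xi>(2)]
    have d: "sq_int (\<lambda>x. \<phi> x - \<xi> x)" by (intro sq_int_diff \<phi> c)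
    have m: "sq_int (\<lambda>x. \<xi> x - (\<phi> x - \<xi> x))" by (intro sq_int_diff \<phi> c)
    have "mass \<phi> r + mass (\<lambda>x. \<xi> x - (\<phi> x - \<xi> x)) r = 2 * mass \<xi> r + 2 * mass (\<lambda>x. \<phi> x - \<xi> x) r"
      "mass0 \<phi> + mass0 (\<lambda>x. \<xi> x - (\<phi> x - \<xi> x)) = 2 * mass0 \<xi> + 2 * mass0 (\<lambda>x. \<phi> x - \<xi> x)"
      using mass_parallelogram[OF c d elim(2)] by simp_all
    moreover have "mass (\<lambda>x. \<xi> x - (\<phi> x - \<xi> x)) r \<le> mass0 (\<lambda>x. \<xi> x - (\<phi> x - \<xi> x))"
      by (rule mass_le_mass0[OF m elim(2)])
    moreover have "mass0 \<xi> - mass \<xi> r \<le> jump \<xi> r" by (rule mass0_diff_mass_le_jump[OF \<xi>(2) elim(2)])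
    moreover have "0 \<le> mass (\<lambda>x. \<phi> x - \<xi> x) r" by (rule mass_nonneg[OF elim(2)])
    moreover have "mass \<phi> r \<le> mass0 \<phi>" by (rule mass_le_mass0[OF \<phi> elim(2)])
    moreover have "jump \<xi> r < e / 4" using elim(1) by simp
    ultimately show ?case using \<xi>(3) by (simp add: dist_real_def)
  qed
qed

text \<open>Backward uniqueness. If the mass vanished at \<open>s\<close>, then \<open>ln (mass + \<epsilon>)\<close> would tend to \<open>- \<infinity>\<close>
  there as \<open>\<epsilon> \<rightarrow> 0\<close>, and convexity would force this at every time in \<open>(0, s)\<close>; but the mass tends
  to the positive number \<open>mass0 \<phi>\<close> as time tends to 0.\<close>

lemma mass_pos:
  assumes \<phi>: "sq_int \<phi>" and 0: "0 < mass0 \<phi>" and s: "0 < s"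
  shows "0 < mass \<phi> s"
proof (rule ccontr)
  assume "\<not> 0 < mass \<phi> s"
  then have ms: "mass \<phi> s = 0" using mass_nonneg[OF s, of \<phi>] by simp
  have zero: "mass \<phi> r = 0" if r: "0 < r" "r < s" for r
  proof (rule ccontr)
    assume "mass \<phi> r \<noteq> 0"
    then have mr: "0 < mass \<phi> r" using mass_nonneg[OF r(1), of \<phi>] by simp
    define a where "a = r / 2"
    define t where "t = (r - a) / (s - a)"
    have t: "0 < t" "t < 1" using r by (auto simp: t_def a_def field_simps)
    have a: "0 < a" "a < s" using r by (auto simp: a_def)
    have "t * (s - a) = r - a" using a by (simp add: t_def)
    then have rt: "r = (1 - t) *\<^sub>R a + t *\<^sub>R s" by (simp add: algebra_simps)
    define c where "c = ln (mass \<phi> r) - (1 - t) * ln (mass \<phi> a + 1)"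
    define \<epsilon> where "\<epsilon> = min 1 (exp ((c - 1) / t))"
    have \<epsilon>: "0 < \<epsilon>" "\<epsilon> \<le> 1" by (auto simp: \<epsilon>_def)
    have "ln (mass \<phi> r) \<le> ln (mass \<phi> r + \<epsilon>)" using mr \<epsilon> by simp
    also have "\<dots> \<le> (1 - t) * ln (mass \<phi> a + \<epsilon>) + t * ln (mass \<phi> s + \<epsilon>)"
      unfolding rt using convex_onD[OF convex_ln_mass_regularized[OF \<phi> \<epsilon>(1)], of t a s] t a s by simp
    also have "\<dots> \<le> (1 - t) * ln (mass \<phi> a + 1) + t * ((c - 1) / t)"
    proof (intro add_mono mult_left_mono)
      show "ln (mass \<phi> a + \<epsilon>) \<le> ln (mass \<phi> a + 1)"
        using \<epsilon> mass_nonneg[OF a(1), of \<phi>] by (subst ln_le_cancel_iff) auto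
      have "ln \<epsilon> \<le> ln (exp ((c - 1) / t))"
        using \<epsilon> by (subst ln_le_cancel_iff) (auto simp: \<epsilon>_def)
      then show "ln (mass \<phi> s + \<epsilon>) \<le> (c - 1) / t" by (simp add: ms)
    qed (use t in auto)
    finally show False using t by (simp add: c_def)
  qed
  have "(mass \<phi> \<longlongrightarrow> 0) (at_right 0)"
  proof (rule tendsto_eventually)
    have "\<forall>\<^sub>F r in at_right 0. r < s" using s by (rule eventually_at_right_real[THEN eventually_mono]) auto
    moreover have "\<forall>\<^sub>F r::real in at_right 0. 0 < r" by (simp add: eventually_at_right_less)
    ultimately show "\<forall>\<^sub>F r in at_right 0. mass \<phi> r = 0" by eventually_elim (rule zero)
  qed
  then have "mass0 \<phi> = 0"
    using tendsto_unique[OF trivial_limit_at_right_real mass_tendsto_mass0[OF \<phi>]] by blast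
  then show False using 0 by simp
qed

lemma convex_ln_mass:
  assumes \<phi>: "sq_int \<phi>" and 0: "0 < mass0 \<phi>"
  shows "convex_on {0<..} (\<lambda>s. ln (mass \<phi> s))"
proof (rule convex_onI)
  fix t x y :: real assume t: "0 < t" "t < 1" and xy: "x \<in> {0<..}" "y \<in> {0<..}"
  let ?\<epsilon> = "\<lambda>n. inverse (real (Suc n))"
  have L: "(\<lambda>n. ln (mass \<phi> s + ?\<epsilon> n)) \<longlonglongrightarrow> ln (mass \<phi> s)" if "0 < s" for s
  proof -
    have "(\<lambda>n. ln (mass \<phi> s + ?\<epsilon> n)) \<longlonglongrightarrow> ln (mass \<phi> s + 0)"
      using mass_pos[OF \<phi> 0 that] by (intro tendsto_intros LIMSEQ_inverse_real_of_nat) auto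
    then show ?thesis by simp
  qed
  show "ln (mass \<phi> ((1 - t) *\<^sub>R x + t *\<^sub>R y)) \<le> (1 - t) * ln (mass \<phi> x) + t * ln (mass \<phi> y)"
  proof (rule LIMSEQ_le)
    show "(\<lambda>n. ln (mass \<phi> ((1 - t) *\<^sub>R x + t *\<^sub>R y) + ?\<epsilon> n)) \<longlonglongrightarrow> ln (mass \<phi> ((1 - t) *\<^sub>R x + t *\<^sub>R y))"
      using t xy by (intro L) (simp add: add_pos_pos)
    show "(\<lambda>n. (1 - t) * ln (mass \<phi> x + ?\<epsilon> n) + t * ln (mass \<phi> y + ?\<epsilon> n))
        \<longlonglongrightarrow> (1 - t) * ln (mass \<phi> x) + t * ln (mass \<phi> y)"
      using xy by (intro tendsto_intros L) auto
    show "\<exists>N. \<forall>n\<ge>N. ln (mass \<phi> ((1 - t) *\<^sub>R x + t *\<^sub>R y) + ?\<epsilon> n)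
        \<le> (1 - t) * ln (mass \<phi> x + ?\<epsilon> n) + t * ln (mass \<phi> y + ?\<epsilon> n)"
      using convex_onD[OF convex_ln_mass_regularized[OF \<phi>], of "?\<epsilon> n" t x y for n] t xy by auto
  qed
qed (rule convex_real_interval)

text \<open>For small \<open>r\<close> the energy at \<open>s\<close> is at most the energy at \<open>r\<close>, hence at most the mean loss of
  mass per unit of time up to \<open>r\<close>, hence at most \<open>jump \<xi> r / r\<close>, which tends to the initial
  energy.\<close>

lemma energy_le_smooth:
  assumes b: "bounded_fun \<xi>" and [measurable]: "G \<in> borel_measurable borel" "U \<in> sets borel"
    and lip: "\<And>x y. \<bar>\<xi> x - \<xi> y\<bar> \<le> L * norm (x - y)"
    and U: "AE y in lborel. \<rho> y \<noteq> 0 \<longrightarrow> y \<in> U"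
    and der: "\<And>y z. y \<in> U \<Longrightarrow> ((\<lambda>t. \<xi> (y + t *\<^sub>R z)) has_real_derivative G y \<bullet> z) (at 0)"
    and s: "0 < s"
  shows "energy \<xi> s \<le> (LINT y|lborel. (norm (G y))\<^sup>2 * \<rho> y)"
proof (rule tendsto_lowerbound[OF jump_quotient_tendsto[OF _ _ _ lip U der]])
  have "\<forall>\<^sub>F r in at_right 0. r < s" using s by (rule eventually_at_right_real[THEN eventually_mono]) auto
  moreover have "\<forall>\<^sub>F r::real in at_right 0. 0 < r" by (simp add: eventually_at_right_less)
  ultimately show "\<forall>\<^sub>F r in at_right 0. energy \<xi> s \<le> jump \<xi> r / r"
  proof eventually_elim
    case (elim r)
    have "energy \<xi> s \<le> energy \<xi> r" using elim by (intro energy_antimono[OF b]) auto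
    moreover have "r * energy \<xi> r \<le> jump \<xi> r"
      using energy_le_mass0_drop[OF b elim(2)] mass0_diff_mass_le_jump[OF b elim(2)] by simp
    ultimately show ?case using elim(2) by (simp add: field_simps) (meson mult_left_mono less_imp_le order.trans)
  qed
qed (use b in \<open>auto simp: bounded_fun_def\<close>)

end

section \<open>Smooth functions and test functions\<close>

lemma C_k_Suc_imp: "C_k (Suc k) f \<Longrightarrow> C_k k f"
proof (induction k arbitrary: f)
  case 0
  then show ?case
    by (auto intro!: differentiable_imp_continuous_on simp: differentiable_on_def differentiable_at_withinI)
next
  case (Suc k)
  then show ?case by (metis C_k.simps(2))
qed

lemma C_k_const: "C_k k (\<lambda>x. c)"
  by (induction k arbitrary: c) auto

lemma C_k_SucI:
  assumes "\<And>x. (f has_derivative f' x) (at x)" "\<And>v. C_k k (\<lambda>x. f' x v)"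
  shows "C_k (Suc k) f"
proof -
  have "frechet_derivative f (at x) = f' x" for x
    using frechet_derivative_at[OF assms(1)] by simp
  then show ?thesis using assms by (auto simp: differentiable_def)
qed

lemma C_k_SucD: "C_k (Suc k) f \<Longrightarrow> (f has_derivative frechet_derivative f (at x)) (at x)"
  by (simp add: frechet_derivative_works)

lemma C_k_add: "C_k k f \<Longrightarrow> C_k k g \<Longrightarrow> C_k k (\<lambda>x. f x + g x)"
proof (induction k arbitrary: f g)
  case 0 then show ?case by (simp add: continuous_on_add)
next
  case (Suc k)
  show ?case
    by (rule C_k_SucI[OF has_derivative_add[OF C_k_SucD[OF Suc.prems(1)] C_k_SucD[OF Suc.prems(2)]]])
       (use Suc in auto)
qed

lemma C_k_mult: "C_k k f \<Longrightarrow> C_k k g \<Longrightarrow> C_k k (\<lambda>x. f x * g x)"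
proof (induction k arbitrary: f g)
  case 0 then show ?case by (simp add: continuous_on_mult)
next
  case (Suc k)
  show ?case
    by (rule C_k_SucI[OF has_derivative_mult[OF C_k_SucD[OF Suc.prems(1)] C_k_SucD[OF Suc.prems(2)]]])
       (intro C_k_add Suc.IH, use Suc.prems C_k_Suc_imp in auto)
qed

lemma C_k_prod: "finite I \<Longrightarrow> (\<And>i. i \<in> I \<Longrightarrow> C_k k (f i)) \<Longrightarrow> C_k k (\<lambda>x. \<Prod>i\<in>I. f i x)"
  by (induction I rule: finite_induct) (auto intro: C_k_const C_k_mult)

lemma C_k_inner: "C_k k (\<lambda>x. x \<bullet> v)"
proof (cases k)
  case (Suc j)
  have d: "((\<lambda>x. x \<bullet> v) has_derivative (\<lambda>h. h \<bullet> v)) (at x)" for x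
    by (intro has_derivative_inner_left has_derivative_ident)
  show ?thesis unfolding Suc by (rule C_k_SucI[OF d C_k_const])
qed (auto intro!: continuous_intros)

text \<open>The derivatives of the outer function are supplied as a sequence \<open>G\<close>, which keeps the
  induction on \<open>k\<close> free of higher derivatives of composed functions.\<close>

lemma C_k_compose:
  assumes G: "\<And>j t. (G j has_real_derivative G (Suc j) t) (at t)"
  shows "C_k k f \<Longrightarrow> C_k k (\<lambda>x. G j (f x))"
proof (induction k arbitrary: f j)
  case 0
  have "continuous_on UNIV (G j)"
    using G by (intro continuous_at_imp_continuous_on ballI DERIV_isCont) blast
  then show ?case using 0 by (auto intro: continuous_on_compose2)
next
  case (Suc k)
  have d: "((\<lambda>x. G j (f x)) has_derivative (\<lambda>h. frechet_derivative f (at x) h * G (Suc j) (f x))) (at x)" for x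
    using has_derivative_compose[OF C_k_SucD[OF Suc.prems] G[unfolded has_field_derivative_def]]
    by (simp add: mult.commute)
  show ?case
    by (rule C_k_SucI[OF d], intro C_k_mult Suc.IH) (use Suc.prems C_k_Suc_imp in auto)
qed

lemma C_k_affine: "C_k k \<psi> \<Longrightarrow> C_k k (\<lambda>x. \<psi> (t + c *\<^sub>R x))"
proof (induction k arbitrary: \<psi>)
  case 0
  then show ?case by (auto intro!: continuous_on_compose2[of UNIV \<psi>] continuous_intros)
next
  case (Suc k)
  have d: "((\<lambda>x. \<psi> (t + c *\<^sub>R x)) has_derivative (\<lambda>h. c * frechet_derivative \<psi> (at (t + c *\<^sub>R x)) h)) (at x)" for x
  proof -
    have "((\<lambda>x. t + c *\<^sub>R x) has_derivative (\<lambda>h. c *\<^sub>R h)) (at x)"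
      by (auto intro!: derivative_eq_intros)
    from has_derivative_compose[OF this C_k_SucD[OF Suc.prems]]
    have "((\<lambda>x. \<psi> (t + c *\<^sub>R x)) has_derivative (\<lambda>h. frechet_derivative \<psi> (at (t + c *\<^sub>R x)) (c *\<^sub>R h))) (at x)" .
    moreover have "linear (frechet_derivative \<psi> (at y))" for y
      using Suc.prems by (simp add: linear_frechet_derivative)
    ultimately show ?thesis by (simp add: linear_cmul)
  qed
  have "C_k k (\<lambda>x. frechet_derivative \<psi> (at x) v)" for v using Suc.prems by simp
  from C_k_mult[OF C_k_const Suc.IH[OF this]] show ?case by (intro C_k_SucI[OF d])
qed

text \<open>\<open>flat j\<close> is the derivative of order \<open>j\<close> of the smooth function \<open>exp (- 1 / t)\<close>, extended by
  0 to \<open>t \<le> 0\<close>. In the variable \<open>u = 1 / t\<close> differentiation sends \<open>p(u) exp (- u)\<close> to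
  \<open>u\<^sup>2 (p(u) - p'(u)) exp (- u)\<close>, whence the recursion.\<close>

fun flat_poly :: "nat \<Rightarrow> real poly" where
  "flat_poly 0 = 1"
| "flat_poly (Suc j) = [:0, 0, 1:] * (flat_poly j - pderiv (flat_poly j))"

definition flat :: "nat \<Rightarrow> real \<Rightarrow> real" where
  "flat j t = (if t \<le> 0 then 0 else poly (flat_poly j) (inverse t) * exp (- inverse t))"

lemma poly_times_exp_tendsto_0: "((\<lambda>y. poly q y * exp (- y)) \<longlongrightarrow> (0::real)) at_top"
proof -
  have "((\<lambda>y. \<Sum>i\<le>degree q. coeff q i * (y ^ i / exp y)) \<longlongrightarrow> (\<Sum>i\<le>degree q. coeff q i * 0)) at_top"
    by (intro tendsto_sum tendsto_mult tendsto_const tendsto_power_div_exp_0)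
  moreover have "poly q y * exp (- y) = (\<Sum>i\<le>degree q. coeff q i * (y ^ i / exp y))" for y
    by (simp add: poly_altdef sum_distrib_right exp_minus divide_inverse mult.assoc)
  ultimately show ?thesis by simp
qed

lemma flat_deriv: "(flat j has_real_derivative flat (Suc j) t) (at t)"
proof -
  consider "t < 0" | "t = 0" | "0 < t" by linarith
  then show ?thesis
  proof cases
    case 1
    have "((\<lambda>_. 0) has_real_derivative 0) (at t)" by simp
    then have "(flat j has_real_derivative 0) (at t)"
      by (rule has_field_derivative_transform_within_open[of _ _ _ "{..<0}"]) (use 1 in \<open>auto simp: flat_def\<close>)
    then show ?thesis using 1 by (simp add: flat_def)
  next
    case 3
    have "((\<lambda>t. poly (flat_poly j) (inverse t) * exp (- inverse t)) has_real_derivative flat (Suc j) t) (at t)"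
      using 3 by (auto intro!: derivative_eq_intros DERIV_chain2[OF poly_DERIV] simp: flat_def field_simps power2_eq_square)
    then show ?thesis
      by (rule has_field_derivative_transform_within_open[of _ _ _ "{0<..}"]) (use 3 in \<open>auto simp: flat_def\<close>)
  next
    case 2
    have "((\<lambda>h. flat j h / h) \<longlongrightarrow> 0) (at 0)"
    proof (rule filterlim_split_at)
      show "((\<lambda>h. flat j h / h) \<longlongrightarrow> 0) (at_left 0)"
        by (rule tendsto_eventually) (auto simp: eventually_at_left_field flat_def intro!: exI[of _ "-1"])
      have "((\<lambda>h. poly ([:0, 1:] * flat_poly j) (inverse h) * exp (- inverse h)) \<longlongrightarrow> 0) (at_right 0)"
        by (rule filterlim_compose[OF poly_times_exp_tendsto_0 filterlim_inverse_at_top_right])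
      moreover have "\<forall>\<^sub>F h in at_right 0. poly ([:0, 1:] * flat_poly j) (inverse h) * exp (- inverse h) = flat j h / h"
        using eventually_at_right_less[of "0::real"] by eventually_elim (simp add: flat_def field_simps)
      ultimately show "((\<lambda>h. flat j h / h) \<longlongrightarrow> 0) (at_right 0)"
        by (rule Lim_transform_eventually)
    qed
    then show ?thesis unfolding 2 by (simp add: has_field_derivative_iff flat_def)
  qed
qed

lemma flat_pos_iff: "0 < flat 0 t \<longleftrightarrow> 0 < t"
  by (auto simp: flat_def)

lemma flat_nonneg: "0 \<le> flat 0 t"
  by (simp add: flat_def)

definition bump :: "'a::euclidean_space \<Rightarrow> 'a \<Rightarrow> 'a \<Rightarrow> real" where
  "bump a b x = (\<Prod>i\<in>Basis. flat 0 (x \<bullet> i - a \<bullet> i) * flat 0 (b \<bullet> i - x \<bullet> i))"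

lemma bump_nonneg: "0 \<le> bump a b x"
  unfolding bump_def by (intro prod_nonneg mult_nonneg_nonneg flat_nonneg ballI)

lemma bump_pos_iff: "0 < bump a b x \<longleftrightarrow> x \<in> box a b"
proof
  assume "0 < bump a b x"
  then have "bump a b x \<noteq> 0" by simp
  then have "flat 0 (x \<bullet> i - a \<bullet> i) \<noteq> 0 \<and> flat 0 (b \<bullet> i - x \<bullet> i) \<noteq> 0" if "i \<in> Basis" for i
    using that by (auto simp: bump_def)
  then have "0 < flat 0 (x \<bullet> i - a \<bullet> i) \<and> 0 < flat 0 (b \<bullet> i - x \<bullet> i)" if "i \<in> Basis" for i
    using that flat_nonneg by (metis less_eq_real_def)
  then show "x \<in> box a b" by (simp add: mem_box flat_pos_iff)
next
  assume "x \<in> box a b"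
  then show "0 < bump a b x"
    unfolding bump_def by (intro prod_pos ballI mult_pos_pos) (auto simp: mem_box flat_pos_iff)
qed

lemma bump_eq_0_iff: "bump a b x = 0 \<longleftrightarrow> x \<notin> box a b"
  using bump_pos_iff[of a b x] bump_nonneg[of a b x] by linarith

lemma smooth_bump: "C_k k (bump a b)"
proof -
  have 1: "C_k k (\<lambda>x. flat 0 (x \<bullet> i - a \<bullet> i))" for i
    using C_k_compose[where G=flat and j=0, OF flat_deriv C_k_add[OF C_k_inner[of k i] C_k_const[of k "- (a \<bullet> i)"]]] by simp
  have "C_k k (\<lambda>x. (-1) * (x \<bullet> i) + b \<bullet> i)" for i
    by (intro C_k_add C_k_mult C_k_const C_k_inner)
  from C_k_compose[where G=flat and j=0, OF flat_deriv this]
  have 2: "C_k k (\<lambda>x. flat 0 (b \<bullet> i - x \<bullet> i))" for i by simp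
  show ?thesis unfolding bump_def[abs_def] by (intro C_k_prod C_k_mult 1 2 finite_Basis)
qed

lemma test_functionsI:
  assumes "\<And>k. C_k k \<psi>" "\<And>x. \<psi> x \<noteq> 0 \<Longrightarrow> x \<in> C" "compact C" "C \<subseteq> U"
  shows "\<psi> \<in> test_functions U"
proof -
  have "closure {x. \<psi> x \<noteq> 0} \<subseteq> C"
    using assms(2) compact_imp_closed[OF assms(3)] by (intro closure_minimal) auto
  moreover have "compact (closure {x. \<psi> x \<noteq> 0})"
    unfolding compact_closure
    by (rule bounded_subset[OF compact_imp_bounded[OF assms(3)]]) (use assms(2) in blast)
  ultimately show ?thesis
    using assms(1,4) by (simp add: test_functions_def order.trans)
qed

lemma test_functionsD:
  assumes "\<psi> \<in> test_functions U"
  shows "C_k k \<psi>" "compact (closure {x. \<psi> x \<noteq> 0})" "closure {x. \<psi> x \<noteq> 0} \<subseteq> U"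
  using assms by (auto simp: test_functions_def)

lemma test_function_continuous: "\<psi> \<in> test_functions U \<Longrightarrow> continuous_on UNIV \<psi>"
  using test_functionsD(1)[of \<psi> U 0] by simp

lemma test_function_derivative:
  assumes "\<psi> \<in> test_functions U"
  shows "(\<psi> has_derivative frechet_derivative \<psi> (at x)) (at x)"
    and "continuous_on UNIV (\<lambda>x. frechet_derivative \<psi> (at x) b)"
    and "x \<notin> closure {x. \<psi> x \<noteq> 0} \<Longrightarrow> frechet_derivative \<psi> (at x) b = 0"
proof -
  show "(\<psi> has_derivative frechet_derivative \<psi> (at x)) (at x)"
    using C_k_SucD[OF test_functionsD(1)[OF assms, of "Suc 0"]] .
  show "continuous_on UNIV (\<lambda>x. frechet_derivative \<psi> (at x) b)"
    using test_functionsD(1)[OF assms, of "Suc 0"] by simp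
  assume x: "x \<notin> closure {x. \<psi> x \<noteq> 0}"
  have "((\<lambda>_. 0) has_derivative (\<lambda>_. 0)) (at x)" by simp
  then have "(\<psi> has_derivative (\<lambda>_. 0)) (at x)"
  proof (rule has_derivative_transform_within_open)
    show "open (- closure {x. \<psi> x \<noteq> 0})" by (simp add: open_Compl)
    show "0 = \<psi> y" if "y \<in> - closure {x. \<psi> x \<noteq> 0}" for y
      using closure_subset[of "{x. \<psi> x \<noteq> 0}"] that by auto
  qed (use x in simp)
  from frechet_derivative_at[OF this] show "frechet_derivative \<psi> (at x) b = 0" by metis
qed

lemma continuous_compact_support_bounded:
  fixes f :: "'a::euclidean_space \<Rightarrow> real"
  assumes "continuous_on UNIV f" "compact C" "\<And>x. x \<notin> C \<Longrightarrow> f x = 0"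
  shows "\<exists>B. \<forall>x. \<bar>f x\<bar> \<le> B"
proof -
  have "compact (f ` C)" using assms by (intro compact_continuous_image) (auto intro: continuous_on_subset)
  then obtain B where B: "\<And>x. x \<in> C \<Longrightarrow> \<bar>f x\<bar> \<le> B"
    using compact_imp_bounded bounded_real by (metis imageI)
  have "\<bar>f x\<bar> \<le> max B 0" for x using B[of x] assms(3)[of x] by (cases "x \<in> C") auto
  then show ?thesis by blast
qed

lemma integrable_mult_compact_support:
  fixes f :: "'a::euclidean_space \<Rightarrow> real"
  assumes f: "set_integrable lborel C f" and \<psi>: "continuous_on UNIV \<psi>" and C: "compact C" "\<And>x. x \<notin> C \<Longrightarrow> \<psi> x = 0"
  shows "integrable lborel (\<lambda>x. f x * \<psi> x)"
proof -
  obtain B where B: "\<And>x. \<bar>\<psi> x\<bar> \<le> B" using continuous_compact_support_bounded[OF \<psi> C] by blast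
  have [measurable]: "\<psi> \<in> borel_measurable borel" by (rule borel_measurable_continuous_onI[OF \<psi>])
  have f': "integrable lborel (\<lambda>x. indicator C x *\<^sub>R f x)" using f by (simp add: set_integrable_def)
  have [measurable]: "(\<lambda>x. indicator C x *\<^sub>R f x) \<in> borel_measurable borel" using f' by auto
  have eq: "(\<lambda>x. f x * \<psi> x) = (\<lambda>x. (indicator C x *\<^sub>R f x) * \<psi> x)"
    using C(2) by (auto simp: fun_eq_iff indicator_def)
  show ?thesis
    unfolding eq
  proof (rule Bochner_Integration.integrable_bound)
    show "integrable lborel (\<lambda>x. (indicator C x *\<^sub>R f x) * B)" using f' by simp
    show "AE x in lborel. norm ((indicator C x *\<^sub>R f x) * \<psi> x) \<le> norm ((indicator C x *\<^sub>R f x) * B)"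
      using order.trans[OF B abs_ge_self] by (intro AE_I2) (auto simp: abs_mult intro!: mult_left_mono)
    show "(\<lambda>x. (indicator C x *\<^sub>R f x) * \<psi> x) \<in> borel_measurable lborel" by measurable
  qed
qed

lemma integrable_mult_test_function:
  fixes f :: "'a::euclidean_space \<Rightarrow> real"
  assumes f: "locally_integrable_on U f" and \<psi>: "\<psi> \<in> test_functions U"
  shows "integrable lborel (\<lambda>x. f x * \<psi> x)"
    and "integrable lborel (\<lambda>x. f x * frechet_derivative \<psi> (at x) b)"
proof -
  let ?C = "closure {x. \<psi> x \<noteq> 0}"
  have fC: "set_integrable lborel ?C f"
    using f test_functionsD(2,3)[OF \<psi>] by (simp add: locally_integrable_on_def)
  show "integrable lborel (\<lambda>x. f x * \<psi> x)"
  proof (rule integrable_mult_compact_support[OF fC test_function_continuous[OF \<psi>] test_functionsD(2)[OF \<psi>]])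
    fix x assume "x \<notin> ?C"
    then show "\<psi> x = 0" using closure_subset[of "{x. \<psi> x \<noteq> 0}"] by blast
  qed
  show "integrable lborel (\<lambda>x. f x * frechet_derivative \<psi> (at x) b)"
    by (rule integrable_mult_compact_support[OF fC test_function_derivative(2)[OF \<psi>] test_functionsD(2)[OF \<psi>]
          test_function_derivative(3)[OF \<psi>]])
qed

lemma set_integrable_continuous_on_compact:
  fixes f :: "'a::euclidean_space \<Rightarrow> 'b::euclidean_space"
  assumes "continuous_on UNIV f" "compact C"
  shows "set_integrable lborel C f"
  unfolding set_integrable_def
  by (rule borel_integrable_compact[OF assms(2)]) (rule continuous_on_subset[OF assms(1)], simp)

section \<open>Weak gradients\<close>

text \<open>Positive and negative part of \<open>g\<close> define two measures that agree on boxes, hence everywhere.\<close>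

lemma integrable_box_zero_imp_zero:
  fixes g :: "'a::euclidean_space \<Rightarrow> real"
  assumes g: "integrable lborel g" and 0: "\<And>a b. (LINT x|lborel. indicator (box a b) x * g x) = 0"
  shows "AE x in lborel. g x = 0"
proof -
  have [measurable]: "g \<in> borel_measurable borel" using g by auto
  let ?p = "density lborel (\<lambda>x. ennreal (g x))" and ?n = "density lborel (\<lambda>x. ennreal (- g x))"
  let ?E = "range (\<lambda>(a, b). box a b :: 'a set)"
  have "?p = ?n"
  proof (rule measure_eqI_generator_eq)
    show "Int_stable ?E" by (auto simp: Int_stable_def box_Int_box)
    show "?E \<subseteq> Pow UNIV" "sets ?p = sigma_sets UNIV ?E" "sets ?n = sigma_sets UNIV ?E"
      by (simp_all add: borel_eq_box)
    let ?A = "\<lambda>n::nat. box (- (real n *\<^sub>R One)) (real n *\<^sub>R One) :: 'a set"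
    show "range ?A \<subseteq> ?E" "(\<Union>i. ?A i) = UNIV" unfolding UN_box_eq_UNIV by auto
    have em: "emeasure (density lborel (\<lambda>x. ennreal (f x))) A = ennreal (LINT x|lborel. indicator A x * max 0 (f x))"
      if "integrable lborel f" "A \<in> sets borel" for f :: "'a \<Rightarrow> real" and A
    proof -
      have [measurable]: "f \<in> borel_measurable borel" "A \<in> sets borel" using that by auto
      have "integrable lborel (\<lambda>x. max 0 (f x))" using that by auto
      then have "integrable lborel (\<lambda>x. indicator A x * max 0 (f x))"
        using integrable_mult_indicator[of A lborel "\<lambda>x. max 0 (f x)"] that by simp
      then have "(\<integral>\<^sup>+x. ennreal (indicator A x * max 0 (f x)) \<partial>lborel) = ennreal (LINT x|lborel. indicator A x * max 0 (f x))"
        by (intro nn_integral_eq_integral) auto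
      moreover have "(\<integral>\<^sup>+x. ennreal (f x) * indicator A x \<partial>lborel) = (\<integral>\<^sup>+x. ennreal (indicator A x * max 0 (f x)) \<partial>lborel)"
        by (intro nn_integral_cong) (auto simp: indicator_def max_def ennreal_neg)
      ultimately show ?thesis by (simp add: emeasure_density)
    qed
    have ng: "integrable lborel (\<lambda>x. - g x)" using g by simp
    show "emeasure ?p (?A i) \<noteq> \<infinity>" for i by (subst em[OF g]) auto
    fix X assume "X \<in> ?E"
    then obtain a b where X: "X = box a b" by auto
    have i: "integrable lborel (\<lambda>x. indicator X x * max 0 (g x))" "integrable lborel (\<lambda>x. indicator X x * max 0 (- g x))"
      using integrable_mult_indicator[of X lborel "\<lambda>x. max 0 (g x)"] integrable_mult_indicator[of X lborel "\<lambda>x. max 0 (- g x)"] g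
      by (auto simp: X)
    have "(LINT x|lborel. indicator X x * max 0 (g x)) - (LINT x|lborel. indicator X x * max 0 (- g x))
        = (LINT x|lborel. indicator X x * max 0 (g x) - indicator X x * max 0 (- g x))"
      using i by simp
    also have "\<dots> = (LINT x|lborel. indicator X x * g x)"
      by (intro Bochner_Integration.integral_cong) (auto simp: max_def indicator_def)
    also have "\<dots> = 0" unfolding X by (rule 0)
    finally show "emeasure ?p X = emeasure ?n X"
      by (simp add: em[OF g] em[OF ng] X)
  qed
  then have "AE x in lborel. ennreal (g x) = ennreal (- g x)"
    by (subst (asm) sigma_finite_measure.density_unique_iff[OF lborel.sigma_finite_measure_axioms]) auto
  then show ?thesis
    by eventually_elim (metis ennreal_eq_0_iff linorder_le_cases neg_le_0_iff_le antisym)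
qed

text \<open>The test functions \<open>1 - exp (- k b)\<close>, with \<open>b\<close> a bump function positive exactly on the open
  box, increase to the indicator function of the box.\<close>

lemma integral_box_eq_0_of_test_functions:
  fixes g :: "'a::euclidean_space \<Rightarrow> real"
  assumes g: "set_integrable lborel (cbox a b) g" and sub: "cbox a b \<subseteq> U"
    and 0: "\<And>\<psi>. \<psi> \<in> test_functions U \<Longrightarrow> (LINT x|lborel. g x * \<psi> x) = 0"
  shows "(LINT x|lborel. indicator (box a b) x * g x) = 0"
proof -
  define \<psi> where "\<psi> k x = 1 - exp (- (real k * bump a b x))" for k x
  \<comment> \<open>The derivatives of \<open>t \<mapsto> 1 - exp (- k t)\<close>.\<close>
  define E where "E = (\<lambda>k j t. (if j = 0 then 1 else 0) - (- real k) ^ j * exp (- (real k * t)))"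
  have E: "(E k j has_real_derivative E k (Suc j) t) (at t)" for k j t
    unfolding E_def by (auto intro!: derivative_eq_intros simp: algebra_simps)
  have smooth: "C_k m (\<psi> k)" for m k
    using C_k_compose[where G="E k" and j=0, OF E smooth_bump[of m a b]] by (simp add: E_def \<psi>_def[abs_def])
  have supp: "x \<in> cbox a b" if "\<psi> k x \<noteq> 0" for k x
    using that bump_eq_0_iff[of a b x] box_subset_cbox[of a b] by (auto simp: \<psi>_def)
  have test: "\<psi> k \<in> test_functions U" for k
    by (rule test_functionsI[OF smooth supp compact_cbox sub])
  have i: "integrable lborel (\<lambda>x. indicator (cbox a b) x *\<^sub>R g x)" using g by (simp add: set_integrable_def)
  have [measurable]: "(\<lambda>x. indicator (cbox a b) x *\<^sub>R g x) \<in> borel_measurable borel" using i by auto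
  have [measurable]: "\<psi> k \<in> borel_measurable borel" for k
    using test_function_continuous[OF test] by (rule borel_measurable_continuous_onI)
  have "(\<lambda>k. LINT x|lborel. (indicator (cbox a b) x *\<^sub>R g x) * \<psi> k x)
      \<longlonglongrightarrow> (LINT x|lborel. (indicator (cbox a b) x *\<^sub>R g x) * indicator (box a b) x)"
  proof (rule integral_dominated_convergence[where w="\<lambda>x. \<bar>indicator (cbox a b) x *\<^sub>R g x\<bar>"])
    show "integrable lborel (\<lambda>x. \<bar>indicator (cbox a b) x *\<^sub>R g x\<bar>)" using i by (rule integrable_abs)
    show "AE x in lborel. norm ((indicator (cbox a b) x *\<^sub>R g x) * \<psi> k x) \<le> \<bar>indicator (cbox a b) x *\<^sub>R g x\<bar>" for k
    proof (rule AE_I2)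
      fix x
      have "0 \<le> real k * bump a b x" using bump_nonneg[of a b x] by simp
      then have "\<bar>\<psi> k x\<bar> \<le> 1" by (auto simp: \<psi>_def)
      then show "norm ((indicator (cbox a b) x *\<^sub>R g x) * \<psi> k x) \<le> \<bar>indicator (cbox a b) x *\<^sub>R g x\<bar>"
        by (simp add: abs_mult mult_left_le)
    qed
    show "AE x in lborel. (\<lambda>k. (indicator (cbox a b) x *\<^sub>R g x) * \<psi> k x) \<longlonglongrightarrow> (indicator (cbox a b) x *\<^sub>R g x) * indicator (box a b) x"
    proof (rule AE_I2, rule tendsto_mult[OF tendsto_const])
      fix x
      show "(\<lambda>k. \<psi> k x) \<longlonglongrightarrow> indicator (box a b) x"
      proof (cases "x \<in> box a b")
        case True
        then have "0 < bump a b x" by (simp add: bump_pos_iff)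
        then have "filterlim (\<lambda>k. real k * bump a b x) at_top sequentially"
          by (intro filterlim_at_top_mult_tendsto_pos[OF tendsto_const] filterlim_real_sequentially)
        then have "(\<lambda>k. exp (- (real k * bump a b x))) \<longlonglongrightarrow> 0"
          by (intro filterlim_compose[OF exp_at_bot]) (simp add: filterlim_uminus_at_bot)
        from tendsto_diff[OF tendsto_const[of 1] this] show ?thesis using True by (simp add: \<psi>_def)
      next
        case False
        then show ?thesis using bump_eq_0_iff[of a b x] by (simp add: \<psi>_def)
      qed
    qed
  qed measurable
  moreover have "(LINT x|lborel. (indicator (cbox a b) x *\<^sub>R g x) * \<psi> k x) = 0" for k
  proof -
    have eq: "(indicator (cbox a b) x *\<^sub>R g x) * \<psi> k x = g x * \<psi> k x" for x
      using supp[of k x] by (auto simp: indicator_def)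
    show ?thesis by (simp only: eq 0[OF test])
  qed
  ultimately have "(LINT x|lborel. (indicator (cbox a b) x *\<^sub>R g x) * indicator (box a b) x) = 0"
    using LIMSEQ_unique[OF _ tendsto_const] by (simp add: LIMSEQ_const_iff)
  moreover have eq: "(indicator (cbox a b) x *\<^sub>R g x) * indicator (box a b) x = indicator (box a b) x * g x" for x
    using box_subset_cbox[of a b] by (auto simp: indicator_def)
  ultimately show ?thesis by (simp only: eq)
qed

text \<open>The fundamental lemma of the calculus of variations, on countably many boxes that cover \<open>U\<close>.\<close>

lemma fundamental_lemma:
  fixes g :: "'a::euclidean_space \<Rightarrow> real"
  assumes U: "open U" and g: "locally_integrable_on U g"
    and 0: "\<And>\<psi>. \<psi> \<in> test_functions U \<Longrightarrow> (LINT x|lborel. g x * \<psi> x) = 0"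
  shows "AE x in lborel. x \<in> U \<longrightarrow> g x = 0"
proof -
  have box: "AE x in lborel. x \<in> cbox a b \<longrightarrow> g x = 0" if sub: "cbox a b \<subseteq> U" for a b
  proof -
    have gi: "set_integrable lborel (cbox c d) g" if "cbox c d \<subseteq> U" for c d
      using g that by (auto simp: locally_integrable_on_def)
    have "set_integrable lborel (box a b) g"
      by (rule set_integrable_subset[OF gi[OF sub]]) (auto simp: box_subset_cbox)
    then have i: "integrable lborel (\<lambda>x. indicator (box a b) x * g x)" by (simp add: set_integrable_def)
    have "AE x in lborel. indicator (box a b) x * g x = 0"
    proof (rule integrable_box_zero_imp_zero[OF i])
      fix c d :: 'a
      obtain p q where pq: "box c d \<inter> box a b = box p q" using box_Int_box[of c d a b] by blast
      have eq: "indicator (box c d) x * (indicator (box a b) x * g x) = indicator (box p q) x * g x" for x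
        unfolding pq[symmetric] by (auto simp: indicator_def)
      show "(LINT x|lborel. indicator (box c d) x * (indicator (box a b) x * g x)) = 0"
      proof (cases "box p q = {}")
        case True then show ?thesis unfolding eq by simp
      next
        case False
        have "closure (box p q) \<subseteq> closure (box a b)" using pq by (intro closure_mono) auto
        moreover have "box a b \<noteq> {}" using False pq by auto
        ultimately have "cbox p q \<subseteq> U" using False sub by (simp add: closure_box)
        then show ?thesis unfolding eq by (intro integral_box_eq_0_of_test_functions[OF gi _ 0])
      qed
    qed
    moreover have "AE x in lborel. x \<notin> cbox a b - box a b"
    proof -
      have "AE x in lebesgue. x \<notin> cbox a b - box a b"
        using negligible_frontier_interval[of a b] by (intro AE_not_in) (simp add: negligible_iff_null_sets)
      then show ?thesis by (simp add: AE_completion_iff)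
    qed
    ultimately show ?thesis by eventually_elim (auto simp: indicator_def)
  qed
  obtain D where D: "countable D" "\<And>X. X \<in> D \<Longrightarrow> X \<subseteq> U" "\<And>X. X \<in> D \<Longrightarrow> \<exists>a b. X = cbox a b" "\<Union>D = U"
  proof (rule open_countable_Union_open_cbox[OF U])
    fix D :: "'a set set"
    assume "countable D" "D \<subseteq> Pow U" "\<And>X. X \<in> D \<Longrightarrow> \<exists>a b. X = cbox a b" "\<Union>D = U"
    then show thesis by (intro that[of D]) auto
  qed
  have "\<forall>X\<in>D. AE x in lborel. x \<in> X \<longrightarrow> g x = 0"
  proof
    fix X assume X: "X \<in> D"
    then obtain a b where "X = cbox a b" using D(3) by blast
    then show "AE x in lborel. x \<in> X \<longrightarrow> g x = 0" using box[of a b] D(2)[OF X] by simp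
  qed
  then have "AE x in lborel. \<forall>X\<in>D. x \<in> X \<longrightarrow> g x = 0"
    by (simp only: AE_ball_countable[OF D(1)])
  then show ?thesis
  proof eventually_elim
    case (elim x)
    show ?case
    proof
      assume "x \<in> U"
      then obtain X where "X \<in> D" "x \<in> X" using D(4) by auto
      then show "g x = 0" using elim by blast
    qed
  qed
qed

lemma locally_integrable_on_inner:
  assumes "locally_integrable_on U g"
  shows "locally_integrable_on U (\<lambda>x. g x \<bullet> b)"
  using assms unfolding locally_integrable_on_def set_integrable_def
  by (auto dest!: spec intro: integrable_inner_left simp flip: inner_scaleR_left)

lemma weak_gradient_unique:
  fixes f :: "'a::euclidean_space \<Rightarrow> real"
  assumes U: "open U" and g: "is_weak_gradient U f g" and h: "is_weak_gradient U f h"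
  shows "AE x in lborel. x \<in> U \<longrightarrow> g x = h x"
proof -
  have "AE x in lborel. x \<in> U \<longrightarrow> (g x \<bullet> b) - (h x \<bullet> b) = 0" if b: "b \<in> Basis" for b
  proof (rule fundamental_lemma[OF U])
    have lg: "locally_integrable_on U (\<lambda>x. g x \<bullet> b)" and lh: "locally_integrable_on U (\<lambda>x. h x \<bullet> b)"
      using g h by (auto simp: is_weak_gradient_def intro: locally_integrable_on_inner)
    then show "locally_integrable_on U (\<lambda>x. (g x \<bullet> b) - (h x \<bullet> b))"
      by (auto simp: locally_integrable_on_def)
    fix \<psi> assume \<psi>: "\<psi> \<in> test_functions U"
    note i = integrable_mult_test_function(1)[OF lg \<psi>] integrable_mult_test_function(1)[OF lh \<psi>]
    have "(LINT x|lborel. (g x \<bullet> b) * \<psi> x) = (LINT x|lborel. (h x \<bullet> b) * \<psi> x)"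
    proof -
      have "(LINT x|lborel. f x * frechet_derivative \<psi> (at x) b) = - (LINT x|lborel. (g x \<bullet> b) * \<psi> x)"
        "(LINT x|lborel. f x * frechet_derivative \<psi> (at x) b) = - (LINT x|lborel. (h x \<bullet> b) * \<psi> x)"
        using g h \<psi> b unfolding is_weak_gradient_def by blast+
      then show ?thesis by simp
    qed
    then show "(LINT x|lborel. ((g x \<bullet> b) - (h x \<bullet> b)) * \<psi> x) = 0"
      using i by (simp add: left_diff_distrib)
  qed
  then have "AE x in lborel. \<forall>b\<in>Basis. x \<in> U \<longrightarrow> (g x \<bullet> b) - (h x \<bullet> b) = 0"
    by (rule AE_finite_allI[OF finite_Basis])
  then show ?thesis by eventually_elim (auto intro: euclidean_eqI)
qed

lemma weak_gradient_weak:
  assumes "is_weak_gradient U f g" shows "is_weak_gradient U f (weak_gradient U f)"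
  unfolding weak_gradient_def by (rule someI[where P="is_weak_gradient U f", OF assms])

lemma has_derivative_imp_directional:
  fixes \<psi> :: "'a::euclidean_space \<Rightarrow> real"
  assumes "(\<psi> has_derivative D) (at x)"
  shows "((\<lambda>t. \<psi> (x + t *\<^sub>R v)) has_real_derivative D v) (at 0)"
proof -
  have "((\<lambda>t::real. x + t *\<^sub>R v) has_derivative (\<lambda>t. t *\<^sub>R v)) (at 0)"
    by (auto intro!: derivative_eq_intros)
  moreover have "(\<psi> has_derivative D) (at (x + 0 *\<^sub>R v))" using assms by simp
  ultimately have "((\<lambda>t. \<psi> (x + t *\<^sub>R v)) has_derivative (\<lambda>t. D (t *\<^sub>R v))) (at 0)"
    by (rule has_derivative_compose)
  moreover have "linear D" using assms has_derivative_linear by blast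
  ultimately show ?thesis by (simp add: has_field_derivative_def linear_cmul mult_commute_abs)
qed

text \<open>Integrate the directional derivative of \<open>f \<psi>\<close> for a test function \<open>\<psi>\<close>.\<close>

lemma classical_weak_gradient:
  fixes f :: "'a::euclidean_space \<Rightarrow> real" and g :: "'a \<Rightarrow> 'a"
  assumes f: "continuous_on UNIV f" and g: "continuous_on UNIV g"
    and der: "\<And>x b. b \<in> Basis \<Longrightarrow> ((\<lambda>t. f (x + t *\<^sub>R b)) has_real_derivative g x \<bullet> b) (at 0)"
  shows "is_weak_gradient UNIV f g"
  unfolding is_weak_gradient_def
proof (intro conjI ballI)
  show "locally_integrable_on UNIV f" "locally_integrable_on UNIV g"
    using f g by (auto simp: locally_integrable_on_def intro: set_integrable_continuous_on_compact)
  show "g \<in> borel_measurable borel" by (rule borel_measurable_continuous_onI[OF g])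
  fix \<psi> b assume \<psi>: "\<psi> \<in> test_functions (UNIV :: 'a set)" and b: "b \<in> (Basis :: 'a set)"
  let ?d = "\<lambda>x. frechet_derivative \<psi> (at x) b"
  have gb: "continuous_on UNIV (\<lambda>x. g x \<bullet> b)" by (intro continuous_intros g)
  have lf: "locally_integrable_on UNIV f" and lg: "locally_integrable_on UNIV (\<lambda>x. g x \<bullet> b)"
    using f gb by (auto simp: locally_integrable_on_def intro: set_integrable_continuous_on_compact)
  note i = integrable_mult_test_function(2)[OF lf \<psi>, of b] integrable_mult_test_function(1)[OF lg \<psi>]
    integrable_mult_test_function(1)[OF lf \<psi>]
  have "(LINT x|lborel. (g x \<bullet> b) * \<psi> x + ?d x * f x) = 0"
  proof (rule integral_directional_derivative_eq_0[where F="\<lambda>x. f x * \<psi> x" and e=b])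
    show "((\<lambda>t. f (x + t *\<^sub>R b) * \<psi> (x + t *\<^sub>R b)) has_real_derivative (g x \<bullet> b) * \<psi> x + ?d x * f x) (at 0)" for x
      using DERIV_mult[OF der[OF b, of x] has_derivative_imp_directional[OF test_function_derivative(1)[OF \<psi>, of x], of b]]
      by simp
    show "continuous_on UNIV (\<lambda>x. (g x \<bullet> b) * \<psi> x + ?d x * f x)"
      by (intro continuous_intros gb f test_function_derivative(2)[OF \<psi>] test_function_continuous[OF \<psi>])
    show "integrable lborel (\<lambda>x. (g x \<bullet> b) * \<psi> x + ?d x * f x)" using i by (simp add: mult.commute)
  qed (rule i)
  then show "(LINT x|lborel. f x * ?d x) = - (LINT x|lborel. (g x \<bullet> b) * \<psi> x)"
    using i by (simp add: mult.commute[of "?d _"])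
qed

text \<open>The product of a test function on \<open>U\<close> with \<open>\<theta>\<close> is again a test function on \<open>U\<close>, and it
  produces the additional term by the product rule.\<close>

lemma weak_gradient_mult:
  fixes f \<theta> :: "'a::euclidean_space \<Rightarrow> real" and g :: "'a \<Rightarrow> 'a"
  assumes fg: "is_weak_gradient U f g" and fm: "f \<in> borel_measurable borel" and \<theta>: "\<theta> \<in> test_functions UNIV"
  shows "is_weak_gradient U (\<lambda>x. \<theta> x * f x)
     (\<lambda>x. \<theta> x *\<^sub>R g x + f x *\<^sub>R (\<Sum>b\<in>Basis. frechet_derivative \<theta> (at x) b *\<^sub>R b))"
proof -
  let ?D = "\<lambda>x. \<Sum>b\<in>Basis. frechet_derivative \<theta> (at x) b *\<^sub>R b"
  have f: "locally_integrable_on U f" and g: "locally_integrable_on U g" and [measurable]: "g \<in> borel_measurable borel"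
    and fb: "f \<in> borel_measurable borel"
    using fg fm by (auto simp: is_weak_gradient_def)
  note [measurable] = fb
  have cD: "continuous_on UNIV ?D" by (intro continuous_intros test_function_derivative(2)[OF \<theta>])
  have c\<theta>: "continuous_on UNIV \<theta>" by (rule test_function_continuous[OF \<theta>])
  have [measurable]: "\<theta> \<in> borel_measurable borel" "?D \<in> borel_measurable borel"
    by (rule borel_measurable_continuous_onI[OF c\<theta>], rule borel_measurable_continuous_onI[OF cD])
  obtain B where B: "\<And>x. \<bar>\<theta> x\<bar> \<le> B"
    using continuous_compact_support_bounded[OF c\<theta> test_functionsD(2)[OF \<theta>]] closure_subset[of "{x. \<theta> x \<noteq> 0}"] by blast
  have "\<exists>B. \<forall>x. \<bar>norm (?D x)\<bar> \<le> B"
    by (rule continuous_compact_support_bounded[OF _ test_functionsD(2)[OF \<theta>]])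
       (use test_function_derivative(3)[OF \<theta>] in \<open>auto intro!: continuous_intros cD\<close>)
  then obtain B' where B': "\<And>x. norm (?D x) \<le> B'" by auto
  have l1: "locally_integrable_on U (\<lambda>x. \<theta> x * f x)"
    unfolding locally_integrable_on_def set_integrable_def
  proof (intro allI impI)
    fix C assume "compact C \<and> C \<subseteq> U"
    then have i: "integrable lborel (\<lambda>x. indicator C x *\<^sub>R f x)" and [measurable]: "C \<in> sets borel"
      using f by (auto simp: locally_integrable_on_def set_integrable_def compact_imp_closed)
    show "integrable lborel (\<lambda>x. indicator C x *\<^sub>R (\<theta> x * f x))"
    proof (rule Bochner_Integration.integrable_bound)
      show "integrable lborel (\<lambda>x. B * (indicator C x *\<^sub>R f x))" using i by simp
      show "AE x in lborel. norm (indicator C x *\<^sub>R (\<theta> x * f x)) \<le> norm (B * (indicator C x *\<^sub>R f x))"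
        using order.trans[OF B abs_ge_self] by (intro AE_I2) (auto simp: abs_mult indicator_def intro!: mult_right_mono)
    qed measurable
  qed
  have l2: "locally_integrable_on U (\<lambda>x. \<theta> x *\<^sub>R g x + f x *\<^sub>R ?D x)"
    unfolding locally_integrable_on_def set_integrable_def
  proof (intro allI impI)
    fix C assume "compact C \<and> C \<subseteq> U"
    then have i: "integrable lborel (\<lambda>x. indicator C x *\<^sub>R f x)" "integrable lborel (\<lambda>x. indicator C x *\<^sub>R g x)"
      and [measurable]: "C \<in> sets borel"
      using f g by (auto simp: locally_integrable_on_def set_integrable_def compact_imp_closed)
    show "integrable lborel (\<lambda>x. indicator C x *\<^sub>R (\<theta> x *\<^sub>R g x + f x *\<^sub>R ?D x))"
    proof (rule Bochner_Integration.integrable_bound)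
      show "integrable lborel (\<lambda>x. B * norm (indicator C x *\<^sub>R g x) + norm (indicator C x *\<^sub>R f x) * B')"
        using i by (intro Bochner_Integration.integrable_add integrable_mult_right integrable_mult_left integrable_norm)
      show "AE x in lborel. norm (indicator C x *\<^sub>R (\<theta> x *\<^sub>R g x + f x *\<^sub>R ?D x))
          \<le> norm (B * norm (indicator C x *\<^sub>R g x) + norm (indicator C x *\<^sub>R f x) * B')"
      proof (rule AE_I2)
        fix x
        have "norm (\<theta> x *\<^sub>R g x + f x *\<^sub>R ?D x) \<le> \<bar>\<theta> x\<bar> * norm (g x) + \<bar>f x\<bar> * norm (?D x)"
          using norm_triangle_ineq[of "\<theta> x *\<^sub>R g x" "f x *\<^sub>R ?D x"] by simp
        also have "\<dots> \<le> B * norm (g x) + \<bar>f x\<bar> * B'"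
          by (intro add_mono mult_right_mono mult_left_mono B B') auto
        finally show "norm (indicator C x *\<^sub>R (\<theta> x *\<^sub>R g x + f x *\<^sub>R ?D x))
          \<le> norm (B * norm (indicator C x *\<^sub>R g x) + norm (indicator C x *\<^sub>R f x) * B')"
          by (auto simp: indicator_def)
      qed
    qed measurable
  qed
  show ?thesis
    unfolding is_weak_gradient_def
  proof (intro conjI ballI l1 l2)
    show "(\<lambda>x. \<theta> x *\<^sub>R g x + f x *\<^sub>R ?D x) \<in> borel_measurable borel" by measurable
    fix \<psi> b assume \<psi>: "\<psi> \<in> test_functions U" and b: "b \<in> (Basis :: 'a set)"
    have p: "(\<lambda>x. \<theta> x * \<psi> x) \<in> test_functions U"
    proof (rule test_functionsI[OF C_k_mult[OF test_functionsD(1)[OF \<theta>] test_functionsD(1)[OF \<psi>]]])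
      show "x \<in> closure {x. \<psi> x \<noteq> 0}" if "\<theta> x * \<psi> x \<noteq> 0" for x
        using that closure_subset[of "{x. \<psi> x \<noteq> 0}"] by auto
    qed (use test_functionsD(2,3)[OF \<psi>] in auto)
    have dp: "frechet_derivative (\<lambda>x. \<theta> x * \<psi> x) (at x) b
        = \<theta> x * frechet_derivative \<psi> (at x) b + frechet_derivative \<theta> (at x) b * \<psi> x" for x
      using frechet_derivative_at[OF has_derivative_mult[OF test_function_derivative(1)[OF \<theta>] test_function_derivative(1)[OF \<psi>]], of x]
      by (metis (no_types, lifting))
    have Db: "?D x \<bullet> b = frechet_derivative \<theta> (at x) b" for x
      using b by simp
    have i1: "integrable lborel (\<lambda>x. \<theta> x * f x * frechet_derivative \<psi> (at x) b)"
      by (rule integrable_mult_test_function(2)[OF l1 \<psi>])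
    have i2: "integrable lborel (\<lambda>x. (\<theta> x *\<^sub>R g x + f x *\<^sub>R ?D x) \<bullet> b * \<psi> x)"
      by (rule integrable_mult_test_function(1)[OF locally_integrable_on_inner[OF l2] \<psi>])
    have i3: "integrable lborel (\<lambda>x. f x * frechet_derivative (\<lambda>x. \<theta> x * \<psi> x) (at x) b)"
      by (rule integrable_mult_test_function(2)[OF f p])
    have i4: "integrable lborel (\<lambda>x. (g x \<bullet> b) * (\<theta> x * \<psi> x))"
      by (rule integrable_mult_test_function(1)[OF locally_integrable_on_inner[OF g] p])
    have "(LINT x|lborel. \<theta> x * f x * frechet_derivative \<psi> (at x) b) + (LINT x|lborel. (\<theta> x *\<^sub>R g x + f x *\<^sub>R ?D x) \<bullet> b * \<psi> x)
        = (LINT x|lborel. \<theta> x * f x * frechet_derivative \<psi> (at x) b + (\<theta> x *\<^sub>R g x + f x *\<^sub>R ?D x) \<bullet> b * \<psi> x)"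
      by (rule Bochner_Integration.integral_add[OF i1 i2, symmetric])
    also have "\<dots> = (LINT x|lborel. f x * frechet_derivative (\<lambda>x. \<theta> x * \<psi> x) (at x) b + (g x \<bullet> b) * (\<theta> x * \<psi> x))"
      by (intro Bochner_Integration.integral_cong refl) (simp only: dp Db inner_add_left inner_scaleR_left, simp add: algebra_simps)
    also have "\<dots> = 0"
      using fg p b by (simp add: Bochner_Integration.integral_add[OF i3 i4] is_weak_gradient_def)
    finally show "(LINT x|lborel. \<theta> x * f x * frechet_derivative \<psi> (at x) b)
        = - (LINT x|lborel. (\<theta> x *\<^sub>R g x + f x *\<^sub>R ?D x) \<bullet> b * \<psi> x)" by simp
  qed
qed

section \<open>Gaussian convolution preserves log-concavity\<close>

text \<open>The one-dimensional Brunn--Minkowski inequality for intervals, which form the level sets in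
  the application.\<close>

lemma emeasure_convex_combination_ge:
  fixes S T W :: "real set"
  assumes S: "convex S" "S \<noteq> {}" "bounded S" and T: "convex T" "T \<noteq> {}" "bounded T"
    and t: "0 < t" "t < 1" and W: "W \<in> sets borel" "\<And>x y. x \<in> S \<Longrightarrow> y \<in> T \<Longrightarrow> (1 - t) * x + t * y \<in> W"
  shows "ennreal (1 - t) * emeasure lborel S + ennreal t * emeasure lborel T \<le> emeasure lborel W"
proof -
  have bd: "bdd_above S" "bdd_below S" "bdd_above T" "bdd_below T"
    using S(3) T(3) by (auto simp: bounded_imp_bdd_above bounded_imp_bdd_below)
  define a b c d where "a = Inf S" and "b = Sup S" and "c = Inf T" and "d = Sup T"
  have ab: "a \<le> b" and cd: "c \<le> d"
    unfolding a_def b_def c_def d_def using bd S(2) T(2) by (auto intro: cInf_le_cSup)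
  have "S \<subseteq> {a..b}" "T \<subseteq> {c..d}"
    unfolding a_def b_def c_def d_def using bd by (auto intro: cInf_lower cSup_upper)
  then have mS: "emeasure lborel S \<le> ennreal (b - a)" and mT: "emeasure lborel T \<le> ennreal (d - c)"
    using emeasure_mono[of S "{a..b}" lborel] emeasure_mono[of T "{c..d}" lborel] ab cd by auto
  let ?l = "(1 - t) * a + t * c" and ?u = "(1 - t) * b + t * d"
  have lu: "?l \<le> ?u" using ab cd t by (intro add_mono mult_left_mono) auto
  let ?C = "(\<Union>x\<in>(\<lambda>x. (1 - t) *\<^sub>R x) ` S. \<Union>y\<in>(\<lambda>y. t *\<^sub>R y) ` T. {x + y})"
  have C: "is_interval ?C"
    unfolding is_interval_convex_1 by (intro convex_sums convex_scaling S(1) T(1))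
  have "{?l<..<?u} \<subseteq> W"
  proof
    fix w assume w: "w \<in> {?l<..<?u}"
    have "a < a + (w - ?l)" "c < c + (w - ?l)" using w by auto
    then obtain x1 y1 where 1: "x1 \<in> S" "x1 < a + (w - ?l)" "y1 \<in> T" "y1 < c + (w - ?l)"
      using cInf_lessD[OF S(2), of "a + (w - ?l)"] cInf_lessD[OF T(2), of "c + (w - ?l)"]
      by (auto simp: a_def[symmetric] c_def[symmetric])
    have "b - (?u - w) < b" "d - (?u - w) < d" using w by auto
    then obtain x2 y2 where 2: "x2 \<in> S" "b - (?u - w) < x2" "y2 \<in> T" "d - (?u - w) < y2"
      using less_cSupD[OF S(2), of "b - (?u - w)"] less_cSupD[OF T(2), of "d - (?u - w)"]
      by (auto simp: b_def[symmetric] d_def[symmetric])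
    have "(1 - t) * x1 + t * y1 \<le> (1 - t) * (a + (w - ?l)) + t * (c + (w - ?l))"
      using 1 t by (intro add_mono mult_left_mono) auto
    then have l: "(1 - t) * x1 + t * y1 \<le> w" by (simp add: algebra_simps)
    have "(1 - t) * (b - (?u - w)) + t * (d - (?u - w)) \<le> (1 - t) * x2 + t * y2"
      using 2 t by (intro add_mono mult_left_mono) auto
    then have u: "w \<le> (1 - t) * x2 + t * y2" by (simp add: algebra_simps)
    have "(1 - t) * x1 + t * y1 \<in> ?C" "(1 - t) * x2 + t * y2 \<in> ?C" using 1 2 by auto
    from mem_is_interval_1_I[OF C this l u] show "w \<in> W" using W(2) by auto
  qed
  then have "emeasure lborel {?l<..<?u} \<le> emeasure lborel W" using W(1) by (intro emeasure_mono) auto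
  moreover have "ennreal (1 - t) * ennreal (b - a) + ennreal t * ennreal (d - c) = emeasure lborel {?l<..<?u}"
  proof -
    have "?u - ?l = (1 - t) * (b - a) + t * (d - c)" by (simp add: algebra_simps)
    then have "emeasure lborel {?l<..<?u} = ennreal ((1 - t) * (b - a) + t * (d - c))" using lu by simp
    also have "\<dots> = ennreal (1 - t) * ennreal (b - a) + ennreal t * ennreal (d - c)"
      using t ab cd by (subst ennreal_plus) (simp_all add: ennreal_mult)
    finally show ?thesis by simp
  qed
  moreover have "ennreal (1 - t) * emeasure lborel S + ennreal t * emeasure lborel T
      \<le> ennreal (1 - t) * ennreal (b - a) + ennreal t * ennreal (d - c)"
    by (intro add_mono mult_left_mono mS mT) auto
  ultimately show ?thesis by simp
qed

text \<open>Layer cake representation, restricted to levels below 1.\<close>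

lemma layer_cake_unit:
  fixes f :: "real \<Rightarrow> real"
  assumes [measurable]: "f \<in> borel_measurable borel"
  shows "(\<integral>\<^sup>+r. indicator {0<..<1} r * emeasure lborel {x. r < f x} \<partial>lborel) = (\<integral>\<^sup>+x. ennreal (min 1 (f x)) \<partial>lborel)"
proof -
  have "(\<integral>\<^sup>+r. indicator {0<..<1} r * emeasure lborel {x. r < f x} \<partial>lborel)
      = (\<integral>\<^sup>+r. (\<integral>\<^sup>+x. indicator {0<..<1} r * indicator {x. r < f x} x \<partial>lborel) \<partial>lborel)"
    by (intro nn_integral_cong) (simp add: nn_integral_cmult)
  also have "\<dots> = (\<integral>\<^sup>+x. (\<integral>\<^sup>+r. indicator {0<..<1} r * indicator {x. r < f x} x \<partial>lborel) \<partial>lborel)"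
    by (rule lborel_pair.Fubini') measurable
  also have "\<dots> = (\<integral>\<^sup>+x. ennreal (min 1 (f x)) \<partial>lborel)"
  proof (rule nn_integral_cong)
    fix x
    have "(\<integral>\<^sup>+r. indicator {0<..<1::real} r * indicator {x. r < f x} x \<partial>lborel) = (\<integral>\<^sup>+r. indicator {0<..<min 1 (f x)} r \<partial>lborel)"
      by (intro nn_integral_cong) (auto simp: indicator_def)
    also have "\<dots> = ennreal (min 1 (f x))"
      by (cases "0 \<le> min 1 (f x)") (auto simp: ennreal_neg)
    finally show "(\<integral>\<^sup>+r. indicator {0<..<1::real} r * indicator {x. r < f x} x \<partial>lborel) = ennreal (min 1 (f x))" .
  qed
  finally show ?thesis .
qed

lemma weighted_geometric_le_arithmetic:
  fixes a b :: real
  assumes "0 \<le> a" "0 \<le> b" "0 < t" "t < 1"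
  shows "a powr (1 - t) * b powr t \<le> (1 - t) * a + t * b"
proof (cases "a = 0 \<or> b = 0")
  case False
  then show ?thesis using assms by (intro Youngs_inequality_0) auto
qed (use assms in auto)

text \<open>Prekopa--Leindler in dimension one, for functions whose level sets are bounded intervals.
  After division by their suprema, \<open>F\<close> and \<open>G\<close> have nonempty level sets at the same levels
  \<open>r < 1\<close>. The hypothesis puts convex combinations of these into the level set of \<open>H\<close>, so
  Brunn--Minkowski and integration over \<open>r\<close> give the arithmetic mean of the normalised integrals
  as a lower bound, and this exceeds the geometric mean.\<close>

lemma prekopa_leindler_1D:
  fixes F G H :: "real \<Rightarrow> real"
  assumes F: "integrable lborel F" "\<And>x. 0 \<le> F x" "\<And>x. F x \<le> C" "\<And>r. 0 < r \<Longrightarrow> convex {x. r < F x} \<and> bounded {x. r < F x}"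
    and G: "integrable lborel G" "\<And>x. 0 \<le> G x" "\<And>x. G x \<le> C" "\<And>r. 0 < r \<Longrightarrow> convex {x. r < G x} \<and> bounded {x. r < G x}"
    and H: "integrable lborel H" "\<And>x. 0 \<le> H x" and t: "0 < t" "t < 1"
    and le: "\<And>x y. F x powr (1 - t) * G y powr t \<le> H ((1 - t) * x + t * y)"
  shows "(LINT x|lborel. F x) powr (1 - t) * (LINT x|lborel. G x) powr t \<le> (LINT x|lborel. H x)"
proof (cases "(LINT x|lborel. F x) = 0 \<or> (LINT x|lborel. G x) = 0")
  case True
  then show ?thesis using H(2) by (auto intro: integral_nonneg_AE)
next
  case False
  have [measurable]: "F \<in> borel_measurable borel" "G \<in> borel_measurable borel" "H \<in> borel_measurable borel"
    using F(1) G(1) H(1) by auto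
  define A B where "A = (SUP x. F x)" and "B = (SUP x. G x)"
  have bdF: "bdd_above (range F)" and bdG: "bdd_above (range G)" by (rule bdd_aboveI2, rule F(3), rule bdd_aboveI2, rule G(3))
  have FA: "F x \<le> A" and GB: "G x \<le> B" for x
    unfolding A_def B_def using bdF bdG by (auto intro: cSUP_upper)
  have A: "0 < A"
  proof (rule ccontr)
    assume "\<not> 0 < A"
    then have "F x = 0" for x using FA[of x] F(2)[of x] by simp
    then show False using False by simp
  qed
  have B: "0 < B"
  proof (rule ccontr)
    assume "\<not> 0 < B"
    then have "G x = 0" for x using GB[of x] G(2)[of x] by simp
    then show False using False by simp
  qed
  define D where "D = A powr (1 - t) * B powr t"
  have D: "0 < D" using A B by (simp add: D_def)
  define f g h where "f x = F x / A" and "g x = G x / B" and "h x = H x / D" for x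
  have [measurable]: "f \<in> borel_measurable borel" "g \<in> borel_measurable borel" "h \<in> borel_measurable borel"
    unfolding f_def[abs_def] g_def[abs_def] h_def[abs_def] by measurable
  have f1: "0 \<le> f x" "f x \<le> 1" and g1: "0 \<le> g x" "g x \<le> 1" for x
    using F(2) G(2) FA GB A B by (auto simp: f_def g_def)
  have h0: "0 \<le> h x" for x using H(2) D by (simp add: h_def)
  have level: "ennreal (1 - t) * emeasure lborel {x. r < f x} + ennreal t * emeasure lborel {x. r < g x} \<le> emeasure lborel {x. r < h x}"
    if r: "0 < r" "r < 1" for r
  proof (rule emeasure_convex_combination_ge)
    have ef: "{x. r < f x} = {x. r * A < F x}" and eg: "{x. r < g x} = {x. r * B < G x}"
      using A B by (auto simp: f_def g_def field_simps)
    show "convex {x. r < f x}" "bounded {x. r < f x}" unfolding ef using F(4)[of "r * A"] r A by auto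
    show "convex {x. r < g x}" "bounded {x. r < g x}" unfolding eg using G(4)[of "r * B"] r B by auto
    have "r * A < A" "r * B < B" using r A B by auto
    then show "{x. r < f x} \<noteq> {}" "{x. r < g x} \<noteq> {}"
      unfolding ef eg A_def B_def using less_cSUP_iff[OF _ bdF] less_cSUP_iff[OF _ bdG] by auto
    show "{x. r < h x} \<in> sets borel" by measurable
    fix x y assume xy: "x \<in> {x. r < f x}" "y \<in> {x. r < g x}"
    have "r = r powr (1 - t) * r powr t" using r by (simp flip: powr_add)
    also have "\<dots> < f x powr (1 - t) * g y powr t"
      using xy r t by (intro mult_strict_mono powr_less_mono2) auto
    also have "\<dots> = F x powr (1 - t) * G y powr t / D"
      using F(2) G(2) A B by (simp add: f_def g_def D_def powr_divide)
    also have "\<dots> \<le> h ((1 - t) * x + t * y)"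
      unfolding h_def using le D by (intro divide_right_mono) auto
    finally show "(1 - t) * x + t * y \<in> {x. r < h x}" by simp
  qed (use t in auto)
  have fi: "integrable lborel f" and gi: "integrable lborel g" and hi: "integrable lborel h"
    unfolding f_def[abs_def] g_def[abs_def] h_def[abs_def] using F(1) G(1) H(1) by simp_all
  have nnf: "(\<integral>\<^sup>+x. ennreal (min 1 (f x)) \<partial>lborel) = ennreal (LINT x|lborel. f x)"
    using f1 by (subst nn_integral_eq_integral[OF fi, symmetric]) (auto simp: min_absorb2)
  have nng: "(\<integral>\<^sup>+x. ennreal (min 1 (g x)) \<partial>lborel) = ennreal (LINT x|lborel. g x)"
    using g1 by (subst nn_integral_eq_integral[OF gi, symmetric]) (auto simp: min_absorb2)
  have m: "(\<lambda>r. emeasure lborel {x. r < q x}) \<in> borel_measurable borel"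
    if [measurable]: "q \<in> borel_measurable borel" for q :: "real \<Rightarrow> real"
    by measurable
  note [measurable] = m[of f] m[of g] m[of h]
  have "ennreal ((1 - t) * (LINT x|lborel. f x) + t * (LINT x|lborel. g x))
      = ennreal (1 - t) * ennreal (LINT x|lborel. f x) + ennreal t * ennreal (LINT x|lborel. g x)"
    using t f1 g1 by (simp add: ennreal_mult integral_nonneg_AE)
  also have "\<dots> = (\<integral>\<^sup>+r. indicator {0<..<1} r * (ennreal (1 - t) * emeasure lborel {x. r < f x} + ennreal t * emeasure lborel {x. r < g x}) \<partial>lborel)"
    unfolding nnf[symmetric] nng[symmetric]
    by (subst (1 2) layer_cake_unit[symmetric]) (simp_all add: nn_integral_add nn_integral_cmult distrib_left mult.left_commute)
  also have "\<dots> \<le> (\<integral>\<^sup>+r. indicator {0<..<1} r * emeasure lborel {x. r < h x} \<partial>lborel)"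
    by (intro nn_integral_mono) (auto simp: indicator_def intro: level)
  also have "\<dots> = (\<integral>\<^sup>+x. ennreal (min 1 (h x)) \<partial>lborel)" by (rule layer_cake_unit) measurable
  also have "\<dots> \<le> (\<integral>\<^sup>+x. ennreal (h x) \<partial>lborel)" by (intro nn_integral_mono ennreal_leI) auto
  also have "\<dots> = ennreal (LINT x|lborel. h x)"
    using h0 by (intro nn_integral_eq_integral hi) auto
  finally have "(1 - t) * (LINT x|lborel. f x) + t * (LINT x|lborel. g x) \<le> (LINT x|lborel. h x)"
    using h0 by (simp add: ennreal_le_iff integral_nonneg_AE)
  then have "(LINT x|lborel. f x) powr (1 - t) * (LINT x|lborel. g x) powr t \<le> (LINT x|lborel. h x)"
    using weighted_geometric_le_arithmetic[of "LINT x|lborel. f x" "LINT x|lborel. g x" t] f1 g1 t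
    by (simp add: integral_nonneg_AE)
  moreover have "(LINT x|lborel. f x) powr (1 - t) * (LINT x|lborel. g x) powr t
      = (LINT x|lborel. F x) powr (1 - t) * (LINT x|lborel. G x) powr t / D"
    using A B F(2) G(2) by (simp add: f_def g_def D_def powr_divide integral_nonneg_AE)
  moreover have "(LINT x|lborel. h x) = (LINT x|lborel. H x) / D" by (simp add: h_def)
  ultimately show ?thesis using D by (simp add: divide_le_cancel)
qed

text \<open>Unlike concavity of the logarithm, this form needs no separate treatment of zeros:
  \<open>0 powr t = 0\<close>, so it holds trivially for nonnegative \<open>f\<close> vanishing at an endpoint, and it
  forces \<open>{x. 0 < f x}\<close> to be convex.\<close>

definition log_concave_fun :: "('a::real_vector \<Rightarrow> real) \<Rightarrow> bool" where
  "log_concave_fun f \<longleftrightarrow> (\<forall>x y t. 0 < t \<longrightarrow> t < 1 \<longrightarrow> f x powr (1 - t) * f y powr t \<le> f ((1 - t) *\<^sub>R x + t *\<^sub>R y))"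

lemma log_concave_funD:
  "log_concave_fun f \<Longrightarrow> 0 < t \<Longrightarrow> t < 1 \<Longrightarrow> f x powr (1 - t) * f y powr t \<le> f ((1 - t) *\<^sub>R x + t *\<^sub>R y)"
  by (simp add: log_concave_fun_def)

lemma log_concave_fun_convex_level:
  assumes f: "log_concave_fun f" and r: "0 < r"
  shows "convex {x. r < f x}"
  unfolding convex_alt
proof (intro ballI allI impI, elim conjE)
  fix x y t assume xy: "x \<in> {x. r < f x}" "y \<in> {x. r < f x}" and t: "0 \<le> t" "t \<le> (1::real)"
  consider "t = 0" | "t = 1" | "0 < t" "t < 1" using t by linarith
  then show "(1 - t) *\<^sub>R x + t *\<^sub>R y \<in> {x. r < f x}"
  proof cases
    case 3
    have "r = r powr (1 - t) * r powr t" using r by (simp flip: powr_add)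
    also have "\<dots> < f x powr (1 - t) * f y powr t"
      using xy r 3 by (intro mult_strict_mono powr_less_mono2) auto
    also have "\<dots> \<le> f ((1 - t) *\<^sub>R x + t *\<^sub>R y)" by (rule log_concave_funD[OF f 3])
    finally show ?thesis by simp
  qed (use xy in auto)
qed

lemma log_concave_normal_density:
  assumes "0 < \<sigma>" shows "log_concave_fun (normal_density 0 \<sigma>)"
  unfolding log_concave_fun_def
proof (intro allI impI)
  fix x y t :: real assume t: "0 < t" "t < 1"
  define c where "c = 1 / sqrt (2 * pi * \<sigma>\<^sup>2)"
  have c: "0 < c" using assms by (simp add: c_def)
  have n: "normal_density 0 \<sigma> z = exp (ln c - z\<^sup>2 / (2 * \<sigma>\<^sup>2))" for z
  proof -
    have "normal_density 0 \<sigma> z = c * exp (- (z\<^sup>2 / (2 * \<sigma>\<^sup>2)))" by (simp add: normal_density_def c_def)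
    moreover have "exp (ln c + - (z\<^sup>2 / (2 * \<sigma>\<^sup>2))) = c * exp (- (z\<^sup>2 / (2 * \<sigma>\<^sup>2)))"
      using c by (simp only: exp_add exp_ln)
    ultimately show ?thesis by (simp only: diff_conv_add_uminus)
  qed
  have "((1 - t) * x + t * y)\<^sup>2 \<le> (1 - t) * x\<^sup>2 + t * y\<^sup>2"
  proof -
    have "0 \<le> t * (1 - t) * (x - y)\<^sup>2" using t by simp
    then show ?thesis by (simp add: power2_eq_square algebra_simps)
  qed
  then have "((1 - t) * x + t * y)\<^sup>2 / (2 * \<sigma>\<^sup>2) \<le> ((1 - t) * x\<^sup>2 + t * y\<^sup>2) / (2 * \<sigma>\<^sup>2)"
    by (intro divide_right_mono) auto
  moreover have "(1 - t) * (ln c - x\<^sup>2 / (2 * \<sigma>\<^sup>2)) + t * (ln c - y\<^sup>2 / (2 * \<sigma>\<^sup>2)) = ln c - ((1 - t) * x\<^sup>2 + t * y\<^sup>2) / (2 * \<sigma>\<^sup>2)"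
    by (simp add: left_diff_distrib right_diff_distrib distrib_left add_divide_distrib diff_divide_distrib)
  ultimately have "(1 - t) * (ln c - x\<^sup>2 / (2 * \<sigma>\<^sup>2)) + t * (ln c - y\<^sup>2 / (2 * \<sigma>\<^sup>2)) \<le> ln c - ((1 - t) * x + t * y)\<^sup>2 / (2 * \<sigma>\<^sup>2)"
    by simp
  then show "normal_density 0 \<sigma> x powr (1 - t) * normal_density 0 \<sigma> y powr t \<le> normal_density 0 \<sigma> ((1 - t) *\<^sub>R x + t *\<^sub>R y)"
  proof -
    have e: "exp a powr u = exp (u * a)" for a u :: real by (simp add: powr_def)
    show ?thesis using \<open>_ \<le> ln c - ((1 - t) * x + t * y)\<^sup>2 / (2 * \<sigma>\<^sup>2)\<close>
      by (simp only: n e exp_add[symmetric] exp_le_cancel_iff real_scaleR_def)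
  qed
qed

lemma bounded_normal_density_level:
  assumes "0 < \<sigma>" "0 < r" shows "bounded {x. r < normal_density 0 \<sigma> x}"
proof -
  define c where "c = 1 / sqrt (2 * pi * \<sigma>\<^sup>2)"
  have c: "0 < c" using assms by (simp add: c_def)
  have "\<bar>x\<bar> \<le> sqrt (2 * \<sigma>\<^sup>2 * (c / r))" if "r < normal_density 0 \<sigma> x" for x
  proof -
    let ?y = "x\<^sup>2 / (2 * \<sigma>\<^sup>2)"
    have "r < c * exp (- ?y)" using that by (simp add: normal_density_def c_def)
    then have "exp ?y < c / r" using assms by (simp add: exp_minus field_simps)
    moreover have "?y \<le> exp ?y" by (rule order.trans[OF _ exp_ge_add_one_self]) simp
    ultimately have "?y \<le> c / r" by simp
    then have "x\<^sup>2 \<le> 2 * \<sigma>\<^sup>2 * (c / r)" using assms(1) by (simp add: pos_divide_le_eq mult.commute)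
    then show ?thesis using real_le_rsqrt by (simp add: real_sqrt_le_mono flip: real_sqrt_abs)
  qed
  then show ?thesis unfolding bounded_iff real_norm_def by blast
qed

text \<open>The integrand is log-concave jointly in \<open>x\<close> and \<open>r\<close>, and its level sets in \<open>r\<close> are bounded
  because of the Gaussian factor, so one-dimensional Prekopa--Leindler applies.\<close>

lemma log_concave_convolve_line:
  fixes f :: "'a::euclidean_space \<Rightarrow> real"
  assumes f: "log_concave_fun f" and [measurable]: "f \<in> borel_measurable borel" and bd: "\<And>x. 0 \<le> f x" "\<And>x. f x \<le> M"
    and \<sigma>: "0 < \<sigma>"
  shows "integrable lborel (\<lambda>r. f (x + r *\<^sub>R e) * normal_density 0 \<sigma> r)"
    and "log_concave_fun (\<lambda>x. LINT r|lborel. f (x + r *\<^sub>R e) * normal_density 0 \<sigma> r)"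
    and "(\<lambda>x. LINT r|lborel. f (x + r *\<^sub>R e) * normal_density 0 \<sigma> r) \<in> borel_measurable borel"
    and "0 \<le> (LINT r|lborel. f (x + r *\<^sub>R e) * normal_density 0 \<sigma> r)"
    and "(LINT r|lborel. f (x + r *\<^sub>R e) * normal_density 0 \<sigma> r) \<le> M"
proof -
  let ?n = "normal_density 0 \<sigma>"
  have M: "0 \<le> M" using order.trans[OF bd] by blast
  have ni: "integrable lborel ?n" using \<sigma> by (rule integrable_normal_density)
  show i: "integrable lborel (\<lambda>r. f (x + r *\<^sub>R e) * ?n r)" for x
  proof (rule Bochner_Integration.integrable_bound)
    show "integrable lborel (\<lambda>r. M * ?n r)" using ni by simp
    show "AE r in lborel. norm (f (x + r *\<^sub>R e) * ?n r) \<le> norm (M * ?n r)"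
      using bd M by (intro AE_I2) (auto simp: abs_mult intro!: mult_right_mono)
  qed measurable
  show "(\<lambda>x. LINT r|lborel. f (x + r *\<^sub>R e) * ?n r) \<in> borel_measurable borel"
    by measurable
  show "0 \<le> (LINT r|lborel. f (x + r *\<^sub>R e) * ?n r)"
    using bd by (intro integral_nonneg_AE AE_I2) simp
  have "(LINT r|lborel. f (x + r *\<^sub>R e) * ?n r) \<le> (LINT r|lborel. M * ?n r)"
    using ni bd by (intro integral_mono i) (auto intro!: mult_right_mono)
  then show "(LINT r|lborel. f (x + r *\<^sub>R e) * ?n r) \<le> M"
    using integral_normal_density[OF \<sigma>, of 0] by simp
  define F where "F x r = f (x + r *\<^sub>R e) * ?n r" for x r
  have lc: "F x a powr (1 - t) * F y b powr t \<le> F ((1 - t) *\<^sub>R x + t *\<^sub>R y) ((1 - t) * a + t * b)"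
    if t: "0 < t" "t < 1" for x y a b t
  proof -
    have "F x a powr (1 - t) * F y b powr t
        = (f (x + a *\<^sub>R e) powr (1 - t) * f (y + b *\<^sub>R e) powr t) * (?n a powr (1 - t) * ?n b powr t)"
      using bd by (simp add: F_def powr_mult)
    also have "\<dots> \<le> f ((1 - t) *\<^sub>R (x + a *\<^sub>R e) + t *\<^sub>R (y + b *\<^sub>R e)) * ?n ((1 - t) *\<^sub>R a + t *\<^sub>R b)"
      using bd by (intro mult_mono log_concave_funD[OF f t] log_concave_funD[OF log_concave_normal_density[OF \<sigma>] t]) auto
    also have "\<dots> = F ((1 - t) *\<^sub>R x + t *\<^sub>R y) ((1 - t) * a + t * b)"
      by (simp add: F_def algebra_simps)
    finally show ?thesis .
  qed
  have lcF: "log_concave_fun (F x)" for x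
    unfolding log_concave_fun_def using lc[of _ x _ x] by (auto simp flip: scaleR_left_distrib)
  have n1: "?n r \<le> 1 / sqrt (2 * pi * \<sigma>\<^sup>2)" for r
    using \<sigma> by (simp add: normal_density_def divide_right_mono)
  have FC: "F x r \<le> M * (1 / sqrt (2 * pi * \<sigma>\<^sup>2))" for x r
    unfolding F_def using bd M by (intro mult_mono n1) auto
  have lev: "convex {r. q < F x r} \<and> bounded {r. q < F x r}" if q: "0 < q" for x q
  proof
    show "convex {r. q < F x r}" by (rule log_concave_fun_convex_level[OF lcF q])
    have "{r. q < F x r} \<subseteq> {r. q / (M + 1) < ?n r}"
    proof safe
      fix r assume "q < F x r"
      also have "\<dots> \<le> (M + 1) * ?n r" unfolding F_def using bd(2)[of "x + r *\<^sub>R e"] by (intro mult_right_mono) auto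
      finally show "q / (M + 1) < ?n r" using M by (simp add: field_simps add_nonneg_pos)
    qed
    then show "bounded {r. q < F x r}"
      using bounded_normal_density_level[OF \<sigma>, of "q / (M + 1)"] q M by (auto intro: bounded_subset)
  qed
  show "log_concave_fun (\<lambda>x. LINT r|lborel. f (x + r *\<^sub>R e) * ?n r)"
    unfolding log_concave_fun_def F_def[symmetric]
  proof (intro allI impI)
    fix x y :: 'a and t :: real assume t: "0 < t" "t < 1"
    show "(LINT r|lborel. F x r) powr (1 - t) * (LINT r|lborel. F y r) powr t
        \<le> (LINT r|lborel. F ((1 - t) *\<^sub>R x + t *\<^sub>R y) r)"
      using i bd by (intro prekopa_leindler_1D[OF _ _ FC lev _ _ FC lev _ _ t lc[OF t]]) (auto simp: F_def)
  qed
qed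

text \<open>A Gaussian in \<open>n\<close> dimensions is a product of Gaussians along the coordinate axes, so the
  convolution is an iteration of \<open>log_concave_convolve_line\<close> over the basis vectors, and
  Prekopa--Leindler is used in dimension one only.\<close>

lemma log_concave_heat:
  fixes f :: "'a::euclidean_space \<Rightarrow> real"
  assumes f: "log_concave_fun f" "f \<in> borel_measurable borel" "\<And>x. 0 \<le> f x" "\<And>x. f x \<le> M" and s: "0 < s"
  shows "log_concave_fun (\<lambda>x. LINT z|lborel. f (x + z) * gauss s z)"
proof -
  let ?n = "normal_density 0 (sqrt s)"
  have \<sigma>: "0 < sqrt s" using s by simp
  interpret product_sigma_finite "\<lambda>_::'a. lborel :: real measure" by standard
  have [measurable]: "f \<in> borel_measurable borel" by (rule f)
  define P where "P I h \<longleftrightarrow> (\<forall>x. (\<integral>\<^sup>+z. ennreal (f (x + (\<Sum>b\<in>I. z b *\<^sub>R b)) * (\<Prod>b\<in>I. ?n (z b))) \<partial>(\<Pi>\<^sub>M b\<in>I. lborel)) = ennreal (h x))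
      \<and> log_concave_fun h \<and> h \<in> borel_measurable borel \<and> (\<forall>x. 0 \<le> h x \<and> h x \<le> M)" for I and h :: "'a \<Rightarrow> real"
  have "\<exists>h. P I h" if "finite I" for I
    using that
  proof (induction I rule: finite_induct)
    case empty
    have "P {} f" using f by (simp add: P_def PiM_empty nn_integral_count_space_finite)
    then show ?case by blast
  next
    case (insert i I)
    then obtain h where h: "P I h" by blast
    then have hx: "(\<integral>\<^sup>+z. ennreal (f (x + (\<Sum>b\<in>I. z b *\<^sub>R b)) * (\<Prod>b\<in>I. ?n (z b))) \<partial>(\<Pi>\<^sub>M b\<in>I. lborel)) = ennreal (h x)" for x
      by (simp add: P_def)
    have hp: "log_concave_fun h" "h \<in> borel_measurable borel" "\<And>x. 0 \<le> h x" "\<And>x. h x \<le> M" using h by (auto simp: P_def)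
    define h' where "h' x = (LINT r|lborel. h (x + r *\<^sub>R i) * ?n r)" for x
    note L = log_concave_convolve_line[OF hp \<sigma>, where e=i]
    have "(\<integral>\<^sup>+z. ennreal (f (x + (\<Sum>b\<in>insert i I. z b *\<^sub>R b)) * (\<Prod>b\<in>insert i I. ?n (z b))) \<partial>(\<Pi>\<^sub>M b\<in>insert i I. lborel)) = ennreal (h' x)" for x
    proof -
      have "(\<integral>\<^sup>+z. ennreal (f (x + (\<Sum>b\<in>insert i I. z b *\<^sub>R b)) * (\<Prod>b\<in>insert i I. ?n (z b))) \<partial>(\<Pi>\<^sub>M b\<in>insert i I. lborel))
        = (\<integral>\<^sup>+r. (\<integral>\<^sup>+z. ennreal (f (x + (\<Sum>b\<in>insert i I. (z(i := r)) b *\<^sub>R b)) * (\<Prod>b\<in>insert i I. ?n ((z(i := r)) b))) \<partial>(\<Pi>\<^sub>M b\<in>I. lborel)) \<partial>lborel)"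
        using insert.hyps by (intro product_nn_integral_insert_rev) measurable
      also have "\<dots> = (\<integral>\<^sup>+r. ennreal (h (x + r *\<^sub>R i) * ?n r) \<partial>lborel)"
      proof (rule nn_integral_cong)
        fix r
        have s: "(\<Sum>b\<in>insert i I. (z(i := r)) b *\<^sub>R b) = r *\<^sub>R i + (\<Sum>b\<in>I. z b *\<^sub>R b)" for z
          using insert.hyps by (auto intro!: sum.cong)
        have p: "(\<Prod>b\<in>insert i I. ?n ((z(i := r)) b)) = ?n r * (\<Prod>b\<in>I. ?n (z b))" for z
          using insert.hyps by (auto intro!: prod.cong)
        have "(\<integral>\<^sup>+z. ennreal (f (x + (\<Sum>b\<in>insert i I. (z(i := r)) b *\<^sub>R b)) * (\<Prod>b\<in>insert i I. ?n ((z(i := r)) b))) \<partial>(\<Pi>\<^sub>M b\<in>I. lborel))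
          = (\<integral>\<^sup>+z. ennreal (?n r) * ennreal (f ((x + r *\<^sub>R i) + (\<Sum>b\<in>I. z b *\<^sub>R b)) * (\<Prod>b\<in>I. ?n (z b))) \<partial>(\<Pi>\<^sub>M b\<in>I. lborel))"
          unfolding s p using f(3) by (intro nn_integral_cong) (simp add: prod_nonneg mult_ac add.assoc flip: ennreal_mult)
        also have "\<dots> = ennreal (?n r) * ennreal (h (x + r *\<^sub>R i))"
          using insert.hyps by (subst nn_integral_cmult) (measurable, simp add: hx)
        also have "\<dots> = ennreal (h (x + r *\<^sub>R i) * ?n r)"
          using hp(3) by (simp add: mult.commute flip: ennreal_mult)
        finally show "(\<integral>\<^sup>+z. ennreal (f (x + (\<Sum>b\<in>insert i I. (z(i := r)) b *\<^sub>R b)) * (\<Prod>b\<in>insert i I. ?n ((z(i := r)) b))) \<partial>(\<Pi>\<^sub>M b\<in>I. lborel))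
          = ennreal (h (x + r *\<^sub>R i) * ?n r)" .
      qed
      also have "\<dots> = ennreal (h' x)"
        unfolding h'_def using hp(3) by (intro nn_integral_eq_integral L) auto
      finally show ?thesis .
    qed
    then have "P (insert i I) h'"
      unfolding P_def using L(2-5) by (simp add: h'_def[abs_def])
    then show ?case by blast
  qed
  then obtain h where h: "P Basis h" by (metis finite_Basis)
  have "(LINT z|lborel. f (x + z) * gauss s z) = h x" for x
  proof -
    have "(\<integral>\<^sup>+z. ennreal (f (x + z) * gauss s z) \<partial>lborel)
        = (\<integral>\<^sup>+z. ennreal (f (x + (\<Sum>b\<in>Basis. z b *\<^sub>R b)) * gauss s (\<Sum>b\<in>Basis. z b *\<^sub>R b)) \<partial>(\<Pi>\<^sub>M b\<in>(Basis :: 'a set). lborel))"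
      by (subst lborel_eq, subst nn_integral_distr) measurable
    also have "\<dots> = (\<integral>\<^sup>+z. ennreal (f (x + (\<Sum>b\<in>Basis. z b *\<^sub>R b)) * (\<Prod>b\<in>Basis. ?n (z b))) \<partial>(\<Pi>\<^sub>M b\<in>(Basis :: 'a set). lborel))"
      by (simp add: gauss_eq_prod[OF s])
    also have "\<dots> = ennreal (h x)" using h by (simp add: P_def)
    finally have "(\<integral>\<^sup>+z. ennreal (f (x + z) * gauss s z) \<partial>lborel) = ennreal (h x)" .
    then show ?thesis
      using h f(3) by (intro integral_eq_nn_integral[THEN trans]) (auto simp: P_def)
  qed
  then show ?thesis using h by (simp add: P_def)
qed

section \<open>Log-concave probability densities\<close>

locale log_concave_prob = prob_density +
  assumes log_concave: "log_concave_fun \<rho>"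
begin

text \<open>The open convex set on which \<open>\<mu>\<close> lives, up to a null set; it is \<open>pos_domain \<rho>\<close>.\<close>

definition dom :: "'a set" where
  "dom = interior {x. 0 < \<rho> x}"

lemma convex_pos: "convex {x. 0 < \<rho> x}"
  unfolding convex_alt
proof (intro ballI allI impI, elim conjE)
  fix x y t assume xy: "x \<in> {x. 0 < \<rho> x}" "y \<in> {x. 0 < \<rho> x}" and t: "0 \<le> t" "t \<le> (1::real)"
  consider "t = 0" | "t = 1" | "0 < t" "t < 1" using t by linarith
  then show "(1 - t) *\<^sub>R x + t *\<^sub>R y \<in> {x. 0 < \<rho> x}"
  proof cases
    case 3
    have "0 < \<rho> x powr (1 - t) * \<rho> y powr t" using xy by simp
    also have "\<dots> \<le> \<rho> ((1 - t) *\<^sub>R x + t *\<^sub>R y)" by (rule log_concave_funD[OF log_concave 3])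
    finally show ?thesis by simp
  qed (use xy in auto)
qed

lemma open_dom: "open dom" and convex_dom: "convex dom" and dom_pos: "x \<in> dom \<Longrightarrow> 0 < \<rho> x"
  using interior_subset[of "{x. 0 < \<rho> x}"] convex_interior[OF convex_pos] by (auto simp: dom_def)

lemma AE_dom: "AE x in lborel. \<rho> x \<noteq> 0 \<longrightarrow> x \<in> dom"
proof -
  have "AE x in lebesgue. x \<notin> frontier {x. 0 < \<rho> x}"
    using negligible_convex_frontier[OF convex_pos] by (intro AE_not_in) (simp add: negligible_iff_null_sets)
  then have "AE x in lborel. x \<notin> frontier {x. 0 < \<rho> x}" by (simp add: AE_completion_iff)
  then show ?thesis
  proof eventually_elim
    case (elim x)
    show ?case
    proof
      assume "\<rho> x \<noteq> 0"
      then have "x \<in> {x. 0 < \<rho> x}" using nonneg[of x] by simp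
      then show "x \<in> dom"
        using elim closure_subset[of "{x. 0 < \<rho> x}"] by (auto simp: frontier_def dom_def)
    qed
  qed
qed

lemma dom_nonempty: "dom \<noteq> {}"
proof
  assume "dom = {}"
  then have "AE x in lborel. \<rho> x = 0" using AE_dom by simp
  then have "(LINT x|lborel. \<rho> x) = 0" by (rule integral_eq_zero_AE)
  then show False using integral by simp
qed

text \<open>Concave functions on open sets are continuous.\<close>

lemma continuous_on_dom: "continuous_on dom \<rho>"
proof -
  have "convex_on dom (\<lambda>x. - ln (\<rho> x))"
  proof (rule convex_onI[OF _ convex_dom])
    fix t x y assume t: "0 < t" "t < (1::real)" and xy: "x \<in> dom" "y \<in> dom"
    have "(1 - t) * ln (\<rho> x) + t * ln (\<rho> y) = ln (\<rho> x powr (1 - t) * \<rho> y powr t)"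
      using xy[THEN dom_pos] by (simp add: ln_mult ln_powr)
    also have "\<dots> \<le> ln (\<rho> ((1 - t) *\<^sub>R x + t *\<^sub>R y))"
      using xy[THEN dom_pos] log_concave_funD[OF log_concave t, of x y] by (intro ln_mono) auto
    finally show "- ln (\<rho> ((1 - t) *\<^sub>R x + t *\<^sub>R y)) \<le> (1 - t) * - ln (\<rho> x) + t * - ln (\<rho> y)" by simp
  qed
  from convex_on_continuous[OF open_dom this] have "continuous_on dom (\<lambda>x. exp (- (- ln (\<rho> x))))"
    by (rule continuous_on_exp[OF continuous_on_minus])
  moreover have "exp (- (- ln (\<rho> x))) = \<rho> x" if "x \<in> dom" for x using dom_pos[OF that] by simp
  ultimately show ?thesis by (metis (no_types, lifting) continuous_on_cong)
qed

lemma lower_bound_on_compact: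
  assumes "compact C" "C \<subseteq> dom"
  shows "\<exists>m>0. \<forall>x\<in>C. m \<le> \<rho> x"
proof (cases "C = {}")
  case False
  obtain x where x: "x \<in> C" "\<And>y. y \<in> C \<Longrightarrow> \<rho> x \<le> \<rho> y"
    using continuous_attains_inf[OF assms(1) False continuous_on_subset[OF continuous_on_dom assms(2)]] by blast
  then show ?thesis using dom_pos assms(2) by (intro exI[of _ "\<rho> x"]) auto
qed (auto intro: exI[of _ 1])

lemma exists_box_in_dom: "\<exists>p q. cbox p q \<subseteq> dom \<and> (\<forall>i\<in>Basis. p \<bullet> i < q \<bullet> i)"
proof -
  obtain x where "x \<in> dom" using dom_nonempty by blast
  then obtain e where e: "0 < e" "cball x e \<subseteq> dom" using open_dom open_contains_cball by metis
  obtain a b where ab: "x \<in> box a b" "box a b \<subseteq> ball x e"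
    using rational_boxes[OF e(1), of x] by metis
  have ne: "box a b \<noteq> {}" using ab by auto
  have "cbox a b \<subseteq> closure (ball x e)" using closure_mono[OF ab(2)] ne by (simp add: closure_box)
  then have "cbox a b \<subseteq> dom" using e by auto
  then show ?thesis using ab(1) by (intro exI[of _ a] exI[of _ b]) (force simp: mem_box)
qed

text \<open>If \<open>\<rho>\<close> is at least \<open>m\<close> on a box, then \<open>\<rho> \<ge> \<surd>(\<rho>(x) m)\<close> on the box shrunk by the factor 1/2
  towards \<open>x\<close>. As the total integral is 1, a large value \<open>\<rho>(x)\<close> is impossible.\<close>

lemma bounded_density: "\<exists>M. \<forall>x. \<rho> x \<le> M"
proof -
  obtain p q where pq: "cbox p q \<subseteq> dom" "\<And>i. i \<in> Basis \<Longrightarrow> p \<bullet> i < q \<bullet> i" using exists_box_in_dom by blast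
  obtain m where m: "0 < m" "\<And>x. x \<in> cbox p q \<Longrightarrow> m \<le> \<rho> x"
    using lower_bound_on_compact[OF compact_cbox pq(1)] by blast
  define c where "c = measure lborel (cbox p q)"
  have c: "0 < c" unfolding c_def using pq(2) by (simp add: content_pos_lt_eq)
  have "\<rho> x \<le> (2 ^ DIM('a) / c)\<^sup>2 / m" for x
  proof -
    have "sqrt (\<rho> x * m) * c \<le> 2 ^ DIM('a)"
    proof -
      have "sqrt (\<rho> x * m) * c = (LINT z|lborel. sqrt (\<rho> x * m) * indicator (cbox p q) z)"
        by (simp add: c_def)
      also have "\<dots> \<le> (LINT z|lborel. \<rho> ((1 / 2) *\<^sub>R x + (1 / 2) *\<^sub>R z))"
      proof (rule integral_mono)
        show "integrable lborel (\<lambda>z. \<rho> ((1 / 2) *\<^sub>R x + (1 / 2) *\<^sub>R z))"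
          using integrable by (subst integrable_lborel_affine) auto
        show "integrable lborel (\<lambda>z. sqrt (\<rho> x * m) * indicator (cbox p q) z)"
          by (intro integrable_mult_right integrable_real_indicator) (auto simp: emeasure_lborel_cbox_eq)
        fix z
        show "sqrt (\<rho> x * m) * indicator (cbox p q) z \<le> \<rho> ((1 / 2) *\<^sub>R x + (1 / 2) *\<^sub>R z)"
        proof (cases "z \<in> cbox p q")
          case True
          have "sqrt (\<rho> x * m) \<le> sqrt (\<rho> x * \<rho> z)"
            using m(2)[OF True] nonneg by (intro real_sqrt_le_mono mult_left_mono) auto
          also have "\<dots> = \<rho> x powr (1 - 1 / 2) * \<rho> z powr (1 / 2)"
            using nonneg by (simp add: powr_half_sqrt real_sqrt_mult)
          also have "\<dots> \<le> \<rho> ((1 - 1 / 2) *\<^sub>R x + (1 / 2) *\<^sub>R z)"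
            by (rule log_concave_funD[OF log_concave]) auto
          finally show ?thesis using True by simp
        qed (use nonneg in simp)
      qed
      also have "\<dots> = 2 ^ DIM('a)"
        using integral by (subst integral_lborel_affine) (auto simp: power_one_over)
      finally show ?thesis .
    qed
    then have "sqrt (\<rho> x * m) \<le> 2 ^ DIM('a) / c" using c by (simp add: field_simps)
    then have "(sqrt (\<rho> x * m))\<^sup>2 \<le> (2 ^ DIM('a) / c)\<^sup>2" using nonneg m by (intro power_mono) auto
    then have "\<rho> x * m \<le> (2 ^ DIM('a) / c)\<^sup>2" using nonneg[of x] m by simp
    then show ?thesis using m by (simp add: pos_le_divide_eq)
  qed
  then show ?thesis by blast
qed

lemma log_concave_evol: assumes s: "0 < s" shows "log_concave_fun (evol s)"
proof -
  obtain M where M: "\<And>x. \<rho> x \<le> M" using bounded_density by blast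
  have "evol s x = (LINT z|lborel. \<rho> (x + z) * gauss s z)" for x
  proof -
    have "evol s x = (LINT y|lborel. \<rho> y * gauss s (x - y))" by (simp add: evol_def conv_def)
    also have "\<dots> = (LINT z|lborel. \<rho> (z + x) * gauss s (x - (z + x)))"
      by (rule integral_lborel_translation[symmetric]) measurable
    finally show ?thesis by (simp add: gauss_minus add.commute)
  qed
  then have "evol s = (\<lambda>x. LINT z|lborel. \<rho> (x + z) * gauss s z)" by (rule ext)
  then show ?thesis using log_concave_heat[OF log_concave measurable_density nonneg M s] by simp
qed

lemma score_hess_quadratic_form:
  fixes a :: "'a \<Rightarrow> real"
  assumes s: "0 < s"
  defines "e \<equiv> \<Sum>i\<in>Basis. a i *\<^sub>R i"
  shows "(\<Sum>i\<in>Basis. \<Sum>c\<in>Basis. a i * a c * score_hess c i s x) = score_hess e e s x"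
proof -
  have k: "integrable lborel (\<lambda>y. 1 * \<rho> y * k s (x - y))"
    if kd: "gauss_dominated k" and kc: "continuous_on UNIV (k s)" for k :: "real \<Rightarrow> 'a \<Rightarrow> real"
  proof -
    obtain C where C: "\<And>z. \<bar>k s z\<bar> \<le> C" using gauss_dominated_bounded[OF kd s order.refl] by auto
    show ?thesis
      using integrable_conv_kernel[OF integrable borel_measurable_continuous_onI[OF kc] C] by simp
  qed
  have ze: "z \<bullet> e = (\<Sum>i\<in>Basis. a i * (z \<bullet> i))" for z by (simp add: e_def inner_sum_right)
  have g1: "gauss1 s e z = (\<Sum>i\<in>Basis. a i * gauss1 s i z)" for z
    by (simp add: gauss1_def ze sum_negf sum_divide_distrib sum_distrib_right mult.assoc)
  have g2: "gauss2 s e e z = (\<Sum>i\<in>Basis. \<Sum>c\<in>Basis. a i * a c * gauss2 s c i z)" for z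
  proof -
    have "gauss2 s e e z = ((\<Sum>i\<in>Basis. a i * (z \<bullet> i)) * (\<Sum>c\<in>Basis. a c * (z \<bullet> c)) / s\<^sup>2 - (\<Sum>i\<in>Basis. a i * (e \<bullet> i)) / s) * gauss s z"
      by (simp add: gauss2_def ze[of z] ze[of e])
    also have "(\<Sum>i\<in>Basis. a i * (e \<bullet> i)) = (\<Sum>i\<in>Basis. \<Sum>c\<in>Basis. a i * a c * (c \<bullet> i))"
      by (simp add: e_def inner_sum_left sum_distrib_left mult.assoc)
    also have "(\<Sum>i\<in>Basis. a i * (z \<bullet> i)) * (\<Sum>c\<in>Basis. a c * (z \<bullet> c)) = (\<Sum>i\<in>Basis. \<Sum>c\<in>Basis. a i * a c * ((z \<bullet> c) * (z \<bullet> i)))"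
      by (simp add: sum_product mult_ac)
    finally show ?thesis
      by (simp add: gauss2_def sum_divide_distrib sum_distrib_right sum_subtractf[symmetric] right_diff_distrib left_diff_distrib mult.assoc)
  qed
  have "conv (gauss1 s e) (\<lambda>y. 1 * \<rho> y) x = (\<Sum>i\<in>Basis. a i * conv (gauss1 s i) (\<lambda>y. 1 * \<rho> y) x)"
    unfolding conv_def g1 sum_distrib_left
    using k[OF gauss_dominated_derivs(2) continuous_gauss_derivs(1)] by (simp add: mult.left_commute[of "\<rho> _"])
  then have sc: "score e s x = (\<Sum>i\<in>Basis. a i * score i s x)"
    by (simp add: score_def ratio_def sum_divide_distrib)
  have "conv (gauss2 s e e) (\<lambda>y. 1 * \<rho> y) x = (\<Sum>i\<in>Basis. \<Sum>c\<in>Basis. a i * a c * conv (gauss2 s c i) (\<lambda>y. 1 * \<rho> y) x)"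
    unfolding conv_def g2 sum_distrib_left
    using k[OF gauss_dominated_derivs(3) continuous_gauss_derivs(2)] by (simp add: mult.left_commute[of "\<rho> _"])
  then have r2: "ratio (\<lambda>_. 1) (\<lambda>s. gauss2 s e e) s x = (\<Sum>i\<in>Basis. \<Sum>c\<in>Basis. a i * a c * ratio (\<lambda>_. 1) (\<lambda>s. gauss2 s c i) s x)"
    by (simp add: ratio_def sum_divide_distrib)
  have "score e s x * score e s x = (\<Sum>i\<in>Basis. \<Sum>c\<in>Basis. a i * a c * (score c s x * score i s x))"
    unfolding sc by (simp add: sum_product mult_ac)
  then show ?thesis
    by (simp add: score_hess_def r2 right_diff_distrib sum_subtractf)
qed

text \<open>The symmetric second difference \<open>m\<close> of \<open>ln \<rho>\<^sub>s\<close> along \<open>e\<close> is nonpositive by log-concavity. A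
  positive second derivative at \<open>x\<close> would make \<open>m\<close> increase from \<open>m 0 = 0\<close>.\<close>

lemma score_hess_diag_nonpos:
  assumes s: "0 < s"
  shows "score_hess e e s x \<le> 0"
proof (rule ccontr)
  assume "\<not> score_hess e e s x \<le> 0"
  then have pos: "0 < score_hess e e s x" by simp
  let ?v = "\<lambda>t. evol s (x + t *\<^sub>R e)" and ?g = "\<lambda>t. score e s (x + t *\<^sub>R e)"
  define m where "m t = ln (?v t) + ln (?v (- t)) - 2 * ln (?v 0)" for t
  have v: "0 < ?v t" for t by (rule evol_pos[OF s])
  have m_le: "m t \<le> 0" for t
  proof -
    have "evol s (x + t *\<^sub>R e) powr (1 - 1 / 2) * evol s (x + (- t) *\<^sub>R e) powr (1 / 2)
        \<le> evol s ((1 - 1 / 2) *\<^sub>R (x + t *\<^sub>R e) + (1 / 2) *\<^sub>R (x + (- t) *\<^sub>R e))"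
      by (rule log_concave_funD[OF log_concave_evol[OF s]]) auto
    also have "(1 - 1 / 2) *\<^sub>R (x + t *\<^sub>R e) + (1 / 2) *\<^sub>R (x + (- t) *\<^sub>R e) = x + 0 *\<^sub>R e"
      by (simp add: algebra_simps flip: scaleR_add_left)
    finally have "ln (?v t powr (1 / 2) * ?v (- t) powr (1 / 2)) \<le> ln (?v 0)"
      using v[of t] v[of "- t"] by (intro ln_mono) auto
    then show ?thesis using v[of t] v[of "- t"] by (simp add: m_def ln_mult ln_powr)
  qed
  have L: "((\<lambda>t. ln (?v t)) has_real_derivative ?g t) (at t)" for t
    by (rule DERIV_cong[OF DERIV_chain2[OF DERIV_ln_divide[OF v] evol_deriv[OF s]]]) (use v[of t] in simp)
  have neg: "((\<lambda>t. f (- t)) has_real_derivative - D) (at t)" if "(f has_real_derivative D) (at (- t))" for f D t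
    using DERIV_chain2[OF that DERIV_minus[OF DERIV_ident]] by simp
  have m': "(m has_real_derivative ?g t - ?g (- t)) (at t)" for t
    unfolding m_def[abs_def]
    by (rule DERIV_cong[OF DERIV_diff[OF DERIV_add[OF L neg[OF L]] DERIV_const]]) simp
  have "((\<lambda>t. ?g t - ?g (- t)) has_real_derivative 2 * score_hess e e s x) (at 0)"
    by (rule DERIV_cong[OF DERIV_diff[OF score_deriv[OF s] neg[OF score_deriv[OF s]]]]) simp
  from DERIV_pos_inc_right[OF this] pos obtain d where d: "0 < d" "\<And>h. 0 < h \<Longrightarrow> h < d \<Longrightarrow> 0 < ?g h - ?g (- h)"
    by auto
  have "\<exists>z>0. z < d / 2 \<and> m (d / 2) - m 0 = (d / 2 - 0) * (?g z - ?g (- z))"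
    using d(1) by (intro MVT2 m') auto
  then obtain z where z: "0 < z" "z < d / 2" "m (d / 2) - m 0 = d / 2 * (?g z - ?g (- z))" by auto
  have "0 < d / 2 * (?g z - ?g (- z))" using d(1) d(2)[of z] z by (intro mult_pos_pos) auto
  moreover have "m 0 = 0" by (simp add: m_def)
  ultimately show False using z(3) m_le[of "d / 2"] by simp
qed

end

text \<open>The quadratic form of the Hessian in coordinates is the second derivative along a single
  direction.\<close>

sublocale log_concave_prob \<subseteq> concave_evolution
proof
  show "(\<Sum>i\<in>Basis. \<Sum>c\<in>Basis. a i * a c * score_hess c i s x) \<le> 0" if "0 < s" for s a x
    unfolding score_hess_quadratic_form[OF that] by (rule score_hess_diag_nonpos[OF that])
qed

section \<open>The initial energy bounds the energy at positive times\<close>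

text \<open>Jensen's inequality for the square, allowing an infinite right-hand side.\<close>

lemma sq_integral_le_nn_integral:
  fixes f k :: "'a::euclidean_space \<Rightarrow> real"
  assumes [measurable]: "f \<in> borel_measurable borel" and k: "integrable lborel k" "\<And>x. 0 \<le> k x" "(LINT x|lborel. k x) = 1"
  shows "ennreal ((LINT x|lborel. f x * k x)\<^sup>2) \<le> (\<integral>\<^sup>+x. ennreal ((f x)\<^sup>2 * k x) \<partial>lborel)"
proof (cases "(\<integral>\<^sup>+x. ennreal ((f x)\<^sup>2 * k x) \<partial>lborel) < \<infinity>")
  case True
  have [measurable]: "k \<in> borel_measurable borel" using k(1) by auto
  have i2: "integrable lborel (\<lambda>x. (f x)\<^sup>2 * k x)"
    using True k(2) by (intro integrableI_nonneg) auto
  have i1: "integrable lborel (\<lambda>x. f x * k x)"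
  proof (rule Bochner_Integration.integrable_bound)
    show "integrable lborel (\<lambda>x. k x + (f x)\<^sup>2 * k x)" using k i2 by simp
    show "AE x in lborel. norm (f x * k x) \<le> norm (k x + (f x)\<^sup>2 * k x)"
    proof (rule AE_I2)
      fix x
      have "0 \<le> (\<bar>f x\<bar> - 1)\<^sup>2" by simp
      then have "\<bar>f x\<bar> \<le> 1 + (f x)\<^sup>2" by (simp add: power2_eq_square algebra_simps)
      from mult_right_mono[OF this k(2)[of x]]
      show "norm (f x * k x) \<le> norm (k x + (f x)\<^sup>2 * k x)"
        using k(2)[of x] by (simp add: abs_mult algebra_simps)
    qed
  qed measurable
  let ?c = "LINT x|lborel. f x * k x"
  have "0 \<le> (LINT x|lborel. (f x - ?c)\<^sup>2 * k x)" using k(2) by (intro integral_nonneg_AE AE_I2) simp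
  also have "\<dots> = (LINT x|lborel. (f x)\<^sup>2 * k x - 2 * ?c * (f x * k x) + ?c\<^sup>2 * k x)"
    by (intro Bochner_Integration.integral_cong refl) (simp add: power2_eq_square algebra_simps)
  also have "\<dots> = (LINT x|lborel. (f x)\<^sup>2 * k x) - ?c\<^sup>2"
    using i1 i2 k by (simp add: power2_eq_square)
  finally have "?c\<^sup>2 \<le> (LINT x|lborel. (f x)\<^sup>2 * k x)" by simp
  moreover have "(\<integral>\<^sup>+x. ennreal ((f x)\<^sup>2 * k x) \<partial>lborel) = ennreal (LINT x|lborel. (f x)\<^sup>2 * k x)"
    using k(2) by (intro nn_integral_eq_integral i2) auto
  ultimately show ?thesis by (simp add: ennreal_leI)
qed (simp add: not_less top_unique)

lemma nn_integral_lborel_affine: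
  fixes f :: "'a::euclidean_space \<Rightarrow> ennreal"
  assumes [measurable]: "f \<in> borel_measurable borel" and c: "c \<noteq> 0"
  shows "(\<integral>\<^sup>+x. f x \<partial>lborel) = ennreal (\<bar>c\<bar> ^ DIM('a)) * (\<integral>\<^sup>+x. f (t + c *\<^sub>R x) \<partial>lborel)"
  by (subst lborel_affine[OF c, of t])
     (simp add: nn_integral_density nn_integral_distr nn_integral_cmult ennreal_power)

lemma frechet_derivative_affine:
  fixes \<psi> :: "'a::euclidean_space \<Rightarrow> real"
  assumes "\<And>k. C_k k \<psi>"
  shows "frechet_derivative (\<lambda>x. \<psi> (t + c *\<^sub>R x)) (at x) b = c * frechet_derivative \<psi> (at (t + c *\<^sub>R x)) b"
proof -
  note d = assms[of "Suc 0"]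
  have "((\<lambda>x. t + c *\<^sub>R x) has_derivative (\<lambda>h. c *\<^sub>R h)) (at x)"
    by (auto intro!: derivative_eq_intros)
  from has_derivative_compose[OF this C_k_SucD[OF d]]
  have "((\<lambda>x. \<psi> (t + c *\<^sub>R x)) has_derivative (\<lambda>h. frechet_derivative \<psi> (at (t + c *\<^sub>R x)) (c *\<^sub>R h))) (at x)" .
  from frechet_derivative_at[OF this]
  have "frechet_derivative (\<lambda>x. \<psi> (t + c *\<^sub>R x)) (at x) b = frechet_derivative \<psi> (at (t + c *\<^sub>R x)) (c *\<^sub>R b)"
    by metis
  moreover have "linear (frechet_derivative \<psi> (at y))" for y
    using d by (simp add: linear_frechet_derivative)
  ultimately show ?thesis by (simp add: linear_cmul)
qed

lemma frechet_derivative_sum_Basis: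
  assumes "\<psi> \<in> test_functions U"
  shows "frechet_derivative \<psi> (at x) e = (\<Sum>b\<in>Basis. (e \<bullet> b) * frechet_derivative \<psi> (at x) b)"
proof -
  have l: "linear (frechet_derivative \<psi> (at x))"
    using test_function_derivative(1)[OF assms] has_derivative_linear by blast
  have "frechet_derivative \<psi> (at x) (\<Sum>b\<in>Basis. (e \<bullet> b) *\<^sub>R b) = (\<Sum>b\<in>Basis. (e \<bullet> b) * frechet_derivative \<psi> (at x) b)"
    by (simp add: linear_sum[OF l] linear_cmul[OF l])
  then show ?thesis by (simp add: euclidean_representation)
qed

lemma test_function_bounded:
  assumes "\<psi> \<in> test_functions U"
  shows "\<exists>B. \<forall>x. \<bar>\<psi> x\<bar> \<le> B" "\<exists>B. \<forall>x. \<bar>frechet_derivative \<psi> (at x) b\<bar> \<le> B"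
proof -
  show "\<exists>B. \<forall>x. \<bar>\<psi> x\<bar> \<le> B"
    by (rule continuous_compact_support_bounded[OF test_function_continuous[OF assms] test_functionsD(2)[OF assms]])
       (use closure_subset[of "{x. \<psi> x \<noteq> 0}"] in blast)
  show "\<exists>B. \<forall>x. \<bar>frechet_derivative \<psi> (at x) b\<bar> \<le> B"
    by (rule continuous_compact_support_bounded[OF test_function_derivative(2)[OF assms] test_functionsD(2)[OF assms]
          test_function_derivative(3)[OF assms]])
qed

text \<open>Mollification of an integrable function is smooth enough for \<open>energy_le_smooth\<close>: it is
  bounded, Lipschitz and continuously differentiable.\<close>

lemma conv_test_function:
  fixes w k :: "'a::euclidean_space \<Rightarrow> real"
  assumes w: "integrable lborel w" and k: "k \<in> test_functions UNIV"
  shows conv_test_deriv: "((\<lambda>t. conv k w (x + t *\<^sub>R e)) has_real_derivative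
      (\<Sum>b\<in>Basis. (e \<bullet> b) * conv (\<lambda>z. frechet_derivative k (at z) b) w (x + t *\<^sub>R e))) (at t)"
    and conv_test_bounded: "\<exists>B. \<forall>x. \<bar>conv k w x\<bar> \<le> B"
    and conv_test_lipschitz: "\<exists>L\<ge>0. \<forall>x y. \<bar>conv k w x - conv k w y\<bar> \<le> L * norm (x - y)"
    and conv_test_continuous: "continuous_on UNIV (conv k w)" "continuous_on UNIV (conv (\<lambda>z. frechet_derivative k (at z) b) w)"
proof -
  let ?k' = "\<lambda>b z. frechet_derivative k (at z) b"
  have bd: "\<exists>B. \<forall>x. \<bar>conv q w x\<bar> \<le> B" if q: "continuous_on UNIV q" "\<exists>B. \<forall>z. \<bar>q z\<bar> \<le> B" for q :: "'a \<Rightarrow> real"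
  proof -
    obtain B where B: "\<And>z. \<bar>q z\<bar> \<le> B" using q(2) by blast
    have [measurable]: "q \<in> borel_measurable borel" by (rule borel_measurable_continuous_onI[OF q(1)])
    have "\<bar>conv q w x\<bar> \<le> (LINT y|lborel. \<bar>w y\<bar> * B)" for x
      unfolding conv_def
    proof (rule order.trans[OF integral_abs_bound integral_mono])
      show "integrable lborel (\<lambda>y. \<bar>w y * q (x - y)\<bar>)"
        by (intro integrable_abs integrable_conv_kernel[OF w _ B]) measurable
      show "integrable lborel (\<lambda>y. \<bar>w y\<bar> * B)" using w by simp
      show "\<bar>w y * q (x - y)\<bar> \<le> \<bar>w y\<bar> * B" for y by (simp add: abs_mult B mult_left_mono)
    qed
    then show ?thesis by blast
  qed
  note kc = test_function_continuous[OF k] and kb = test_function_bounded(1)[OF k]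
    and dc = test_function_derivative(2)[OF k] and db = test_function_bounded(2)[OF k]
  show "\<exists>B. \<forall>x. \<bar>conv k w x\<bar> \<le> B" by (rule bd[OF kc kb])
  have b': "\<exists>B. \<forall>x. \<bar>conv (?k' b) w x\<bar> \<le> B" for b by (rule bd[OF dc db])
  obtain C where C: "\<And>z. \<bar>k z\<bar> \<le> C" using kb by blast
  show "continuous_on UNIV (conv k w)" by (rule continuous_conv[OF w kc C])
  show "continuous_on UNIV (conv (?k' b) w)" for b
  proof -
    obtain C' where C': "\<And>z. \<bar>?k' b z\<bar> \<le> C'" using db by blast
    show ?thesis by (rule continuous_conv[OF w dc C'])
  qed
  show der: "((\<lambda>t. conv k w (x + t *\<^sub>R e)) has_real_derivative
      (\<Sum>b\<in>Basis. (e \<bullet> b) * conv (?k' b) w (x + t *\<^sub>R e))) (at t)" for x e t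
  proof -
    obtain C' where C': "\<And>z. \<bar>?k' e z\<bar> \<le> C'" using db by blast
    have d: "((\<lambda>t. k (z + t *\<^sub>R e)) has_real_derivative ?k' e (z + t *\<^sub>R e)) (at t)" for z t
      by (rule directional_deriv_shift[OF has_derivative_imp_directional[OF test_function_derivative(1)[OF k]]])
    have i: "integrable lborel (\<lambda>y. w y * ?k' b (z - y))" for b z
    proof -
      obtain D where D: "\<And>z. \<bar>?k' b z\<bar> \<le> D" using db by blast
      show ?thesis by (rule integrable_conv_kernel[OF w borel_measurable_continuous_onI[OF dc] D])
    qed
    have "conv (?k' e) w z = (LINT y|lborel. (\<Sum>b\<in>Basis. (e \<bullet> b) * (w y * ?k' b (z - y))))" for z
      unfolding conv_def
      by (intro Bochner_Integration.integral_cong refl, subst frechet_derivative_sum_Basis[OF k])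
         (simp add: sum_distrib_left mult.left_commute)
    then have "conv (?k' e) w z = (\<Sum>b\<in>Basis. (e \<bullet> b) * conv (?k' b) w z)" for z
      using i by (simp add: conv_def)
    then show ?thesis using conv_deriv[OF w kc C C' d, of x t] by simp
  qed
  have "\<exists>B. \<forall>b. \<forall>x. \<bar>conv (?k' b) w x\<bar> \<le> B b" using b' by metis
  then obtain B where B: "\<And>b x. \<bar>conv (?k' b) w x\<bar> \<le> B b" by blast
  have B0: "0 \<le> B b" for b using order.trans[OF abs_ge_zero B] .
  let ?L = "\<Sum>b\<in>(Basis :: 'a set). B b"
  have "\<bar>conv k w x - conv k w y\<bar> \<le> ?L * norm (x - y)" for x y
  proof -
    let ?e = "x - y"
    have "norm (conv k w (y + 1 *\<^sub>R ?e) - conv k w (y + 0 *\<^sub>R ?e)) \<le> (?L * norm ?e) * norm (1 - 0 :: real)"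
    proof (rule field_differentiable_bound[of UNIV "\<lambda>t. conv k w (y + t *\<^sub>R ?e)"])
      fix t :: real
      show "((\<lambda>t. conv k w (y + t *\<^sub>R ?e)) has_field_derivative
        (\<Sum>b\<in>Basis. (?e \<bullet> b) * conv (?k' b) w (y + t *\<^sub>R ?e))) (at t within UNIV)" using der by simp
      have "\<bar>\<Sum>b\<in>Basis. (?e \<bullet> b) * conv (?k' b) w (y + t *\<^sub>R ?e)\<bar> \<le> (\<Sum>b\<in>Basis. norm ?e * B b)"
        by (rule order.trans[OF sum_abs sum_mono]) (auto simp: abs_mult intro!: mult_mono Basis_le_norm B)
      then show "norm (\<Sum>b\<in>Basis. (?e \<bullet> b) * conv (?k' b) w (y + t *\<^sub>R ?e)) \<le> ?L * norm ?e"
        by (simp add: sum_distrib_right mult.commute)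
    qed auto
    then show ?thesis by simp
  qed
  then show "\<exists>L\<ge>0. \<forall>x y. \<bar>conv k w x - conv k w y\<bar> \<le> L * norm (x - y)"
    using B0 by (intro exI[of _ ?L]) (auto intro: sum_nonneg)
qed

text \<open>A bump function on the box, normalised.\<close>

lemma exists_mollifier:
  assumes pq: "\<And>i. i \<in> Basis \<Longrightarrow> p \<bullet> i < q \<bullet> (i::'a::euclidean_space)"
  shows "\<exists>\<eta>. (\<forall>k. C_k k \<eta>) \<and> (\<forall>z. 0 \<le> \<eta> z) \<and> integrable lborel \<eta> \<and> (LINT z|lborel. \<eta> z) = 1 \<and> (\<forall>z. \<eta> z \<noteq> 0 \<longrightarrow> z \<in> cbox p q)"
proof -
  have c: "continuous_on UNIV (bump p q)" using smooth_bump[of 0 p q] by simp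
  have [measurable]: "bump p q \<in> borel_measurable borel" by (rule borel_measurable_continuous_onI[OF c])
  have s: "bump p q x = indicator (cbox p q) x *\<^sub>R bump p q x" for x
    using bump_eq_0_iff[of p q x] box_subset_cbox[of p q] by (auto simp: indicator_def)
  have i: "integrable lborel (bump p q)"
    using borel_integrable_compact[OF compact_cbox continuous_on_subset[OF c], of p q]
    by (subst s[abs_def]) simp
  have "(LINT z|lborel. bump p q z) \<noteq> 0"
  proof
    assume "(LINT z|lborel. bump p q z) = 0"
    then have "AE z in lborel. bump p q z = 0"
      using integral_nonneg_eq_0_iff_AE[OF i] bump_nonneg[of p q] by simp
    then have "AE z in lborel. z \<notin> box p q" by (simp add: bump_eq_0_iff)
    then have "emeasure lborel (box p q) = 0" by (subst (asm) AE_iff_null) (auto simp: null_sets_def)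
    moreover have "emeasure lborel (box p q) = ennreal (\<Prod>b\<in>Basis. (q - p) \<bullet> b)"
      using pq by (intro emeasure_lborel_box) (auto intro: less_imp_le)
    moreover have "0 < (\<Prod>b\<in>Basis. (q - p) \<bullet> b)" using pq by (intro prod_pos) (auto simp: inner_diff_left)
    ultimately show False by (metis ennreal_eq_0_iff linorder_not_le)
  qed
  moreover have "0 \<le> (LINT z|lborel. bump p q z)" using bump_nonneg[of p q] by (intro integral_nonneg_AE) auto
  ultimately have pos: "0 < (LINT z|lborel. bump p q z)" by simp
  define \<eta> where "\<eta> z = bump p q z * (1 / (LINT z|lborel. bump p q z))" for z
  have "C_k k \<eta>" for k unfolding \<eta>_def[abs_def] by (intro C_k_mult smooth_bump C_k_const)
  moreover have "0 \<le> \<eta> z" for z using bump_nonneg[of p q z] pos by (simp add: \<eta>_def)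
  moreover have "integrable lborel \<eta>" unfolding \<eta>_def[abs_def] using i by simp
  moreover have "(LINT z|lborel. \<eta> z) = 1" unfolding \<eta>_def[abs_def] using pos by simp
  moreover have "z \<in> cbox p q" if "\<eta> z \<noteq> 0" for z
    using that bump_eq_0_iff[of p q z] box_subset_cbox[of p q] by (auto simp: \<eta>_def)
  ultimately show ?thesis by blast
qed

text \<open>Data for a regularisation that respects the domain: a box inside it, on which \<open>\<rho>\<close> is bounded
  below, and a smooth probability density \<open>\<eta>\<close> supported in the box. A function is regularised by
  averaging its values at \<open>l x + (1 - l) z\<close> over \<open>z\<close> with density \<open>\<eta>\<close>. For \<open>x\<close> up to the boundary
  of the domain these points stay in its interior, since the map pulls \<open>x\<close> towards the box.\<close>

locale mollified = log_concave_prob +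
  fixes p q :: 'a and m M :: real and \<eta> :: "'a \<Rightarrow> real"
  assumes box: "cbox p q \<subseteq> dom" and m: "0 < m" "\<And>z. z \<in> cbox p q \<Longrightarrow> m \<le> \<rho> z" and M: "\<And>x. \<rho> x \<le> M" "m \<le> M"
    and smooth: "\<And>k. C_k k \<eta>" and \<eta>_nonneg: "\<And>z. 0 \<le> \<eta> z" and \<eta>_int: "integrable lborel \<eta>" "(LINT z|lborel. \<eta> z) = 1"
    and \<eta>_supp: "\<And>z. \<eta> z \<noteq> 0 \<Longrightarrow> z \<in> cbox p q"
begin

lemma measurable_\<eta> [measurable]: "\<eta> \<in> borel_measurable borel"
  using \<eta>_int by auto

text \<open>Log-concavity on the segment from \<open>x\<close> to \<open>z\<close>, with \<open>m \<le> \<rho> z\<close> and \<open>\<rho> x \<le> M\<close>. The constant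
  tends to 1 as \<open>l \<rightarrow> 1\<close>; this is why moving towards the box costs nothing in the limit.\<close>

lemma density_le_shrunk:
  assumes l: "0 < l" "l < 1" and z: "\<eta> z \<noteq> 0"
  shows "\<rho> x \<le> (M / m) powr (1 - l) * \<rho> (l *\<^sub>R x + (1 - l) *\<^sub>R z)"
proof -
  have "\<rho> x = \<rho> x powr l * \<rho> x powr (1 - l)" using nonneg[of x] by (cases "\<rho> x = 0") (simp_all flip: powr_add)
  also have "\<dots> \<le> \<rho> x powr l * M powr (1 - l)"
    using l nonneg M by (intro mult_left_mono powr_mono2) auto
  also have "\<dots> = (M / m) powr (1 - l) * (\<rho> x powr l * m powr (1 - l))"
    using m(1) M(2) by (simp add: powr_divide)
  also have "\<dots> \<le> (M / m) powr (1 - l) * (\<rho> x powr (1 - (1 - l)) * \<rho> z powr (1 - l))"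
  proof -
    have "m powr (1 - l) \<le> \<rho> z powr (1 - l)" using l m \<eta>_supp[OF z] by (intro powr_mono2) auto
    then show ?thesis by (intro mult_left_mono) (auto intro!: mult_left_mono)
  qed
  also have "\<dots> \<le> (M / m) powr (1 - l) * \<rho> ((1 - (1 - l)) *\<^sub>R x + (1 - l) *\<^sub>R z)"
    using l by (intro mult_left_mono log_concave_funD[OF log_concave]) auto
  finally show ?thesis by simp
qed

text \<open>The density of \<open>(l - 1) z\<close> when \<open>z\<close> has density \<open>\<eta>\<close>, so that averaging over
  \<open>l x + (1 - l) z\<close> is convolution with \<open>kern l\<close> evaluated at \<open>l x\<close>.\<close>

definition kern :: "real \<Rightarrow> 'a \<Rightarrow> real" where
  "kern l w = 1 / (1 - l) ^ DIM('a) * \<eta> (0 + (- 1 / (1 - l)) *\<^sub>R w)"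

lemma kern_test: assumes "l < 1" shows "kern l \<in> test_functions UNIV"
proof (rule test_functionsI)
  show "C_k k (kern l)" for k unfolding kern_def[abs_def] by (intro C_k_mult C_k_const C_k_affine smooth)
  show "compact ((\<lambda>z. (- (1 - l)) *\<^sub>R z) ` cbox p q)" by (intro compact_scaling compact_cbox)
  fix w assume "kern l w \<noteq> 0"
  then have "(- 1 / (1 - l)) *\<^sub>R w \<in> cbox p q" using \<eta>_supp by (auto simp: kern_def)
  then have "(- (1 - l)) *\<^sub>R ((- 1 / (1 - l)) *\<^sub>R w) \<in> (\<lambda>z. (- (1 - l)) *\<^sub>R z) ` cbox p q" by (rule imageI)
  moreover have "(- (1 - l)) * (- 1 / (1 - l)) = 1" using assms by (simp add: field_simps)
  ultimately show "w \<in> (\<lambda>z. (- (1 - l)) *\<^sub>R z) ` cbox p q" by (simp only: scaleR_scaleR scaleR_one)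
qed simp

lemma kern_shift: "l < 1 \<Longrightarrow> kern l (y - (y + (1 - l) *\<^sub>R z)) = \<eta> z / (1 - l) ^ DIM('a)"
  by (simp add: kern_def)

lemma kern_nonneg: "l < 1 \<Longrightarrow> 0 \<le> kern l w"
  by (simp add: kern_def \<eta>_nonneg)

lemma integral_kern_shift:
  assumes [measurable]: "f \<in> borel_measurable borel" and l: "l < 1"
  shows "(LINT v|lborel. f v * kern l (y - v)) = (LINT z|lborel. f (y + (1 - l) *\<^sub>R z) * \<eta> z)"
    and "integrable lborel (\<lambda>v. f v * kern l (y - v)) \<longleftrightarrow> integrable lborel (\<lambda>z. f (y + (1 - l) *\<^sub>R z) * \<eta> z)"
    and "(\<integral>\<^sup>+v. ennreal (f v * kern l (y - v)) \<partial>lborel) = (\<integral>\<^sup>+z. ennreal (f (y + (1 - l) *\<^sub>R z) * \<eta> z) \<partial>lborel)"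
proof -
  have [measurable]: "kern l \<in> borel_measurable borel"
    by (rule borel_measurable_continuous_onI[OF test_function_continuous[OF kern_test[OF l]]])
  let ?F = "\<lambda>v. f v * kern l (y - v)" and ?c = "(1 - l) ^ DIM('a)"
  have c: "0 < ?c" using l by simp
  have s: "?F (y + (1 - l) *\<^sub>R z) = f (y + (1 - l) *\<^sub>R z) * \<eta> z / ?c" for z
    by (simp only: kern_shift[OF l] times_divide_eq_right)
  have "(LINT z|lborel. ?F (y + (1 - l) *\<^sub>R z)) = (LINT v|lborel. ?F v) / \<bar>1 - l\<bar> ^ DIM('a)"
    using l by (intro integral_lborel_affine) auto
  then show "(LINT v|lborel. ?F v) = (LINT z|lborel. f (y + (1 - l) *\<^sub>R z) * \<eta> z)"
    using c l unfolding s by simp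
  have "integrable lborel (\<lambda>z. ?F (y + (1 - l) *\<^sub>R z)) \<longleftrightarrow> integrable lborel ?F"
    using l by (intro integrable_lborel_affine) auto
  then show "integrable lborel ?F \<longleftrightarrow> integrable lborel (\<lambda>z. f (y + (1 - l) *\<^sub>R z) * \<eta> z)"
    using c l unfolding s divide_inverse by simp
  have "(\<integral>\<^sup>+v. ennreal (?F v) \<partial>lborel) = ennreal (\<bar>1 - l\<bar> ^ DIM('a)) * (\<integral>\<^sup>+z. ennreal (?F (y + (1 - l) *\<^sub>R z)) \<partial>lborel)"
    using l by (intro nn_integral_lborel_affine) auto
  also have "\<dots> = (\<integral>\<^sup>+z. ennreal ?c * ennreal (f (y + (1 - l) *\<^sub>R z) * \<eta> z / ?c) \<partial>lborel)"
    using l unfolding s by (subst nn_integral_cmult) simp_all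
  also have "\<dots> = (\<integral>\<^sup>+z. ennreal (f (y + (1 - l) *\<^sub>R z) * \<eta> z) \<partial>lborel)"
    using c l by (intro nn_integral_cong) (simp flip: ennreal_mult')
  finally show "(\<integral>\<^sup>+v. ennreal (?F v) \<partial>lborel) = (\<integral>\<^sup>+z. ennreal (f (y + (1 - l) *\<^sub>R z) * \<eta> z) \<partial>lborel)" .
qed

lemma shrunk_in_dom:
  assumes l: "0 \<le> l" "l < 1" and x: "x \<in> closure dom" and z: "z \<in> cbox p q"
  shows "l *\<^sub>R x + (1 - l) *\<^sub>R z \<in> dom"
proof -
  have "x - (1 - l) *\<^sub>R (x - z) \<in> interior dom"
    using l x z box open_dom by (intro mem_interior_closure_convex_shrink[OF convex_dom]) (auto simp: interior_open)
  then show ?thesis using open_dom by (simp add: interior_open algebra_simps)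
qed

text \<open>All points \<open>l x + (1 - l) z\<close> with \<open>x\<close> in the closure of the domain and \<open>z\<close> in the box: a
  closed subset of the open domain. Its bounded parts are compact, so \<open>\<rho>\<close> is bounded below there
  and weak derivatives on the domain can be used.\<close>

definition core :: "real \<Rightarrow> 'a set" where
  "core l = (\<Union>x\<in>(\<lambda>x. (1 - l) *\<^sub>R x) ` cbox p q. \<Union>y\<in>(\<lambda>x. l *\<^sub>R x) ` closure dom. {x + y})"

lemma closed_core: "closed (core l)"
  unfolding core_def by (intro compact_closed_sums compact_scaling compact_cbox closed_scaling closed_closure)

lemma core_subset: "0 \<le> l \<Longrightarrow> l < 1 \<Longrightarrow> core l \<subseteq> dom"
  using shrunk_in_dom[of l] by (auto simp: core_def add.commute)

lemma in_core: "x \<in> closure dom \<Longrightarrow> z \<in> cbox p q \<Longrightarrow> l *\<^sub>R x + (1 - l) *\<^sub>R z \<in> core l"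
  unfolding core_def
  by (intro UN_I[of "(1 - l) *\<^sub>R z"] UN_I[of "l *\<^sub>R x"] imageI) (simp_all add: add.commute)

text \<open>The gradient of the regularised function is \<open>l\<close> times the average of \<open>g\<close>. By Jensen's
  inequality the square of the average is at most the average of the square; \<open>density_le_shrunk\<close>
  moves the weight from \<open>x\<close> to \<open>l x + (1 - l) z\<close>; and the change of variables contributes
  \<open>1 / l ^ n\<close>. Since the regularised function is smooth, its energy at time \<open>s\<close> is at most its
  initial energy.\<close>

lemma mollification:
  assumes \<phi>: "sq_int \<phi>" and R: "\<And>x. x \<notin> cball 0 R \<Longrightarrow> \<phi> x = 0"
    and g: "is_weak_gradient dom \<phi> g" "integrable lborel (\<lambda>x. (norm (g x))\<^sup>2 * \<rho> x)"
    and l: "0 < l" "l < 1" and s: "0 < s"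
  shows "\<exists>\<xi>. bounded_fun \<xi> \<and> (\<forall>x\<in>dom. \<xi> x = (LINT z|lborel. \<phi> (l *\<^sub>R x + (1 - l) *\<^sub>R z) * \<eta> z)) \<and>
     energy \<xi> s \<le> (l\<^sup>2 * (M / m) powr (1 - l) / l ^ DIM('a)) * (LINT x|lborel. (norm (g x))\<^sup>2 * \<rho> x)"
proof -
  define K where "K = core l \<inter> cball 0 R"
  have K: "compact K" "K \<subseteq> dom"
  proof -
    show "compact K" unfolding K_def by (intro closed_Int_compact closed_core compact_cball)
    have "core l \<subseteq> dom" using core_subset[of l] l by simp
    then show "K \<subseteq> dom" unfolding K_def by blast
  qed
  have [measurable]: "K \<in> sets borel" using K(1) by (simp add: compact_imp_closed)
  have [measurable]: "\<phi> \<in> borel_measurable borel" "g \<in> borel_measurable borel"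
    using \<phi> g(1) by (auto simp: sq_int_def is_weak_gradient_def)
  \<comment> \<open>Cutting off outside \<open>K\<close> makes \<open>\<phi>\<close> integrable on the whole space and does not change the
    averages at points of the domain.\<close>
  define w where "w v = indicator K v * \<phi> v" for v
  have [measurable]: "w \<in> borel_measurable borel" unfolding w_def[abs_def] by measurable
  have w: "integrable lborel w"
  proof -
    obtain c where c: "0 < c" "\<And>x. x \<in> K \<Longrightarrow> c \<le> \<rho> x" using lower_bound_on_compact[OF K] by blast
    show ?thesis
    proof (rule Bochner_Integration.integrable_bound)
      show "integrable lborel (\<lambda>x. indicator K x + (1 / c) * ((\<phi> x)\<^sup>2 * \<rho> x))"
        using emeasure_compact_finite[OF K(1)] sq_int_sq_integrable[OF \<phi>]
        by (intro Bochner_Integration.integrable_add integrable_mult_right integrable_real_indicator) auto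
      show "AE x in lborel. norm (w x) \<le> norm (indicator K x + (1 / c) * ((\<phi> x)\<^sup>2 * \<rho> x))"
      proof (rule AE_I2)
        fix x
        show "norm (w x) \<le> norm (indicator K x + (1 / c) * ((\<phi> x)\<^sup>2 * \<rho> x))"
        proof (cases "x \<in> K")
          case True
          have "0 \<le> (\<bar>\<phi> x\<bar> - 1)\<^sup>2" by simp
          then have "\<bar>\<phi> x\<bar> \<le> 1 + (\<phi> x)\<^sup>2" by (simp add: power2_eq_square algebra_simps)
          also have "(\<phi> x)\<^sup>2 \<le> (1 / c) * ((\<phi> x)\<^sup>2 * \<rho> x)"
            using mult_left_mono[OF c(2)[OF True], of "(\<phi> x)\<^sup>2"] c(1) by (simp add: field_simps)
          finally show ?thesis using True by (simp add: w_def)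
        qed (simp add: w_def)
      qed
    qed measurable
  qed
  note kt = kern_test[OF l(2)]
  have [measurable]: "kern l \<in> borel_measurable borel"
    by (rule borel_measurable_continuous_onI[OF test_function_continuous[OF kt]])
  let ?h = "conv (kern l) w" and ?d = "\<lambda>b. conv (\<lambda>z. frechet_derivative (kern l) (at z) b) w"
  define \<xi> where "\<xi> x = ?h (l *\<^sub>R x)" for x
  define G where "G x = (\<Sum>b\<in>Basis. (l * ?d b (l *\<^sub>R x)) *\<^sub>R b)" for x
  have cont: "continuous_on UNIV \<xi>"
    unfolding \<xi>_def[abs_def] by (rule continuous_on_compose2[OF conv_test_continuous(1)[OF w kt]]) (auto intro!: continuous_intros)
  have contG: "continuous_on UNIV G"
    unfolding G_def[abs_def]
    by (intro continuous_intros continuous_on_compose2[OF conv_test_continuous(2)[OF w kt]]) auto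
  have [measurable]: "G \<in> borel_measurable borel" by (rule borel_measurable_continuous_onI[OF contG])
  have bounded: "bounded_fun \<xi>"
    using conv_test_bounded[OF w kt] borel_measurable_continuous_onI[OF cont]
    unfolding bounded_fun_def \<xi>_def by blast
  have w_eq: "w (l *\<^sub>R x + (1 - l) *\<^sub>R z) * \<eta> z = \<phi> (l *\<^sub>R x + (1 - l) *\<^sub>R z) * \<eta> z" if "x \<in> dom" for x z
    using that \<eta>_supp[of z] in_core[of x z l] R[of "l *\<^sub>R x + (1 - l) *\<^sub>R z"] closure_subset[of dom]
    by (auto simp: w_def K_def indicator_def)
  have \<xi>_eq: "\<xi> x = (LINT z|lborel. \<phi> (l *\<^sub>R x + (1 - l) *\<^sub>R z) * \<eta> z)" if x: "x \<in> dom" for x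
  proof -
    have "\<xi> x = (LINT v|lborel. w v * kern l (l *\<^sub>R x - v))" by (simp add: \<xi>_def conv_def)
    also have "\<dots> = (LINT z|lborel. w (l *\<^sub>R x + (1 - l) *\<^sub>R z) * \<eta> z)"
      using l by (intro integral_kern_shift(1)) auto
    finally show ?thesis by (simp only: w_eq[OF x])
  qed
  have der: "((\<lambda>t. \<xi> (y + t *\<^sub>R z)) has_real_derivative G y \<bullet> z) (at 0)" for y z
  proof -
    have "((\<lambda>t. ?h (l *\<^sub>R y + t *\<^sub>R (l *\<^sub>R z))) has_real_derivative
        (\<Sum>b\<in>Basis. ((l *\<^sub>R z) \<bullet> b) * ?d b (l *\<^sub>R y + 0 *\<^sub>R (l *\<^sub>R z)))) (at 0)"
      by (rule conv_test_deriv[OF w kt])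
    moreover have "(\<Sum>b\<in>Basis. ((l *\<^sub>R z) \<bullet> b) * ?d b (l *\<^sub>R y + 0 *\<^sub>R (l *\<^sub>R z))) = G y \<bullet> z"
      by (simp only: G_def inner_sum_left inner_scaleR_left scaleR_zero_left add_0_right) (simp add: mult_ac inner_commute)
    ultimately show ?thesis by (simp add: \<xi>_def algebra_simps)
  qed
  obtain L where L: "0 \<le> L" "\<And>x y. \<bar>?h x - ?h y\<bar> \<le> L * norm (x - y)" using conv_test_lipschitz[OF w kt] by blast
  have lip: "\<bar>\<xi> x - \<xi> y\<bar> \<le> (L * l) * norm (x - y)" for x y
    using L(2)[of "l *\<^sub>R x" "l *\<^sub>R y"] l by (simp add: \<xi>_def flip: scaleR_diff_right)
  have e1: "energy \<xi> s \<le> (LINT y|lborel. (norm (G y))\<^sup>2 * \<rho> y)"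
    using open_dom by (intro energy_le_smooth[OF bounded _ _ lip AE_dom der s]) auto
  have G_eq: "?d b (l *\<^sub>R x) = (LINT v|lborel. (g v \<bullet> b) * kern l (l *\<^sub>R x - v))"
    if x: "x \<in> dom" and b: "b \<in> Basis" for x b
  proof -
    \<comment> \<open>The reflected and translated kernel is a test function on the domain, so it can be paired
      with the weak gradient.\<close>
    define \<psi> where "\<psi> v = kern l (l *\<^sub>R x + (-1) *\<^sub>R v)" for v
    define C where "C = (\<lambda>z. l *\<^sub>R x + (1 - l) *\<^sub>R z) ` cbox p q"
    have C: "compact C" "C \<subseteq> dom" "C \<subseteq> core l"
    proof -
      show "compact C" unfolding C_def
        by (intro compact_continuous_image continuous_intros compact_cbox)
      show "C \<subseteq> core l" unfolding C_def using in_core[of x _ l] x closure_subset[of dom] by blast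
      then show "C \<subseteq> dom" using core_subset[of l] l by auto
    qed
    have supp: "v \<in> C" if "\<psi> v \<noteq> 0" for v
    proof -
      have "(- 1 / (1 - l)) *\<^sub>R (l *\<^sub>R x + (-1) *\<^sub>R v) \<in> cbox p q" using that \<eta>_supp by (auto simp: \<psi>_def kern_def)
      then have "l *\<^sub>R x + (1 - l) *\<^sub>R ((- 1 / (1 - l)) *\<^sub>R (l *\<^sub>R x + (-1) *\<^sub>R v)) \<in> C" unfolding C_def by (rule imageI)
      then show ?thesis using l by simp
    qed
    have \<psi>: "\<psi> \<in> test_functions dom"
    proof (rule test_functionsI[OF _ supp C(1,2)])
      show "C_k k \<psi>" for k
        unfolding \<psi>_def[abs_def] by (rule C_k_affine[OF test_functionsD(1)[OF kt]])
    qed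
    have d\<psi>: "frechet_derivative \<psi> (at v) b = - frechet_derivative (kern l) (at (l *\<^sub>R x - v)) b" for v
      unfolding \<psi>_def[abs_def] using frechet_derivative_affine[OF test_functionsD(1)[OF kt], of "l *\<^sub>R x" "-1" v b] by simp
    have "closure {v. \<psi> v \<noteq> 0} \<subseteq> C" using supp compact_imp_closed[OF C(1)] by (intro closure_minimal) auto
    then have z: "frechet_derivative \<psi> (at v) b = 0" if "v \<notin> C" for v
      using test_function_derivative(3)[OF \<psi>, of v b] that by blast
    have eq: "w v * frechet_derivative (kern l) (at (l *\<^sub>R x - v)) b = - (\<phi> v * frechet_derivative \<psi> (at v) b)" for v
      using z[of v] R[of v] C(3) by (cases "v \<in> C") (auto simp: d\<psi> w_def K_def indicator_def)
    have "?d b (l *\<^sub>R x) = - (LINT v|lborel. \<phi> v * frechet_derivative \<psi> (at v) b)"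
      unfolding conv_def eq by simp
    also have "\<dots> = (LINT v|lborel. (g v \<bullet> b) * \<psi> v)"
      using g(1) \<psi> b by (simp add: is_weak_gradient_def)
    finally show ?thesis by (simp add: \<psi>_def)
  qed
  let ?c = "l\<^sup>2 * (M / m) powr (1 - l) / l ^ DIM('a)" and ?E = "LINT x|lborel. (norm (g x))\<^sup>2 * \<rho> x"
  have E0: "0 \<le> ?E" using nonneg by (intro integral_nonneg_AE AE_I2) simp
  have k1: "integrable lborel (\<lambda>v. kern l (y - v))" "(LINT v|lborel. kern l (y - v)) = 1" for y
    using integral_kern_shift(1,2)[of "\<lambda>_. 1" l y] \<eta>_int l by auto
  have Gsq: "ennreal ((norm (G x))\<^sup>2) \<le> ennreal (l\<^sup>2) * (\<integral>\<^sup>+z. ennreal ((norm (g (l *\<^sub>R x + (1 - l) *\<^sub>R z)))\<^sup>2 * \<eta> z) \<partial>lborel)"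
    if x: "x \<in> dom" for x
  proof -
    have Gb: "G x \<bullet> b = l * ?d b (l *\<^sub>R x)" if "b \<in> Basis" for b using that by (simp add: G_def)
    have n: "(norm y)\<^sup>2 = (\<Sum>b\<in>Basis. (y \<bullet> b)\<^sup>2)" for y :: 'a
      unfolding power2_norm_eq_inner euclidean_inner[of y y] by (simp only: power2_eq_square)
    have "(norm (G x))\<^sup>2 = l\<^sup>2 * (\<Sum>b\<in>Basis. (?d b (l *\<^sub>R x))\<^sup>2)"
      by (subst n) (simp add: Gb power_mult_distrib sum_distrib_left)
    then have "ennreal ((norm (G x))\<^sup>2) = ennreal (l\<^sup>2) * (\<Sum>b\<in>Basis. ennreal ((?d b (l *\<^sub>R x))\<^sup>2))"
      by (simp add: ennreal_mult sum_nonneg)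
    also have "\<dots> \<le> ennreal (l\<^sup>2) * (\<Sum>b\<in>Basis. \<integral>\<^sup>+v. ennreal ((g v \<bullet> b)\<^sup>2 * kern l (l *\<^sub>R x - v)) \<partial>lborel)"
    proof (intro mult_left_mono sum_mono)
      fix b :: 'a assume b: "b \<in> Basis"
      show "ennreal ((?d b (l *\<^sub>R x))\<^sup>2) \<le> (\<integral>\<^sup>+v. ennreal ((g v \<bullet> b)\<^sup>2 * kern l (l *\<^sub>R x - v)) \<partial>lborel)"
        unfolding G_eq[OF x b]
        by (rule sq_integral_le_nn_integral) (use k1 kern_nonneg[OF l(2)] in auto)
    qed simp
    also have "(\<Sum>b\<in>Basis. \<integral>\<^sup>+v. ennreal ((g v \<bullet> b)\<^sup>2 * kern l (l *\<^sub>R x - v)) \<partial>lborel)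
        = (\<integral>\<^sup>+v. (\<Sum>b\<in>Basis. ennreal ((g v \<bullet> b)\<^sup>2 * kern l (l *\<^sub>R x - v))) \<partial>lborel)"
      by (subst nn_integral_sum) auto
    also have "\<dots> = (\<integral>\<^sup>+v. ennreal ((norm (g v))\<^sup>2 * kern l (l *\<^sub>R x - v)) \<partial>lborel)"
      using kern_nonneg[OF l(2)] by (intro nn_integral_cong) (simp add: n[of "g _"] sum_distrib_right)
    also have "\<dots> = (\<integral>\<^sup>+z. ennreal ((norm (g (l *\<^sub>R x + (1 - l) *\<^sub>R z)))\<^sup>2 * \<eta> z) \<partial>lborel)"
      using l by (intro integral_kern_shift(3)) auto
    finally show ?thesis .
  qed
  let ?C = "(M / m) powr (1 - l)"
  have "(\<integral>\<^sup>+x. ennreal ((norm (G x))\<^sup>2 * \<rho> x) \<partial>lborel)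
      \<le> (\<integral>\<^sup>+x. (\<integral>\<^sup>+z. ennreal (l\<^sup>2 * ?C) * (ennreal (\<eta> z) * ennreal ((norm (g (l *\<^sub>R x + (1 - l) *\<^sub>R z)))\<^sup>2 * \<rho> (l *\<^sub>R x + (1 - l) *\<^sub>R z))) \<partial>lborel) \<partial>lborel)"
  proof (rule nn_integral_mono_AE)
    show "AE x in lborel. ennreal ((norm (G x))\<^sup>2 * \<rho> x)
      \<le> (\<integral>\<^sup>+z. ennreal (l\<^sup>2 * ?C) * (ennreal (\<eta> z) * ennreal ((norm (g (l *\<^sub>R x + (1 - l) *\<^sub>R z)))\<^sup>2 * \<rho> (l *\<^sub>R x + (1 - l) *\<^sub>R z))) \<partial>lborel)"
      using AE_dom
    proof eventually_elim
      case (elim x)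
      show ?case
      proof (cases "\<rho> x = 0")
        case False
        then have x: "x \<in> dom" using elim by simp
        have "ennreal ((norm (G x))\<^sup>2 * \<rho> x) \<le> ennreal (l\<^sup>2) * (\<integral>\<^sup>+z. ennreal ((norm (g (l *\<^sub>R x + (1 - l) *\<^sub>R z)))\<^sup>2 * \<eta> z) \<partial>lborel) * ennreal (\<rho> x)"
          using mult_right_mono[OF Gsq[OF x], of "ennreal (\<rho> x)"] nonneg[of x] by (simp add: ennreal_mult)
        also have "\<dots> = (\<integral>\<^sup>+z. ennreal (l\<^sup>2) * ennreal ((norm (g (l *\<^sub>R x + (1 - l) *\<^sub>R z)))\<^sup>2 * \<eta> z) * ennreal (\<rho> x) \<partial>lborel)"
          by (simp add: nn_integral_cmult nn_integral_multc)
        also have "\<dots> \<le> (\<integral>\<^sup>+z. ennreal (l\<^sup>2 * ?C) * (ennreal (\<eta> z) * ennreal ((norm (g (l *\<^sub>R x + (1 - l) *\<^sub>R z)))\<^sup>2 * \<rho> (l *\<^sub>R x + (1 - l) *\<^sub>R z))) \<partial>lborel)"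
        proof (rule nn_integral_mono)
          fix z
          let ?y = "l *\<^sub>R x + (1 - l) *\<^sub>R z"
          have "\<eta> z * \<rho> x \<le> \<eta> z * (?C * \<rho> ?y)"
          proof (cases "\<eta> z = 0")
            case False
            show ?thesis by (rule mult_left_mono[OF density_le_shrunk[OF l False] \<eta>_nonneg])
          qed simp
          then have "l\<^sup>2 * (norm (g ?y))\<^sup>2 * (\<eta> z * \<rho> x) \<le> l\<^sup>2 * (norm (g ?y))\<^sup>2 * (\<eta> z * (?C * \<rho> ?y))"
            by (rule mult_left_mono) simp
          then have "l\<^sup>2 * ((norm (g ?y))\<^sup>2 * \<eta> z) * \<rho> x \<le> (l\<^sup>2 * ?C) * (\<eta> z * ((norm (g ?y))\<^sup>2 * \<rho> ?y))"
            by (simp add: mult_ac)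
          then show "ennreal (l\<^sup>2) * ennreal ((norm (g ?y))\<^sup>2 * \<eta> z) * ennreal (\<rho> x)
              \<le> ennreal (l\<^sup>2 * ?C) * (ennreal (\<eta> z) * ennreal ((norm (g ?y))\<^sup>2 * \<rho> ?y))"
            using \<eta>_nonneg[of z] nonneg by (simp add: ennreal_leI flip: ennreal_mult)
        qed
        finally show ?thesis .
      qed simp
    qed
  qed
  also have "\<dots> = (\<integral>\<^sup>+z. (\<integral>\<^sup>+x. ennreal (l\<^sup>2 * ?C) * (ennreal (\<eta> z) * ennreal ((norm (g (l *\<^sub>R x + (1 - l) *\<^sub>R z)))\<^sup>2 * \<rho> (l *\<^sub>R x + (1 - l) *\<^sub>R z))) \<partial>lborel) \<partial>lborel)"
    by (rule lborel_pair.Fubini') measurable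
  also have "\<dots> = (\<integral>\<^sup>+z. ennreal (l\<^sup>2 * ?C) * (ennreal (\<eta> z) * ennreal (?E / l ^ DIM('a))) \<partial>lborel)"
  proof (rule nn_integral_cong)
    fix z
    have "(\<integral>\<^sup>+x. ennreal ((norm (g x))\<^sup>2 * \<rho> x) \<partial>lborel)
        = ennreal (\<bar>l\<bar> ^ DIM('a)) * (\<integral>\<^sup>+x. ennreal ((norm (g ((1 - l) *\<^sub>R z + l *\<^sub>R x)))\<^sup>2 * \<rho> ((1 - l) *\<^sub>R z + l *\<^sub>R x)) \<partial>lborel)"
      using l by (intro nn_integral_lborel_affine) auto
    moreover have "(\<integral>\<^sup>+x. ennreal ((norm (g x))\<^sup>2 * \<rho> x) \<partial>lborel) = ennreal ?E"
      using nonneg by (intro nn_integral_eq_integral g) auto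
    ultimately have e: "ennreal ?E = ennreal (l ^ DIM('a)) * (\<integral>\<^sup>+x. ennreal ((norm (g (l *\<^sub>R x + (1 - l) *\<^sub>R z)))\<^sup>2 * \<rho> (l *\<^sub>R x + (1 - l) *\<^sub>R z)) \<partial>lborel)"
      using l by (simp add: add.commute)
    have "ennreal (?E / l ^ DIM('a)) = ennreal (1 / l ^ DIM('a)) * ennreal ?E"
      using l by (simp flip: ennreal_mult')
    also have "\<dots> = ennreal (1 / l ^ DIM('a)) * ennreal (l ^ DIM('a)) * (\<integral>\<^sup>+x. ennreal ((norm (g (l *\<^sub>R x + (1 - l) *\<^sub>R z)))\<^sup>2 * \<rho> (l *\<^sub>R x + (1 - l) *\<^sub>R z)) \<partial>lborel)"
      unfolding e by (simp add: mult.assoc)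
    also have "ennreal (1 / l ^ DIM('a)) * ennreal (l ^ DIM('a)) = 1"
      using l by (simp flip: ennreal_mult')
    finally have "(\<integral>\<^sup>+x. ennreal ((norm (g (l *\<^sub>R x + (1 - l) *\<^sub>R z)))\<^sup>2 * \<rho> (l *\<^sub>R x + (1 - l) *\<^sub>R z)) \<partial>lborel) = ennreal (?E / l ^ DIM('a))"
      by simp
    then show "(\<integral>\<^sup>+x. ennreal (l\<^sup>2 * ?C) * (ennreal (\<eta> z) * ennreal ((norm (g (l *\<^sub>R x + (1 - l) *\<^sub>R z)))\<^sup>2 * \<rho> (l *\<^sub>R x + (1 - l) *\<^sub>R z))) \<partial>lborel)
        = ennreal (l\<^sup>2 * ?C) * (ennreal (\<eta> z) * ennreal (?E / l ^ DIM('a)))"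
      by (simp add: nn_integral_cmult)
  qed
  also have "\<dots> = ennreal (?c * ?E)"
  proof -
    have "(\<integral>\<^sup>+z. ennreal (\<eta> z) \<partial>lborel) = 1"
      using \<eta>_int \<eta>_nonneg by (subst nn_integral_eq_integral) auto
    then show ?thesis
      using l E0 by (simp add: nn_integral_cmult nn_integral_multc flip: ennreal_mult)
  qed
  finally have "(LINT x|lborel. (norm (G x))\<^sup>2 * \<rho> x) \<le> ?c * ?E"
    using l E0 by (intro integral_real_bounded) auto
  with e1 have "energy \<xi> s \<le> ?c * ?E" by simp
  with bounded \<xi>_eq show ?thesis by blast
qed

text \<open>As \<open>\<phi>\<close> is merely measurable, \<open>\<phi> (l x + (1 - l) z)\<close> need not converge as \<open>l \<rightarrow> 1\<close>. In the
  variable \<open>w = l x + (1 - l) z\<close> the argument of \<open>\<phi>\<close> is fixed, and only the density and the kernel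
  move, both of which are continuous. Their product is dominated with the help of
  \<open>density_le_shrunk\<close>, and \<open>l \<ge> 1/2\<close> keeps the Jacobian bounded.\<close>

lemma mollification_ratio_tendsto:
  assumes \<phi>: "sq_int \<phi>" and l: "\<And>n. 1 / 2 \<le> l n" "\<And>n. l n < 1" "l \<longlonglongrightarrow> 1"
    and \<xi>: "\<And>n. bounded_fun (\<xi> n)"
      "\<And>n x. x \<in> dom \<Longrightarrow> \<xi> n x = (LINT z|lborel. \<phi> (l n *\<^sub>R x + (1 - l n) *\<^sub>R z) * \<eta> z)"
    and k: "gauss_dominated k" "continuous_on UNIV (k s)" and s: "0 < s"
  shows "(\<lambda>n. ratio (\<xi> n) k s y) \<longlonglongrightarrow> ratio \<phi> k s y"
proof -
  obtain B where B: "\<And>z. \<bar>k s z\<bar> \<le> B" using gauss_dominated_bounded[OF k(1) s order.refl] by auto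
  have B0: "0 \<le> B" using order.trans[OF abs_ge_zero B] .
  have [measurable]: "k s \<in> borel_measurable borel" by (rule borel_measurable_continuous_onI[OF k(2)])
  have [measurable]: "\<phi> \<in> borel_measurable borel" by (rule sq_int_measurable[OF \<phi>])
  have lp: "0 < l n" for n using l(1)[of n] by linarith
  \<comment> \<open>The solution \<open>x\<close> of \<open>l x + (1 - l) z = w\<close>; \<open>P\<close> is the integrand in the variable \<open>x\<close>, and \<open>S\<close>
    is the one in the variable \<open>w\<close>.\<close>
  define pull where "pull n z w = (1 / l n) *\<^sub>R (w - (1 - l n) *\<^sub>R z)" for n and z w :: 'a
  have pull: "l n *\<^sub>R pull n z w + (1 - l n) *\<^sub>R z = w" "pull n z (l n *\<^sub>R x + (1 - l n) *\<^sub>R z) = x" for n z w x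
    using lp[of n] by (simp_all add: pull_def)
  have [measurable]: "(\<lambda>p. pull n (fst p) (snd p)) \<in> borel_measurable (lborel \<Otimes>\<^sub>M lborel)" "pull n z \<in> borel_measurable borel" for n z
    unfolding pull_def by measurable
  define F where "F n z w = \<phi> w * \<eta> z * (\<rho> (pull n z w) * k s (y - pull n z w))" for n z w
  define S where "S n z w = F n z w / l n ^ DIM('a)" for n z w
  define P where "P n z x = \<phi> (l n *\<^sub>R x + (1 - l n) *\<^sub>R z) * \<eta> z * (\<rho> x * k s (y - x))" for n z x
  have FP: "F n z (l n *\<^sub>R x + (1 - l n) *\<^sub>R z) = P n z x" for n z x
    by (simp add: F_def P_def pull)
  have [measurable]: "(\<lambda>p. S n (fst p) (snd p)) \<in> borel_measurable (lborel \<Otimes>\<^sub>M lborel)" "F n z \<in> borel_measurable borel"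
    "(\<lambda>p. P n (fst p) (snd p)) \<in> borel_measurable (lborel \<Otimes>\<^sub>M lborel)" for n z
    unfolding S_def F_def P_def by measurable
  let ?C = "M / m"
  have C1: "1 \<le> ?C" using m M by simp
  have Fle: "\<bar>F n z w\<bar> \<le> (?C * B) * (\<eta> z * \<bar>\<phi> w * \<rho> w\<bar>)" for n z w
  proof (cases "\<eta> z = 0")
    case False
    have "\<rho> (pull n z w) \<le> ?C powr (1 - l n) * \<rho> w"
      using density_le_shrunk[OF lp[of n] l(2)[of n] False, of "pull n z w"] by (simp add: pull)
    also have "\<dots> \<le> ?C powr 1 * \<rho> w"
      using C1 lp[of n] nonneg by (intro mult_right_mono powr_mono) auto
    also have "?C powr 1 = ?C" by (rule powr_one) (use C1 in linarith)
    finally have r: "\<rho> (pull n z w) \<le> ?C * \<rho> w" .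
    have "\<bar>F n z w\<bar> = \<bar>\<phi> w\<bar> * \<eta> z * (\<rho> (pull n z w) * \<bar>k s (y - pull n z w)\<bar>)"
      using \<eta>_nonneg[of z] nonneg by (simp add: F_def abs_mult)
    also have "\<dots> \<le> \<bar>\<phi> w\<bar> * \<eta> z * ((?C * \<rho> w) * B)"
      using \<eta>_nonneg[of z] order.trans[OF nonneg r] by (intro mult_left_mono mult_mono r B) (auto intro!: mult_nonneg_nonneg)
    finally show ?thesis using nonneg[of w] by (simp add: abs_mult mult_ac)
  qed (simp add: F_def)
  have Sle: "\<bar>S n z w\<bar> \<le> (2 ^ DIM('a) * (?C * B)) * (\<eta> z * \<bar>\<phi> w * \<rho> w\<bar>)" for n z w
  proof -
    have "1 / l n ^ DIM('a) = (1 / l n) ^ DIM('a)" by (simp add: power_one_over)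
    also have "\<dots> \<le> 2 ^ DIM('a)" using lp[of n] l(1)[of n] by (intro power_mono) (auto simp: field_simps)
    finally have i: "1 / l n ^ DIM('a) \<le> 2 ^ DIM('a)" .
    have "\<bar>S n z w\<bar> = (1 / l n ^ DIM('a)) * \<bar>F n z w\<bar>" using lp[of n] by (simp add: S_def)
    also have "\<dots> \<le> 2 ^ DIM('a) * ((?C * B) * (\<eta> z * \<bar>\<phi> w * \<rho> w\<bar>))"
      using lp[of n] by (intro mult_mono i Fle) auto
    finally show ?thesis by (simp add: mult.assoc)
  qed
  have W: "integrable (lborel \<Otimes>\<^sub>M lborel) (\<lambda>p. (2 ^ DIM('a) * (?C * B)) * (case p of (z, w) \<Rightarrow> \<eta> z * \<bar>\<phi> w * \<rho> w\<bar>))"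
    by (intro integrable_mult_right integrable_pair_prod \<eta>_int integrable_abs sq_int_integrable[OF \<phi>])
  have Sb: "AE p in (lborel \<Otimes>\<^sub>M lborel). norm (S n (fst p) (snd p)) \<le> (2 ^ DIM('a) * (?C * B)) * (case p of (z, w) \<Rightarrow> \<eta> z * \<bar>\<phi> w * \<rho> w\<bar>)" for n
    using Sle by (intro AE_I2) (simp add: case_prod_unfold)
  have Si: "integrable (lborel \<Otimes>\<^sub>M lborel) (\<lambda>p. S n (fst p) (snd p))" for n
  proof (rule Bochner_Integration.integrable_bound[OF W])
    show "AE p in (lborel \<Otimes>\<^sub>M lborel). norm (S n (fst p) (snd p)) \<le> norm ((2 ^ DIM('a) * (?C * B)) * (case p of (z, w) \<Rightarrow> \<eta> z * \<bar>\<phi> w * \<rho> w\<bar>))"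
      using Sb[of n]
    proof eventually_elim
      case (elim p)
      then show ?case unfolding real_norm_def[of "_ * _"] by (rule order.trans[OF _ abs_ge_self])
    qed
  qed measurable
  have sub: "(LINT x|lborel. P n z x) = (LINT w|lborel. S n z w)" "(LINT x|lborel. \<bar>P n z x\<bar>) = (LINT w|lborel. \<bar>S n z w\<bar>)"
    "integrable lborel (P n z) \<longleftrightarrow> integrable lborel (S n z)" for n z
  proof -
    have e: "P n z x = F n z ((1 - l n) *\<^sub>R z + l n *\<^sub>R x)" for x using FP[of n z x] by (simp add: add.commute)
    show "(LINT x|lborel. P n z x) = (LINT w|lborel. S n z w)"
      unfolding e S_def using integral_lborel_affine[of "F n z" "l n" "(1 - l n) *\<^sub>R z"] lp[of n] by simp
    show "(LINT x|lborel. \<bar>P n z x\<bar>) = (LINT w|lborel. \<bar>S n z w\<bar>)"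
      unfolding e S_def using integral_lborel_affine[of "\<lambda>w. \<bar>F n z w\<bar>" "l n" "(1 - l n) *\<^sub>R z"] lp[of n] by simp
    have "integrable lborel (P n z) \<longleftrightarrow> integrable lborel (F n z)"
      unfolding e[abs_def] using integrable_lborel_affine[of "F n z" "l n" "(1 - l n) *\<^sub>R z"] lp[of n] by simp
    also have "\<dots> \<longleftrightarrow> integrable lborel (S n z)"
      unfolding S_def[abs_def] divide_inverse using lp[of n] by simp
    finally show "integrable lborel (P n z) \<longleftrightarrow> integrable lborel (S n z)" .
  qed
  have Si': "integrable (lborel \<Otimes>\<^sub>M lborel) (\<lambda>(z, w). S n z w)" for n using Si[of n] by (simp add: case_prod_unfold)
  have Pi: "integrable (lborel \<Otimes>\<^sub>M lborel) (\<lambda>(z, x). P n z x)" for n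
  proof (rule lborel_pair.Fubini_integrable)
    show "(\<lambda>(z, x). P n z x) \<in> borel_measurable (lborel \<Otimes>\<^sub>M lborel)" by (simp add: case_prod_unfold)
    have "integrable (lborel \<Otimes>\<^sub>M lborel) (\<lambda>(z, w). \<bar>S n z w\<bar>)" using integrable_abs[OF Si[of n]] by (simp add: case_prod_unfold)
    from lborel_pair.integrable_fst[OF this]
    show "integrable lborel (\<lambda>z. LINT x|lborel. norm (case (z, x) of (z, x) \<Rightarrow> P n z x))" by (simp add: sub)
    show "AE z in lborel. integrable lborel (\<lambda>x. case (z, x) of (z, x) \<Rightarrow> P n z x)"
      using lborel_pair.AE_integrable_fst[OF Si'[of n]] by (simp add: sub)
  qed
  have eq: "conv (k s) (\<lambda>x. \<xi> n x * \<rho> x) y = (LINT p|(lborel \<Otimes>\<^sub>M lborel). S n (fst p) (snd p))" for n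
  proof -
    have "conv (k s) (\<lambda>x. \<xi> n x * \<rho> x) y = (LINT x|lborel. (LINT z|lborel. P n z x))"
      unfolding conv_def
    proof (rule integral_cong_AE)
      have [measurable]: "\<xi> n \<in> borel_measurable borel" using \<xi>(1)[of n] by (simp add: bounded_fun_def)
      show "(\<lambda>x. \<xi> n x * \<rho> x * k s (y - x)) \<in> borel_measurable lborel" by measurable
      have "(\<lambda>(x, z). P n z x) \<in> borel_measurable (lborel \<Otimes>\<^sub>M lborel)" unfolding P_def by measurable
      then show "(\<lambda>x. LINT z|lborel. P n z x) \<in> borel_measurable lborel" by measurable
      show "AE x in lborel. \<xi> n x * \<rho> x * k s (y - x) = (LINT z|lborel. P n z x)"
        using AE_dom
      proof eventually_elim
        case (elim x)
        have "(LINT z|lborel. P n z x) = (LINT z|lborel. \<phi> (l n *\<^sub>R x + (1 - l n) *\<^sub>R z) * \<eta> z) * (\<rho> x * k s (y - x))"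
          unfolding P_def by simp
        then show ?case using elim \<xi>(2)[of x n] by (cases "\<rho> x = 0") (simp_all add: mult.assoc)
      qed
    qed
    also have "\<dots> = (LINT z|lborel. (LINT x|lborel. P n z x))" by (rule lborel_pair.Fubini_integral[OF Pi])
    also have "\<dots> = (LINT z|lborel. (LINT w|lborel. S n z w))" by (simp only: sub)
    also have "\<dots> = (LINT p|(lborel \<Otimes>\<^sub>M lborel). S n (fst p) (snd p))"
      using lborel_pair.integral_fst[OF Si'[of n]] by (simp add: case_prod_unfold)
    finally show ?thesis .
  qed
  let ?S = "\<lambda>p. \<eta> (fst p) * (\<phi> (snd p) * \<rho> (snd p) * k s (y - snd p))"
  have lim: "AE p in (lborel \<Otimes>\<^sub>M lborel). (\<lambda>n. S n (fst p) (snd p)) \<longlonglongrightarrow> ?S p"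
  proof -
    have [measurable]: "dom \<in> sets borel" using open_dom by simp
    have "AE p in (lborel \<Otimes>\<^sub>M lborel). \<rho> (snd p) \<noteq> 0 \<longrightarrow> snd p \<in> dom"
    proof (rule lborel_pair.AE_pair_measure)
      show "{p \<in> space (lborel \<Otimes>\<^sub>M lborel). \<rho> (snd p) \<noteq> 0 \<longrightarrow> snd p \<in> dom} \<in> sets (lborel \<Otimes>\<^sub>M lborel)" by measurable
      show "AE x in lborel. AE w in lborel. \<rho> (snd (x, w)) \<noteq> 0 \<longrightarrow> snd (x, w) \<in> dom"
        using AE_dom by simp
    qed
    then show ?thesis
    proof eventually_elim
      case (elim p)
      obtain z w where p: "p = (z, w)" by fastforce
      show ?case
      proof (cases "w \<in> dom")
        case True
        have "(\<lambda>n. pull n z w) \<longlonglongrightarrow> (1 / 1) *\<^sub>R (w - (1 - 1) *\<^sub>R z)"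
          unfolding pull_def by (intro tendsto_intros l(3)) auto
        then have b: "(\<lambda>n. pull n z w) \<longlonglongrightarrow> w" by simp
        have "isCont \<rho> w" using continuous_on_dom open_dom True by (simp add: continuous_on_eq_continuous_at)
        then have r: "(\<lambda>n. \<rho> (pull n z w)) \<longlonglongrightarrow> \<rho> w" using b by (rule isCont_tendsto_compose)
        have "isCont (k s) (y - w)" using k(2) by (simp add: continuous_on_eq_continuous_at)
        moreover have "(\<lambda>n. y - pull n z w) \<longlonglongrightarrow> y - w" by (intro tendsto_intros b)
        ultimately have q: "(\<lambda>n. k s (y - pull n z w)) \<longlonglongrightarrow> k s (y - w)" by (rule isCont_tendsto_compose)
        have "(\<lambda>n. S n z w) \<longlonglongrightarrow> \<phi> w * \<eta> z * (\<rho> w * k s (y - w)) / 1 ^ DIM('a)"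
          unfolding S_def F_def by (intro tendsto_intros r q l(3)) auto
        then show ?thesis by (simp add: p mult_ac)
      next
        case False
        then have 0: "\<rho> w = 0" using elim by (auto simp: p)
        then have "S n z w = 0" for n using Sle[of n z w] by simp
        then show ?thesis using 0 by (simp add: p)
      qed
    qed
  qed
  have mS: "?S \<in> borel_measurable (lborel \<Otimes>\<^sub>M lborel)" by measurable
  have "(\<lambda>n. LINT p|(lborel \<Otimes>\<^sub>M lborel). S n (fst p) (snd p)) \<longlonglongrightarrow> (LINT p|(lborel \<Otimes>\<^sub>M lborel). ?S p)"
    by (rule integral_dominated_convergence[OF mS _ W lim Sb]) measurable
  moreover have "(LINT p|(lborel \<Otimes>\<^sub>M lborel). ?S p) = conv (k s) (\<lambda>x. \<phi> x * \<rho> x) y"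
  proof -
    have "integrable (lborel \<Otimes>\<^sub>M lborel) (\<lambda>(z, w). \<eta> z * (\<phi> w * \<rho> w * k s (y - w)))"
      by (intro integrable_pair_prod \<eta>_int integrable_conv_kernel[OF sq_int_integrable[OF \<phi>] _ B]) measurable
    from lborel_pair.integral_fst[OF this]
    show ?thesis by (simp add: case_prod_unfold \<eta>_int conv_def)
  qed
  ultimately have "(\<lambda>n. conv (k s) (\<lambda>x. \<xi> n x * \<rho> x) y) \<longlonglongrightarrow> conv (k s) (\<lambda>x. \<phi> x * \<rho> x) y"
    by (simp only: eq)
  then show ?thesis
    unfolding ratio_def using evol_pos[OF s, of y] by (intro tendsto_intros) simp_all
qed

text \<open>Regularise with \<open>l \<rightarrow> 1\<close>: the constants in \<open>mollification\<close> tend to 1, and the energy at time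
  \<open>s > 0\<close> is lower semicontinuous.\<close>

lemma energy_le_gradient_mollified:
  assumes \<phi>: "sq_int \<phi>" and R: "\<And>x. x \<notin> cball 0 R \<Longrightarrow> \<phi> x = 0"
    and g: "is_weak_gradient dom \<phi> g" "integrable lborel (\<lambda>x. (norm (g x))\<^sup>2 * \<rho> x)" and s: "0 < s"
  shows "energy \<phi> s \<le> (LINT x|lborel. (norm (g x))\<^sup>2 * \<rho> x)"
proof -
  let ?E = "LINT x|lborel. (norm (g x))\<^sup>2 * \<rho> x"
  define l where "l n = 1 - inverse (real (Suc (Suc n)))" for n
  have l: "1 / 2 \<le> l n" "l n < 1" for n by (auto simp: l_def field_simps)
  have lp: "0 < l n" for n using l(1)[of n] by linarith
  have liml: "l \<longlonglongrightarrow> 1"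
  proof -
    have "(\<lambda>n. 1 - inverse (real (Suc (Suc n)))) \<longlonglongrightarrow> 1 - 0"
      by (rule tendsto_diff[OF tendsto_const LIMSEQ_Suc[OF LIMSEQ_inverse_real_of_nat]])
    then show ?thesis by (simp add: l_def[abs_def])
  qed
  let ?c = "\<lambda>n. (l n)\<^sup>2 * (M / m) powr (1 - l n) / l n ^ DIM('a)"
  have "\<forall>n. \<exists>\<xi>. bounded_fun \<xi> \<and> (\<forall>x\<in>dom. \<xi> x = (LINT z|lborel. \<phi> (l n *\<^sub>R x + (1 - l n) *\<^sub>R z) * \<eta> z)) \<and> energy \<xi> s \<le> ?c n * ?E"
    using mollification[OF \<phi> R g lp l(2) s] by blast
  from choice[OF this] obtain \<xi> where \<xi>_all: "\<forall>n. bounded_fun (\<xi> n) \<and>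
      (\<forall>x\<in>dom. \<xi> n x = (LINT z|lborel. \<phi> (l n *\<^sub>R x + (1 - l n) *\<^sub>R z) * \<eta> z)) \<and> energy (\<xi> n) s \<le> ?c n * ?E" ..
  then have \<xi>: "bounded_fun (\<xi> n)"
      "x \<in> dom \<Longrightarrow> \<xi> n x = (LINT z|lborel. \<phi> (l n *\<^sub>R x + (1 - l n) *\<^sub>R z) * \<eta> z)"
      "energy (\<xi> n) s \<le> ?c n * ?E" for n x
    by simp_all
  have "?c \<longlonglongrightarrow> 1\<^sup>2 * (M / m) powr (1 - 1) / 1 ^ DIM('a)"
    using m M by (intro tendsto_intros liml) auto
  then have "?c \<longlonglongrightarrow> 1" using m M by simp
  from tendsto_mult[OF this tendsto_const] have lim: "(\<lambda>n. ?c n * ?E) \<longlonglongrightarrow> ?E" by simp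
  have lim': "(\<lambda>n. dmean (\<xi> n) b s x) \<longlonglongrightarrow> dmean \<phi> b s x" for b x
    by (intro dmean_tendsto mollification_ratio_tendsto[OF \<phi> l liml \<xi>(1,2)] s)
  show ?thesis
    by (rule energy_fatou(2)[OF s bounded_sq_int[OF \<xi>(1)] \<phi> tame_integrable[OF tame_energy[OF \<xi>(1)] s] lim' \<xi>(3) lim])
qed

end

context log_concave_prob begin

lemma energy_le_gradient_of_bounded_support:
  assumes \<phi>: "sq_int \<phi>" and R: "\<And>x. x \<notin> cball 0 R \<Longrightarrow> \<phi> x = 0"
    and g: "is_weak_gradient dom \<phi> g" "integrable lborel (\<lambda>x. (norm (g x))\<^sup>2 * \<rho> x)" and s: "0 < s"
  shows "energy \<phi> s \<le> (LINT x|lborel. (norm (g x))\<^sup>2 * \<rho> x)"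
proof -
  obtain p q where pq: "cbox p q \<subseteq> dom" "\<And>i. i \<in> Basis \<Longrightarrow> p \<bullet> i < q \<bullet> i" using exists_box_in_dom by blast
  obtain m where m: "0 < m" "\<And>x. x \<in> cbox p q \<Longrightarrow> m \<le> \<rho> x"
    using lower_bound_on_compact[OF compact_cbox pq(1)] by blast
  obtain M where M: "\<And>x. \<rho> x \<le> M" using bounded_density by blast
  have "p \<in> cbox p q" using pq(2) by (auto simp: mem_box intro: less_imp_le)
  then have mM: "m \<le> M" using m(2)[of p] M[of p] by simp
  obtain \<eta> where \<eta>: "\<And>k. C_k k \<eta>" "\<And>z. 0 \<le> \<eta> z" "integrable lborel \<eta>" "(LINT z|lborel. \<eta> z) = 1" "\<And>z. \<eta> z \<noteq> 0 \<Longrightarrow> z \<in> cbox p q"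
    using exists_mollifier[OF pq(2)] by blast
  interpret mollified \<rho> p q m M \<eta>
    by unfold_locales (use pq m M mM \<eta> in auto)
  show ?thesis by (rule energy_le_gradient_mollified[OF assms])
qed

text \<open>Smooth cutoffs at radius of order \<open>n\<close> reduce the claim to functions of bounded support; the
  additional term of the gradient carries a factor \<open>r n \<rightarrow> 0\<close>.\<close>

lemma energy_le_gradient:
  assumes \<phi>: "sq_int \<phi>" and g: "is_weak_gradient dom \<phi> g" "integrable lborel (\<lambda>x. (norm (g x))\<^sup>2 * \<rho> x)" and s: "0 < s"
  shows "energy \<phi> s \<le> (LINT x|lborel. (norm (g x))\<^sup>2 * \<rho> x)"
proof -
  have [measurable]: "\<phi> \<in> borel_measurable borel" "g \<in> borel_measurable borel"
    using \<phi> g(1) by (auto simp: sq_int_def is_weak_gradient_def)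
  let ?b = "bump (- One) (One :: 'a)"
  have b0: "0 < ?b 0" by (simp add: bump_pos_iff mem_box)
  define \<theta> where "\<theta> x = (1 / ?b 0) * ?b x" for x
  have sm: "C_k k \<theta>" for k unfolding \<theta>_def[abs_def] by (intro C_k_mult C_k_const smooth_bump)
  have supp: "x \<in> cbox (- One) One" if "\<theta> x \<noteq> 0" for x
    using that bump_eq_0_iff[of "- One" One x] box_subset_cbox[of "- One" "One :: 'a"] by (auto simp: \<theta>_def)
  have \<theta>: "\<theta> \<in> test_functions UNIV" by (rule test_functionsI[OF sm supp]) auto
  obtain B where B: "\<And>x. \<bar>\<theta> x\<bar> \<le> B" using test_function_bounded(1)[OF \<theta>] by blast
  let ?D = "\<lambda>\<theta> x. \<Sum>b\<in>Basis. frechet_derivative \<theta> (at x) b *\<^sub>R b"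
  have "\<exists>B. \<forall>b x. \<bar>frechet_derivative \<theta> (at x) b\<bar> \<le> B b" using test_function_bounded(2)[OF \<theta>] by metis
  then obtain B' where B': "\<And>b x. \<bar>frechet_derivative \<theta> (at x) b\<bar> \<le> B' b" by blast
  have DB: "norm (?D \<theta> x) \<le> (\<Sum>b\<in>Basis. B' b)" for x
    by (rule order.trans[OF norm_sum sum_mono]) (simp add: B')
  let ?B' = "\<Sum>b\<in>(Basis :: 'a set). B' b"
  define r where "r n = inverse (real (Suc n))" for n
  have r: "0 < r n" "r n \<le> 1" for n by (auto simp: r_def field_simps)
  have rlim: "r \<longlonglongrightarrow> 0" unfolding r_def[abs_def] by (rule LIMSEQ_inverse_real_of_nat)
  define \<theta>n where "\<theta>n n x = \<theta> (0 + r n *\<^sub>R x)" for n x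
  have smn: "C_k k (\<theta>n n)" for k n unfolding \<theta>n_def[abs_def] by (rule C_k_affine[OF sm])
  have suppn: "x \<in> (\<lambda>x. (1 / r n) *\<^sub>R x) ` cbox (- One) One" if "\<theta>n n x \<noteq> 0" for n x
  proof -
    have "r n *\<^sub>R x \<in> cbox (- One) One" using supp that by (simp add: \<theta>n_def)
    then have "(1 / r n) *\<^sub>R (r n *\<^sub>R x) \<in> (\<lambda>x. (1 / r n) *\<^sub>R x) ` cbox (- One) One" by (rule imageI)
    then show ?thesis using r(1)[of n] by simp
  qed
  have cs: "compact ((\<lambda>x. (1 / r n) *\<^sub>R x) ` cbox (- One) (One :: 'a))" for n by (intro compact_scaling compact_cbox)
  have \<theta>n: "\<theta>n n \<in> test_functions UNIV" for n by (rule test_functionsI[OF smn suppn cs]) auto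
  have Dn: "?D (\<theta>n n) x = r n *\<^sub>R ?D \<theta> (r n *\<^sub>R x)" for n x
    unfolding \<theta>n_def[abs_def] frechet_derivative_affine[OF sm] by (simp add: scaleR_sum_right)
  define \<phi>n where "\<phi>n n x = \<theta>n n x * \<phi> x" for n x
  define gn where "gn n x = \<theta>n n x *\<^sub>R g x + \<phi> x *\<^sub>R ?D (\<theta>n n) x" for n x
  have wg: "is_weak_gradient dom (\<phi>n n) (gn n)" for n
    unfolding \<phi>n_def[abs_def] gn_def[abs_def] by (rule weak_gradient_mult[OF g(1) _ \<theta>n]) measurable
  have [measurable]: "gn n \<in> borel_measurable borel" for n using wg[of n] by (simp add: is_weak_gradient_def)
  have [measurable]: "\<theta>n n \<in> borel_measurable borel" for n
    by (rule borel_measurable_continuous_onI[OF test_function_continuous[OF \<theta>n]])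
  have [measurable]: "\<phi>n n \<in> borel_measurable borel" for n unfolding \<phi>n_def[abs_def] by measurable
  have Bn: "\<bar>\<theta>n n x\<bar> \<le> B" for n x by (simp add: \<theta>n_def B)
  have B0: "0 \<le> B" using order.trans[OF abs_ge_zero B] .
  have le: "\<bar>\<phi>n n x\<bar> \<le> \<bar>B * \<phi> x\<bar>" for n x
    unfolding \<phi>n_def abs_mult using order.trans[OF Bn abs_ge_self] by (intro mult_right_mono) auto
  have BI: "sq_int (\<lambda>x. B * \<phi> x)" by (rule sq_int_cmult[OF \<phi>])
  have sqn: "sq_int (\<phi>n n)" for n by (rule sq_int_dominated(1)[OF BI _ le]) measurable
  have \<theta>lim: "(\<lambda>n. \<theta>n n x) \<longlonglongrightarrow> 1" for x
  proof -
    have "(\<lambda>n. 0 + r n *\<^sub>R x) \<longlonglongrightarrow> 0 + 0 *\<^sub>R x" by (intro tendsto_intros rlim)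
    moreover have "isCont \<theta> (0 + 0 *\<^sub>R x)" using test_function_continuous[OF \<theta>] by (simp add: continuous_on_eq_continuous_at)
    ultimately have "(\<lambda>n. \<theta> (0 + r n *\<^sub>R x)) \<longlonglongrightarrow> \<theta> (0 + 0 *\<^sub>R x)" by (intro isCont_tendsto_compose[of _ \<theta>])
    moreover have "\<theta> (0 + 0 *\<^sub>R x) = 1" using b0 by (simp add: \<theta>_def)
    ultimately show ?thesis by (simp add: \<theta>n_def)
  qed
  have \<phi>lim: "(\<lambda>n. \<phi>n n x) \<longlonglongrightarrow> \<phi> x" for x
    using tendsto_mult[OF \<theta>lim[of x] tendsto_const[of "\<phi> x"]] by (simp add: \<phi>n_def)
  have Dle: "norm (?D (\<theta>n n) x) \<le> r n * ?B'" for n x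
    unfolding Dn using DB[of "r n *\<^sub>R x"] r(1)[of n] by (simp add: mult_left_mono)
  have glim: "(\<lambda>n. gn n x) \<longlonglongrightarrow> g x" for x
  proof -
    have "(\<lambda>n. ?D (\<theta>n n) x) \<longlonglongrightarrow> 0"
    proof (rule Lim_null_comparison)
      show "\<forall>\<^sub>F n in sequentially. norm (?D (\<theta>n n) x) \<le> r n * ?B'" using Dle by simp
      show "(\<lambda>n. r n * ?B') \<longlonglongrightarrow> 0" using tendsto_mult[OF rlim tendsto_const[of ?B']] by simp
    qed
    from tendsto_add[OF tendsto_scaleR[OF \<theta>lim[of x] tendsto_const[of "g x"]] tendsto_scaleR[OF tendsto_const[of "\<phi> x"] this]]
    show ?thesis by (simp add: gn_def)
  qed
  have B'0: "0 \<le> ?B'" using order.trans[OF norm_ge_zero DB[of 0]] .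
  let ?W = "\<lambda>x. 2 * B\<^sup>2 * ((norm (g x))\<^sup>2 * \<rho> x) + 2 * ?B'\<^sup>2 * ((\<phi> x)\<^sup>2 * \<rho> x)"
  have W: "integrable lborel ?W" using g(2) sq_int_sq_integrable[OF \<phi>] by simp
  have gle: "(norm (gn n x))\<^sup>2 * \<rho> x \<le> ?W x" for n x
  proof -
    have "norm (gn n x) \<le> \<bar>\<theta>n n x\<bar> * norm (g x) + \<bar>\<phi> x\<bar> * norm (?D (\<theta>n n) x)"
      unfolding gn_def using norm_triangle_ineq[of "\<theta>n n x *\<^sub>R g x" "\<phi> x *\<^sub>R ?D (\<theta>n n) x"] by simp
    also have "\<dots> \<le> B * norm (g x) + \<bar>\<phi> x\<bar> * ?B'"
    proof (intro add_mono mult_right_mono mult_left_mono Bn)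
      have "r n * ?B' \<le> 1 * ?B'" using r(2)[of n] B'0 by (intro mult_right_mono) auto
      then show "norm (?D (\<theta>n n) x) \<le> ?B'" using Dle[of n x] by simp
    qed auto
    finally have "(norm (gn n x))\<^sup>2 \<le> (B * norm (g x) + \<bar>\<phi> x\<bar> * ?B')\<^sup>2" by (intro power_mono) auto
    also have "\<dots> \<le> 2 * (B * norm (g x))\<^sup>2 + 2 * (\<bar>\<phi> x\<bar> * ?B')\<^sup>2"
      using zero_le_power2[of "B * norm (g x) - \<bar>\<phi> x\<bar> * ?B'"] by (simp add: power2_eq_square algebra_simps)
    also have "\<dots> = 2 * B\<^sup>2 * (norm (g x))\<^sup>2 + 2 * ?B'\<^sup>2 * (\<phi> x)\<^sup>2" by (simp add: power_mult_distrib)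
    finally show ?thesis using mult_right_mono[OF _ nonneg[of x]] by (fastforce simp: distrib_right mult.assoc)
  qed
  have gi: "integrable lborel (\<lambda>x. (norm (gn n x))\<^sup>2 * \<rho> x)" for n
  proof (rule Bochner_Integration.integrable_bound[OF W])
    show "AE x in lborel. norm ((norm (gn n x))\<^sup>2 * \<rho> x) \<le> norm (?W x)"
      using order.trans[OF gle abs_ge_self] nonneg by (intro AE_I2) simp
  qed measurable
  have Elim: "(\<lambda>n. LINT x|lborel. (norm (gn n x))\<^sup>2 * \<rho> x) \<longlonglongrightarrow> (LINT x|lborel. (norm (g x))\<^sup>2 * \<rho> x)"
  proof (rule integral_dominated_convergence[OF _ _ W])
    show "AE x in lborel. (\<lambda>n. (norm (gn n x))\<^sup>2 * \<rho> x) \<longlonglongrightarrow> (norm (g x))\<^sup>2 * \<rho> x"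
      by (intro AE_I2 tendsto_intros glim)
    show "AE x in lborel. norm ((norm (gn n x))\<^sup>2 * \<rho> x) \<le> ?W x" for n
      using gle nonneg by (intro AE_I2) simp
  qed measurable
  have En: "energy (\<phi>n n) s \<le> (LINT x|lborel. (norm (gn n x))\<^sup>2 * \<rho> x)" for n
  proof -
    obtain R where "(\<lambda>x. (1 / r n) *\<^sub>R x) ` cbox (- One) (One :: 'a) \<subseteq> ball 0 R"
      using bounded_subset_ballD[OF compact_imp_bounded[OF cs[of n]]] by blast
    then have R: "(\<lambda>x. (1 / r n) *\<^sub>R x) ` cbox (- One) (One :: 'a) \<subseteq> cball 0 R"
      using ball_subset_cball by blast
    have "\<phi>n n x = 0" if "x \<notin> cball 0 R" for x
    proof -
      have "\<theta>n n x = 0" using suppn[of n x] R that by blast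
      then show ?thesis by (simp add: \<phi>n_def)
    qed
    then show ?thesis by (rule energy_le_gradient_of_bounded_support[OF sqn _ wg gi s])
  qed
  have lim: "(\<lambda>n. dmean (\<phi>n n) b s x) \<longlonglongrightarrow> dmean \<phi> b s x" for b x
    by (intro dmean_tendsto ratio_tendsto_dominated[OF sq_int_integrable[OF BI] _ _ \<phi>lim le] s) measurable
  show ?thesis
    by (rule energy_fatou(2)[OF s sqn \<phi> integrable_energy[OF sqn s] lim En Elim])
qed

end

section \<open>The Rayleigh quotient along the evolution\<close>

lemma convex_on_cong_on:
  assumes f: "convex_on S f" and eq: "\<And>x. x \<in> S \<Longrightarrow> f x = g x"
  shows "convex_on S g"
  unfolding convex_on_def
proof (intro conjI ballI allI impI)
  show S: "convex S" by (rule convex_on_imp_convex[OF f])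
  fix x y and u v :: real assume xy: "x \<in> S" "y \<in> S" and uv: "0 \<le> u" "0 \<le> v" "u + v = 1"
  have "f (u *\<^sub>R x + v *\<^sub>R y) \<le> u * f x + v * f y" using f xy uv by (simp add: convex_on_def)
  then show "g (u *\<^sub>R x + v *\<^sub>R y) \<le> u * g x + v * g y"
    using eq xy convexD[OF S xy uv] by simp
qed

text \<open>Shift both endpoints to the right by \<open>e\<close> and let \<open>e \<rightarrow> 0\<close>; at positive points continuity is
  automatic for convex functions.\<close>

lemma convex_on_closed_half_line:
  fixes f :: "real \<Rightarrow> real"
  assumes f: "convex_on {0<..} f" and 0: "(f \<longlongrightarrow> f 0) (at_right 0)"
  shows "convex_on {0..} f"
proof (rule convex_onI)
  have L: "((\<lambda>e. f (x + e)) \<longlongrightarrow> f x) (at_right 0)" if "0 \<le> x" for x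
  proof (cases "x = 0")
    case False
    then have "isCont f x"
      using that convex_on_continuous[OF _ f] by (simp add: continuous_on_eq_continuous_at)
    moreover have "((\<lambda>e. x + e) \<longlongrightarrow> x + 0) (at_right 0)" by (intro tendsto_intros)
    ultimately show ?thesis by (intro isCont_tendsto_compose[of x f]) simp_all
  qed (use 0 in simp)
  fix t x y :: real assume t: "0 < t" "t < 1" and xy: "x \<in> {0..}" "y \<in> {0..}"
  have z: "0 \<le> (1 - t) *\<^sub>R x + t *\<^sub>R y" using t xy by (auto intro!: add_nonneg_nonneg)
  show "f ((1 - t) *\<^sub>R x + t *\<^sub>R y) \<le> (1 - t) * f x + t * f y"
  proof (rule tendsto_le[OF trivial_limit_at_right_real _ L[OF z]])
    show "((\<lambda>e. (1 - t) * f (x + e) + t * f (y + e)) \<longlongrightarrow> (1 - t) * f x + t * f y) (at_right 0)"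
      using xy by (intro tendsto_intros L) auto
    have "f ((1 - t) *\<^sub>R x + t *\<^sub>R y + e) \<le> (1 - t) * f (x + e) + t * f (y + e)" if "0 < e" for e
    proof -
      have "(1 - t) *\<^sub>R x + t *\<^sub>R y + e = (1 - t) *\<^sub>R (x + e) + t *\<^sub>R (y + e)" by (simp add: algebra_simps)
      then show ?thesis using convex_onD[OF f, of t "x + e" "y + e"] t xy that by simp
    qed
    then show "\<forall>\<^sub>F e in at_right 0. f ((1 - t) *\<^sub>R x + t *\<^sub>R y + e) \<le> (1 - t) * f (x + e) + t * f (y + e)"
      by (auto simp: eventually_at_right_less intro!: eventually_mono[OF eventually_at_right_less])
  qed
qed simp

lemma density_square_norm:
  fixes w :: "'a::euclidean_space \<Rightarrow> real" and f :: "'a \<Rightarrow> 'b::real_normed_vector"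
  assumes [measurable]: "w \<in> borel_measurable borel" "f \<in> borel_measurable borel" and w: "\<And>x. 0 \<le> w x"
  shows integrable_density_square_norm:
      "integrable (density lborel (\<lambda>x. ennreal (w x))) (\<lambda>x. (norm (f x))\<^sup>2) \<longleftrightarrow> integrable lborel (\<lambda>x. (norm (f x))\<^sup>2 * w x)"
    and integral_density_square_norm:
      "(LINT x|density lborel (\<lambda>x. ennreal (w x)). (norm (f x))\<^sup>2) = (LINT x|lborel. (norm (f x))\<^sup>2 * w x)"
  using w by (auto simp: integrable_density integral_density mult.commute)

lemma weak_gradient_measurable: "is_weak_gradient U f g \<Longrightarrow> g \<in> borel_measurable borel"
  by (simp add: is_weak_gradient_def)

context
  fixes U :: "'a::euclidean_space set" and w f :: "'a \<Rightarrow> real" and g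
  assumes U: "open U" "AE x in lborel. w x \<noteq> 0 \<longrightarrow> x \<in> U"
    and w: "w \<in> borel_measurable borel" "\<And>x. 0 \<le> w x"
    and f: "f \<in> borel_measurable borel" and g: "is_weak_gradient U f g"
begin

lemma H1_space_density:
  assumes "integrable lborel (\<lambda>x. (f x)\<^sup>2 * w x)" "integrable lborel (\<lambda>x. (norm (g x))\<^sup>2 * w x)"
  shows "f \<in> H1_space U (density lborel (\<lambda>x. ennreal (w x)))"
proof -
  have "f \<in> L2_space (density lborel (\<lambda>x. ennreal (w x)))" "g \<in> L2_space (density lborel (\<lambda>x. ennreal (w x)))"
    using assms integrable_density_square_norm[OF w(1) f w(2)]
      integrable_density_square_norm[OF w(1) weak_gradient_measurable[OF g] w(2)] f weak_gradient_measurable[OF g]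
    by (simp_all add: L2_space_def)
  then show ?thesis using g by (auto simp: H1_space_def)
qed

lemma rayleigh_density:
  "rayleigh U (density lborel (\<lambda>x. ennreal (w x))) f = (LINT x|lborel. (norm (g x))\<^sup>2 * w x) / (LINT x|lborel. (f x)\<^sup>2 * w x)"
proof -
  have h: "is_weak_gradient U f (weak_gradient U f)" by (rule weak_gradient_weak[OF g])
  have [measurable]: "weak_gradient U f \<in> borel_measurable borel" "g \<in> borel_measurable borel" "w \<in> borel_measurable borel"
    using h weak_gradient_measurable[OF g] w by (auto simp: is_weak_gradient_def)
  have "AE x in lborel. (norm (weak_gradient U f x))\<^sup>2 * w x = (norm (g x))\<^sup>2 * w x"
    using weak_gradient_unique[OF U(1) h g] U(2) by eventually_elim auto
  then have "(LINT x|lborel. (norm (weak_gradient U f x))\<^sup>2 * w x) = (LINT x|lborel. (norm (g x))\<^sup>2 * w x)"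
    by (intro integral_cong_AE) measurable
  then show ?thesis
    using integral_density_square_norm[OF w(1) _ w(2), of "weak_gradient U f"] integral_density_square_norm[OF w(1) f w(2)]
    by (simp add: rayleigh_def)
qed

end

lemma L2_norm_density:
  fixes w f :: "'a::euclidean_space \<Rightarrow> real"
  assumes "w \<in> borel_measurable borel" "f \<in> borel_measurable borel" "\<And>x. 0 \<le> w x"
  shows "L2_norm (density lborel (\<lambda>x. ennreal (w x))) f = sqrt (LINT x|lborel. (f x)\<^sup>2 * w x)"
  using integral_density_square_norm[OF assms] by (simp add: L2_norm_def)

lemma (in prob_density) ennreal_evol:
  assumes s: "0 < s"
  shows "ennreal (evol s z) = (\<integral>\<^sup>+x. ennreal (\<rho> x) * ennreal (gauss s (z - x)) \<partial>lborel)"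
proof -
  have "(\<integral>\<^sup>+x. ennreal (\<rho> x * gauss s (z - x)) \<partial>lborel) = ennreal (evol s z)"
    unfolding evol_def conv_def
    using nonneg gauss_pos[OF s] by (intro nn_integral_eq_integral integrable_gauss_kernel[OF integrable s] AE_I2 mult_nonneg_nonneg) (simp_all add: less_imp_le)
  then show ?thesis using nonneg by (simp add: ennreal_mult')
qed

lemma measure_at_density:
  fixes \<rho> :: "'a::ordered_euclidean_space \<Rightarrow> real"
  assumes "prob_density \<rho>" and s: "0 < s"
  shows "measure_at (density lborel (\<lambda>x. ennreal (\<rho> x))) s = density lborel (\<lambda>x. ennreal (prob_density.evol \<rho> s x))"
proof -
  interpret prob_density \<rho> by fact
  let ?M = "density lborel (\<lambda>x. ennreal (\<rho> x))" and ?G = "density lborel (\<lambda>x::'a. ennreal (gauss s x))"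
  have [measurable]: "\<rho> \<in> borel_measurable borel" using integrable by auto
  have [measurable]: "evol s \<in> borel_measurable borel" by (intro borel_measurable_continuous_onI continuous_evol s)
  have fin: "finite_measure ?M" "finite_measure ?G"
  proof -
    have "(\<integral>\<^sup>+x. ennreal (\<rho> x) \<partial>lborel) = 1"
      using nn_integral_eq_integral[OF integrable] nonneg integral by simp
    then show "finite_measure ?M" by (intro finite_measureI) (simp add: emeasure_density)
    have gi: "integrable lborel (gauss s :: 'a \<Rightarrow> real)" "(LINT x|lborel. gauss s (x :: 'a)) = 1"
      by (rule integrable_gauss[OF s], rule integral_gauss[OF s])
    have "(\<integral>\<^sup>+x. ennreal (gauss s (x :: 'a)) \<partial>lborel) = 1"
      using nn_integral_eq_integral[OF gi(1)] gauss_pos[OF s] gi(2) by (simp add: less_imp_le)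
    then show "finite_measure ?G" by (intro finite_measureI) (simp add: emeasure_density)
  qed
  have shift: "(\<integral>\<^sup>+y. f y \<partial>lborel) = (\<integral>\<^sup>+z. f (z - x) \<partial>lborel)" if [measurable]: "f \<in> borel_measurable borel" for f :: "'a \<Rightarrow> ennreal" and x
  proof -
    have "(\<integral>\<^sup>+z. f (z - x) \<partial>lborel) = (\<integral>\<^sup>+z. f z \<partial>(distr lborel borel ((+) (- x))))"
      by (subst nn_integral_distr) simp_all
    then show ?thesis by (simp add: lborel_distr_plus)
  qed
  have "?M \<star> ?G = density lborel (\<lambda>x. ennreal (evol s x))"
  proof (rule measure_eqI)
    fix A :: "'a set" assume "A \<in> sets (?M \<star> ?G)"
    then have [measurable]: "A \<in> sets borel" by simp
    have "emeasure (?M \<star> ?G) A = (\<integral>\<^sup>+x. \<integral>\<^sup>+y. indicator A (x + y) \<partial>?G \<partial>?M)"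
      using fin by (intro convolution_emeasure') simp_all
    also have "\<dots> = (\<integral>\<^sup>+x. ennreal (\<rho> x) * (\<integral>\<^sup>+y. ennreal (gauss s y) * indicator A (x + y) \<partial>lborel) \<partial>lborel)"
      by (simp add: nn_integral_density)
    also have "\<dots> = (\<integral>\<^sup>+x. \<integral>\<^sup>+z. ennreal (\<rho> x) * (ennreal (gauss s (z - x)) * indicator A z) \<partial>lborel \<partial>lborel)"
    proof (intro nn_integral_cong)
      fix x
      show "ennreal (\<rho> x) * (\<integral>\<^sup>+y. ennreal (gauss s y) * indicator A (x + y) \<partial>lborel)
        = (\<integral>\<^sup>+z. ennreal (\<rho> x) * (ennreal (gauss s (z - x)) * indicator A z) \<partial>lborel)"
        by (subst shift[of _ x]) (simp_all add: nn_integral_cmult)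
    qed
    also have "\<dots> = (\<integral>\<^sup>+z. \<integral>\<^sup>+x. ennreal (\<rho> x) * (ennreal (gauss s (z - x)) * indicator A z) \<partial>lborel \<partial>lborel)"
      by (rule lborel_pair.Fubini') measurable
    also have "\<dots> = (\<integral>\<^sup>+z. ennreal (evol s z) * indicator A z \<partial>lborel)"
      by (simp add: ennreal_evol[OF s] nn_integral_multc flip: mult.assoc)
    also have "\<dots> = emeasure (density lborel (\<lambda>x. ennreal (evol s x))) A"
      by (simp add: emeasure_density)
    finally show "emeasure (?M \<star> ?G) A = emeasure (density lborel (\<lambda>x. ennreal (evol s x))) A" .
  qed simp
  then show ?thesis using s by (simp add: measure_at_def)
qed

lemma (in prob_density) grad_mean_weak_gradient:
  assumes \<phi>: "sq_int \<phi>" and s: "0 < s"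
  shows "is_weak_gradient UNIV (mean \<phi> s) (grad_mean \<phi> s)"
proof (rule classical_weak_gradient[OF continuous_mean[OF \<phi> s] continuous_grad_mean[OF \<phi> s]])
  fix x b :: 'a assume "b \<in> Basis"
  then show "((\<lambda>t. mean \<phi> s (x + t *\<^sub>R b)) has_real_derivative grad_mean \<phi> s x \<bullet> b) (at 0)"
    using mean_deriv[OF sq_int_integrable[OF \<phi>] s, of x b 0] by (simp add: grad_mean_def)
qed

lemma (in prob_density) Q_eq_mean: "0 < s \<Longrightarrow> Q \<rho> s \<phi> = mean \<phi> s"
  by (simp add: Q_def mean_def ratio_def[abs_def] heat_eq_conv evol_def)

lemma log_concave_prob_density:
  fixes \<rho> :: "'a::euclidean_space \<Rightarrow> real"
  assumes "prob_space M" "log_concave_density M \<rho>"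
  shows "log_concave_prob \<rho>"
proof
  have [measurable]: "\<rho> \<in> borel_measurable borel" and nn: "\<And>x. 0 \<le> \<rho> x" and M: "M = density lborel (\<lambda>x. ennreal (\<rho> x))"
    and conc: "concave_on {x. 0 < \<rho> x} (\<lambda>x. ln (\<rho> x))" and conv: "convex {x. 0 < \<rho> x}"
    using assms(2) by (auto simp: log_concave_density_def)
  show "0 \<le> \<rho> x" for x by (rule nn)
  have n1: "(\<integral>\<^sup>+x. ennreal (\<rho> x) \<partial>lborel) = 1"
    using prob_space.emeasure_space_1[OF assms(1)] by (simp add: M emeasure_density)
  show i: "integrable lborel \<rho>" using n1 nn by (intro integrableI_nonneg) auto
  show "(LINT x|lborel. \<rho> x) = 1" using n1 nn_integral_eq_integral[OF i] nn by simp
  show "log_concave_fun \<rho>"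
    unfolding log_concave_fun_def
  proof (intro allI impI)
    fix x y :: 'a and t :: real assume t: "0 < t" "t < 1"
    show "\<rho> x powr (1 - t) * \<rho> y powr t \<le> \<rho> ((1 - t) *\<^sub>R x + t *\<^sub>R y)"
    proof (cases "\<rho> x = 0 \<or> \<rho> y = 0")
      case False
      then have p: "0 < \<rho> x" "0 < \<rho> y" using nn[of x] nn[of y] by auto
      have pz: "0 < \<rho> ((1 - t) *\<^sub>R x + t *\<^sub>R y)"
        using convexD[OF conv, of x y "1 - t" t] p t by simp
      have "exp ((1 - t) * ln (\<rho> x) + t * ln (\<rho> y)) \<le> exp (ln (\<rho> ((1 - t) *\<^sub>R x + t *\<^sub>R y)))"
        using concave_onD[OF conc, of t x y] p t by simp
      then show ?thesis using p pz by (simp add: powr_def exp_add)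
    qed (use nn in auto)
  qed
qed

context log_concave_prob
begin

text \<open>The integral formula for the mass applies to positive times only, so the value at time 0 is
  put in by hand; by \<open>mass_tendsto_mass0\<close> this is the continuous extension.\<close>

definition mass_from_0 :: "('a \<Rightarrow> real) \<Rightarrow> real \<Rightarrow> real" where
  "mass_from_0 \<phi> s = (if s = 0 then mass0 \<phi> else mass \<phi> s)"

lemma mass_from_0_pos: "sq_int \<phi> \<Longrightarrow> 0 < mass0 \<phi> \<Longrightarrow> 0 \<le> s \<Longrightarrow> 0 < mass_from_0 \<phi> s"
  using mass_pos[of \<phi> s] by (auto simp: mass_from_0_def)

lemma mass_from_0_tendsto:
  assumes "sq_int \<phi>" shows "(mass_from_0 \<phi> \<longlongrightarrow> mass_from_0 \<phi> 0) (at_right 0)"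
proof (rule Lim_transform_eventually)
  show "(mass \<phi> \<longlongrightarrow> mass_from_0 \<phi> 0) (at_right 0)" using mass_tendsto_mass0[OF assms] by (simp add: mass_from_0_def)
  show "\<forall>\<^sub>F s in at_right 0. mass \<phi> s = mass_from_0 \<phi> s"
    by (rule eventually_mono[OF eventually_at_right_less]) (simp add: mass_from_0_def)
qed

lemma convex_ln_mass_from_0:
  assumes \<phi>: "sq_int \<phi>" and 0: "0 < mass0 \<phi>"
  shows "convex_on {0..} (\<lambda>s. ln (mass_from_0 \<phi> s))"
proof (rule convex_on_closed_half_line)
  show "convex_on {0<..} (\<lambda>s. ln (mass_from_0 \<phi> s))"
    using convex_ln_mass[OF assms] by (rule convex_on_cong_on) (auto simp: mass_from_0_def)
  show "((\<lambda>s. ln (mass_from_0 \<phi> s)) \<longlongrightarrow> ln (mass_from_0 \<phi> 0)) (at_right 0)"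
    using mass_from_0_pos[OF assms, of 0] by (intro tendsto_ln mass_from_0_tendsto \<phi>) auto
qed

text \<open>For \<open>0 < r < t\<close> the Rayleigh quotient at \<open>t\<close> is at most the one at \<open>r\<close>, whose numerator is
  at most the initial energy and whose denominator tends to the initial mass as \<open>r \<rightarrow> 0\<close>.\<close>

lemma energy_mass_cross_0:
  assumes \<phi>: "sq_int \<phi>" and g: "is_weak_gradient dom \<phi> g" "integrable lborel (\<lambda>x. (norm (g x))\<^sup>2 * \<rho> x)" and t: "0 < t"
  shows "energy \<phi> t * mass0 \<phi> \<le> (LINT x|lborel. (norm (g x))\<^sup>2 * \<rho> x) * mass \<phi> t"
proof (rule tendsto_upperbound[OF tendsto_mult[OF tendsto_const mass_tendsto_mass0[OF \<phi>]] _ trivial_limit_at_right_real])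
  show "\<forall>\<^sub>F r in at_right 0. energy \<phi> t * mass \<phi> r \<le> (LINT x|lborel. (norm (g x))\<^sup>2 * \<rho> x) * mass \<phi> t"
    using eventually_at_right_less eventually_at_right_real[OF t]
  proof eventually_elim
    case (elim r)
    then have r: "0 < r" "r \<le> t" by auto
    have "energy \<phi> t * mass \<phi> r \<le> energy \<phi> r * mass \<phi> t" by (rule energy_mass_cross[OF \<phi> r])
    also have "\<dots> \<le> (LINT x|lborel. (norm (g x))\<^sup>2 * \<rho> x) * mass \<phi> t"
      by (intro mult_right_mono energy_le_gradient[OF \<phi> g r(1)] mass_nonneg t)
    finally show ?case .
  qed
qed

end

theorem theorem2p4:
  fixes M :: "(real ^ 'n) measure" and \<rho> \<phi> :: "real ^ 'n \<Rightarrow> real"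
  assumes "prob_space M"
    and "log_concave_density M \<rho>"
    and "\<phi> \<in> H1_space (pos_domain \<rho>) M"
    and "\<not> (AE x in M. \<phi> x = 0)"
  shows "(\<forall>s\<ge>0. Q \<rho> s \<phi> \<in> H1_space (pos_domain (density_at \<rho> s)) (measure_at M s) \<and>
                 0 < L2_norm (measure_at M s) (Q \<rho> s \<phi>)) \<and>
    antimono_on {0..}
      (\<lambda>s. rayleigh (pos_domain (density_at \<rho> s)) (measure_at M s) (Q \<rho> s \<phi>)) \<and>
    convex_on {0..} (\<lambda>s. ln (L2_norm (measure_at M s) (Q \<rho> s \<phi>)))"
proof -
  interpret log_concave_prob \<rho> by (rule log_concave_prob_density[OF assms(1,2)])
  have M: "M = density lborel (\<lambda>x. ennreal (\<rho> x))" and m[measurable]: "\<rho> \<in> borel_measurable borel"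
    using assms(2) by (auto simp: log_concave_density_def)
  obtain g where L: "\<phi> \<in> L2_space M" "g \<in> L2_space M" and "is_weak_gradient (pos_domain \<rho>) \<phi> g"
    using assms(3) by (auto simp: H1_space_def)
  then have g: "is_weak_gradient dom \<phi> g" by (simp add: pos_domain_def dom_def)
  have \<phi>m[measurable]: "\<phi> \<in> borel_measurable borel" and gm[measurable]: "g \<in> borel_measurable borel"
    using L by (auto simp: L2_space_def M)
  have \<phi>: "sq_int \<phi>" and gi: "integrable lborel (\<lambda>x. (norm (g x))\<^sup>2 * \<rho> x)"
    using L integrable_density_square_norm[OF m \<phi>m nonneg] integrable_density_square_norm[OF m gm nonneg]
    by (auto simp: L2_space_def M sq_int_def)
  let ?E = "\<lambda>s. if s = 0 then LINT x|lborel. (norm (g x))\<^sup>2 * \<rho> x else energy \<phi> s"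
  have "mass0 \<phi> \<noteq> 0"
  proof
    assume "mass0 \<phi> = 0"
    then have "AE x in lborel. (\<phi> x)\<^sup>2 * \<rho> x = 0"
      unfolding mass0_def using sq_int_sq_integrable[OF \<phi>] nonneg
      by (subst integral_nonneg_eq_0_iff_AE[symmetric]) auto
    then have "AE x in M. \<phi> x = 0" unfolding M by (subst AE_density) auto
    then show False using assms(4) by simp
  qed
  then have 0: "0 < mass0 \<phi>" using mass0_nonneg[of \<phi>] by simp
  \<comment> \<open>At time 0 the operator is the identity and derivatives are weak derivatives on the interior
    of the support; at positive times everything is smooth and positive on the whole space.\<close>
  have at0: "measure_at M 0 = M" "Q \<rho> 0 \<phi> = \<phi>" "pos_domain (density_at \<rho> 0) = dom"
    by (simp_all add: measure_at_def Q_def density_at_def pos_domain_def dom_def)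
  have pd: "pos_domain \<rho> = dom" by (simp add: pos_domain_def dom_def)
  have ats: "measure_at M s = density lborel (\<lambda>x. ennreal (evol s x))" "Q \<rho> s \<phi> = mean \<phi> s"
    "pos_domain (density_at \<rho> s) = UNIV" if s: "0 < s" for s
  proof -
    show "measure_at M s = density lborel (\<lambda>x. ennreal (evol s x))"
      unfolding M by (rule measure_at_density[OF prob_density_axioms s])
    have "density_at \<rho> s = evol s" using s by (simp add: density_at_def heat_eq_conv evol_def)
    then show "pos_domain (density_at \<rho> s) = UNIV" using evol_pos[OF s] by (simp add: pos_domain_def)
  qed (rule Q_eq_mean[OF s])
  have em: "evol s \<in> borel_measurable borel" "mean \<phi> s \<in> borel_measurable borel" if "0 < s" for s
    by (intro borel_measurable_continuous_onI continuous_evol continuous_mean \<phi> that)+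
  have en: "0 \<le> evol s x" if "0 < s" for s x using evol_pos[OF that] by (rule less_imp_le)
  have H1: "Q \<rho> s \<phi> \<in> H1_space (pos_domain (density_at \<rho> s)) (measure_at M s)"
    and norm: "L2_norm (measure_at M s) (Q \<rho> s \<phi>) = sqrt (mass_from_0 \<phi> s)"
    and ray: "rayleigh (pos_domain (density_at \<rho> s)) (measure_at M s) (Q \<rho> s \<phi>) = ?E s / mass_from_0 \<phi> s"
    if "0 \<le> s" for s
  proof (atomize (full), cases "s = 0")
    case True
    show "Q \<rho> s \<phi> \<in> H1_space (pos_domain (density_at \<rho> s)) (measure_at M s) \<and>
      L2_norm (measure_at M s) (Q \<rho> s \<phi>) = sqrt (mass_from_0 \<phi> s) \<and>
      rayleigh (pos_domain (density_at \<rho> s)) (measure_at M s) (Q \<rho> s \<phi>) = ?E s / mass_from_0 \<phi> s"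
      unfolding True at0
      using assms(3) rayleigh_density[OF open_dom AE_dom m nonneg \<phi>m g] L2_norm_density[OF m \<phi>m nonneg]
      by (simp add: M pd mass_from_0_def mass0_def)
  next
    case False
    then have s: "0 < s" using that by simp
    note gs = grad_mean_weak_gradient[OF \<phi> s]
    show "Q \<rho> s \<phi> \<in> H1_space (pos_domain (density_at \<rho> s)) (measure_at M s) \<and>
      L2_norm (measure_at M s) (Q \<rho> s \<phi>) = sqrt (mass_from_0 \<phi> s) \<and>
      rayleigh (pos_domain (density_at \<rho> s)) (measure_at M s) (Q \<rho> s \<phi>) = ?E s / mass_from_0 \<phi> s"
      using H1_space_density[OF open_UNIV AE_I2 em(1)[OF s] en[OF s] em(2)[OF s] gs integrable_mean_sq[OF \<phi> s]]
        rayleigh_density[OF open_UNIV AE_I2 em(1)[OF s] en[OF s] em(2)[OF s] gs]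
        L2_norm_density[OF em[OF s] en[OF s]] integrable_energy[OF \<phi> s] s
      by (simp add: ats mass_from_0_def mass_def energy_eq norm_grad_mean)
  qed
  have pos: "0 < mass_from_0 \<phi> s" if "0 \<le> s" for s by (rule mass_from_0_pos[OF \<phi> 0 that])
  show ?thesis
  proof (intro conjI allI impI)
    fix s :: real assume "0 \<le> s"
    then show "Q \<rho> s \<phi> \<in> H1_space (pos_domain (density_at \<rho> s)) (measure_at M s)"
      "0 < L2_norm (measure_at M s) (Q \<rho> s \<phi>)"
      using H1 norm pos by auto
  next
    show "antimono_on {0..} (\<lambda>s. rayleigh (pos_domain (density_at \<rho> s)) (measure_at M s) (Q \<rho> s \<phi>))"
    proof (rule monotone_onI)
      fix s t :: real assume "s \<in> {0..}" "t \<in> {0..}" and st: "s \<le> t"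
      then have s: "0 \<le> s" and t: "0 \<le> t" by auto
      have "?E t * mass_from_0 \<phi> s \<le> ?E s * mass_from_0 \<phi> t"
        using energy_mass_cross[OF \<phi> _ st] energy_mass_cross_0[OF \<phi> g gi, of t] s st
        by (auto simp: mass_from_0_def)
      then show "rayleigh (pos_domain (density_at \<rho> t)) (measure_at M t) (Q \<rho> t \<phi>)
          \<le> rayleigh (pos_domain (density_at \<rho> s)) (measure_at M s) (Q \<rho> s \<phi>)"
        unfolding ray[OF s] ray[OF t] using pos[OF s] pos[OF t] by (simp only: frac_le_eq pos_divide_le_eq pos_le_divide_eq times_divide_eq_left times_divide_eq_right)
    qed
  next
    have "convex_on {0..} (\<lambda>s. (1 / 2) * ln (mass_from_0 \<phi> s))"
      by (intro convex_on_cmul convex_ln_mass_from_0 \<phi> 0) simp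
    then show "convex_on {0..} (\<lambda>s. ln (L2_norm (measure_at M s) (Q \<rho> s \<phi>)))"
    proof (rule convex_on_cong_on)
      fix s :: real assume "s \<in> {0..}"
      then have s: "0 \<le> s" by simp
      show "1 / 2 * ln (mass_from_0 \<phi> s) = ln (L2_norm (measure_at M s) (Q \<rho> s \<phi>))"
        unfolding norm[OF s] using pos[OF s] by (simp add: ln_sqrt)
    qed
  qed
qed

end
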